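(* Let $(\Omega,\mathcal{F},\mathbb{F}=(\mathcal{F}_t)_{t\ge 0},\mathbf{P})$ be a filtered probability space satisfying the usual assumptions. (1) Let $\tau$ be an $\mathbb{F}$-pseudo-stopping time that avoids $\mathbb{F}$-stopping times, and let $\mathbb{G}$ be the progressive enlargement of $\mathbb{F}$ by $\tau$. Then the $\mathbb{G}$-dual predictable projection of $\mathbf{1}_{\tau\le t}$ is $\log\left(\frac{1}{Z^\tau_{t\wedge\tau}}\right)$, where $Z^\tau_t=\mathbf{P}[\tau>t\mid\mathcal{F}_t]$. (2) Let $g$ be an honest time that avoids $\mathbb{F}$-stopping times, and let $\mathbb{G}$ be the progressive enlargement of $\mathbb{F}$ by $g$. Then the $\mathbb{G}$-dual predictable projection of $\mathbf{1}_{g\le t}$ is $A^g_t$, where $A^g$ denotes the $\mathbb{F}$-dual optional projection of the process $\mathbf{1}_{\{g\le t\}}$.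
   Context: A random time is a nonnegative $\mathcal{F}$-measurable random variable $\rho:\Omega\to[0,\infty]$. It avoids $\mathbb{F}$-stopping times if $\mathbf{P}[\rho=T]=0$ for every $\mathbb{F}$-stopping time $T$. It is an $\mathbb{F}$-pseudo-stopping time if $\mathbf{E}M_\rho=\mathbf{E}M_0$ for every $\mathbb{F}$-martingale $M$ in $\mathcal{H}^1$. It is an honest time if it is the end of an $\mathbb{F}$-optional set. $Z^\rho_t=\mathbf{P}[\rho>t\mid\mathcal{F}_t]$ is taken càdlàg. The progressive enlargement of $\mathbb{F}$ by $\rho$ is the smallest filtration $\mathbb{G}=(\mathcal{G}_t)$ satisfying the usual assumptions, containing $\mathbb{F}$ and making $\rho$ a stopping time: $\mathcal{G}_t=\mathcal{K}_{t+}$ with $\mathcal{K}_t=\mathcal{F}_t\vee\sigma(\rho\wedge t)$. *)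

theory Defs
  imports "HOL-Probability.Probability"
begin

(* A filtration is a family F :: real => 'a measure of which only the members F t with 0 <= t
   matter, and of F t only its space and its sigma-algebra. Likewise a process X :: real => 'a => 'b
   is only looked at for t >= 0 and on space M. Random times take values in [0, infinity], that is,
   in ennreal. *)

section \<open>Filtered probability spaces under the usual assumptions\<close>

locale usual_filtered_prob_space = prob_space M + complete_measure M
  for M :: "'a measure" and F :: "real \<Rightarrow> 'a measure" +
  assumes subalgebra_filtration: "\<And>t. 0 \<le> t \<Longrightarrow> subalgebra M (F t)"
    and filtration_mono: "\<And>s t. 0 \<le> s \<Longrightarrow> s \<le> t \<Longrightarrow> sets (F s) \<subseteq> sets (F t)"
    and null_sets_in_filtration: "null_sets M \<subseteq> sets (F 0)"
    and filtration_right_continuous: "\<And>t. 0 \<le> t \<Longrightarrow> (\<Inter>s\<in>{t<..}. sets (F s)) = sets (F t)"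

section \<open>Processes\<close>

definition adapted :: "(real \<Rightarrow> 'a measure) \<Rightarrow> (real \<Rightarrow> 'a \<Rightarrow> real) \<Rightarrow> bool" where
  "adapted F X \<longleftrightarrow> (\<forall>t\<ge>0. X t \<in> borel_measurable (F t))"

definition cadlag_path :: "(real \<Rightarrow> real) \<Rightarrow> bool" where
  "cadlag_path x \<longleftrightarrow>
     (\<forall>t\<ge>0. continuous (at_right t) x) \<and> (\<forall>t>0. \<exists>l. (x \<longlongrightarrow> l) (at_left t))"

definition caglad_path :: "(real \<Rightarrow> real) \<Rightarrow> bool" where
  "caglad_path x \<longleftrightarrow>
     (\<forall>t>0. continuous (at_left t) x) \<and> (\<forall>t\<ge>0. \<exists>l. (x \<longlongrightarrow> l) (at_right t))"

definition cadlag :: "'a measure \<Rightarrow> (real \<Rightarrow> 'a \<Rightarrow> real) \<Rightarrow> bool" where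
  "cadlag M X \<longleftrightarrow> (\<forall>\<omega>\<in>space M. cadlag_path (\<lambda>t. X t \<omega>))"

definition caglad :: "'a measure \<Rightarrow> (real \<Rightarrow> 'a \<Rightarrow> real) \<Rightarrow> bool" where
  "caglad M X \<longleftrightarrow> (\<forall>\<omega>\<in>space M. caglad_path (\<lambda>t. X t \<omega>))"

definition process_generated_sigma ::
    "'a measure \<Rightarrow> (real \<Rightarrow> 'a \<Rightarrow> real) set \<Rightarrow> (real \<times> 'a) measure" where
  "process_generated_sigma M \<X> = sigma ({0..} \<times> space M)
     {{(t, \<omega>). 0 \<le> t \<and> \<omega> \<in> space M \<and> X t \<omega> \<in> B} | X B. X \<in> \<X> \<and> B \<in> sets borel}"

definition optional_sigma ::
    "'a measure \<Rightarrow> (real \<Rightarrow> 'a measure) \<Rightarrow> (real \<times> 'a) measure" where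
  "optional_sigma M F = process_generated_sigma M {X. adapted F X \<and> cadlag M X}"

definition predictable_sigma ::
    "'a measure \<Rightarrow> (real \<Rightarrow> 'a measure) \<Rightarrow> (real \<times> 'a) measure" where
  "predictable_sigma M F = process_generated_sigma M {X. adapted F X \<and> caglad M X}"

definition martingale ::
    "'a measure \<Rightarrow> (real \<Rightarrow> 'a measure) \<Rightarrow> (real \<Rightarrow> 'a \<Rightarrow> real) \<Rightarrow> bool" where
  "martingale M F X \<longleftrightarrow> adapted F X \<and> (\<forall>t\<ge>0. integrable M (X t)) \<and>
     (\<forall>s t. 0 \<le> s \<and> s \<le> t \<longrightarrow> (AE \<omega> in M. real_cond_exp M (F s) (X t) \<omega> = X s \<omega>))"

definition H1_martingale ::
    "'a measure \<Rightarrow> (real \<Rightarrow> 'a measure) \<Rightarrow> (real \<Rightarrow> 'a \<Rightarrow> real) \<Rightarrow> bool" where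
  "H1_martingale M F X \<longleftrightarrow> martingale M F X \<and> cadlag M X \<and>
     (\<integral>\<^sup>+\<omega>. (SUP t\<in>{0..}. ennreal \<bar>X t \<omega>\<bar>) \<partial>M) < \<infinity>"

section \<open>Random times\<close>

definition random_time :: "'a measure \<Rightarrow> ('a \<Rightarrow> ennreal) \<Rightarrow> bool" where
  "random_time M \<rho> \<longleftrightarrow> \<rho> \<in> borel_measurable M"

(* The library's stopping_time requires T to take values in the index type of the filtration;
   here T may take the value infinity although the filtration is indexed by finite times. *)
definition stopping_time_ext ::
    "'a measure \<Rightarrow> (real \<Rightarrow> 'a measure) \<Rightarrow> ('a \<Rightarrow> ennreal) \<Rightarrow> bool" where
  "stopping_time_ext M F T \<longleftrightarrow> (\<forall>t\<ge>0. {\<omega>\<in>space M. T \<omega> \<le> ennreal t} \<in> sets (F t))"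

(* T = infinity is a stopping time, so an avoiding time is almost surely finite. *)
definition avoids_stopping_times ::
    "'a measure \<Rightarrow> (real \<Rightarrow> 'a measure) \<Rightarrow> ('a \<Rightarrow> ennreal) \<Rightarrow> bool" where
  "avoids_stopping_times M F \<rho> \<longleftrightarrow>
     (\<forall>T. stopping_time_ext M F T \<longrightarrow> measure M {\<omega>\<in>space M. \<rho> \<omega> = T \<omega>} = 0)"

(* On {rho = infinity} the value is the limit at infinity, which exists almost surely for a
   martingale in H1. *)
definition at_random_time :: "(real \<Rightarrow> 'a \<Rightarrow> real) \<Rightarrow> ('a \<Rightarrow> ennreal) \<Rightarrow> 'a \<Rightarrow> real" where
  "at_random_time X \<rho> \<omega> =
     (if \<rho> \<omega> = \<infinity> then Lim at_top (\<lambda>t. X t \<omega>) else X (enn2real (\<rho> \<omega>)) \<omega>)"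

definition stopped_process :: "(real \<Rightarrow> 'a \<Rightarrow> real) \<Rightarrow> ('a \<Rightarrow> ennreal) \<Rightarrow> real \<Rightarrow> 'a \<Rightarrow> real" where
  "stopped_process X \<rho> t \<omega> = X (enn2real (min (ennreal t) (\<rho> \<omega>))) \<omega>"

definition pseudo_stopping_time ::
    "'a measure \<Rightarrow> (real \<Rightarrow> 'a measure) \<Rightarrow> ('a \<Rightarrow> ennreal) \<Rightarrow> bool" where
  "pseudo_stopping_time M F \<rho> \<longleftrightarrow> random_time M \<rho> \<and>
     (\<forall>X. H1_martingale M F X \<longrightarrow> (\<integral>\<omega>. at_random_time X \<rho> \<omega> \<partial>M) = (\<integral>\<omega>. X 0 \<omega> \<partial>M))"

(* The end of a set is the supremum of its section; the supremum of the empty section is 0. *)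
definition honest_time ::
    "'a measure \<Rightarrow> (real \<Rightarrow> 'a measure) \<Rightarrow> ('a \<Rightarrow> ennreal) \<Rightarrow> bool" where
  "honest_time M F \<rho> \<longleftrightarrow> random_time M \<rho> \<and>
     (\<exists>\<Gamma>\<in>sets (optional_sigma M F). \<forall>\<omega>\<in>space M. \<rho> \<omega> = Sup {ennreal t | t. (t, \<omega>) \<in> \<Gamma>})"

(* Z is a cadlag version of the process P[rho > t | F_t]; it is unique up to indistinguishability. *)
definition azema_supermartingale ::
    "'a measure \<Rightarrow> (real \<Rightarrow> 'a measure) \<Rightarrow> ('a \<Rightarrow> ennreal) \<Rightarrow> (real \<Rightarrow> 'a \<Rightarrow> real) \<Rightarrow> bool" where
  "azema_supermartingale M F \<rho> Z \<longleftrightarrow> adapted F Z \<and> cadlag M Z \<and>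
     (\<forall>t\<ge>0. AE \<omega> in M. Z t \<omega> = real_cond_exp M (F t) (indicator {\<omega>. ennreal t < \<rho> \<omega>}) \<omega>)"

definition jump_process :: "('a \<Rightarrow> ennreal) \<Rightarrow> real \<Rightarrow> 'a \<Rightarrow> real" where
  "jump_process \<rho> t = indicator {\<omega>. \<rho> \<omega> \<le> ennreal t}"

section \<open>Progressive enlargement\<close>

definition filtration_join_time ::
    "'a measure \<Rightarrow> (real \<Rightarrow> 'a measure) \<Rightarrow> ('a \<Rightarrow> ennreal) \<Rightarrow> real \<Rightarrow> 'a measure" where
  "filtration_join_time M F \<rho> t = sigma (space M)
     (sets (F t) \<union> sets (vimage_algebra (space M) (\<lambda>\<omega>. min (\<rho> \<omega>) (ennreal t)) borel))"

definition progressive_enlargement ::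
    "'a measure \<Rightarrow> (real \<Rightarrow> 'a measure) \<Rightarrow> ('a \<Rightarrow> ennreal) \<Rightarrow> real \<Rightarrow> 'a measure" where
  "progressive_enlargement M F \<rho> t =
     sigma (space M) (\<Inter>s\<in>{t<..}. sets (filtration_join_time M F \<rho> s))"

section \<open>Dual projections\<close>

definition increasing_path :: "(real \<Rightarrow> real) \<Rightarrow> bool" where
  "increasing_path v \<longleftrightarrow> 0 \<le> v 0 \<and> mono_on {0..} v \<and> (\<forall>t\<ge>0. continuous (at_right t) v)"

(* The Stieltjes integral over [0, infinity) against a process with value 0 before time 0, so that
   a nonzero initial value V 0 counts as a mass at time 0. *)
definition stieltjes_integral ::
    "(real \<Rightarrow> 'a \<Rightarrow> ennreal) \<Rightarrow> (real \<Rightarrow> 'a \<Rightarrow> real) \<Rightarrow> 'a \<Rightarrow> ennreal" where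
  "stieltjes_integral X V \<omega> =
     (\<integral>\<^sup>+t\<in>{0..}. X t \<omega> \<partial>interval_measure (\<lambda>t. if t < 0 then 0 else V t \<omega>))"

(* V is the dual projection of the (raw, i.e. not necessarily adapted) integrable increasing process
   A with respect to a sigma-algebra on [0, infinity) x Omega: a measurable increasing process with
   E(int X dV) = E(int X dA) for all measurable nonnegative X. It is unique up to
   indistinguishability, and path properties are accordingly only required almost surely. *)
definition dual_projection ::
    "'a measure \<Rightarrow> (real \<times> 'a) measure \<Rightarrow> (real \<Rightarrow> 'a \<Rightarrow> real) \<Rightarrow> (real \<Rightarrow> 'a \<Rightarrow> real) \<Rightarrow> bool" where
  "dual_projection M \<Sigma> A V \<longleftrightarrow>
     (\<lambda>(t, \<omega>). V t \<omega>) \<in> borel_measurable \<Sigma> \<and>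
     (AE \<omega> in M. increasing_path (\<lambda>t. V t \<omega>)) \<and>
     (\<forall>X. (\<lambda>(t, \<omega>). X t \<omega>) \<in> borel_measurable \<Sigma> \<longrightarrow>
        (\<integral>\<^sup>+\<omega>. stieltjes_integral X V \<omega> \<partial>M) = (\<integral>\<^sup>+\<omega>. stieltjes_integral X A \<omega> \<partial>M))"

definition dual_optional_projection ::
    "'a measure \<Rightarrow> (real \<Rightarrow> 'a measure) \<Rightarrow> (real \<Rightarrow> 'a \<Rightarrow> real) \<Rightarrow> (real \<Rightarrow> 'a \<Rightarrow> real) \<Rightarrow> bool" where
  "dual_optional_projection M F = dual_projection M (optional_sigma M F)"

definition dual_predictable_projection ::
    "'a measure \<Rightarrow> (real \<Rightarrow> 'a measure) \<Rightarrow> (real \<Rightarrow> 'a \<Rightarrow> real) \<Rightarrow> (real \<Rightarrow> 'a \<Rightarrow> real) \<Rightarrow> bool" where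
  "dual_predictable_projection M F = dual_projection M (predictable_sigma M F)"

end

theory Submission
  imports Defs
begin

text \<open>Before \<open>\<rho>\<close>, the progressive enlargement carries no more information than the original filtration.
  Hence a predictable increasing process \<open>V\<close> that is constant after \<open>\<rho>\<close> is the dual predictable projection
  of the indicator of \<open>\<rho> \<le> t\<close> as soon as \<open>E (V t - V s) 1\<^sub>B = P (B, s < \<rho> \<le> t)\<close> for \<open>B\<close> in \<open>F s\<close>.

  If \<open>g\<close> is the end of an optional set, its dual optional projection \<open>A\<close> satisfies this identity by definition.
  It is continuous because \<open>g\<close> avoids the first passage times at which \<open>A\<close> jumps, and constant after \<open>g\<close>
  because \<open>dA\<close> is carried by the set and its left accumulation points, none of which lies after \<open>g\<close>.

  For a pseudo-stopping time, stopping at \<open>\<tau>\<close> the martingale closed by a bounded \<open>\<xi>\<close> shows that \<open>1 - Z\<close> is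
  increasing and has, against such martingales, the same integrals as the indicator of \<open>\<tau> \<le> t\<close>. Since \<open>\<tau>\<close> avoids
  stopping times, the quadratic variation of \<open>1 - Z\<close> vanishes, so that \<open>Z\<close> is continuous. As \<open>P (\<tau> > t | F t) = Z t\<close>,
  the mean of the increment of \<open>ln (1 / Z)\<close> stopped at \<open>\<tau>\<close> is a limit of Riemann sums for the integral of \<open>Z\<close>
  against \<open>ln (1 / Z)\<close>, which is the decrement of \<open>Z\<close>.\<close>

section \<open>Measurable projections\<close>

text \<open>Two obstacles shape the argument. The left accumulation points of an optional set form
  an optional set only because projections of jointly measurable sets are measurable: whether the
  set meets a time interval is an uncountable union of events. This is why the Suslin operation and
  completeness enter. Secondly, the definition of a pseudo-stopping time speaks of cadlag
  martingales only, whereas \<open>1 - Z\<close> has to be tested with an arbitrary bounded \<xi>. A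
  cadlag version of the martingale closed by \<xi> is therefore constructed, and boundedness of
  \<xi> reduces this to an energy estimate in L2. For the logarithm, increments up to \<tau> have no
  uniform bound, since \<open>Z\<close> may come close to \<open>0\<close>. Their Riemann sums never
  exceed the increment itself, so Fatou's lemma in one direction and this bound in the other take
  the place of a dominating function. That \<open>Z > 0\<close> at \<tau> comes from avoidance of
  the time at which \<open>Z\<close> reaches \<open>0\<close>.\<close>

inductive_set box_unions :: "'a measure \<Rightarrow> (real \<times> 'a) set set" for N where
  empty: "{} \<in> box_unions N"
| insert: "B \<in> sets N \<Longrightarrow> K \<in> box_unions N \<Longrightarrow> {a..b} \<times> B \<union> K \<in> box_unions N"

lemma box_in_box_unions: "B \<in> sets N \<Longrightarrow> {a..b} \<times> B \<in> box_unions N"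
  using box_unions.insert[OF _ box_unions.empty, of B N a b] by simp

lemma box_unions_Un: "K \<in> box_unions N \<Longrightarrow> L \<in> box_unions N \<Longrightarrow> K \<union> L \<in> box_unions N"
  by (induction rule: box_unions.induct) (auto simp: Un_assoc intro: box_unions.insert)

lemma box_unions_UN:
  "finite I \<Longrightarrow> (\<And>i. i \<in> I \<Longrightarrow> K i \<in> box_unions N) \<Longrightarrow> (\<Union>i\<in>I. K i) \<in> box_unions N"
  by (induction rule: finite_induct) (auto intro: box_unions.empty box_unions_Un)

lemma box_unions_Int: "K \<in> box_unions N \<Longrightarrow> L \<in> box_unions N \<Longrightarrow> K \<inter> L \<in> box_unions N"
proof (induction rule: box_unions.induct)
  case empty
  then show ?case by (simp add: box_unions.empty)
next
  case (insert B K a b)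
  have "({a..b} \<times> B) \<inter> L \<in> box_unions N"
    using insert.prems
  proof (induction rule: box_unions.induct)
    case empty
    then show ?case by (simp add: box_unions.empty)
  next
    case (insert C L c d)
    have "({a..b} \<times> B) \<inter> ({c..d} \<times> C \<union> L) = {max a c..min b d} \<times> (B \<inter> C) \<union> ({a..b} \<times> B) \<inter> L"
      by auto
    then show ?case
      using box_unions.insert[of "B \<inter> C"] insert \<open>B \<in> sets N\<close> by simp
  qed
  then show ?case using insert by (simp add: Int_Un_distrib2 box_unions_Un)
qed

text \<open>\<open>Suc n\<close> because the empty intersection would be the whole type, which is no
  finite union of bounded boxes.\<close>

lemma box_unions_INT:
  "(\<And>i. i < Suc n \<Longrightarrow> K i \<in> box_unions N) \<Longrightarrow> (\<Inter>i<Suc n. K i) \<in> box_unions N"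
proof (induction n)
  case (Suc n)
  then have "(\<Inter>i<Suc n. K i) \<inter> K (Suc n) \<in> box_unions N" by (intro box_unions_Int) auto
  moreover have "(\<Inter>i<Suc (Suc n). K i) = (\<Inter>i<Suc n. K i) \<inter> K (Suc n)"
    by (auto simp: less_Suc_eq)
  ultimately show ?case by simp
qed (simp add: lessThan_Suc)

lemma snd_box_unions: "K \<in> box_unions N \<Longrightarrow> snd ` K \<in> sets N"
  by (induction rule: box_unions.induct) (auto simp: image_Un snd_image_times)

lemma compact_section_box_unions: "K \<in> box_unions N \<Longrightarrow> compact {t. (t, \<omega>) \<in> K}"
proof (induction rule: box_unions.induct)
  case (insert B K a b)
  have "{t. (t, \<omega>) \<in> {a..b} \<times> B \<union> K} = (if \<omega> \<in> B then {a..b} else {}) \<union> {t. (t, \<omega>) \<in> K}" by auto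
  then show ?case using insert by (simp add: compact_Un)
qed simp

lemma box_unions_subset: "K \<in> box_unions N \<Longrightarrow> K \<subseteq> UNIV \<times> space N"
  by (induction rule: box_unions.induct) (auto dest: sets.sets_into_space)

text \<open>Projection and decreasing intersection commute only because sections are compact: nested
  nonempty compact sections have a common point. This is the reason for closed bounded intervals in
  \<open>box_unions\<close>; finite unions keep the projections measurable.\<close>

lemma snd_INT_box_unions:
  assumes K: "\<And>n::nat. K n \<in> box_unions N" and dec: "decseq K"
  shows "snd ` (\<Inter>n. K n) = (\<Inter>n. snd ` K n)"
proof (intro set_eqI iffI)
  fix \<omega> assume \<omega>: "\<omega> \<in> (\<Inter>n. snd ` K n)"
  have "(\<Inter>n. {t. (t, \<omega>) \<in> K n}) \<noteq> {}"
  proof (rule compact_nest)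
    show "compact {t. (t, \<omega>) \<in> K n}" for n by (rule compact_section_box_unions[OF K])
    show "{t. (t, \<omega>) \<in> K n} \<noteq> {}" for n
    proof -
      have "\<omega> \<in> snd ` K n" using \<omega> by blast
      then show ?thesis by force
    qed
    show "m \<le> n \<Longrightarrow> {t. (t, \<omega>) \<in> K n} \<subseteq> {t. (t, \<omega>) \<in> K m}" for m n
      using dec by (auto simp: decseq_def)
  qed
  then show "\<omega> \<in> snd ` (\<Inter>n. K n)" by force
qed auto

text \<open>The Suslin operation, with the tree of finite sequences replaced by a dependency condition:
  the set \<^term>\<open>K m \<sigma>\<close> only depends on the first \<open>m + 1\<close> entries of \<^term>\<open>\<sigma>\<close>.\<close>

definition analytic :: "'a measure \<Rightarrow> (real \<times> 'a) set \<Rightarrow> bool" where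
  "analytic N G \<longleftrightarrow> (\<exists>K :: nat \<Rightarrow> (nat \<Rightarrow> nat) \<Rightarrow> (real \<times> 'a) set.
     (\<forall>m \<sigma>. K m \<sigma> \<in> box_unions N) \<and>
     (\<forall>m \<sigma> \<sigma>'. (\<forall>i\<le>m. \<sigma> i = \<sigma>' i) \<longrightarrow> K m \<sigma> = K m \<sigma>') \<and>
     G = {z. \<exists>\<sigma>. \<forall>m. z \<in> K m \<sigma>})"

lemma analytic_box: "B \<in> sets N \<Longrightarrow> analytic N ({a..b} \<times> B)"
  unfolding analytic_def by (rule exI[of _ "\<lambda>_ _. {a..b} \<times> B"]) (auto simp: box_in_box_unions)

lemma analytic_UN:
  assumes "\<And>n::nat. analytic N (G n)"
  shows "analytic N (\<Union>n. G n)"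
proof -
  define R where "R n K \<longleftrightarrow> (\<forall>m \<sigma>. K m \<sigma> \<in> box_unions N) \<and>
     (\<forall>m \<sigma> \<sigma>'. (\<forall>i\<le>m. \<sigma> i = \<sigma>' i) \<longrightarrow> K m \<sigma> = K m \<sigma>') \<and> G n = {z. \<exists>\<sigma>. \<forall>m. z \<in> K m \<sigma>}"
    for n and K :: "nat \<Rightarrow> (nat \<Rightarrow> nat) \<Rightarrow> (real \<times> 'a) set"
  have "\<forall>n. \<exists>K. R n K" using assms by (simp add: analytic_def R_def)
  then obtain K where "\<And>n. R n (K n)" by metis
  then have K: "\<And>n m \<sigma>. K n m \<sigma> \<in> box_unions N"
      "\<And>n m \<sigma> \<sigma>'. (\<forall>i\<le>m. \<sigma> i = \<sigma>' i) \<Longrightarrow> K n m \<sigma> = K n m \<sigma>'"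
      "\<And>n. G n = {z. \<exists>\<sigma>. \<forall>m. z \<in> K n m \<sigma>}"
    unfolding R_def by blast+
  \<comment> \<open>The entry \<open>\<sigma> 0\<close> codes both the index of the member of the
    union and the original entry at \<open>0\<close>, so \<open>L m\<close> still depends on the
    entries up to \<open>m\<close> only.\<close>
  define L where "L m \<sigma> = K (fst (prod_decode (\<sigma> 0))) m (\<sigma>(0 := snd (prod_decode (\<sigma> 0))))" for m \<sigma>
  have "\<forall>m \<sigma>. L m \<sigma> \<in> box_unions N" by (simp add: L_def K(1))
  moreover have "L m \<sigma> = L m \<sigma>'" if "\<forall>i\<le>m. \<sigma> i = \<sigma>' i" for m \<sigma> \<sigma>'
  proof -
    have "\<sigma> 0 = \<sigma>' 0" using that by simp
    then show ?thesis unfolding L_def using that by (auto intro!: K(2))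
  qed
  moreover have "(\<Union>n. G n) = {z. \<exists>\<sigma>. \<forall>m. z \<in> L m \<sigma>}"
  proof (intro set_eqI iffI)
    fix z assume "z \<in> (\<Union>n. G n)"
    then obtain n where "z \<in> G n" by blast
    then obtain \<sigma> where *: "\<forall>m. z \<in> K n m \<sigma>" unfolding K(3) by blast
    have "\<forall>m. z \<in> L m (\<sigma>(0 := prod_encode (n, \<sigma> 0)))"
      using * by (simp add: L_def)
    then show "z \<in> {z. \<exists>\<sigma>. \<forall>m. z \<in> L m \<sigma>}" by (intro CollectI exI)
  next
    fix z assume "z \<in> {z. \<exists>\<sigma>. \<forall>m. z \<in> L m \<sigma>}"
    then obtain \<sigma> where "\<forall>m. z \<in> L m \<sigma>" by (elim CollectE exE)
    then have "\<forall>m. z \<in> K (fst (prod_decode (\<sigma> 0))) m (\<sigma>(0 := snd (prod_decode (\<sigma> 0))))"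
      by (simp add: L_def)
    then have "z \<in> G (fst (prod_decode (\<sigma> 0)))" unfolding K(3) by (intro CollectI exI)
    then show "z \<in> (\<Union>n. G n)" by (rule UN_I[OF UNIV_I])
  qed
  ultimately show ?thesis
    unfolding analytic_def by (intro exI[of _ L] conjI) (assumption | intro allI impI)+
qed

text \<open>Serves the dependency condition for countable intersections: the entries of the
  \<open>i\<close>-th subsequence up to index \<open>m\<close> all sit at positions not beyond
  \<open>prod_encode (i, m)\<close>.\<close>

lemma prod_encode_mono2:
  assumes "n \<le> m"
  shows "prod_encode (i, n) \<le> prod_encode (i, m)"
proof -
  have "triangle (i + n) \<le> triangle (i + m)"
    unfolding triangle_def using assms by (intro div_le_mono mult_le_mono) auto
  then show ?thesis by (simp add: prod_encode_def)
qed

lemma analytic_INT: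
  assumes "\<And>n::nat. analytic N (G n)"
  shows "analytic N (\<Inter>n. G n)"
proof -
  define R where "R n K \<longleftrightarrow> (\<forall>m \<sigma>. K m \<sigma> \<in> box_unions N) \<and>
     (\<forall>m \<sigma> \<sigma>'. (\<forall>i\<le>m. \<sigma> i = \<sigma>' i) \<longrightarrow> K m \<sigma> = K m \<sigma>') \<and> G n = {z. \<exists>\<sigma>. \<forall>m. z \<in> K m \<sigma>}"
    for n and K :: "nat \<Rightarrow> (nat \<Rightarrow> nat) \<Rightarrow> (real \<times> 'a) set"
  have "\<forall>n. \<exists>K. R n K" using assms by (simp add: analytic_def R_def)
  then obtain K where "\<And>n. R n (K n)" by metis
  then have K: "\<And>n m \<sigma>. K n m \<sigma> \<in> box_unions N"
      "\<And>n m \<sigma> \<sigma>'. (\<forall>i\<le>m. \<sigma> i = \<sigma>' i) \<Longrightarrow> K n m \<sigma> = K n m \<sigma>'"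
      "\<And>n. G n = {z. \<exists>\<sigma>. \<forall>m. z \<in> K n m \<sigma>}"
    unfolding R_def by blast+
  \<comment> \<open>One sequence is read as infinitely many interleaved ones, the
    \<open>i\<close>-th sitting at the positions \<open>prod_encode (i, n)\<close>. Level
    \<open>k\<close> of the new scheme tests a single level of a single given scheme.\<close>
  define L where "L k \<sigma> = (case prod_decode k of (i, m) \<Rightarrow> K i m (\<lambda>n. \<sigma> (prod_encode (i, n))))"
    for k and \<sigma> :: "nat \<Rightarrow> nat"
  have "\<forall>m \<sigma>. L m \<sigma> \<in> box_unions N" by (simp add: L_def K(1) split: prod.split)
  moreover have "L k \<sigma> = L k \<sigma>'" if *: "\<forall>i\<le>k. \<sigma> i = \<sigma>' i" for k \<sigma> \<sigma>'
  proof -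
    obtain i m where k: "k = prod_encode (i, m)" by (metis prod_decode_inverse surj_pair)
    have "\<sigma> (prod_encode (i, n)) = \<sigma>' (prod_encode (i, n))" if "n \<le> m" for n
      using * prod_encode_mono2[OF that, of i] by (simp add: k)
    then show ?thesis by (auto simp: L_def k intro!: K(2))
  qed
  moreover have "(\<Inter>n. G n) = {z. \<exists>\<sigma>. \<forall>m. z \<in> L m \<sigma>}"
  proof (intro set_eqI iffI)
    fix z assume "z \<in> (\<Inter>n. G n)"
    then have "\<forall>n. z \<in> G n" by blast
    then have "\<forall>n. \<exists>\<sigma>. \<forall>m. z \<in> K n m \<sigma>" unfolding K(3) by simp
    then obtain \<sigma> where *: "\<And>n m. z \<in> K n m (\<sigma> n)" by metis
    have "\<forall>k. z \<in> L k (\<lambda>k. case prod_decode k of (i, n) \<Rightarrow> \<sigma> i n)"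
      using * by (simp add: L_def split: prod.split)
    then show "z \<in> {z. \<exists>\<sigma>. \<forall>m. z \<in> L m \<sigma>}" by (intro CollectI exI)
  next
    fix z assume "z \<in> {z. \<exists>\<sigma>. \<forall>m. z \<in> L m \<sigma>}"
    then obtain \<sigma> where *: "\<And>k. z \<in> L k \<sigma>" by auto
    have "z \<in> K i m (\<lambda>n. \<sigma> (prod_encode (i, n)))" for i m
      using *[of "prod_encode (i, m)"] by (simp add: L_def)
    then have "\<forall>m. z \<in> K i m (\<lambda>n. \<sigma> (prod_encode (i, n)))" for i by simp
    then have "z \<in> G i" for i unfolding K(3) by (intro CollectI exI)
    then show "z \<in> (\<Inter>n. G n)" by blast
  qed
  ultimately show ?thesis
    unfolding analytic_def by (intro exI[of _ L] conjI) (assumption | intro allI impI)+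
qed

lemma analytic_Un: "analytic N G \<Longrightarrow> analytic N H \<Longrightarrow> analytic N (G \<union> H)"
proof -
  assume *: "analytic N G" "analytic N H"
  have "(\<Union>n::nat. if n = 0 then G else H) = G \<union> H" by (auto split: if_splits)
  with analytic_UN[of N "\<lambda>n. if n = 0 then G else H"] * show ?thesis by simp
qed

lemma analytic_Int: "analytic N G \<Longrightarrow> analytic N H \<Longrightarrow> analytic N (G \<inter> H)"
proof -
  assume *: "analytic N G" "analytic N H"
  have "(\<Inter>n::nat. if n = 0 then G else H) = G \<inter> H" by (auto split: if_splits)
  with analytic_INT[of N "\<lambda>n. if n = 0 then G else H"] * show ?thesis by simp
qed

lemma analytic_UNIV_times: "B \<in> sets N \<Longrightarrow> analytic N (UNIV \<times> B)"
proof -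
  assume "B \<in> sets N"
  then have "analytic N (\<Union>n::nat. {- real n..real n} \<times> B)" by (intro analytic_UN analytic_box)
  moreover have "x \<in> (\<Union>n. {- real n..real n})" for x :: real
    by (rule UN_I[of "nat \<lceil>\<bar>x\<bar>\<rceil>"], simp, simp, linarith)
  then have "(\<Union>n::nat. {- real n..real n} \<times> B) = UNIV \<times> B" by blast
  ultimately show ?thesis by simp
qed

text \<open>Analytic sets are not closed under complements, so the induction over the product
  sigma-algebra runs over the sets that are analytic together with their complement
  (\<open>bi\<close>). Complements are then free by symmetry, and a countable union needs the
  closure under unions on one side and under intersections on the other.\<close>

lemma analytic_pair_measure:
  assumes "G \<in> sets (borel \<Otimes>\<^sub>M N)"
  shows "analytic N G"
proof -
  let ?\<Omega> = "UNIV \<times> space N :: (real \<times> 'a) set"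
  define bi where "bi G \<longleftrightarrow> G \<subseteq> ?\<Omega> \<and> analytic N G \<and> analytic N (?\<Omega> - G)" for G
  have compl: "bi (?\<Omega> - G)" if "bi G" for G
    using that by (auto simp: bi_def double_diff)
  have union: "bi (\<Union>n::nat. G n)" if "\<And>n. bi (G n)" for G
  proof -
    have "?\<Omega> - (\<Union>n. G n) = (\<Inter>n. ?\<Omega> - G n)" by auto
    moreover have "analytic N (\<Inter>n. ?\<Omega> - G n)"
      by (rule analytic_INT) (use that in \<open>simp add: bi_def\<close>)
    moreover have "analytic N (\<Union>n. G n)" by (rule analytic_UN) (use that in \<open>simp add: bi_def\<close>)
    ultimately show ?thesis using that by (auto simp: bi_def)
  qed
  have full: "bi ?\<Omega>" "bi {}"
    using analytic_UNIV_times[of "space N" N] analytic_UNIV_times[of "{}" N] by (auto simp: bi_def)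
  have left: "bi ({..a} \<times> space N)" for a
  proof -
    have "analytic N (\<Union>n::nat. {a - real n..a} \<times> space N)" by (intro analytic_UN analytic_box) simp
    moreover have "x \<in> (\<Union>n. {a - real n..a})" if "x \<le> a" for x
      by (rule UN_I[of "nat \<lceil>a - x\<rceil>"], simp, use that in simp, linarith)
    then have "(\<Union>n::nat. {a - real n..a} \<times> space N) = {..a} \<times> space N" by auto
    ultimately have left: "analytic N ({..a} \<times> space N)" by simp
    have right: "analytic N (\<Union>n::nat. {a + 1 / Suc n..a + n} \<times> space N)"
      by (intro analytic_UN analytic_box) simp
    have "x \<in> (\<Union>n. {a + 1 / Suc n..a + n})" if "a < x" for x
    proof -
      obtain n where n: "1 / real (Suc n) < x - a" using nat_approx_posE[of "x - a"] \<open>a < x\<close> by auto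
      have "1 / Suc (n + nat \<lceil>x - a\<rceil>) \<le> 1 / Suc n" by (simp add: field_simps)
      moreover have "x - a \<le> real (n + nat \<lceil>x - a\<rceil>)" by linarith
      ultimately have "x \<in> {a + 1 / Suc (n + nat \<lceil>x - a\<rceil>)..a + real (n + nat \<lceil>x - a\<rceil>)}"
        using n by auto
      then show ?thesis by blast
    qed
    moreover have "a < x" if "x \<in> {a + 1 / Suc n..a + n}" for x and n :: nat
    proof -
      have "0 < 1 / real (Suc n)" by simp
      moreover have "a + 1 / real (Suc n) \<le> x" using that by simp
      ultimately show ?thesis by linarith
    qed
    ultimately have "(\<Union>n::nat. {a + 1 / Suc n..a + n}) = {a<..}" by blast
    then have "(\<Union>n::nat. {a + 1 / Suc n..a + n} \<times> space N) = {a<..} \<times> space N"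
      by blast
    moreover have "{a<..} \<times> space N = ?\<Omega> - {..a} \<times> space N" by auto
    ultimately have "analytic N (?\<Omega> - {..a} \<times> space N)"
      using right by simp
    with left show ?thesis by (auto simp: bi_def)
  qed
  have strip: "bi (A \<times> space N)" if "A \<in> sets borel" for A
  proof -
    have "A \<in> sigma_sets UNIV (range (\<lambda>a::real. {..a}))"
      using that by (simp add: borel_eq_atMost)
    then show ?thesis
    proof (induction rule: sigma_sets.induct)
      case (Compl A)
      have "(UNIV - A) \<times> space N = ?\<Omega> - A \<times> space N" by auto
      then show ?case using compl[OF Compl(2)] by simp
    next
      case (Union A)
      have "(\<Union>n. A n) \<times> space N = (\<Union>n. A n \<times> space N)" by auto
      then show ?case using union[OF Union(2)] by simp
    qed (auto simp: full left)
  qed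
  have rect: "bi (A \<times> B)" if "A \<in> sets borel" "B \<in> sets N" for A B
  proof -
    have "A \<times> B = (A \<times> space N) \<inter> (UNIV \<times> B)"
      using sets.sets_into_space[OF that(2)] by auto
    moreover have "?\<Omega> - A \<times> B = (?\<Omega> - A \<times> space N) \<union> UNIV \<times> (space N - B)" by auto
    ultimately show ?thesis
      using strip[OF that(1)] that(2) sets.sets_into_space[OF that(2)]
      by (auto simp: bi_def intro!: analytic_Int analytic_Un analytic_UNIV_times)
  qed
  have "G \<in> sigma_sets ?\<Omega> {A \<times> B |A B. A \<in> sets borel \<and> B \<in> sets N}"
    using assms by (simp add: sets_pair_measure)
  then have "bi G"
  proof (induction rule: sigma_sets.induct)
    case (Union A)
    then show ?case using union by blast
  qed (auto simp: full compl rect)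
  then show ?thesis by (simp add: bi_def)
qed

text \<open>Choquet's capacitability argument. Outer measure is continuous along increasing unions
  of arbitrary sets, so upper bounds \<open>\<beta> i\<close> for the entries of \<sigma> can be
  imposed one after the other without falling to \<alpha>. The bounded tree branches finitely; its
  levels up to \<open>k\<close> give a finite union of boxes \<open>H k\<close>, and the projections
  of these decrease to a measurable subset of the projection of \<open>G\<close>.\<close>

lemma analytic_inner_approximation:
  assumes "analytic N G" "\<alpha> < outer_measure_of N (snd ` G)" "finite_measure N"
  obtains B where "B \<in> sets N" "B \<subseteq> snd ` G" "\<alpha> \<le> emeasure N B"
proof -
  interpret finite_measure N by fact
  obtain K :: "nat \<Rightarrow> (nat \<Rightarrow> nat) \<Rightarrow> (real \<times> 'a) set" where K: "\<And>m \<sigma>. K m \<sigma> \<in> box_unions N"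
      and dep: "\<And>m \<sigma> \<sigma>'. (\<forall>i\<le>m. \<sigma> i = \<sigma>' i) \<Longrightarrow> K m \<sigma> = K m \<sigma>'"
      and G: "G = {z. \<exists>\<sigma>. \<forall>m. z \<in> K m \<sigma>}"
    using assms(1) unfolding analytic_def by auto
  \<comment> \<open>The projection of the part of \<open>G\<close> that is reached by some \<sigma>
    whose entries before \<open>k\<close> obey the bounds \<beta>; all later entries are still free,
    so this set need not be measurable.\<close>
  define T where "T \<beta> k = snd ` {z. \<exists>\<sigma>. (\<forall>i<k. \<sigma> i \<le> \<beta> i) \<and> (\<forall>m. z \<in> K m \<sigma>)}"
    for \<beta> :: "nat \<Rightarrow> nat" and k
  have Tsub: "T \<beta> k \<subseteq> space N" for \<beta> k
    using box_unions_subset[OF K] by (force simp: T_def)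
  have step: "\<exists>v. \<alpha> < outer_measure_of N (T (\<beta>(k := v)) (Suc k))"
    if "\<alpha> < outer_measure_of N (T \<beta> k)" for \<beta> k
  proof -
    have "T \<beta> k = (\<Union>v. T (\<beta>(k := v)) (Suc k))"
    proof (intro set_eqI iffI)
      fix \<omega> assume "\<omega> \<in> T \<beta> k"
      then obtain t \<sigma> where *: "\<forall>i<k. \<sigma> i \<le> \<beta> i" "\<forall>m. (t, \<omega>) \<in> K m \<sigma>" by (auto simp: T_def)
      then have "\<forall>i<Suc k. \<sigma> i \<le> (\<beta>(k := \<sigma> k)) i" by (simp add: less_Suc_eq)
      with *(2) have "\<omega> \<in> T (\<beta>(k := \<sigma> k)) (Suc k)"
        unfolding T_def by (intro image_eqI[of _ _ "(t, \<omega>)"] CollectI exI[of _ \<sigma>]) simp_all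
      then show "\<omega> \<in> (\<Union>v. T (\<beta>(k := v)) (Suc k))" by blast
    next
      fix \<omega> assume "\<omega> \<in> (\<Union>v. T (\<beta>(k := v)) (Suc k))"
      then obtain t \<sigma> v where *: "\<forall>i<Suc k. \<sigma> i \<le> (\<beta>(k := v)) i" "\<forall>m. (t, \<omega>) \<in> K m \<sigma>"
        by (auto simp: T_def)
      have "\<forall>i<k. \<sigma> i \<le> \<beta> i" using *(1) by (auto simp: less_Suc_eq)
      then show "\<omega> \<in> T \<beta> k" using *(2)
        unfolding T_def by (intro image_eqI[of _ _ "(t, \<omega>)"] CollectI exI[of _ \<sigma>]) simp_all
    qed
    moreover have "incseq (\<lambda>v. T (\<beta>(k := v)) (Suc k))"
      unfolding incseq_def T_def
    proof (intro allI impI image_mono Collect_mono)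
      fix m n :: nat and z assume mn: "m \<le> n" and
        "\<exists>\<sigma>. (\<forall>i<Suc k. \<sigma> i \<le> (\<beta>(k := m)) i) \<and> (\<forall>m. z \<in> K m \<sigma>)"
      then obtain \<sigma> where *: "\<forall>i<Suc k. \<sigma> i \<le> (\<beta>(k := m)) i" "\<forall>m. z \<in> K m \<sigma>" by blast
      have "\<forall>i<Suc k. \<sigma> i \<le> (\<beta>(k := n)) i"
        using *(1) mn by (auto simp: less_Suc_eq split: if_splits) 
      then show "\<exists>\<sigma>. (\<forall>i<Suc k. \<sigma> i \<le> (\<beta>(k := n)) i) \<and> (\<forall>m. z \<in> K m \<sigma>)"
        using *(2) by blast
    qed
    ultimately have "outer_measure_of N (T \<beta> k) = (SUP v. outer_measure_of N (T (\<beta>(k := v)) (Suc k)))"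
      using SUP_outer_measure_of_incseq[of "\<lambda>v. T (\<beta>(k := v)) (Suc k)" N] Tsub by simp
    then show ?thesis using that by (auto simp: less_SUP_iff)
  qed
  have "\<alpha> < outer_measure_of N (T (\<lambda>_. 0) 0)"
    using assms(2) by (simp add: T_def G)
  then have "\<exists>f. \<forall>n. \<alpha> < outer_measure_of N (T (f n) n) \<and> (\<forall>i<n. f (Suc n) i = f n i)"
  proof (intro dependent_nat_choice)
    fix \<beta> n assume "\<alpha> < outer_measure_of N (T \<beta> n)"
    then obtain v where "\<alpha> < outer_measure_of N (T (\<beta>(n := v)) (Suc n))" using step by blast
    then show "\<exists>\<beta>'. \<alpha> < outer_measure_of N (T \<beta>' (Suc n)) \<and> (\<forall>i<n. \<beta>' i = \<beta> i)"
      by (intro exI[of _ "\<beta>(n := v)"]) simp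
  qed blast
  then obtain f where f: "\<And>n. \<alpha> < outer_measure_of N (T (f n) n)" "\<And>n i. i < n \<Longrightarrow> f (Suc n) i = f n i"
    by blast
  define \<beta> where "\<beta> i = f (Suc i) i" for i
  have fb: "f n i = \<beta> i" if "i < n" for n i
    using that
  proof (induction n)
    case (Suc n)
    then show ?case using f(2)[of i n] by (cases "i = n") (auto simp: \<beta>_def)
  qed simp
  have T\<beta>: "\<alpha> < outer_measure_of N (T \<beta> n)" for n
  proof -
    have "T (f n) n = T \<beta> n" by (simp add: T_def fb)
    then show ?thesis using f(1)[of n] by simp
  qed
  \<comment> \<open>Only the levels up to \<open>k\<close> are tested here. This enlarges the set,
    so the lower bound \<alpha> is inherited from \<open>T \<beta> (Suc k)\<close>, and it makes the
    set a finite union of boxes.\<close>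
  define H where "H k = {z. \<exists>\<sigma>. (\<forall>i<Suc k. \<sigma> i \<le> \<beta> i) \<and> (\<forall>m<Suc k. z \<in> K m \<sigma>)}" for k
  have H_box: "H k \<in> box_unions N" for k
  proof -
    define S where "S = {\<sigma>. (\<forall>i<Suc k. \<sigma> i \<le> \<beta> i) \<and> (\<forall>i\<ge>Suc k. \<sigma> i = 0)}"
    have "S \<subseteq> {\<sigma>. \<forall>i. (i \<in> {..<Suc k} \<longrightarrow> \<sigma> i \<in> {..\<Sum>i<Suc k. \<beta> i}) \<and> (i \<notin> {..<Suc k} \<longrightarrow> \<sigma> i = 0)}"
    proof -
      have "\<beta> i \<le> (\<Sum>i<Suc k. \<beta> i)" if "i < Suc k" for i
        using that by (intro member_le_sum) auto
      then show ?thesis by (auto simp: S_def not_less simp del: sum.lessThan_Suc) (meson order_trans)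
    qed
    then have "finite S" by (rule finite_subset) (intro finite_set_of_finite_funs; simp)
    moreover have "H k = (\<Union>\<sigma>\<in>S. \<Inter>m<Suc k. K m \<sigma>)"
    proof (intro set_eqI iffI)
      fix z assume "z \<in> H k"
      then obtain \<sigma> where *: "\<forall>i<Suc k. \<sigma> i \<le> \<beta> i" "\<forall>m<Suc k. z \<in> K m \<sigma>" by (auto simp: H_def)
      \<comment> \<open>The levels up to \<open>k\<close> do not see entries beyond
        \<open>k\<close>, so these may be set to \<open>0\<close>. Finitely many bounded sequences
        remain.\<close>
      define \<sigma>' where "\<sigma>' i = (if i < Suc k then \<sigma> i else 0)" for i
      have "K m \<sigma>' = K m \<sigma>" if "m < Suc k" for m
        by (rule dep) (use that in \<open>auto simp: \<sigma>'_def\<close>)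
      moreover have "\<sigma>' \<in> S" using *(1) by (auto simp: S_def \<sigma>'_def)
      ultimately show "z \<in> (\<Union>\<sigma>\<in>S. \<Inter>m<Suc k. K m \<sigma>)" using *(2) by (intro UN_I[of \<sigma>']) auto
    next
      fix z assume "z \<in> (\<Union>\<sigma>\<in>S. \<Inter>m<Suc k. K m \<sigma>)"
      then obtain \<sigma> where "\<sigma> \<in> S" "\<forall>m<Suc k. z \<in> K m \<sigma>" by blast
      then show "z \<in> H k" unfolding H_def S_def by (intro CollectI exI[of _ \<sigma>]) simp
    qed
    ultimately show ?thesis by (auto intro!: box_unions_UN box_unions_INT K)
  qed
  have H_dec: "decseq H"
    by (rule decseq_SucI) (auto simp: H_def less_Suc_eq)
  \<comment> \<open>Koenig's lemma. For every \<open>k\<close> there is a sequence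
    \<open>s k\<close> below \<beta> that is correct up to level \<open>k\<close>.
    \<open>Q n \<sigma>\<close> says that infinitely many of them agree with \<sigma> on the entries
    before \<open>n\<close>; since each entry takes finitely many values, such a prefix can always
    be prolonged, and the limiting sequence is correct at all levels.\<close>
  have H_sub: "(\<Inter>k. H k) \<subseteq> G"
  proof
    fix z assume "z \<in> (\<Inter>k. H k)"
    then have "\<forall>k. \<exists>\<sigma>. (\<forall>i<Suc k. \<sigma> i \<le> \<beta> i) \<and> (\<forall>m<Suc k. z \<in> K m \<sigma>)" by (auto simp: H_def)
    then obtain s where s: "\<And>k i. i < Suc k \<Longrightarrow> s k i \<le> \<beta> i" "\<And>k m. m < Suc k \<Longrightarrow> z \<in> K m (s k)"
      by metis
    define Q where "Q n \<sigma> \<longleftrightarrow> infinite {k. \<forall>i<n. s k i = \<sigma> i}" for n and \<sigma> :: "nat \<Rightarrow> nat"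
    have Qstep: "\<exists>v. Q (Suc n) (\<sigma>(n := v))" if "Q n \<sigma>" for n \<sigma>
    proof (rule ccontr)
      assume "\<not> ?thesis"
      then have fin: "finite {k. \<forall>i<Suc n. s k i = (\<sigma>(n := v)) i}" for v by (auto simp: Q_def)
      have "{k. \<forall>i<n. s k i = \<sigma> i} \<subseteq> {..n} \<union> (\<Union>v\<in>{..\<beta> n}. {k. \<forall>i<Suc n. s k i = (\<sigma>(n := v)) i})"
      proof
        fix k assume k: "k \<in> {k. \<forall>i<n. s k i = \<sigma> i}"
        show "k \<in> {..n} \<union> (\<Union>v\<in>{..\<beta> n}. {k. \<forall>i<Suc n. s k i = (\<sigma>(n := v)) i})"
        proof (cases "k \<le> n")
          case False
          then have "s k n \<le> \<beta> n" by (intro s(1)) simp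
          moreover have "\<forall>i<Suc n. s k i = (\<sigma>(n := s k n)) i" using k by (simp add: less_Suc_eq)
          ultimately show ?thesis by blast
        qed simp
      qed
      then have "finite {k. \<forall>i<n. s k i = \<sigma> i}" by (rule finite_subset) (use fin in auto)
      then show False using that by (simp add: Q_def)
    qed
    have "Q 0 (\<lambda>_. 0)" by (simp add: Q_def)
    then have "\<exists>f. \<forall>n. Q n (f n) \<and> (\<forall>i<n. f (Suc n) i = f n i)"
    proof (intro dependent_nat_choice)
      fix \<beta> n assume "Q n \<beta>"
      then obtain v where "Q (Suc n) (\<beta>(n := v))" using Qstep by blast
      then show "\<exists>\<beta>'. Q (Suc n) \<beta>' \<and> (\<forall>i<n. \<beta>' i = \<beta> i)"
        by (intro exI[of _ "\<beta>(n := v)"]) simp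
    qed blast
    then obtain f where f: "\<And>n. Q n (f n)" "\<And>n i. i < n \<Longrightarrow> f (Suc n) i = f n i"
      by blast
    define \<sigma> where "\<sigma> i = f (Suc i) i" for i
    have fs: "f n i = \<sigma> i" if "i < n" for n i
      using that
    proof (induction n)
      case (Suc n)
      then show ?case using f(2)[of i n] by (cases "i = n") (auto simp: \<sigma>_def)
    qed simp
    have "z \<in> K m \<sigma>" for m
    proof -
      have "infinite {k. \<forall>i<Suc m. s k i = \<sigma> i}" using f(1)[of "Suc m"] by (simp add: Q_def fs)
      then obtain k where k: "k > m" "\<forall>i<Suc m. s k i = \<sigma> i"
        by (auto simp: infinite_nat_iff_unbounded)
      then have "K m (s k) = K m \<sigma>" by (intro dep) auto
      then show ?thesis using s(2)[of m k] k(1) by auto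
    qed
    then show "z \<in> G" by (auto simp: G)
  qed
  have "\<alpha> \<le> emeasure N (snd ` H k)" for k
  proof -
    have "T \<beta> (Suc k) \<subseteq> snd ` H k" by (auto simp: T_def H_def)
    then have "outer_measure_of N (T \<beta> (Suc k)) \<le> outer_measure_of N (snd ` H k)"
      by (rule outer_measure_of_mono)
    then show ?thesis using T\<beta>[of "Suc k"] snd_box_unions[OF H_box] by simp
  qed
  moreover have "(INF k. emeasure N (snd ` H k)) = emeasure N (\<Inter>k. snd ` H k)"
    using snd_box_unions[OF H_box] H_dec
    by (intro INF_emeasure_decseq) (auto simp: decseq_def image_mono)
  ultimately have "\<alpha> \<le> emeasure N (\<Inter>k. snd ` H k)"
    by (metis INF_greatest)
  moreover have "(\<Inter>k. snd ` H k) \<subseteq> snd ` G"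
    unfolding snd_INT_box_unions[OF H_box H_dec, symmetric] by (rule image_mono[OF H_sub])
  moreover have "(\<Inter>k. snd ` H k) \<in> sets N"
    using snd_box_unions[OF H_box] by (intro sets.countable_INT) auto
  ultimately show ?thesis using that by blast
qed

text \<open>The outer measure of the projection is attained by a measurable hull \<open>E\<close>,
  and the inner approximations exhaust the same mass. The projection thus differs from a measurable
  set by a subset of a null set, which completeness makes measurable.\<close>

theorem measurable_projection:
  assumes "finite_measure N" "complete_measure N" and G: "G \<in> sets (borel \<Otimes>\<^sub>M N)"
  shows "snd ` (G :: (real \<times> 'a) set) \<in> sets N"
proof -
  interpret finite_measure N by fact
  interpret complete_measure N by fact
  let ?A = "snd ` G"
  have G_sub: "G \<subseteq> UNIV \<times> space N" using sets.sets_into_space[OF G] by (simp add: space_pair_measure)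
  have "?A \<subseteq> space N"
  proof
    fix \<omega> assume "\<omega> \<in> ?A"
    then obtain z where "z \<in> G" "\<omega> = snd z" by blast
    then show "\<omega> \<in> space N" using G_sub by (cases z) auto
  qed
  from outer_measure_of_attain[OF this]
  obtain E where E: "E \<in> sets N" "?A \<subseteq> E" "outer_measure_of N ?A = emeasure N E"
    by (elim bexE conjE)
  have "\<exists>B. B \<in> sets N \<and> B \<subseteq> ?A \<and> emeasure N E - ennreal (1 / Suc n) \<le> emeasure N B" for n
  proof (cases "emeasure N E = 0")
    case True
    then show ?thesis by (intro exI[of _ "{}"]) auto
  next
    case False
    then have "emeasure N E - ennreal (1 / Suc n) < emeasure N E"
      by (intro ennreal_between) (auto simp: less_top[symmetric] zero_less_iff_neq_zero)
    then obtain B where "B \<in> sets N" "B \<subseteq> ?A" "emeasure N E - ennreal (1 / Suc n) \<le> emeasure N B"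
      using analytic_inner_approximation[OF analytic_pair_measure[OF G], of "emeasure N E - ennreal (1 / Suc n)"]
        E(3) assms(1) by auto
    then show ?thesis by blast
  qed
  then obtain B where B: "\<And>n. B n \<in> sets N" "\<And>n. B n \<subseteq> ?A"
      "\<And>n. emeasure N E - ennreal (1 / Suc n) \<le> emeasure N (B n)"
    by metis
  let ?B = "\<Union>n. B n"
  have "?B \<in> sets N" "?B \<subseteq> ?A" using B by auto
  have "emeasure N E \<le> emeasure N ?B + ennreal (1 / Suc n)" for n
  proof -
    have "emeasure N (B n) \<le> emeasure N ?B" using B by (intro emeasure_mono) auto
    then have "emeasure N E - ennreal (1 / Suc n) \<le> emeasure N ?B" using B(3)[of n] by (rule order_trans[rotated])
    then show ?thesis by (simp add: ennreal_minus_le_iff add.commute)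
  qed
  then have "emeasure N E \<le> emeasure N ?B"
  proof -
    assume *: "\<And>n. emeasure N E \<le> emeasure N ?B + ennreal (1 / Suc n)"
    have "(\<lambda>n. emeasure N ?B + ennreal (1 / Suc n)) \<longlonglongrightarrow> emeasure N ?B + ennreal 0"
      by (intro tendsto_intros tendsto_ennrealI LIMSEQ_Suc[OF lim_1_over_n]) 
    then show ?thesis using * by (intro LIMSEQ_le_const) auto
  qed
  then have "emeasure N (E - ?B) = 0"
    using E B \<open>?B \<in> sets N\<close> \<open>?B \<subseteq> ?A\<close>
    by (subst emeasure_Diff) (auto simp: diff_eq_0_iff_ennreal less_top[symmetric])
  then have "E - ?B \<in> null_sets N" using E(1) \<open>?B \<in> sets N\<close> by auto
  then have "?A - ?B \<in> sets N" by (rule complete[rotated]) (use E(2) in auto)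
  then have "(?A - ?B) \<union> ?B \<in> sets N" using \<open>?B \<in> sets N\<close> by (rule sets.Un)
  moreover have "(?A - ?B) \<union> ?B = ?A"
    using Diff_partition[OF \<open>?B \<subseteq> ?A\<close>] by (simp only: Un_commute)
  ultimately show ?thesis by simp
qed

section \<open>Optional and predictable sigma-algebras\<close>

text \<open>The common ground of \<open>F\<close>, of its progressive enlargement and of the
  constant family \<open>M\<close>, so that predictable and optional sets are studied once for all
  of them.\<close>

locale complete_filtration = complete_measure M
  for M :: "'a measure" and F :: "real \<Rightarrow> 'a measure" +
  assumes subalgebra_F: "\<And>t. 0 \<le> t \<Longrightarrow> subalgebra M (F t)"
    and F_mono: "\<And>s t. 0 \<le> s \<Longrightarrow> s \<le> t \<Longrightarrow> sets (F s) \<subseteq> sets (F t)"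
    and null_sets_F0: "null_sets M \<subseteq> sets (F 0)"
begin

lemma space_F: "0 \<le> t \<Longrightarrow> space (F t) = space M"
  using subalgebra_F[of t] by (simp add: subalgebra_def)

lemma sets_F: "0 \<le> t \<Longrightarrow> A \<in> sets (F t) \<Longrightarrow> A \<in> sets M"
  using subalgebra_F[of t] by (auto simp: subalgebra_def)

lemma sets_F_mono: "A \<in> sets (F s) \<Longrightarrow> 0 \<le> s \<Longrightarrow> s \<le> t \<Longrightarrow> A \<in> sets (F t)"
  using F_mono[of s t] by auto

lemma measurable_F_mono: "f \<in> measurable (F s) L \<Longrightarrow> 0 \<le> s \<Longrightarrow> s \<le> t \<Longrightarrow> f \<in> measurable (F t) L"
  by (rule measurable_from_subalg[of "F t" "F s"]) (simp_all add: subalgebra_def space_F F_mono)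

lemma measurable_F_M: "f \<in> measurable (F s) L \<Longrightarrow> 0 \<le> s \<Longrightarrow> f \<in> measurable M L"
  by (rule measurable_from_subalg[OF subalgebra_F])

lemma null_subset_F: "A \<subseteq> N \<Longrightarrow> N \<in> null_sets M \<Longrightarrow> 0 \<le> t \<Longrightarrow> A \<in> sets (F t)"
  by (rule sets_F_mono[of _ 0]) (use complete2[of A N] null_sets_F0 in auto)

lemma AE_E_null:
  assumes "AE \<omega> in M. P \<omega>"
  obtains N where "N \<in> null_sets M" "\<And>\<omega>. \<omega> \<in> space M \<Longrightarrow> \<omega> \<notin> N \<Longrightarrow> P \<omega>"
  using AE_E3[OF assms] by (metis DiffI)

lemma measurable_F_cong_AE:
  assumes "f \<in> borel_measurable (F t)" "AE \<omega> in M. f \<omega> = (g \<omega> :: real)" "0 \<le> t"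
  shows "g \<in> borel_measurable (F t)"
proof -
  obtain N where N: "N \<in> null_sets M" "\<And>\<omega>. \<omega> \<in> space M \<Longrightarrow> \<omega> \<notin> N \<Longrightarrow> f \<omega> = g \<omega>"
    using AE_E_null[OF assms(2)] by blast
  show ?thesis
  proof (rule measurableI)
    fix B :: "real set" assume B: "B \<in> sets borel"
    have "f -` B \<inter> space M \<in> sets (F t)"
      using measurable_sets[OF assms(1) B] by (simp add: space_F assms(3))
    moreover have "N \<in> sets (F t)" using null_subset_F[OF _ N(1) assms(3)] by simp
    moreover have "g -` B \<inter> N \<inter> space M \<in> sets (F t)"
      by (rule null_subset_F[OF _ N(1) assms(3)]) auto
    ultimately have "(f -` B \<inter> space M - N) \<union> (g -` B \<inter> N \<inter> space M) \<in> sets (F t)"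
      by (intro sets.Un sets.Diff)
    moreover have "(f -` B \<inter> space M - N) \<union> (g -` B \<inter> N \<inter> space M) = g -` B \<inter> space M"
      using N(2) by auto
    ultimately show "g -` B \<inter> space (F t) \<in> sets (F t)" by (simp add: space_F assms(3))
  qed simp
qed

end

lemma sets_process_generated_sigma:
  "sets (process_generated_sigma M \<X>) = sigma_sets ({0..} \<times> space M)
     {{(t, \<omega>). 0 \<le> t \<and> \<omega> \<in> space M \<and> X t \<omega> \<in> B} | X B. X \<in> \<X> \<and> B \<in> sets borel}"
  unfolding process_generated_sigma_def by (rule sets_measure_of) auto

lemma space_process_generated_sigma [simp]:
  "space (process_generated_sigma M \<X>) = {0..} \<times> space M"
  unfolding process_generated_sigma_def by (rule space_measure_of) auto

lemma space_optional_sigma [simp]: "space (optional_sigma M F) = {0..} \<times> space M"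
  and space_predictable_sigma [simp]: "space (predictable_sigma M F) = {0..} \<times> space M"
  by (simp_all add: optional_sigma_def predictable_sigma_def)

lemma process_in_sigma:
  "X \<in> \<X> \<Longrightarrow> B \<in> sets borel \<Longrightarrow>
   {(t, \<omega>). 0 \<le> t \<and> \<omega> \<in> space M \<and> X t \<omega> \<in> B} \<in> sets (process_generated_sigma M \<X>)"
  unfolding sets_process_generated_sigma by (intro sigma_sets.Basic) blast

lemma continuous_at_left_const:
  fixes f :: "real \<Rightarrow> real"
  assumes "s < u" "\<And>x. s < x \<Longrightarrow> x < u \<Longrightarrow> f x = f u"
  shows "continuous (at_left u) f"
  unfolding continuous_within
  by (rule tendsto_eventually) (use assms in \<open>auto simp: eventually_at_left_field\<close>)

lemma continuous_at_right_const:
  fixes f :: "real \<Rightarrow> real"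
  assumes "u < s" "\<And>x. u < x \<Longrightarrow> x < s \<Longrightarrow> f x = f u"
  shows "continuous (at_right u) f"
  unfolding continuous_within
  by (rule tendsto_eventually) (use assms in \<open>auto simp: eventually_at_right_field\<close>)

lemma tendsto_at_left_const:
  fixes f :: "real \<Rightarrow> real"
  assumes "s < u" "\<And>x. s < x \<Longrightarrow> x < u \<Longrightarrow> f x = c"
  shows "(f \<longlongrightarrow> c) (at_left u)"
  by (rule tendsto_eventually) (use assms in \<open>auto simp: eventually_at_left_field\<close>)

lemma tendsto_at_right_const:
  fixes f :: "real \<Rightarrow> real"
  assumes "u < s" "\<And>x. u < x \<Longrightarrow> x < s \<Longrightarrow> f x = c"
  shows "(f \<longlongrightarrow> c) (at_right u)"
  by (rule tendsto_eventually) (use assms in \<open>auto simp: eventually_at_right_field\<close>)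

lemma caglad_path_const: "caglad_path (\<lambda>_. c)"
  by (auto simp: caglad_path_def intro: tendsto_const)

lemma caglad_path_Ioc: "caglad_path (\<lambda>u. if s < u \<and> u \<le> t then c else 0)"
  unfolding caglad_path_def
proof (intro conjI allI impI)
  fix u :: real
  show "continuous (at_left u) (\<lambda>u. if s < u \<and> u \<le> t then c else 0)"
  proof (cases "s < u")
    case True
    then show ?thesis
      by (cases "u \<le> t")
         (rule continuous_at_left_const[of s], auto,
          rule continuous_at_left_const[of "max s t"], auto)
  next
    case False
    then show ?thesis by (intro continuous_at_left_const[of "u - 1"]) auto
  qed
  show "\<exists>l. ((\<lambda>u. if s < u \<and> u \<le> t then c else 0) \<longlongrightarrow> l) (at_right u)"
  proof (cases "s \<le> u \<and> u < t")
    case True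
    then show ?thesis by (intro exI[of _ c] tendsto_at_right_const[of u t]) auto
  next
    case False
    then show ?thesis
      by (intro exI[of _ 0] tendsto_at_right_const[of u "if u < s then s else u + 1"])
         (auto split: if_splits)
  qed
qed

lemma caglad_path_0: "caglad_path (\<lambda>u. if u = 0 then c else 0)"
  unfolding caglad_path_def
proof (intro conjI allI impI)
  fix u :: real
  show "continuous (at_left u) (\<lambda>u. if u = 0 then c else 0)" if "0 < u"
    using that by (intro continuous_at_left_const[of 0]) auto
  show "\<exists>l. ((\<lambda>u. if u = 0 then c else 0) \<longlongrightarrow> l) (at_right u)" if "0 \<le> u"
    using that by (intro exI[of _ 0] tendsto_at_right_const[of u "u + 1"]) auto
qed

lemma cadlag_path_Ici: "cadlag_path (\<lambda>u. if s \<le> u then c else 0)"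
  unfolding cadlag_path_def
proof (intro conjI allI impI)
  fix u :: real
  show "continuous (at_right u) (\<lambda>u. if s \<le> u then c else 0)"
    by (rule continuous_at_right_const[of _ "if s \<le> u then u + 1 else s"]) (auto split: if_splits)
  show "\<exists>l. ((\<lambda>u. if s \<le> u then c else 0) \<longlongrightarrow> l) (at_left u)"
  proof (cases "s < u")
    case True
    then show ?thesis by (intro exI[of _ c] tendsto_at_left_const[of s]) auto
  next
    case False
    then show ?thesis by (intro exI[of _ 0] tendsto_at_left_const[of "u - 1"]) auto
  qed
qed

definition predictable_rectangles ::
    "'a measure \<Rightarrow> (real \<Rightarrow> 'a measure) \<Rightarrow> (real \<times> 'a) set set" where
  "predictable_rectangles M F =
     {{0} \<times> B | B. B \<in> sets (F 0)} \<union> {{s<..t} \<times> B | s t B. 0 \<le> s \<and> B \<in> sets (F s)}"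

context complete_filtration
begin

lemma predictable_rectangles_subset: "predictable_rectangles M F \<subseteq> Pow ({0..} \<times> space M)"
  using sets.sets_into_space[of _ "F _"] by (force simp: predictable_rectangles_def space_F)

lemma predictable_rectangles_Int_stable: "Int_stable (predictable_rectangles M F)"
proof (rule Int_stableI)
  fix C D assume C: "C \<in> predictable_rectangles M F" and D: "D \<in> predictable_rectangles M F"
  have empty: "{} \<in> predictable_rectangles M F"
    unfolding predictable_rectangles_def by blast
  consider B B' where "C = {0} \<times> B" "B \<in> sets (F 0)" "D = {0} \<times> B'" "B' \<in> sets (F 0)"
    | "C \<inter> D = {}"
    | s t B s' t' B' where "C = {s<..t} \<times> B" "0 \<le> s" "B \<in> sets (F s)"
        "D = {s'<..t'} \<times> B'" "0 \<le> s'" "B' \<in> sets (F s')"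
    using C D unfolding predictable_rectangles_def by fastforce
  then show "C \<inter> D \<in> predictable_rectangles M F"
  proof cases
    case 1
    then have "C \<inter> D = {0} \<times> (B \<inter> B')" "B \<inter> B' \<in> sets (F 0)" by auto
    then show ?thesis unfolding predictable_rectangles_def by blast
  next
    case 2
    then show ?thesis using empty by simp
  next
    case 3
    then have "C \<inter> D = {max s s'<..min t t'} \<times> (B \<inter> B')" by auto
    moreover have "B \<inter> B' \<in> sets (F (max s s'))"
      using 3 sets_F_mono[of B s "max s s'"] sets_F_mono[of B' s' "max s s'"] by auto
    ultimately show ?thesis unfolding predictable_rectangles_def
      by (intro UnI2 CollectI exI[of _ "max s s'"] exI[of _ "min t t'"] exI[of _ "B \<inter> B'"])
         (use 3 in simp)
  qed
qed

text \<open>A caglad process is the limit of step processes frozen at the left end points of dyadic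
  cells, and these are measurable for the rectangles; conversely the indicator of a rectangle is
  itself adapted and caglad. Unlike the caglad generators, the rectangles are stable under
  intersection, which measure-theoretic inductions require.\<close>

lemma sets_predictable_sigma:
  "sets (predictable_sigma M F) = sigma_sets ({0..} \<times> space M) (predictable_rectangles M F)"
proof (rule antisym)
  define R where "R = sigma ({0..} \<times> space M) (predictable_rectangles M F)"
  have sets_R: "sets R = sigma_sets ({0..} \<times> space M) (predictable_rectangles M F)"
    and space_R[simp]: "space R = {0..} \<times> space M"
    using predictable_rectangles_subset by (simp_all add: R_def)
  have R0: "{0} \<times> B \<in> sets R" if "B \<in> sets (F 0)" for B
    using that unfolding sets_R predictable_rectangles_def by (intro sigma_sets.Basic) blast
  have R1: "{s<..t} \<times> B \<in> sets R" if "0 \<le> s" "B \<in> sets (F s)" for s t B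
    using that unfolding sets_R predictable_rectangles_def by (intro sigma_sets.Basic) blast
  have R2: "{s<..} \<times> B \<in> sets R" if "0 \<le> s" "B \<in> sets (F s)" for s B
  proof -
    have "(\<Union>n::nat. {s<..s + n} \<times> B) \<in> sets R" using R1[OF that] by auto
    moreover have "x \<in> (\<Union>n::nat. {s<..s + n})" if "s < x" for x
      using that real_arch_simple[of "x - s"] by (auto simp: algebra_simps)
    then have "(\<Union>n::nat. {s<..s + n} \<times> B) = {s<..} \<times> B" by auto
    ultimately show ?thesis by simp
  qed
  have sF: "space M \<in> sets (F s)" if "0 \<le> s" for s
    using sets.top[of "F s"] that by (simp add: space_F)
  have fst_meas: "fst \<in> borel_measurable R"
    unfolding borel_measurable_iff_le
  proof
    fix a :: real
    have "{w \<in> space R. fst w \<le> a} = (if a < 0 then {} else {0} \<times> space M \<union> {0<..a} \<times> space M)"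
      by auto
    then show "{w \<in> space R. fst w \<le> a} \<in> sets R" using R0 R1[of 0] sF[of 0] by auto
  qed
  have step: "(\<lambda>z. if s < fst z then X s (snd z) else 0) \<in> borel_measurable R"
    if "0 \<le> s" "adapted F X" for s and X :: "real \<Rightarrow> 'a \<Rightarrow> real"
  proof (rule measurableI)
    fix B :: "real set" assume B: "B \<in> sets borel"
    have XB: "X s -` B \<inter> space M \<in> sets (F s)"
      using that B measurable_sets[of "X s" "F s" borel B] by (auto simp: adapted_def space_F)
    have "(\<lambda>z. if s < fst z then X s (snd z) else 0) -` B \<inter> space R =
        {s<..} \<times> (X s -` B \<inter> space M) \<union> (if 0 \<in> B then space R - {s<..} \<times> space M else {})"
      using that(1) by (auto split: if_splits)
    moreover have "space R - {s<..} \<times> space M \<in> sets R"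
      by (rule sets.compl_sets[OF R2[OF that(1) sF[OF that(1)]]])
    ultimately show "(\<lambda>z. if s < fst z then X s (snd z) else 0) -` B \<inter> space R \<in> sets R"
      using R2[OF that(1) XB] by (simp del: space_R split: if_split)
  qed simp
  have step0: "(\<lambda>z. if fst z = 0 then X 0 (snd z) else 0) \<in> borel_measurable R"
    if "adapted F X" for X :: "real \<Rightarrow> 'a \<Rightarrow> real"
  proof (rule measurableI)
    fix B :: "real set" assume B: "B \<in> sets borel"
    have XB: "X 0 -` B \<inter> space M \<in> sets (F 0)"
      using that B measurable_sets[of "X 0" "F 0" borel B] by (auto simp: adapted_def space_F)
    have "(\<lambda>z. if fst z = 0 then X 0 (snd z) else 0) -` B \<inter> space R =
        {0} \<times> (X 0 -` B \<inter> space M) \<union> (if 0 \<in> B then space R - {0} \<times> space M else {})"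
      by (auto split: if_splits)
    moreover have "space R - {0} \<times> space M \<in> sets R"
      by (rule sets.compl_sets[OF R0[OF sF[OF order_refl]]])
    ultimately show "(\<lambda>z. if fst z = 0 then X 0 (snd z) else 0) -` B \<inter> space R \<in> sets R"
      using R0[OF XB] by (simp del: space_R split: if_split)
  qed simp
  have "(\<lambda>z. X (fst z) (snd z)) \<in> borel_measurable R" if X: "adapted F X" "caglad M X"
    for X :: "real \<Rightarrow> 'a \<Rightarrow> real"
  proof (rule borel_measurable_LIMSEQ_real)
    \<comment> \<open>The ceiling minus one yields a grid point strictly before \<open>t\<close>, at
      which left-continuity can be used; the value frozen there produces rectangles that start after
      it. Time \<open>0\<close> has no predecessor and forms a cell of its own.\<close>
    define f where "f n i z = (if i \<le> 0 then if fst z = 0 then X 0 (snd z) else 0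
      else if (real_of_int i - 1) / 2 ^ n < fst z then X ((real_of_int i - 1) / 2 ^ n) (snd z) else 0)"
      for n :: nat and i :: int and z :: "real \<times> 'a"
    have f_meas: "f n i \<in> borel_measurable R" for n i
      unfolding f_def by (cases "i \<le> 0") (use step0[OF X(1)] step[OF _ X(1), of "(real_of_int i - 1) / 2 ^ n"] in simp_all)
    have ceil: "(\<lambda>z. \<lceil>fst z * 2 ^ n\<rceil>) \<in> measurable R (count_space UNIV)" for n :: nat
      using fst_meas by measurable
    show "(\<lambda>z. f n \<lceil>fst z * 2 ^ n\<rceil> z) \<in> borel_measurable R" for n
      by (rule measurable_compose_countable[OF f_meas ceil])
    fix z assume z: "z \<in> space R"
    obtain t \<omega> where tw: "z = (t, \<omega>)" "0 \<le> t" "\<omega> \<in> space M" using z by auto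
    show "(\<lambda>n. f n \<lceil>fst z * 2 ^ n\<rceil> z) \<longlonglongrightarrow> X (fst z) (snd z)"
    proof (cases "t = 0")
      case True
      then show ?thesis by (simp add: f_def tw)
    next
      case False
      then have t: "0 < t" using tw by simp
      define s where "s n = (real_of_int \<lceil>t * 2 ^ n\<rceil> - 1) / 2 ^ n" for n :: nat
      have s: "s n < t" "t - (1/2) ^ n \<le> s n" for n
      proof -
        have "real_of_int \<lceil>t * 2 ^ n\<rceil> - 1 < t * 2 ^ n" "t * 2 ^ n \<le> real_of_int \<lceil>t * 2 ^ n\<rceil>"
          by linarith+
        then show "s n < t" "t - (1/2) ^ n \<le> s n"
          by (simp_all add: s_def field_simps)
      qed
      have "s \<longlonglongrightarrow> t"
      proof (rule tendsto_sandwich)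
        show "(\<lambda>n. t - (1/2) ^ n) \<longlonglongrightarrow> t"
          by (rule tendsto_eq_intros LIMSEQ_power_zero | simp)+
        show "(\<lambda>_. t) \<longlonglongrightarrow> t" by simp
      qed (use s in \<open>auto intro: always_eventually less_imp_le\<close>)
      then have "filterlim s (at_left t) sequentially"
        using s(1) by (auto simp: filterlim_at intro!: always_eventually)
      moreover have "((\<lambda>t. X t \<omega>) \<longlongrightarrow> X t \<omega>) (at_left t)"
        using X(2) tw(3) t by (auto simp: caglad_def caglad_path_def continuous_within)
      ultimately have "(\<lambda>n. X (s n) \<omega>) \<longlonglongrightarrow> X t \<omega>" by (rule filterlim_compose[rotated])
      moreover have "f n \<lceil>fst z * 2 ^ n\<rceil> z = X (s n) \<omega>" for n
      proof -
        have "0 < t * 2 ^ n" using t by simp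
        then show ?thesis using s(1)[of n] by (simp add: f_def tw s_def)
      qed
      ultimately show ?thesis by (simp add: tw)
    qed
  qed
  note * = this
  have "{(t, \<omega>). 0 \<le> t \<and> \<omega> \<in> space M \<and> X t \<omega> \<in> B} \<in> sets R"
    if "adapted F X" "caglad M X" "B \<in> sets borel" for X B
  proof -
    have "{(t, \<omega>). 0 \<le> t \<and> \<omega> \<in> space M \<and> X t \<omega> \<in> B} = (\<lambda>z. X (fst z) (snd z)) -` B \<inter> space R"
      by auto
    then show ?thesis using measurable_sets[OF *[OF that(1,2)] that(3)] by (simp only:)
  qed
  then show "sets (predictable_sigma M F) \<subseteq> sigma_sets ({0..} \<times> space M) (predictable_rectangles M F)"
    unfolding predictable_sigma_def sets_process_generated_sigma sets_R
    by (intro sigma_sets_mono) auto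
  have rect0: "{0} \<times> B \<in> sets (predictable_sigma M F)" if B: "B \<in> sets (F 0)" for B
  proof -
    define X where "X t \<omega> = (if t = 0 then indicator B \<omega> else 0 :: real)" for t :: real and \<omega>
    have "adapted F X" unfolding adapted_def
    proof (intro allI impI)
      fix t :: real assume "0 \<le> t"
      show "X t \<in> borel_measurable (F t)" using B by (cases "t = 0") (simp_all add: X_def[abs_def])
    qed
    moreover have "caglad M X" by (auto simp: caglad_def X_def caglad_path_0)
    ultimately have "{(t, \<omega>). 0 \<le> t \<and> \<omega> \<in> space M \<and> X t \<omega> \<in> {1}} \<in> sets (predictable_sigma M F)"
      unfolding predictable_sigma_def by (intro process_in_sigma) auto
    moreover have "{(t, \<omega>). 0 \<le> t \<and> \<omega> \<in> space M \<and> X t \<omega> \<in> {1}} = {0} \<times> B"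
      using sets.sets_into_space[OF B] by (auto simp: X_def indicator_def space_F split: if_splits)
    ultimately show ?thesis by simp
  qed
  have rect1: "{s<..t} \<times> B \<in> sets (predictable_sigma M F)" if B: "B \<in> sets (F s)" and s: "0 \<le> s" for B s t
  proof -
    define X where "X u \<omega> = (if s < u \<and> u \<le> t then indicator B \<omega> else 0 :: real)" for u :: real and \<omega>
    have "adapted F X" unfolding adapted_def
    proof (intro allI impI)
      fix u :: real assume "0 \<le> u"
      have "X u = (if s < u \<and> u \<le> t then indicator B else (\<lambda>_. 0))" by (auto simp: X_def)
      then show "X u \<in> borel_measurable (F u)" using sets_F_mono[OF B s, of u] by simp
    qed
    moreover have "caglad M X" by (auto simp: caglad_def X_def caglad_path_Ioc)
    ultimately have "{(t, \<omega>). 0 \<le> t \<and> \<omega> \<in> space M \<and> X t \<omega> \<in> {1}} \<in> sets (predictable_sigma M F)"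
      unfolding predictable_sigma_def by (intro process_in_sigma) auto
    moreover have "{(t, \<omega>). 0 \<le> t \<and> \<omega> \<in> space M \<and> X t \<omega> \<in> {1}} = {s<..t} \<times> B"
      using sets.sets_into_space[OF B] s by (auto simp: X_def indicator_def space_F split: if_splits)
    ultimately show ?thesis by simp
  qed
  have "predictable_rectangles M F \<subseteq> sets (predictable_sigma M F)"
    using rect0 rect1 unfolding predictable_rectangles_def by blast
  then show "sigma_sets ({0..} \<times> space M) (predictable_rectangles M F) \<subseteq> sets (predictable_sigma M F)"
    by (rule sets.sigma_sets_subset[of _ "predictable_sigma M F", simplified])
qed

section \<open>Optional sets: comparison with predictable sets, sections, progressive
  measurability\<close>

lemma Ici_times_optional:
  assumes B: "B \<in> sets (F s)" and s: "0 \<le> s"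
  shows "{s..} \<times> B \<in> sets (optional_sigma M F)"
proof -
  define X where "X u \<omega> = (if s \<le> u then indicator B \<omega> else 0 :: real)" for u :: real and \<omega>
  have "adapted F X" unfolding adapted_def
  proof (intro allI impI)
    fix u :: real assume "0 \<le> u"
    show "X u \<in> borel_measurable (F u)" using sets_F_mono[OF B s, of u]
      by (cases "s \<le> u") (simp_all add: X_def[abs_def])
  qed
  moreover have "cadlag M X" by (auto simp: cadlag_def X_def cadlag_path_Ici)
  ultimately have "{(t, \<omega>). 0 \<le> t \<and> \<omega> \<in> space M \<and> X t \<omega> \<in> {1}} \<in> sets (optional_sigma M F)"
    unfolding optional_sigma_def by (intro process_in_sigma) auto
  moreover have "{(t, \<omega>). 0 \<le> t \<and> \<omega> \<in> space M \<and> X t \<omega> \<in> {1}} = {s..} \<times> B"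
    using sets.sets_into_space[OF B] s by (auto simp: X_def indicator_def space_F split: if_splits)
  ultimately show ?thesis by simp
qed

lemma space_in_F: "0 \<le> t \<Longrightarrow> space M \<in> sets (F t)"
  using sets.top[of "F t"] by (simp add: space_F)

lemma Ioi_times_optional:
  assumes B: "B \<in> sets (F s)" and s: "0 \<le> s"
  shows "{s<..} \<times> B \<in> sets (optional_sigma M F)"
proof -
  have "(\<Union>n. {s + 1 / Suc n..} \<times> B) \<in> sets (optional_sigma M F)"
    using s by (intro sets.countable_UN Ici_times_optional image_subsetI sets_F_mono[OF B]) auto
  moreover have "(\<Union>n. {s + 1 / Suc n..}) = {s<..}"
  proof (intro set_eqI iffI)
    fix x assume "x \<in> (\<Union>n. {s + 1 / Suc n..})"
    then obtain n where "s + 1 / Suc n \<le> x" by (auto simp del: of_nat_Suc)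
    moreover have "0 < 1 / real (Suc n)" by simp
    ultimately have "s < x" by linarith
    then show "x \<in> {s<..}" by simp
  next
    fix x assume "x \<in> {s<..}"
    then obtain n where "1 / real (Suc n) < x - s" using nat_approx_posE[of "x - s"] by auto
    then show "x \<in> (\<Union>n. {s + 1 / Suc n..})" by (intro UN_I[of n]) auto
  qed
  moreover have "(\<Union>n. {s + 1 / Suc n..} \<times> B) = (\<Union>n. {s + 1 / Suc n..}) \<times> B" by blast
  ultimately show ?thesis by simp
qed

lemma predictable_subset_optional: "sets (predictable_sigma M F) \<subseteq> sets (optional_sigma M F)"
proof -
  have "{0} \<times> B \<in> sets (optional_sigma M F)" if "B \<in> sets (F 0)" for B
  proof -
    have "{0..} \<times> B - {0<..} \<times> B \<in> sets (optional_sigma M F)"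
      using that by (intro sets.Diff Ici_times_optional Ioi_times_optional) auto
    moreover have "{0..} \<times> B - {0<..} \<times> B = {0::real} \<times> B" by auto
    ultimately show ?thesis by simp
  qed
  moreover have "{s<..t} \<times> B \<in> sets (optional_sigma M F)" if "B \<in> sets (F s)" "0 \<le> s" for s t B
  proof -
    have "{s<..} \<times> B - {max s t<..} \<times> B \<in> sets (optional_sigma M F)"
      using that by (intro sets.Diff Ioi_times_optional sets_F_mono[OF that]) auto
    moreover have "{s<..} \<times> B - {max s t<..} \<times> B = {s<..t} \<times> B" by auto
    ultimately show ?thesis by simp
  qed
  ultimately have "predictable_rectangles M F \<subseteq> sets (optional_sigma M F)"
    unfolding predictable_rectangles_def by blast
  then show ?thesis
    unfolding sets_predictable_sigma by (rule sets.sigma_sets_subset[of _ "optional_sigma M F", simplified])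
qed

lemma optional_section:
  assumes "C \<in> sets (optional_sigma M F)" "0 \<le> t"
  shows "{\<omega> \<in> space M. (t, \<omega>) \<in> C} \<in> sets (F t)"
  using assms(1) unfolding optional_sigma_def sets_process_generated_sigma
proof (induction rule: sigma_sets.induct)
  case (Basic C)
  then obtain X B where XB: "C = {(t, \<omega>). 0 \<le> t \<and> \<omega> \<in> space M \<and> X t \<omega> \<in> B}" "adapted F X" "B \<in> sets borel"
    by auto
  then have "X t -` B \<inter> space (F t) \<in> sets (F t)"
    using assms(2) by (auto simp: adapted_def intro: measurable_sets)
  moreover have "X t -` B \<inter> space (F t) = {\<omega> \<in> space M. (t, \<omega>) \<in> C}"
    using assms(2) by (auto simp: XB(1) space_F)
  ultimately show ?case by simp
next
  case Empty
  show ?case by simp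
next
  case (Compl C)
  have "space (F t) - {\<omega> \<in> space M. (t, \<omega>) \<in> C} \<in> sets (F t)"
    by (rule sets.compl_sets[OF Compl.IH])
  moreover have "space (F t) - {\<omega> \<in> space M. (t, \<omega>) \<in> C} = {\<omega> \<in> space M. (t, \<omega>) \<in> {0..} \<times> space M - C}"
    using assms(2) by (auto simp: space_F)
  ultimately show ?case by (simp only:)
next
  case (Union C)
  have "{\<omega> \<in> space M. (t, \<omega>) \<in> (\<Union>n. C n)} = (\<Union>n. {\<omega> \<in> space M. (t, \<omega>) \<in> C n})" by blast
  moreover have "(\<Union>n. {\<omega> \<in> space M. (t, \<omega>) \<in> C n}) \<in> sets (F t)"
    by (intro sets.countable_UN image_subsetI Union.IH)
  ultimately show ?case by (simp only:)
qed

lemma optional_adapted: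
  assumes "(\<lambda>(t, \<omega>). V t \<omega>) \<in> borel_measurable (optional_sigma M F)"
  shows "adapted F V"
  unfolding adapted_def
proof (intro allI impI measurableI)
  fix t :: real and B :: "real set" assume t: "0 \<le> t" and B: "B \<in> sets borel"
  have "{\<omega> \<in> space M. (t, \<omega>) \<in> (\<lambda>(t, \<omega>). V t \<omega>) -` B \<inter> space (optional_sigma M F)} \<in> sets (F t)"
    by (rule optional_section[OF measurable_sets[OF assms B] t])
  moreover have "{\<omega> \<in> space M. (t, \<omega>) \<in> (\<lambda>(t, \<omega>). V t \<omega>) -` B \<inter> space (optional_sigma M F)} =
      V t -` B \<inter> space (F t)"
    using t by (auto simp: space_F)
  ultimately show "V t -` B \<inter> space (F t) \<in> sets (F t)" by simp
qed simp

text \<open>Right-continuity calls for grid points strictly after the current time, which must not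
  exceed \<open>t\<close> to be known at \<open>t\<close>. The cut-off \<open>min t\<close> in
  \<open>q\<close> achieves both for times strictly before \<open>t\<close>, hence the strict
  inequality.\<close>

lemma cadlag_progressive:
  assumes X: "adapted F X" "cadlag M X" and t: "0 \<le> t"
  shows "(\<lambda>z. if 0 \<le> fst z \<and> fst z < t then X (fst z) (snd z) else 0) \<in> borel_measurable (borel \<Otimes>\<^sub>M F t)"
proof (rule borel_measurable_LIMSEQ_real)
  define q where "q n i = min t (max 0 ((real_of_int i + 1) / 2 ^ n))" for n :: nat and i
  define f where "f n i z = (if 0 \<le> fst z \<and> fst z < t then X (q n i) (snd z) else 0)"
    for n i and z :: "real \<times> 'a"
  have f_meas: "f n i \<in> borel_measurable (borel \<Otimes>\<^sub>M F t)" for n i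
  proof -
    have q: "0 \<le> q n i" "q n i \<le> t" using t by (auto simp: q_def)
    have "X (q n i) \<in> borel_measurable (F (q n i))" using X(1) q(1) by (simp add: adapted_def)
    from measurable_F_mono[OF this q] have "X (q n i) \<in> borel_measurable (F t)" .
    then have "(\<lambda>z. X (q n i) (snd z)) \<in> borel_measurable (borel \<Otimes>\<^sub>M F t)"
      by (rule measurable_compose[OF measurable_snd])
    then show ?thesis unfolding f_def by measurable
  qed
  have floor: "(\<lambda>z :: real \<times> 'a. \<lfloor>fst z * 2 ^ n\<rfloor>) \<in> measurable (borel \<Otimes>\<^sub>M F t) (count_space UNIV)" for n :: nat
    by measurable
  show "(\<lambda>z. f n \<lfloor>fst z * 2 ^ n\<rfloor> z) \<in> borel_measurable (borel \<Otimes>\<^sub>M F t)" for n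
    by (rule measurable_compose_countable[OF f_meas floor])
  fix z :: "real \<times> 'a" assume z: "z \<in> space (borel \<Otimes>\<^sub>M F t)"
  obtain u \<omega> where tw: "z = (u, \<omega>)" by (cases z)
  then have \<omega>: "\<omega> \<in> space M" using z t by (auto simp: space_pair_measure space_F)
  show "(\<lambda>n. f n \<lfloor>fst z * 2 ^ n\<rfloor> z) \<longlonglongrightarrow> (if 0 \<le> fst z \<and> fst z < t then X (fst z) (snd z) else 0)"
  proof (cases "0 \<le> u \<and> u < t")
    case True
    define s where "s n = q n \<lfloor>u * 2 ^ n\<rfloor>" for n
    have s: "u < s n" "s n \<le> u + (1/2) ^ n" for n
    proof -
      have fl: "real_of_int \<lfloor>u * 2 ^ n\<rfloor> \<le> u * 2 ^ n" "u * 2 ^ n < real_of_int \<lfloor>u * 2 ^ n\<rfloor> + 1"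
        by linarith+
      then have "u < (real_of_int \<lfloor>u * 2 ^ n\<rfloor> + 1) / 2 ^ n"
        "(real_of_int \<lfloor>u * 2 ^ n\<rfloor> + 1) / 2 ^ n \<le> u + (1/2) ^ n"
        by (simp_all add: field_simps)
      then show "u < s n" "s n \<le> u + (1/2) ^ n" using True by (auto simp: s_def q_def)
    qed
    have "s \<longlonglongrightarrow> u"
    proof (rule tendsto_sandwich)
      show "(\<lambda>_. u) \<longlonglongrightarrow> u" by simp
      show "(\<lambda>n. u + (1/2) ^ n) \<longlonglongrightarrow> u"
        by (rule tendsto_eq_intros LIMSEQ_power_zero | simp)+
    qed (use s in \<open>auto intro: always_eventually less_imp_le\<close>)
    then have "filterlim s (at_right u) sequentially"
      using s(1) by (auto simp: filterlim_at intro!: always_eventually)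
    moreover have "((\<lambda>t. X t \<omega>) \<longlongrightarrow> X u \<omega>) (at_right u)"
      using X(2) \<omega> True by (auto simp: cadlag_def cadlag_path_def continuous_within)
    ultimately have "(\<lambda>n. X (s n) \<omega>) \<longlonglongrightarrow> X u \<omega>" by (rule filterlim_compose[rotated])
    then show ?thesis using True by (simp add: f_def tw s_def)
  qed (auto simp: f_def tw)
qed

lemma optional_progressive:
  assumes "C \<in> sets (optional_sigma M F)" and t: "0 \<le> t"
  shows "C \<inter> {..<t} \<times> UNIV \<in> sets (borel \<Otimes>\<^sub>M F t)"
  using assms(1) unfolding optional_sigma_def sets_process_generated_sigma
proof (induction rule: sigma_sets.induct)
  have top: "{0..<t} \<times> space M \<in> sets (borel \<Otimes>\<^sub>M F t)"
    using t by (intro pair_measureI space_in_F) auto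
  {
    case (Basic C)
    then obtain X B where C: "C = {(t, \<omega>). 0 \<le> t \<and> \<omega> \<in> space M \<and> X t \<omega> \<in> B}" and
      XB: "adapted F X" "cadlag M X" "B \<in> sets borel"
      by auto
    have "((\<lambda>z. if 0 \<le> fst z \<and> fst z < t then X (fst z) (snd z) else 0) -` B \<inter> space (borel \<Otimes>\<^sub>M F t)) \<inter>
        {0..<t} \<times> space M \<in> sets (borel \<Otimes>\<^sub>M F t)"
      by (intro sets.Int top measurable_sets[OF cadlag_progressive] XB t)
    also have "((\<lambda>z. if 0 \<le> fst z \<and> fst z < t then X (fst z) (snd z) else 0) -` B \<inter> space (borel \<Otimes>\<^sub>M F t)) \<inter>
        {0..<t} \<times> space M = C \<inter> {..<t} \<times> UNIV"
      using t by (auto simp: C space_pair_measure space_F)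
    finally show ?case .
  next
    case (Compl C)
    then have "{0..<t} \<times> space M - C \<inter> {..<t} \<times> UNIV \<in> sets (borel \<Otimes>\<^sub>M F t)"
      using top by (intro sets.Diff)
    moreover have "{0..<t} \<times> space M - C \<inter> {..<t} \<times> UNIV = ({0..} \<times> space M - C) \<inter> {..<t} \<times> UNIV" by auto
    ultimately show ?case by simp
  next
    case (Union C)
    have "(\<Union>n. C n) \<inter> {..<t} \<times> UNIV = (\<Union>n. C n \<inter> {..<t} \<times> UNIV)" by auto
    moreover have "(\<Union>n. C n \<inter> {..<t} \<times> UNIV) \<in> sets (borel \<Otimes>\<^sub>M F t)"
      by (intro sets.countable_UN image_subsetI Union.IH)
    ultimately show ?case by (simp only:)
  next
    case Empty
    show ?case by simp
  }
qed

lemma optional_pair: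
  assumes "C \<in> sets (optional_sigma M F)"
  shows "C \<in> sets (borel \<Otimes>\<^sub>M M)"
proof -
  have pair_sub: "sets (borel \<Otimes>\<^sub>M F t) \<subseteq> sets (borel \<Otimes>\<^sub>M M)" if "0 \<le> t" for t
    unfolding sets_pair_measure space_F[OF that] using sets_F[OF that] by (intro sigma_sets_mono') auto
  then have "(\<Union>n::nat. C \<inter> {..<real n} \<times> UNIV) \<in> sets (borel \<Otimes>\<^sub>M M)"
    by (intro sets.countable_UN image_subsetI) (rule subsetD[OF pair_sub optional_progressive[OF assms]]; simp)
  moreover have "(\<Union>n::nat. C \<inter> {..<real n} \<times> UNIV) = C"
    using reals_Archimedean2 by auto
  ultimately show ?thesis by simp
qed

text \<open>Every subset of a null set is already known at time \<open>0\<close>, so it may be the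
  base of a predictable rectangle. Above \<open>N\<close> there is therefore no difference between
  jointly measurable and predictable sets.\<close>

lemma null_times_predictable:
  assumes C: "C \<in> sets (borel \<Otimes>\<^sub>M M)" and N: "N \<in> null_sets M"
  shows "C \<inter> {0..} \<times> N \<in> sets (predictable_sigma M F)"
proof -
  have N_sub: "N \<subseteq> space M" using sets.sets_into_space[OF null_setsD2[OF N]] .
  have rect0: "{0} \<times> B \<in> sets (predictable_sigma M F)" if "B \<subseteq> N" for B
    unfolding sets_predictable_sigma predictable_rectangles_def
    using null_subset_F[OF that N, of 0] by (intro sigma_sets.Basic) blast
  have rect: "{0<..a} \<times> B \<in> sets (predictable_sigma M F)" if "B \<subseteq> N" for a B
    unfolding sets_predictable_sigma predictable_rectangles_def
    using null_subset_F[OF that N, of 0] by (intro sigma_sets.Basic) blast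
  have Icc: "{0..a} \<times> B \<in> sets (predictable_sigma M F)" if "B \<subseteq> N" for a B
  proof (cases "0 \<le> a")
    case True
    then have "{0..a} \<times> B = {0} \<times> B \<union> {0<..a} \<times> B" by auto
    then show ?thesis using rect0[OF that] rect[OF that] by (simp only: sets.Un)
  qed simp
  have Ici: "{0..} \<times> B \<in> sets (predictable_sigma M F)" if "B \<subseteq> N" for B
  proof -
    have "{0..} \<times> B = (\<Union>n::nat. {0..real n} \<times> B)"
      using real_arch_simple by auto
    moreover have "(\<Union>n::nat. {0..real n} \<times> B) \<in> sets (predictable_sigma M F)"
      by (intro sets.countable_UN image_subsetI Icc that)
    ultimately show ?thesis by (simp only:)
  qed
  have strip: "(A \<inter> {0..}) \<times> B \<in> sets (predictable_sigma M F)" if "A \<in> sets borel" "B \<subseteq> N" for A B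
  proof -
    have "A \<in> sigma_sets UNIV (range (\<lambda>a::real. {..a}))"
      using that by (simp add: borel_eq_atMost)
    then show ?thesis
    proof (induction rule: sigma_sets.induct)
      case (Basic A)
      then obtain a where "A = {..a}" by auto
      moreover have "{..a} \<inter> {0..} = {0..a}" by auto
      ultimately show ?case using Icc[OF that(2), of a] by simp
    next
      case (Compl A)
      have "((UNIV - A) \<inter> {0..}) \<times> B = {0..} \<times> B - (A \<inter> {0..}) \<times> B" by auto
      then show ?case using Ici[OF that(2)] Compl(2) by (simp only: sets.Diff)
    next
      case (Union A)
      have "((\<Union>n. A n) \<inter> {0..}) \<times> B = (\<Union>n. (A n \<inter> {0..}) \<times> B)" by auto
      moreover have "(\<Union>n. (A n \<inter> {0..}) \<times> B) \<in> sets (predictable_sigma M F)"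
        by (intro sets.countable_UN image_subsetI Union.IH)
      ultimately show ?case by (simp only:)
    qed simp
  qed
  have "C \<in> sigma_sets (UNIV \<times> space M) {A \<times> B |A B. A \<in> sets borel \<and> B \<in> sets M}"
    using C by (simp add: sets_pair_measure)
  then show ?thesis
  proof (induction rule: sigma_sets.induct)
    case (Basic C)
    then obtain A B where "C = A \<times> B" "A \<in> sets borel" by auto
    moreover have "A \<times> B \<inter> {0..} \<times> N = (A \<inter> {0..}) \<times> (B \<inter> N)" by auto
    ultimately show ?case using strip[of A "B \<inter> N"] by simp
  next
    case (Compl C)
    have "(UNIV \<times> space M - C) \<inter> {0..} \<times> N = {0..} \<times> N - C \<inter> {0..} \<times> N"
      using N_sub by auto
    then show ?case using Ici[OF order_refl] Compl(2) by (simp only: sets.Diff)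
  next
    case (Union C)
    have "(\<Union>n. C n) \<inter> {0..} \<times> N = (\<Union>n. C n \<inter> {0..} \<times> N)" by auto
    moreover have "(\<Union>n. C n \<inter> {0..} \<times> N) \<in> sets (predictable_sigma M F)"
      by (intro sets.countable_UN image_subsetI Union.IH)
    ultimately show ?case by (simp only:)
  qed simp
qed

text \<open>Completeness puts every evanescent jointly measurable set into the predictable
  sigma-algebra, so path properties are only needed almost surely.\<close>

lemma AE_caglad_predictable:
  assumes V: "adapted F V" "AE \<omega> in M. caglad_path (\<lambda>t. V t \<omega>)"
    and joint: "\<And>B. B \<in> sets borel \<Longrightarrow>
      {(t, \<omega>). 0 \<le> t \<and> \<omega> \<in> space M \<and> V t \<omega> \<in> B} \<in> sets (borel \<Otimes>\<^sub>M M)"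
  shows "(\<lambda>(t, \<omega>). V t \<omega>) \<in> borel_measurable (predictable_sigma M F)"
proof -
  obtain N where N: "N \<in> null_sets M" "\<And>\<omega>. \<omega> \<in> space M \<Longrightarrow> \<omega> \<notin> N \<Longrightarrow> caglad_path (\<lambda>t. V t \<omega>)"
    using AE_E_null[OF V(2)] by blast
  define W where "W t \<omega> = (if \<omega> \<in> N then 0 else V t \<omega>)" for t \<omega>
  have "adapted F W" unfolding adapted_def
  proof (intro allI impI)
    fix t :: real assume t: "0 \<le> t"
    show "W t \<in> borel_measurable (F t)"
    proof (rule measurable_F_cong_AE[of "V t"])
      show "AE \<omega> in M. V t \<omega> = W t \<omega>"
        by (rule AE_I'[OF N(1)]) (auto simp: W_def)
    qed (use V(1) t in \<open>auto simp: adapted_def\<close>)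
  qed
  moreover have "caglad M W"
    unfolding caglad_def
  proof
    fix \<omega> assume "\<omega> \<in> space M"
    then show "caglad_path (\<lambda>t. W t \<omega>)"
      using N(2)[of \<omega>] by (cases "\<omega> \<in> N") (simp_all add: W_def caglad_path_const)
  qed
  ultimately have W: "{(t, \<omega>). 0 \<le> t \<and> \<omega> \<in> space M \<and> W t \<omega> \<in> B} \<in> sets (predictable_sigma M F)"
    if "B \<in> sets borel" for B
    using that unfolding predictable_sigma_def by (intro process_in_sigma) auto
  have top: "{0..} \<times> space M \<in> sets (predictable_sigma M F)"
    using sets.top[of "predictable_sigma M F"] by simp
  have N_pred: "{0..} \<times> N \<in> sets (predictable_sigma M F)"
  proof -
    have "(UNIV :: real set) \<times> space M \<in> sets (borel \<Otimes>\<^sub>M M)" by (intro pair_measureI) auto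
    from null_times_predictable[OF this N(1)]
    have "(UNIV :: real set) \<times> space M \<inter> {0..} \<times> N \<in> sets (predictable_sigma M F)" .
    moreover have "(UNIV :: real set) \<times> space M \<inter> {0..} \<times> N = {0..} \<times> N"
      using sets.sets_into_space[OF null_setsD2[OF N(1)]] by auto
    ultimately show ?thesis by (simp only:)
  qed
  show ?thesis
  proof (rule measurableI)
    fix B :: "real set" assume B: "B \<in> sets borel"
    have "({(t, \<omega>). 0 \<le> t \<and> \<omega> \<in> space M \<and> W t \<omega> \<in> B} - {0..} \<times> N) \<union>
        ({(t, \<omega>). 0 \<le> t \<and> \<omega> \<in> space M \<and> V t \<omega> \<in> B} \<inter> {0..} \<times> N) \<in> sets (predictable_sigma M F)"
      by (intro sets.Un sets.Diff W B N_pred null_times_predictable joint N(1))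
    also have "({(t, \<omega>). 0 \<le> t \<and> \<omega> \<in> space M \<and> W t \<omega> \<in> B} - {0..} \<times> N) \<union>
        ({(t, \<omega>). 0 \<le> t \<and> \<omega> \<in> space M \<and> V t \<omega> \<in> B} \<inter> {0..} \<times> N) =
        (\<lambda>(t, \<omega>). V t \<omega>) -` B \<inter> space (predictable_sigma M F)"
      by (auto simp: W_def)
    finally show "(\<lambda>(t, \<omega>). V t \<omega>) -` B \<inter> space (predictable_sigma M F) \<in> sets (predictable_sigma M F)" .
  qed simp
qed

end

section \<open>Stieltjes measures\<close>

lemma interval_measure_eqI:
  fixes F :: "real \<Rightarrow> real"
  assumes F: "mono F" "\<And>a. continuous (at_right a) F" and N: "sets N = sets borel"
    and eq: "\<And>a b. a \<le> b \<Longrightarrow> emeasure N {a<..b} = ennreal (F b - F a)"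
  shows "interval_measure F = N"
proof (rule measure_eqI_generator_eq)
  let ?E = "range (\<lambda>(a, b). {a<..b::real})"
  show "Int_stable ?E"
  proof (rule Int_stableI)
    fix C D assume "C \<in> ?E" "D \<in> ?E"
    then obtain a b c d where "C = {a<..b}" "D = {c<..d}" by auto
    then have "C \<inter> D = (\<lambda>(a, b). {a<..b}) (max a c, min b d)" by auto
    then show "C \<inter> D \<in> ?E" by (metis rangeI)
  qed
  show "sets (interval_measure F) = sigma_sets UNIV ?E" "sets N = sigma_sets UNIV ?E"
    using N by (simp, subst borel_sigma_sets_Ioc, simp)+
  show "emeasure (interval_measure F) X = emeasure N X" if X: "X \<in> ?E" for X
  proof -
    obtain a b where X: "X = {a<..b}" using X by auto
    show ?thesis
      using F eq[of a b] by (cases "a \<le> b") (auto simp: X emeasure_interval_measure_Ioc_eq mono_def)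
  qed
  show "range (\<lambda>i::nat. {- real i<..real i}) \<subseteq> ?E" by auto
  show "(\<Union>i::nat. {- real i<..real i}) = UNIV"
  proof (intro set_eqI iffI UNIV_I)
    fix x :: real
    obtain n :: nat where "\<bar>x\<bar> < real n" using reals_Archimedean2 by blast
    then show "x \<in> (\<Union>i::nat. {- real i<..real i})" by (intro UN_I[of n]) auto
  qed
  show "emeasure (interval_measure F) {- real i<..real i} \<noteq> \<infinity>" for i
    using F by (simp add: emeasure_interval_measure_Ioc_eq mono_def)
qed simp

lemma continuous_at_right_zero_extension:
  fixes v :: "real \<Rightarrow> real"
  assumes "\<And>t. 0 \<le> t \<Longrightarrow> continuous (at_right t) v"
  shows "continuous (at_right a) (\<lambda>t. if t < 0 then 0 else v t)"
proof (cases "a < 0")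
  case True
  then show ?thesis by (intro continuous_at_right_const[of a 0]) auto
next
  case False
  then have "((\<lambda>t. v t) \<longlongrightarrow> v a) (at_right a)" using assms[of a] by (auto simp: continuous_within)
  moreover have "eventually (\<lambda>t. v t = (if t < 0 then 0 else v t)) (at_right a)"
    using False by (auto simp: eventually_at_right_field intro!: exI[of _ "a + 1"])
  ultimately show ?thesis
    using False by (auto simp: continuous_within intro: Lim_transform_eventually)
qed

lemma increasing_path_extension:
  assumes "increasing_path v"
  shows "mono (\<lambda>t. if t < 0 then 0 else v t)"
    and "continuous (at_right a) (\<lambda>t. if t < 0 then 0 else v t)"
proof -
  have v: "0 \<le> v 0" "\<And>s t. 0 \<le> s \<Longrightarrow> s \<le> t \<Longrightarrow> v s \<le> v t"
    using assms by (auto simp: increasing_path_def mono_on_def)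
  show "mono (\<lambda>t. if t < 0 then 0 else v t)"
  proof (rule monoI)
    fix s t :: real assume "s \<le> t"
    then show "(if s < 0 then 0 else v s) \<le> (if t < 0 then 0 else v t)"
      using v(1) v(2)[of 0 t] v(2)[of s t] by auto
  qed
  show "continuous (at_right a) (\<lambda>t. if t < 0 then 0 else v t)"
    using assms by (intro continuous_at_right_zero_extension) (auto simp: increasing_path_def)
qed

lemma emeasure_increasing_path_Ioc:
  assumes "increasing_path v" "0 \<le> s" "s \<le> t"
  shows "emeasure (interval_measure (\<lambda>t. if t < 0 then 0 else v t)) {s<..t} = ennreal (v t - v s)"
  using increasing_path_extension[OF assms(1)] assms(2,3)
  by (subst emeasure_interval_measure_Ioc_eq) (auto simp: mono_def)

lemma emeasure_increasing_path_0:
  assumes "increasing_path v" "v 0 = 0"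
  shows "emeasure (interval_measure (\<lambda>t. if t < 0 then 0 else v t)) {0} = 0"
proof -
  let ?\<nu> = "interval_measure (\<lambda>t. if t < 0 then 0 else v t)"
  have "emeasure ?\<nu> {-1<..0} = 0"
    using increasing_path_extension[OF assms(1)] assms(2)
    by (subst emeasure_interval_measure_Ioc_eq) (auto simp: mono_def)
  moreover have "emeasure ?\<nu> {0} \<le> emeasure ?\<nu> {-1<..0}" by (intro emeasure_mono) auto
  ultimately show ?thesis by simp
qed

lemma Ioi_eq_UN_Ioc: "{0<..} = (\<Union>n::nat. {0<..real n})"
  using real_arch_simple by auto

lemma emeasure_increasing_path_Ici:
  assumes v: "increasing_path v" "v 0 = 0"
  shows "emeasure (interval_measure (\<lambda>t. if t < 0 then 0 else v t)) {0..} = (SUP n::nat. ennreal (v n))"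
proof -
  let ?\<nu> = "interval_measure (\<lambda>t. if t < 0 then 0 else v t)"
  have "emeasure ?\<nu> ({0} \<union> {0<..}) = emeasure ?\<nu> {0} + emeasure ?\<nu> {0<..}"
    by (intro plus_emeasure[symmetric]) auto
  moreover have "{0} \<union> {0<..} = {0::real..}" by auto
  moreover have "emeasure ?\<nu> {0<..} = (SUP n::nat. emeasure ?\<nu> {0<..real n})"
    unfolding Ioi_eq_UN_Ioc by (intro SUP_emeasure_incseq[symmetric]) (auto simp: incseq_def)
  moreover have "emeasure ?\<nu> {0<..real n} = ennreal (v n)" for n
    using emeasure_increasing_path_Ioc[OF v(1), of 0 "real n"] v(2) by simp
  ultimately show ?thesis using emeasure_increasing_path_0[OF v] by simp
qed

text \<open>The Stieltjes measure of the jump path is the Dirac mass at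
  \<open>\<rho> \<omega>\<close>, or the zero measure if \<open>\<rho> \<omega>\<close> is infinite.
  A jump at time \<open>0\<close> is seen because paths are continued by \<open>0\<close> to
  negative times.\<close>

lemma stieltjes_integral_jump_process:
  assumes "(\<lambda>t. X t \<omega> * indicator {0..} t) \<in> borel_measurable borel"
  shows "stieltjes_integral X (jump_process \<rho>) \<omega> = (if \<rho> \<omega> < \<infinity> then X (enn2real (\<rho> \<omega>)) \<omega> else 0)"
proof (cases "\<rho> \<omega> = \<infinity>")
  case True
  then have "(\<lambda>t. if t < 0 then 0 else jump_process \<rho> t \<omega>) = (\<lambda>_. 0)"
    by (auto simp: jump_process_def fun_eq_iff top.extremum_unique)
  moreover have "interval_measure (\<lambda>_. 0) = null_measure borel"
    by (rule interval_measure_eqI) (auto simp: mono_def)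
  ultimately show ?thesis using True by (simp add: stieltjes_integral_def nn_integral_null_measure)
next
  case False
  then obtain r where r: "\<rho> \<omega> = ennreal r" "0 \<le> r" by (cases "\<rho> \<omega>") auto
  have eq: "(\<lambda>t. if t < 0 then 0 else jump_process \<rho> t \<omega>) = (\<lambda>t. if r \<le> t then 1 else 0)"
    using r by (auto simp: jump_process_def fun_eq_iff indicator_def)
  have "interval_measure (\<lambda>t. if r \<le> t then 1 else 0) = return borel r"
  proof (rule interval_measure_eqI)
    show "continuous (at_right a) (\<lambda>t. if r \<le> t then 1 else 0 :: real)" for a
      using cadlag_path_Ici[of r 1]
      by (intro continuous_at_right_const[of _ "if r \<le> a then a + 1 else r"]) (auto split: if_splits)
  qed (auto simp: mono_def indicator_def)
  then have "stieltjes_integral X (jump_process \<rho>) \<omega> = (\<integral>\<^sup>+t. X t \<omega> * indicator {0..} t \<partial>return borel r)"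
    by (simp add: stieltjes_integral_def eq)
  also have "\<dots> = X r \<omega> * indicator {0..} r"
    by (rule nn_integral_return) (use assms in auto)
  finally show ?thesis using r by simp
qed

section \<open>Extension from rectangles to predictable integrands\<close>

context complete_filtration
begin

lemma predictable_pair: "C \<in> sets (predictable_sigma M F) \<Longrightarrow> C \<in> sets (borel \<Otimes>\<^sub>M M)"
  using predictable_subset_optional optional_pair by blast

lemma optional_time_section: "C \<in> sets (optional_sigma M F) \<Longrightarrow> {t. (t, \<omega>) \<in> C} \<in> sets borel"
  using sets_Pair2[OF optional_pair, of C \<omega>] by (simp add: vimage_def)

lemma optional_time_section_measurable:
  fixes X :: "real \<Rightarrow> 'a \<Rightarrow> ennreal"
  assumes X: "(\<lambda>(t, \<omega>). X t \<omega>) \<in> borel_measurable (optional_sigma M F)" and \<omega>: "\<omega> \<in> space M"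
  shows "(\<lambda>t. X t \<omega> * indicator {0..} t) \<in> borel_measurable borel"
proof (rule measurableI)
  fix B :: "ennreal set" assume B: "B \<in> sets borel"
  have "{t. (t, \<omega>) \<in> (\<lambda>(t, \<omega>). X t \<omega>) -` B \<inter> space (optional_sigma M F)} \<in> sets borel"
    by (rule optional_time_section[OF measurable_sets[OF X B]])
  moreover have "{t. (t, \<omega>) \<in> (\<lambda>(t, \<omega>). X t \<omega>) -` B \<inter> space (optional_sigma M F)} =
      {t. 0 \<le> t \<and> X t \<omega> \<in> B}" using \<omega> by auto
  ultimately have "{t. 0 \<le> t \<and> X t \<omega> \<in> B} \<in> sets borel" by (simp only:)
  moreover have "{t::real. t < 0 \<and> 0 \<in> B} \<in> sets borel" by (cases "0 \<in> B") auto
  ultimately have "{t. 0 \<le> t \<and> X t \<omega> \<in> B} \<union> {t. t < 0 \<and> 0 \<in> B} \<in> sets borel"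
    by (rule sets.Un)
  also have "{t. 0 \<le> t \<and> X t \<omega> \<in> B} \<union> {t. t < 0 \<and> 0 \<in> B} =
      (\<lambda>t. X t \<omega> * indicator {0..} t) -` B \<inter> space borel"
    by (auto simp: not_le split: split_indicator_asm)
  finally show "(\<lambda>t. X t \<omega> * indicator {0..} t) -` B \<inter> space borel \<in> sets borel" .
qed simp

lemma predictable_measurable_optional:
  "f \<in> measurable (predictable_sigma M F) L \<Longrightarrow> f \<in> measurable (optional_sigma M F) L"
  by (rule measurable_from_subalg[of "optional_sigma M F" "predictable_sigma M F"])
     (simp_all add: subalgebra_def predictable_subset_optional)

lemma random_time_graph:
  assumes C: "C \<in> sets (borel \<Otimes>\<^sub>M M)" and \<tau>: "\<tau> \<in> borel_measurable M"
  shows "{\<omega> \<in> space M. \<tau> \<omega> < \<infinity> \<and> (enn2real (\<tau> \<omega>), \<omega>) \<in> C} \<in> sets M"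
proof -
  have "(\<lambda>\<omega>. (enn2real (\<tau> \<omega>), \<omega>)) \<in> measurable M (borel \<Otimes>\<^sub>M M)" using \<tau> by measurable
  from measurable_sets[OF this C]
  have "(\<lambda>\<omega>. (enn2real (\<tau> \<omega>), \<omega>)) -` C \<inter> space M \<in> sets M" .
  moreover have "{\<omega> \<in> space M. \<tau> \<omega> < \<infinity>} \<in> sets M" using \<tau> by measurable
  ultimately have "((\<lambda>\<omega>. (enn2real (\<tau> \<omega>), \<omega>)) -` C \<inter> space M) \<inter> {\<omega> \<in> space M. \<tau> \<omega> < \<infinity>} \<in> sets M"
    by (rule sets.Int)
  also have "((\<lambda>\<omega>. (enn2real (\<tau> \<omega>), \<omega>)) -` C \<inter> space M) \<inter> {\<omega> \<in> space M. \<tau> \<omega> < \<infinity>} =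
      {\<omega> \<in> space M. \<tau> \<omega> < \<infinity> \<and> (enn2real (\<tau> \<omega>), \<omega>) \<in> C}" by auto
  finally show ?thesis .
qed

text \<open>Two measures on the predictable sets are compared on an intersection-stable generator;
  measurability of the kernel is proved in the same induction. Complements are subtractions, so
  total masses have to agree and path measures have to be finite. Finiteness comes from
  \<open>bdd\<close>; the total mass comes from the rectangles over \<open>{0<..n}\<close> by
  monotone convergence, and the rectangles at time \<open>0\<close> carry no mass on either
  side.\<close>

lemma stieltjes_predictable_sets:
  fixes V :: "real \<Rightarrow> 'a \<Rightarrow> real"
  defines "\<nu> \<equiv> \<lambda>\<omega>. interval_measure (\<lambda>t. if t < 0 then 0 else V t \<omega>)"
  assumes V: "\<And>t. 0 \<le> t \<Longrightarrow> V t \<in> borel_measurable M"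
    and path: "\<And>\<omega>. \<omega> \<in> space M \<Longrightarrow> increasing_path (\<lambda>t. V t \<omega>)"
    and V0: "\<And>\<omega>. \<omega> \<in> space M \<Longrightarrow> V 0 \<omega> = 0"
    and bdd: "\<And>\<omega>. \<omega> \<in> space M \<Longrightarrow> \<exists>K. \<forall>t\<ge>0. V t \<omega> \<le> K"
    and \<tau>: "\<tau> \<in> borel_measurable M" "AE \<omega> in M. \<tau> \<omega> \<noteq> 0"
    and fin: "finite_measure M"
    and incr: "\<And>s t B. 0 \<le> s \<Longrightarrow> s \<le> t \<Longrightarrow> B \<in> sets (F s) \<Longrightarrow>
      (\<integral>\<^sup>+\<omega>. ennreal (V t \<omega> - V s \<omega>) * indicator B \<omega> \<partial>M) =
      emeasure M {\<omega> \<in> space M. \<omega> \<in> B \<and> ennreal s < \<tau> \<omega> \<and> \<tau> \<omega> \<le> ennreal t}"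
    and C: "C \<in> sets (predictable_sigma M F)"
  shows "(\<lambda>\<omega>. emeasure (\<nu> \<omega>) {t. (t, \<omega>) \<in> C}) \<in> borel_measurable M \<and>
    (\<integral>\<^sup>+\<omega>. emeasure (\<nu> \<omega>) {t. (t, \<omega>) \<in> C} \<partial>M) =
      emeasure M {\<omega> \<in> space M. \<tau> \<omega> < \<infinity> \<and> (enn2real (\<tau> \<omega>), \<omega>) \<in> C}"
proof -
  interpret finite_measure M by (rule fin)
  note \<tau>(1)[measurable]
  have C': "C \<in> sigma_sets ({0..} \<times> space M) (predictable_rectangles M F)"
    using C by (simp add: sets_predictable_sigma)
  have sets_\<nu>: "sets (\<nu> \<omega>) = sets borel" for \<omega> by (simp add: \<nu>_def)
  have pred: "D \<in> sets (predictable_sigma M F)"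
    if "D \<in> sigma_sets ({0..} \<times> space M) (predictable_rectangles M F)" for D
    using that by (simp add: sets_predictable_sigma)
  have sect: "{t. (t, \<omega>) \<in> D} \<in> sets (\<nu> \<omega>)"
    if "D \<in> sigma_sets ({0..} \<times> space M) (predictable_rectangles M F)" for D \<omega>
    using optional_time_section[OF subsetD[OF predictable_subset_optional pred[OF that]]] by (simp add: sets_\<nu>)
  have \<nu>_Ici: "emeasure (\<nu> \<omega>) {0..} = (SUP n::nat. ennreal (V n \<omega>))" if "\<omega> \<in> space M" for \<omega>
    using emeasure_increasing_path_Ici[OF path V0] that by (simp add: \<nu>_def)
  have \<nu>_fin: "emeasure (\<nu> \<omega>) {0..} \<noteq> \<infinity>" if \<omega>: "\<omega> \<in> space M" for \<omega>
  proof -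
    obtain K where "\<forall>t\<ge>0. V t \<omega> \<le> K" using bdd[OF \<omega>] by blast
    then have "(SUP n::nat. ennreal (V n \<omega>)) \<le> ennreal K" by (intro SUP_least ennreal_leI) auto
    then have "emeasure (\<nu> \<omega>) {0..} \<le> ennreal K" using \<nu>_Ici[OF \<omega>] by simp
    also have "\<dots> < \<infinity>" by simp
    finally show ?thesis by simp
  qed
  have top_meas: "(\<lambda>\<omega>. emeasure (\<nu> \<omega>) {0..}) \<in> borel_measurable M"
  proof -
    have "(\<lambda>\<omega>. SUP n::nat. ennreal (V n \<omega>)) \<in> borel_measurable M"
      using V by (intro borel_measurable_SUP measurable_compose[OF _ measurable_ennreal]) auto
    then show ?thesis by (rule measurable_cong[THEN iffD1, rotated]) (simp add: \<nu>_Ici)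
  qed
  have top_int: "(\<integral>\<^sup>+\<omega>. emeasure (\<nu> \<omega>) {0..} \<partial>M) = emeasure M {\<omega> \<in> space M. \<tau> \<omega> < \<infinity>}"
  proof -
    have "(\<integral>\<^sup>+\<omega>. emeasure (\<nu> \<omega>) {0..} \<partial>M) = (\<integral>\<^sup>+\<omega>. (SUP n::nat. ennreal (V n \<omega>)) \<partial>M)"
      by (intro nn_integral_cong) (simp add: \<nu>_Ici)
    also have "\<dots> = (SUP n::nat. \<integral>\<^sup>+\<omega>. ennreal (V n \<omega>) \<partial>M)"
    proof (rule nn_integral_monotone_convergence_SUP_AE)
      show "AE \<omega> in M. ennreal (V (real n) \<omega>) \<le> ennreal (V (real (Suc n)) \<omega>)" for n
        using path by (intro AE_I2 ennreal_leI) (auto simp: increasing_path_def mono_on_def)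
    qed (use V in \<open>auto intro: measurable_compose[OF _ measurable_ennreal]\<close>)
    also have "\<dots> = (SUP n::nat. emeasure M {\<omega> \<in> space M. 0 < \<tau> \<omega> \<and> \<tau> \<omega> \<le> ennreal n})"
    proof (rule SUP_cong[OF refl])
      fix n :: nat
      have "(\<integral>\<^sup>+\<omega>. ennreal (V n \<omega>) \<partial>M) = (\<integral>\<^sup>+\<omega>. ennreal (V n \<omega> - V 0 \<omega>) * indicator (space M) \<omega> \<partial>M)"
        by (intro nn_integral_cong) (simp add: V0)
      then show "(\<integral>\<^sup>+\<omega>. ennreal (V n \<omega>) \<partial>M) = emeasure M {\<omega> \<in> space M. 0 < \<tau> \<omega> \<and> \<tau> \<omega> \<le> ennreal n}"
        using incr[of 0 n "space M"] space_in_F[of 0] by (simp cong: conj_cong)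
    qed
    also have "\<dots> = emeasure M (\<Union>n::nat. {\<omega> \<in> space M. 0 < \<tau> \<omega> \<and> \<tau> \<omega> \<le> ennreal n})"
    proof (rule SUP_emeasure_incseq)
      show "range (\<lambda>n::nat. {\<omega> \<in> space M. 0 < \<tau> \<omega> \<and> \<tau> \<omega> \<le> ennreal n}) \<subseteq> sets M"
        by auto
      show "incseq (\<lambda>n::nat. {\<omega> \<in> space M. 0 < \<tau> \<omega> \<and> \<tau> \<omega> \<le> ennreal n})"
        by (intro monoI) (auto elim!: order_trans intro!: ennreal_leI)
    qed
    also have "(\<Union>n::nat. {\<omega> \<in> space M. 0 < \<tau> \<omega> \<and> \<tau> \<omega> \<le> ennreal n}) =
        {\<omega> \<in> space M. 0 < \<tau> \<omega> \<and> \<tau> \<omega> < \<infinity>}"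
    proof (intro set_eqI iffI)
      fix \<omega> assume \<omega>: "\<omega> \<in> {\<omega> \<in> space M. 0 < \<tau> \<omega> \<and> \<tau> \<omega> < \<infinity>}"
      then obtain r where r: "\<tau> \<omega> = ennreal r" "0 \<le> r" by (cases "\<tau> \<omega>") auto
      obtain n :: nat where "r \<le> real n" using real_arch_simple by blast
      then show "\<omega> \<in> (\<Union>n::nat. {\<omega> \<in> space M. 0 < \<tau> \<omega> \<and> \<tau> \<omega> \<le> ennreal n})"
        using \<omega> r by (intro UN_I[of n]) (auto intro: ennreal_leI)
    qed (auto intro: le_less_trans)
    also have "emeasure M {\<omega> \<in> space M. 0 < \<tau> \<omega> \<and> \<tau> \<omega> < \<infinity>} = emeasure M {\<omega> \<in> space M. \<tau> \<omega> < \<infinity>}"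
      using \<tau> by (intro emeasure_eq_AE) (auto simp: zero_less_iff_neq_zero)
    finally show ?thesis .
  qed
  show ?thesis
    using predictable_rectangles_Int_stable predictable_rectangles_subset C'
  proof (induction C rule: sigma_sets_induct_disjoint)
    case (basic C)
    then consider B where "C = {0} \<times> B" "B \<in> sets (F 0)"
      | s t B where "C = {s<..t} \<times> B" "0 \<le> s" "B \<in> sets (F s)"
      unfolding predictable_rectangles_def by blast
    then show ?case
    proof cases
      case 1
      have "emeasure (\<nu> \<omega>) {t. (t, \<omega>) \<in> C} = 0" if "\<omega> \<in> space M" for \<omega>
      proof -
        have "{t. (t, \<omega>) \<in> C} = (if \<omega> \<in> B then {0} else {})" by (auto simp: 1(1))
        then show ?thesis using emeasure_increasing_path_0[OF path V0] that by (simp add: \<nu>_def)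
      qed
      moreover have "emeasure M {\<omega> \<in> space M. \<tau> \<omega> < \<infinity> \<and> (enn2real (\<tau> \<omega>), \<omega>) \<in> C} = emeasure M {}"
      proof (rule emeasure_eq_AE)
        show "AE \<omega> in M. \<omega> \<in> {\<omega> \<in> space M. \<tau> \<omega> < \<infinity> \<and> (enn2real (\<tau> \<omega>), \<omega>) \<in> C} \<longleftrightarrow> \<omega> \<in> {}"
          using \<tau>(2) by (rule eventually_mono) (auto simp: 1(1) enn2real_eq_0_iff)
        show "{\<omega> \<in> space M. \<tau> \<omega> < \<infinity> \<and> (enn2real (\<tau> \<omega>), \<omega>) \<in> C} \<in> sets M"
          by (rule random_time_graph[OF predictable_pair[OF pred[OF sigma_sets.Basic[OF basic]]] \<tau>(1)])
      qed simp
      ultimately show ?thesis by (simp cong: nn_integral_cong measurable_cong)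
    next
      case (2 s u B)
      \<comment> \<open>A rectangle with \<open>u < s\<close> is empty; the maximum leaves the set
        unchanged and provides \<open>s \<le> t\<close> for the hypothesis on increments.\<close>
      define t where "t = max s u"
      have "{s<..u} = {s<..t}" by (auto simp: t_def)
      then have 2: "C = {s<..t} \<times> B" "0 \<le> s" "B \<in> sets (F s)" "s \<le> t"
        using 2 by (auto simp: t_def)
      have *: "emeasure (\<nu> \<omega>) {t. (t, \<omega>) \<in> C} = ennreal (V t \<omega> - V s \<omega>) * indicator B \<omega>"
        if "\<omega> \<in> space M" for \<omega>
      proof -
        have "{t. (t, \<omega>) \<in> C} = (if \<omega> \<in> B then {s<..t} else {})" by (auto simp: 2(1))
        then show ?thesis
          using emeasure_increasing_path_Ioc[OF path[OF that] 2(2,4)] by (simp add: \<nu>_def)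
      qed
      have B: "B \<in> sets M" using sets_F[OF 2(2,3)] .
      have [measurable]: "V t \<in> borel_measurable M" "V s \<in> borel_measurable M" "B \<in> sets M"
        using V 2 B by auto
      have "(\<lambda>\<omega>. ennreal (V t \<omega> - V s \<omega>) * indicator B \<omega>) \<in> borel_measurable M"
        by measurable
      moreover have "{\<omega> \<in> space M. \<tau> \<omega> < \<infinity> \<and> (enn2real (\<tau> \<omega>), \<omega>) \<in> C} =
          {\<omega> \<in> space M. \<omega> \<in> B \<and> ennreal s < \<tau> \<omega> \<and> \<tau> \<omega> \<le> ennreal t}"
      proof (rule Collect_cong, rule conj_cong[OF refl])
        fix \<omega>
        show "(\<tau> \<omega> < \<infinity> \<and> (enn2real (\<tau> \<omega>), \<omega>) \<in> C) = (\<omega> \<in> B \<and> ennreal s < \<tau> \<omega> \<and> \<tau> \<omega> \<le> ennreal t)"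
          using 2 by (cases "\<tau> \<omega>") (auto simp: 2(1) top_unique ennreal_less_iff)
      qed
      ultimately show ?thesis using incr[OF 2(2,4,3)] *
        by (simp cong: nn_integral_cong measurable_cong)
    qed
  next
    case empty
    show ?case by simp
  next
    case (compl C)
    have *: "emeasure (\<nu> \<omega>) {t. (t, \<omega>) \<in> {0..} \<times> space M - C} =
        emeasure (\<nu> \<omega>) {0..} - emeasure (\<nu> \<omega>) {t. (t, \<omega>) \<in> C}"
      and le: "emeasure (\<nu> \<omega>) {t. (t, \<omega>) \<in> C} \<le> emeasure (\<nu> \<omega>) {0..}"
      if \<omega>: "\<omega> \<in> space M" for \<omega>
    proof -
      have sub: "{t. (t, \<omega>) \<in> C} \<subseteq> {0..}"
        using sets.sets_into_space[OF pred[OF compl(1)]] by auto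
      then show le: "emeasure (\<nu> \<omega>) {t. (t, \<omega>) \<in> C} \<le> emeasure (\<nu> \<omega>) {0..}"
        by (intro emeasure_mono) (auto simp: sets_\<nu>)
      have "{t. (t, \<omega>) \<in> {0..} \<times> space M - C} = {0..} - {t. (t, \<omega>) \<in> C}" using \<omega> by auto
      then show "emeasure (\<nu> \<omega>) {t. (t, \<omega>) \<in> {0..} \<times> space M - C} =
          emeasure (\<nu> \<omega>) {0..} - emeasure (\<nu> \<omega>) {t. (t, \<omega>) \<in> C}"
        using sect[OF compl(1)] \<nu>_fin[OF \<omega>] le sub
        by (simp add: emeasure_Diff sets_\<nu> top_unique less_top[symmetric] neq_top_trans)
    qed
    have meas: "(\<lambda>\<omega>. emeasure (\<nu> \<omega>) {t. (t, \<omega>) \<in> {0..} \<times> space M - C}) \<in> borel_measurable M"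
    proof -
      have "(\<lambda>\<omega>. emeasure (\<nu> \<omega>) {0..} - emeasure (\<nu> \<omega>) {t. (t, \<omega>) \<in> C}) \<in> borel_measurable M"
        using top_meas compl(2) by (intro borel_measurable_minus_ennreal) auto
      then show ?thesis by (rule measurable_cong[THEN iffD1, rotated]) (rule *[symmetric])
    qed
    have "(\<integral>\<^sup>+\<omega>. emeasure (\<nu> \<omega>) {t. (t, \<omega>) \<in> {0..} \<times> space M - C} \<partial>M) =
        (\<integral>\<^sup>+\<omega>. emeasure (\<nu> \<omega>) {0..} - emeasure (\<nu> \<omega>) {t. (t, \<omega>) \<in> C} \<partial>M)"
      by (intro nn_integral_cong *)
    also have "\<dots> = (\<integral>\<^sup>+\<omega>. emeasure (\<nu> \<omega>) {0..} \<partial>M) - (\<integral>\<^sup>+\<omega>. emeasure (\<nu> \<omega>) {t. (t, \<omega>) \<in> C} \<partial>M)"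
      using top_meas compl(2) le by (intro nn_integral_diff AE_I2) auto
    also have "\<dots> = emeasure M {\<omega> \<in> space M. \<tau> \<omega> < \<infinity>} -
        emeasure M {\<omega> \<in> space M. \<tau> \<omega> < \<infinity> \<and> (enn2real (\<tau> \<omega>), \<omega>) \<in> C}"
      using compl(2) top_int by simp
    also have "\<dots> = emeasure M ({\<omega> \<in> space M. \<tau> \<omega> < \<infinity>} -
        {\<omega> \<in> space M. \<tau> \<omega> < \<infinity> \<and> (enn2real (\<tau> \<omega>), \<omega>) \<in> C})"
      using random_time_graph[OF predictable_pair[OF pred[OF compl(1)]] \<tau>(1)] \<tau>(1)
      by (intro emeasure_Diff[symmetric]) auto
    also have "{\<omega> \<in> space M. \<tau> \<omega> < \<infinity>} - {\<omega> \<in> space M. \<tau> \<omega> < \<infinity> \<and> (enn2real (\<tau> \<omega>), \<omega>) \<in> C} =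
        {\<omega> \<in> space M. \<tau> \<omega> < \<infinity> \<and> (enn2real (\<tau> \<omega>), \<omega>) \<in> {0..} \<times> space M - C}" by auto
    finally show ?case using meas by blast
  next
    case (union C)
    have *: "emeasure (\<nu> \<omega>) {t. (t, \<omega>) \<in> (\<Union>n. C n)} = (\<Sum>n. emeasure (\<nu> \<omega>) {t. (t, \<omega>) \<in> C n})" for \<omega>
    proof -
      have "{t. (t, \<omega>) \<in> (\<Union>n. C n)} = (\<Union>n. {t. (t, \<omega>) \<in> C n})" by auto
      moreover have "disjoint_family (\<lambda>n. {t. (t, \<omega>) \<in> C n})"
        using union(1) by (auto simp: disjoint_family_on_def)
      moreover have "range (\<lambda>n. {t. (t, \<omega>) \<in> C n}) \<subseteq> sets (\<nu> \<omega>)"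
        by (intro image_subsetI sect) (use union(2) in blast)
      ultimately show ?thesis by (simp add: suminf_emeasure)
    qed
    have "(\<Sum>n. emeasure M {\<omega> \<in> space M. \<tau> \<omega> < \<infinity> \<and> (enn2real (\<tau> \<omega>), \<omega>) \<in> C n}) =
        emeasure M (\<Union>n. {\<omega> \<in> space M. \<tau> \<omega> < \<infinity> \<and> (enn2real (\<tau> \<omega>), \<omega>) \<in> C n})"
    proof (rule suminf_emeasure)
      show "disjoint_family (\<lambda>n. {\<omega> \<in> space M. \<tau> \<omega> < \<infinity> \<and> (enn2real (\<tau> \<omega>), \<omega>) \<in> C n})"
        using union(1) by (auto simp: disjoint_family_on_def)
      show "range (\<lambda>n. {\<omega> \<in> space M. \<tau> \<omega> < \<infinity> \<and> (enn2real (\<tau> \<omega>), \<omega>) \<in> C n}) \<subseteq> sets M"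
        by (intro image_subsetI random_time_graph predictable_pair pred \<tau>(1)) (use union(2) in blast)
    qed
    moreover have "(\<Union>n. {\<omega> \<in> space M. \<tau> \<omega> < \<infinity> \<and> (enn2real (\<tau> \<omega>), \<omega>) \<in> C n}) =
        {\<omega> \<in> space M. \<tau> \<omega> < \<infinity> \<and> (enn2real (\<tau> \<omega>), \<omega>) \<in> (\<Union>n. C n)}" by auto
    ultimately show ?case
      unfolding * using union(3) by (simp add: nn_integral_suminf borel_measurable_suminf_order)
  qed
qed

text \<open>The passage from indicators to nonnegative functions through sums and monotone limits.
  Measurability of the inner integral is carried along, since the outer integral is additive and
  monotonically continuous only for measurable functions.\<close>

lemma stieltjes_predictable:
  fixes V :: "real \<Rightarrow> 'a \<Rightarrow> real" and X :: "real \<Rightarrow> 'a \<Rightarrow> ennreal"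
  assumes V: "\<And>t. 0 \<le> t \<Longrightarrow> V t \<in> borel_measurable M"
    and path: "\<And>\<omega>. \<omega> \<in> space M \<Longrightarrow> increasing_path (\<lambda>t. V t \<omega>)"
    and V0: "\<And>\<omega>. \<omega> \<in> space M \<Longrightarrow> V 0 \<omega> = 0"
    and bdd: "\<And>\<omega>. \<omega> \<in> space M \<Longrightarrow> \<exists>K. \<forall>t\<ge>0. V t \<omega> \<le> K"
    and \<tau>: "\<tau> \<in> borel_measurable M" "AE \<omega> in M. \<tau> \<omega> \<noteq> 0"
    and fin: "finite_measure M"
    and incr: "\<And>s t B. 0 \<le> s \<Longrightarrow> s \<le> t \<Longrightarrow> B \<in> sets (F s) \<Longrightarrow>
      (\<integral>\<^sup>+\<omega>. ennreal (V t \<omega> - V s \<omega>) * indicator B \<omega> \<partial>M) =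
      emeasure M {\<omega> \<in> space M. \<omega> \<in> B \<and> ennreal s < \<tau> \<omega> \<and> \<tau> \<omega> \<le> ennreal t}"
    and X: "(\<lambda>(t, \<omega>). X t \<omega>) \<in> borel_measurable (predictable_sigma M F)"
  shows "(\<integral>\<^sup>+\<omega>. stieltjes_integral X V \<omega> \<partial>M) = (\<integral>\<^sup>+\<omega>. stieltjes_integral X (jump_process \<tau>) \<omega> \<partial>M)"
proof -
  define \<nu> where "\<nu> \<omega> = interval_measure (\<lambda>t. if t < 0 then 0 else V t \<omega>)" for \<omega>
  have sets_\<nu> [measurable_cong]: "sets (\<nu> \<omega>) = sets borel" for \<omega> by (simp add: \<nu>_def)
  let ?I = "\<lambda>f \<omega>. \<integral>\<^sup>+t. f (t, \<omega>) * indicator {0..} t \<partial>\<nu> \<omega>"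
  let ?J = "\<lambda>f \<omega>. if \<tau> \<omega> < \<infinity> then f (enn2real (\<tau> \<omega>), \<omega>) else 0 :: ennreal"
  have sect: "(\<lambda>t. f (t, \<omega>) * indicator {0..} t) \<in> borel_measurable (\<nu> \<omega>)"
    if "f \<in> borel_measurable (predictable_sigma M F)" "\<omega> \<in> space M" for f :: "real \<times> 'a \<Rightarrow> ennreal" and \<omega>
    using optional_time_section_measurable[of "\<lambda>t \<omega>. f (t, \<omega>)" \<omega>] predictable_measurable_optional[OF that(1)] that(2)
    by (simp add: measurable_cong_sets[OF sets_\<nu> refl] case_prod_beta')
  have J_meas: "?J f \<in> borel_measurable M" if f: "f \<in> borel_measurable (predictable_sigma M F)"
    for f :: "real \<times> 'a \<Rightarrow> ennreal"
  proof -
    have "(\<lambda>\<omega>. (enn2real (\<tau> \<omega>), \<omega>)) \<in> measurable M (predictable_sigma M F)"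
    proof (rule measurableI)
      fix C assume C: "C \<in> sets (predictable_sigma M F)"
      have "(\<lambda>\<omega>. (enn2real (\<tau> \<omega>), \<omega>)) \<in> measurable M (borel \<Otimes>\<^sub>M M)" using \<tau>(1) by measurable
      from measurable_sets[OF this predictable_pair[OF C]]
      show "(\<lambda>\<omega>. (enn2real (\<tau> \<omega>), \<omega>)) -` C \<inter> space M \<in> sets M" .
    qed simp
    from measurable_compose[OF this f] show ?thesis using \<tau>(1) by measurable
  qed
  have "?I f \<in> borel_measurable M \<and> integral\<^sup>N M (?I f) = integral\<^sup>N M (?J f)"
    if "f \<in> borel_measurable (predictable_sigma M F)" for f
    using that
  proof (induction f rule: borel_measurable_induct)
    case (cong f g)
    have "?I f \<omega> = ?I g \<omega>" "?J f \<omega> = ?J g \<omega>" if "\<omega> \<in> space M" for \<omega>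
      using cong(3) that by (auto intro!: nn_integral_cong simp: indicator_def)
    then show ?case using cong(4) by (simp cong: nn_integral_cong measurable_cong)
  next
    case (set C)
    have "?I (indicator C) \<omega> = emeasure (\<nu> \<omega>) {t. (t, \<omega>) \<in> C}" for \<omega>
    proof -
      have "?I (indicator C) \<omega> = (\<integral>\<^sup>+t. indicator {t. (t, \<omega>) \<in> C} t \<partial>\<nu> \<omega>)"
        using sets.sets_into_space[OF set] by (intro nn_integral_cong) (auto simp: indicator_def)
      also have "\<dots> = emeasure (\<nu> \<omega>) {t. (t, \<omega>) \<in> C}"
        using optional_time_section[OF subsetD[OF predictable_subset_optional set]]
        by (intro nn_integral_indicator) (simp add: sets_\<nu>)
      finally show ?thesis .
    qed
    moreover have "integral\<^sup>N M (?J (indicator C)) =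
        emeasure M {\<omega> \<in> space M. \<tau> \<omega> < \<infinity> \<and> (enn2real (\<tau> \<omega>), \<omega>) \<in> C}"
      by (subst nn_integral_indicator[OF random_time_graph[OF predictable_pair[OF set] \<tau>(1)], symmetric])
         (auto intro!: nn_integral_cong simp: indicator_def)
    moreover have "(\<lambda>\<omega>. emeasure (\<nu> \<omega>) {t. (t, \<omega>) \<in> C}) \<in> borel_measurable M \<and>
        (\<integral>\<^sup>+\<omega>. emeasure (\<nu> \<omega>) {t. (t, \<omega>) \<in> C} \<partial>M) =
        emeasure M {\<omega> \<in> space M. \<tau> \<omega> < \<infinity> \<and> (enn2real (\<tau> \<omega>), \<omega>) \<in> C}"
      unfolding \<nu>_def by (rule stieltjes_predictable_sets[OF V path V0 bdd \<tau> fin incr set])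
    ultimately show ?case by (simp only:)
  next
    case (mult u c)
    have *: "?I (\<lambda>x. c * u x) \<omega> = c * ?I u \<omega>" if "\<omega> \<in> space M" for \<omega>
      using sect[OF mult(2) that] by (simp add: mult.assoc nn_integral_cmult)
    moreover have "integral\<^sup>N M (?J (\<lambda>x. c * u x)) = c * integral\<^sup>N M (?J u)"
      using J_meas[OF mult(2)] by (subst nn_integral_cmult[symmetric]) (auto intro!: nn_integral_cong)
    moreover have "(\<lambda>\<omega>. c * ?I u \<omega>) \<in> borel_measurable M"
      using mult(4) by (intro borel_measurable_times_ennreal measurable_const) auto
    ultimately show ?case using mult(4)
      by (simp add: nn_integral_cmult cong: nn_integral_cong measurable_cong)
  next
    case (add u v)
    have *: "?I (\<lambda>x. v x + u x) \<omega> = ?I v \<omega> + ?I u \<omega>" if "\<omega> \<in> space M" for \<omega>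
      using sect[OF add(1) that] sect[OF add(3) that] by (simp add: distrib_right nn_integral_add)
    moreover have "integral\<^sup>N M (?J (\<lambda>x. v x + u x)) = integral\<^sup>N M (?J v) + integral\<^sup>N M (?J u)"
      using J_meas[OF add(1)] J_meas[OF add(3)]
      by (subst nn_integral_add[symmetric]) (auto intro!: nn_integral_cong)
    moreover have "(\<lambda>\<omega>. ?I v \<omega> + ?I u \<omega>) \<in> borel_measurable M"
      using add.IH by (intro borel_measurable_add) auto
    ultimately show ?case using add.IH
      by (simp add: nn_integral_add cong: nn_integral_cong measurable_cong)
  next
    case (seq U)
    have *: "?I (SUP i. U i) \<omega> = (SUP i. ?I (U i) \<omega>)" if "\<omega> \<in> space M" for \<omega>
    proof -
      have "?I (SUP i. U i) \<omega> = (\<integral>\<^sup>+t. (SUP i. U i (t, \<omega>) * indicator {0..} t) \<partial>\<nu> \<omega>)"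
        by (simp add: SUP_mult_right_ennreal image_comp)
      also have "\<dots> = (SUP i. ?I (U i) \<omega>)"
        using seq.hyps(3) sect[OF seq.hyps(1) that]
        by (intro nn_integral_monotone_convergence_SUP)
           (auto simp: incseq_def le_fun_def intro!: mult_right_mono)
      finally show ?thesis .
    qed
    have inc: "incseq (\<lambda>i. ?I (U i))"
      using seq.hyps(3) by (auto simp: incseq_def le_fun_def intro!: nn_integral_mono mult_right_mono)
    have "integral\<^sup>N M (?J (SUP i. U i)) = (\<integral>\<^sup>+\<omega>. (SUP i. ?J (U i) \<omega>) \<partial>M)"
      by (intro nn_integral_cong) (auto simp: image_comp)
    also have "\<dots> = (SUP i. integral\<^sup>N M (?J (U i)))"
      using seq.hyps(3) J_meas[OF seq.hyps(1)]
      by (intro nn_integral_monotone_convergence_SUP) (auto simp: incseq_def le_fun_def)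
    also have "\<dots> = (SUP i. integral\<^sup>N M (?I (U i)))" using seq.IH by simp
    also have "\<dots> = (\<integral>\<^sup>+\<omega>. (SUP i. ?I (U i) \<omega>) \<partial>M)"
      using inc seq.IH by (intro nn_integral_monotone_convergence_SUP[symmetric]) auto
    also have "\<dots> = integral\<^sup>N M (?I (SUP i. U i))"
      by (intro nn_integral_cong) (simp only: *)
    finally have "integral\<^sup>N M (?I (SUP i. U i)) = integral\<^sup>N M (?J (SUP i. U i))" by (rule sym)
    moreover have "?I (SUP i. U i) \<in> borel_measurable M"
    proof -
      have "(\<lambda>\<omega>. SUP i. ?I (U i) \<omega>) \<in> borel_measurable M"
        using seq.IH by (intro borel_measurable_SUP) auto
      then show ?thesis by (rule measurable_cong[THEN iffD1, rotated]) (simp only: *)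
    qed
    ultimately show ?case by blast
  qed
  from this[OF X] have "(\<integral>\<^sup>+\<omega>. stieltjes_integral X V \<omega> \<partial>M) =
      (\<integral>\<^sup>+\<omega>. (if \<tau> \<omega> < \<infinity> then X (enn2real (\<tau> \<omega>)) \<omega> else 0) \<partial>M)"
    by (simp add: stieltjes_integral_def \<nu>_def cong: if_cong)
  also have "\<dots> = (\<integral>\<^sup>+\<omega>. stieltjes_integral X (jump_process \<tau>) \<omega> \<partial>M)"
    using optional_time_section_measurable[OF predictable_measurable_optional[OF X]]
    by (intro nn_integral_cong) (simp add: stieltjes_integral_jump_process)
  finally show ?thesis .
qed

end

section \<open>Progressive enlargement\<close>

sublocale usual_filtered_prob_space \<subseteq> complete_filtration M F
  by unfold_locales (use subalgebra_filtration filtration_mono null_sets_in_filtration in auto)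

context usual_filtered_prob_space
begin

lemma sets_F_right:
  assumes "0 \<le> t" "\<And>s. t < s \<Longrightarrow> A \<in> sets (F s)"
  shows "A \<in> sets (F t)"
proof -
  have "A \<in> (\<Inter>s\<in>{t<..}. sets (F s))" using assms(2) by auto
  then show ?thesis using filtration_right_continuous[OF assms(1)] by simp
qed

lemma measurable_F_right:
  fixes f :: "'a \<Rightarrow> 'b::topological_space"
  assumes "0 \<le> t" "\<And>s. t < s \<Longrightarrow> f \<in> borel_measurable (F s)"
  shows "f \<in> borel_measurable (F t)"
proof (rule measurableI)
  fix B :: "'b set" assume B: "B \<in> sets borel"
  have "f -` B \<inter> space M \<in> sets (F s)" if "t < s" for s
    using measurable_sets[OF assms(2)[OF that] B] assms(1) that by (simp add: space_F)
  from sets_F_right[OF assms(1) this] show "f -` B \<inter> space (F t) \<in> sets (F t)"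
    by (simp add: space_F assms(1))
qed simp

context
  fixes \<rho> :: "'a \<Rightarrow> ennreal"
  assumes \<rho>: "\<rho> \<in> borel_measurable M"
begin

lemma space_join: "space (filtration_join_time M F \<rho> t) = space M" if "0 \<le> t"
  unfolding filtration_join_time_def using sets.space_closed[of "F t"] that
  by (intro space_measure_of) (auto simp: space_F sets_vimage_algebra2)

lemma sets_join: "sets (filtration_join_time M F \<rho> t) = sigma_sets (space M)
    (sets (F t) \<union> {(\<lambda>\<omega>. min (\<rho> \<omega>) (ennreal t)) -` A \<inter> space M |A. A \<in> sets borel})" if "0 \<le> t"
proof -
  have "sets (vimage_algebra (space M) (\<lambda>\<omega>. min (\<rho> \<omega>) (ennreal t)) borel) =
      {(\<lambda>\<omega>. min (\<rho> \<omega>) (ennreal t)) -` A \<inter> space M |A. A \<in> sets borel}"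
    by (rule sets_vimage_algebra2) auto
  then show ?thesis
    unfolding filtration_join_time_def using sets.space_closed[of "F t"] that
    by (subst sets_measure_of) (auto simp: space_F)
qed

lemma F_subset_join: "0 \<le> t \<Longrightarrow> sets (F t) \<subseteq> sets (filtration_join_time M F \<rho> t)"
  by (auto simp: sets_join intro: sigma_sets.Basic)

lemma min_measurable_join:
  assumes t: "0 \<le> t"
  shows "(\<lambda>\<omega>. min (\<rho> \<omega>) (ennreal t)) \<in> borel_measurable (filtration_join_time M F \<rho> t)"
proof (rule measurableI)
  fix A :: "ennreal set" assume "A \<in> sets borel"
  then show "(\<lambda>\<omega>. min (\<rho> \<omega>) (ennreal t)) -` A \<inter> space (filtration_join_time M F \<rho> t) \<in>
      sets (filtration_join_time M F \<rho> t)"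
    unfolding sets_join[OF t] space_join[OF t] by (intro sigma_sets.Basic) blast
qed simp

lemma join_subset_M: "0 \<le> t \<Longrightarrow> sets (filtration_join_time M F \<rho> t) \<subseteq> sets M"
proof -
  assume t: "0 \<le> t"
  have "(\<lambda>\<omega>. min (\<rho> \<omega>) (ennreal t)) -` A \<inter> space M \<in> sets M" if "A \<in> sets borel" for A
    by (rule measurable_sets[OF _ that]) (use \<rho> in measurable)
  then have "{(\<lambda>\<omega>. min (\<rho> \<omega>) (ennreal t)) -` A \<inter> space M |A. A \<in> sets borel} \<subseteq> sets M"
    by (intro subsetI) (elim CollectE exE conjE, simp)
  moreover have "sets (F t) \<subseteq> sets M" using subalgebra_F[OF t] by (simp add: subalgebra_def)
  ultimately show ?thesis unfolding sets_join[OF t] by (intro sets.sigma_sets_subset Un_least)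
qed

lemma join_mono: "0 \<le> s \<Longrightarrow> s \<le> t \<Longrightarrow>
  sets (filtration_join_time M F \<rho> s) \<subseteq> sets (filtration_join_time M F \<rho> t)"
proof -
  assume s: "0 \<le> s" "s \<le> t"
  then have t: "0 \<le> t" by simp
  have "(\<lambda>\<omega>. min (\<rho> \<omega>) (ennreal s)) -` A \<inter> space M \<in> sets (filtration_join_time M F \<rho> t)"
    if "A \<in> sets borel" for A
  proof -
    have "(\<lambda>\<omega>. min (min (\<rho> \<omega>) (ennreal t)) (ennreal s)) \<in> borel_measurable (filtration_join_time M F \<rho> t)"
      using min_measurable_join[OF t] by measurable
    moreover have "min (min (\<rho> \<omega>) (ennreal t)) (ennreal s) = min (\<rho> \<omega>) (ennreal s)" for \<omega>
      using ennreal_leI[OF s(2)] by (simp add: min.assoc min_absorb2)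
    ultimately have "(\<lambda>\<omega>. min (\<rho> \<omega>) (ennreal s)) \<in> borel_measurable (filtration_join_time M F \<rho> t)"
      by simp
    from measurable_sets[OF this that] show ?thesis by (simp add: space_join t)
  qed
  then have "{(\<lambda>\<omega>. min (\<rho> \<omega>) (ennreal s)) -` A \<inter> space M |A. A \<in> sets borel} \<subseteq>
      sets (filtration_join_time M F \<rho> t)"
    by (intro subsetI) (elim CollectE exE conjE, simp)
  with order_trans[OF F_mono[OF s] F_subset_join[OF t]]
  have "sets (F s) \<union> {(\<lambda>\<omega>. min (\<rho> \<omega>) (ennreal s)) -` A \<inter> space M |A. A \<in> sets borel} \<subseteq>
      sets (filtration_join_time M F \<rho> t)" by (rule Un_least)
  from sets.sigma_sets_subset[OF this] show ?thesis
    unfolding sets_join[OF s(1)] by (simp add: space_join t)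
qed

text \<open>An intersection of sigma-algebras on the same space is one already; \<open>sigma\<close>
  in the definition merely turns the family of sets into a measure space.\<close>

lemma sets_enlargement:
  assumes t: "0 \<le> t"
  shows "sets (progressive_enlargement M F \<rho> t) = (\<Inter>s\<in>{t<..}. sets (filtration_join_time M F \<rho> s))"
proof -
  let ?I = "\<Inter>s\<in>{t<..}. sets (filtration_join_time M F \<rho> s)"
  have "?I \<subseteq> sets (filtration_join_time M F \<rho> (t + 1))" by (intro INF_lower) simp
  also have "\<dots> \<subseteq> Pow (space M)"
    using sets.space_closed[of "filtration_join_time M F \<rho> (t + 1)"] t by (simp add: space_join)
  finally have "sets (progressive_enlargement M F \<rho> t) = sigma_sets (space M) ?I"
    unfolding progressive_enlargement_def by (rule sets_measure_of)
  also have "\<dots> = ?I"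
  proof (rule antisym)
    show "sigma_sets (space M) ?I \<subseteq> ?I"
    proof (rule INF_greatest)
      fix s assume s: "s \<in> {t<..}"
      have "?I \<subseteq> sets (filtration_join_time M F \<rho> s)" using s by (rule INF_lower)
      from sets.sigma_sets_subset[OF this]
      show "sigma_sets (space M) ?I \<subseteq> sets (filtration_join_time M F \<rho> s)"
        using s t by (simp add: space_join)
    qed
    show "?I \<subseteq> sigma_sets (space M) ?I" by (rule sigma_sets_superset_generator)
  qed
  finally show ?thesis .
qed

lemma space_enlargement:
  assumes t: "0 \<le> t"
  shows "space (progressive_enlargement M F \<rho> t) = space M"
proof -
  let ?I = "\<Inter>s\<in>{t<..}. sets (filtration_join_time M F \<rho> s)"
  have "?I \<subseteq> sets (filtration_join_time M F \<rho> (t + 1))" by (intro INF_lower) simp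
  also have "\<dots> \<subseteq> Pow (space M)"
    using sets.space_closed[of "filtration_join_time M F \<rho> (t + 1)"] t by (simp add: space_join)
  finally show ?thesis unfolding progressive_enlargement_def by (rule space_measure_of)
qed

lemma join_subset_enlargement:
  assumes t: "0 \<le> t"
  shows "sets (filtration_join_time M F \<rho> t) \<subseteq> sets (progressive_enlargement M F \<rho> t)"
  unfolding sets_enlargement[OF t] using t by (intro INF_greatest join_mono) auto

lemma F_subset_enlargement: "0 \<le> t \<Longrightarrow> sets (F t) \<subseteq> sets (progressive_enlargement M F \<rho> t)"
  using F_subset_join join_subset_enlargement by blast

lemma complete_filtration_enlargement: "complete_filtration M (progressive_enlargement M F \<rho>)"
proof unfold_locales
  fix s t :: real assume s: "0 \<le> s"
  have "sets (progressive_enlargement M F \<rho> s) \<subseteq> sets (filtration_join_time M F \<rho> (s + 1))"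
    unfolding sets_enlargement[OF s] by (intro INF_lower) simp
  also have "\<dots> \<subseteq> sets M" using s by (intro join_subset_M) simp
  finally show "subalgebra M (progressive_enlargement M F \<rho> s)"
    using s by (simp add: subalgebra_def space_enlargement)
  assume st: "s \<le> t"
  then have t: "0 \<le> t" using s by simp
  show "sets (progressive_enlargement M F \<rho> s) \<subseteq> sets (progressive_enlargement M F \<rho> t)"
    unfolding sets_enlargement[OF s] sets_enlargement[OF t]
    using st by (intro INF_superset_mono) auto
next
  show "null_sets M \<subseteq> sets (progressive_enlargement M F \<rho> 0)"
    using null_sets_F0 F_subset_enlargement[of 0] by auto
qed

text \<open>On the event \<open>t < \<rho>\<close> the variable \<open>min \<rho> t\<close> is the
  constant \<open>t\<close>, so its sigma-algebra is trivial there. Coinciding on this event with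
  some member of \<open>F t\<close> is preserved by complements and countable unions.\<close>

lemma join_trace:
  assumes B: "B \<in> sets (filtration_join_time M F \<rho> t)" and t: "0 \<le> t"
  shows "\<exists>B'\<in>sets (F t). \<forall>\<omega>\<in>space M. ennreal t < \<rho> \<omega> \<longrightarrow> (\<omega> \<in> B \<longleftrightarrow> \<omega> \<in> B')"
  using B unfolding sets_join[OF t]
proof (induction rule: sigma_sets.induct)
  case (Basic B)
  then show ?case
  proof
    assume "B \<in> {(\<lambda>\<omega>. min (\<rho> \<omega>) (ennreal t)) -` A \<inter> space M |A. A \<in> sets borel}"
    then obtain A where A: "B = (\<lambda>\<omega>. min (\<rho> \<omega>) (ennreal t)) -` A \<inter> space M" by blast
    show ?thesis
      by (rule bexI[of _ "if ennreal t \<in> A then space M else {}"])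
         (use t in \<open>auto simp: A min_def space_in_F\<close>)
  qed blast
next
  case (Compl B)
  then obtain B' where B': "B' \<in> sets (F t)" "\<forall>\<omega>\<in>space M. ennreal t < \<rho> \<omega> \<longrightarrow> (\<omega> \<in> B \<longleftrightarrow> \<omega> \<in> B')"
    by blast
  have "space (F t) - B' \<in> sets (F t)" by (rule sets.compl_sets[OF B'(1)])
  then show ?case using B'(2) by (intro bexI[of _ "space M - B'"]) (auto simp: space_F t)
next
  case (Union B)
  then obtain B' where B': "\<And>n. B' n \<in> sets (F t)"
      "\<And>n. \<forall>\<omega>\<in>space M. ennreal t < \<rho> \<omega> \<longrightarrow> (\<omega> \<in> B n \<longleftrightarrow> \<omega> \<in> B' n)"
    by metis
  have "(\<Union>n. B' n) \<in> sets (F t)" by (intro sets.countable_UN image_subsetI B'(1))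
  then show ?case using B'(2) by (intro bexI[of _ "\<Union>n. B' n"]) auto
qed (use t in auto)

text \<open>A member of the enlargement at \<open>s\<close> belongs to the join at each later time
  \<open>u n\<close>, where it has a trace \<open>B' n\<close> valid on \<open>u n < \<rho>\<close>.
  As \<open>u n\<close> decreases to \<open>s\<close>, every path with \<open>s < \<rho>\<close>
  eventually satisfies this, so the limes inferior \<open>L\<close> of the traces is a trace on
  \<open>s < \<rho>\<close>. It is determined by times arbitrarily close to \<open>s\<close>, and
  right-continuity of \<open>F\<close> puts it into \<open>F s\<close>.\<close>

lemma enlargement_trace:
  assumes B: "B \<in> sets (progressive_enlargement M F \<rho> s)" and s: "0 \<le> s"
  obtains B' where "B' \<in> sets (F s)" "\<And>\<omega>. \<omega> \<in> space M \<Longrightarrow> ennreal s < \<rho> \<omega> \<Longrightarrow> \<omega> \<in> B \<longleftrightarrow> \<omega> \<in> B'"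
proof -
  define u where "u n = s + 1 / Suc n" for n
  have u: "s < u n" "0 \<le> u n" for n using s by (auto simp: u_def add_pos_nonneg less_imp_le)
  have u_dec: "u n \<le> u m" if "m \<le> n" for m n using that by (auto simp: u_def field_simps)
  have "\<exists>B'\<in>sets (F (u n)). \<forall>\<omega>\<in>space M. ennreal (u n) < \<rho> \<omega> \<longrightarrow> (\<omega> \<in> B \<longleftrightarrow> \<omega> \<in> B')" for n
    using B u by (intro join_trace) (auto simp: sets_enlargement s)
  then obtain B' where B': "\<And>n. B' n \<in> sets (F (u n))"
      "\<And>n \<omega>. \<omega> \<in> space M \<Longrightarrow> ennreal (u n) < \<rho> \<omega> \<Longrightarrow> (\<omega> \<in> B \<longleftrightarrow> \<omega> \<in> B' n)"
    by metis
  define L where "L = {\<omega>. \<exists>N. \<forall>n\<ge>N. \<omega> \<in> B' n}"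
  show ?thesis
  proof
    show "L \<in> sets (F s)"
    proof (rule sets_F_right[OF s])
      fix r assume r: "s < r"
      then obtain m where m: "1 / real (Suc m) < r - s" using nat_approx_posE[of "r - s"] by auto
      then have um: "u m \<le> r" by (simp add: u_def)
      have Br: "B' n \<in> sets (F r)" if "m \<le> n" for n
        by (rule sets_F_mono[OF B'(1) u(2)]) (use u_dec[OF that] um in simp)
      have "(\<Inter>n. B' (n + max N m)) \<in> sets (F r)" for N
        by (rule sets.countable_INT, rule image_subsetI, rule Br) simp_all
      then have "(\<Union>N. \<Inter>n. B' (n + max N m)) \<in> sets (F r)"
        by (intro sets.countable_UN image_subsetI)
      also have "(\<Union>N. \<Inter>n. B' (n + max N m)) = L"
      proof (intro set_eqI iffI)
        fix \<omega> assume "\<omega> \<in> (\<Union>N. \<Inter>n. B' (n + max N m))"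
        then obtain N where N: "\<And>n. \<omega> \<in> B' (n + max N m)" by blast
        have "\<omega> \<in> B' n" if "max N m \<le> n" for n
          using N[of "n - max N m"] that by (simp only: le_add_diff_inverse2)
        then show "\<omega> \<in> L" unfolding L_def by (intro CollectI exI[of _ "max N m"] allI impI)
      next
        fix \<omega> assume "\<omega> \<in> L"
        then obtain N where "\<And>n. N \<le> n \<Longrightarrow> \<omega> \<in> B' n" by (auto simp: L_def)
        then have "\<omega> \<in> (\<Inter>n. B' (n + max N m))" by simp
        then show "\<omega> \<in> (\<Union>N. \<Inter>n. B' (n + max N m))" by blast
      qed
      finally show "L \<in> sets (F r)" .
    qed
    fix \<omega> assume \<omega>: "\<omega> \<in> space M" "ennreal s < \<rho> \<omega>"
    have "\<exists>m. \<forall>n\<ge>m. ennreal (u n) < \<rho> \<omega>"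
    proof (cases "\<rho> \<omega>")
      case (real r)
      then have "s < r" using \<omega>(2) s by (simp add: ennreal_less_iff)
      then obtain m where m: "1 / real (Suc m) < r - s" using nat_approx_posE[of "r - s"] by auto
      have "u n < r" if "m \<le> n" for n using u_dec[OF that] m by (simp add: u_def)
      then show ?thesis using real u(2) by (auto simp: ennreal_less_iff)
    qed simp
    then obtain m where m: "\<And>n. m \<le> n \<Longrightarrow> ennreal (u n) < \<rho> \<omega>" by blast
    have eq: "\<omega> \<in> B \<longleftrightarrow> \<omega> \<in> B' n" if "m \<le> n" for n using B'(2)[OF \<omega>(1) m[OF that]] .
    show "\<omega> \<in> B \<longleftrightarrow> \<omega> \<in> L"
    proof
      assume "\<omega> \<in> B"
      then show "\<omega> \<in> L" unfolding L_def using eq by blast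
    next
      assume "\<omega> \<in> L"
      then obtain N where "\<And>n. N \<le> n \<Longrightarrow> \<omega> \<in> B' n" by (auto simp: L_def)
      then have "\<omega> \<in> B' (max N m)" by simp
      then show "\<omega> \<in> B" using eq[of "max N m"] by simp
    qed
  qed
qed

text \<open>On \<open>\<rho> \<le> s\<close> both sides of \<open>incr\<close> vanish, the left one
  because \<open>V\<close> is constant after \<rho>. A base \<open>B\<close> from the enlargement
  may therefore be replaced by its trace in \<open>F s\<close>, so the identity on rectangles of
  \<open>F\<close> extends to rectangles of the enlargement. Constancy after a finite \<rho> also
  bounds each path by its value at \<rho>, which makes the path measures finite.\<close>

lemma dual_predictable_projection_enlargementI:
  assumes \<rho>_AE: "AE \<omega> in M. \<rho> \<omega> \<noteq> 0" "AE \<omega> in M. \<rho> \<omega> < \<infinity>"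
    and V: "(\<lambda>(t, \<omega>). V t \<omega>) \<in> borel_measurable (predictable_sigma M (progressive_enlargement M F \<rho>))"
    and path: "AE \<omega> in M. increasing_path (\<lambda>t. V t \<omega>)"
    and V0: "AE \<omega> in M. V 0 \<omega> = 0"
    and stop: "AE \<omega> in M. \<forall>t\<ge>enn2real (\<rho> \<omega>). V t \<omega> = V (enn2real (\<rho> \<omega>)) \<omega>"
    and incr: "\<And>s t B. 0 \<le> s \<Longrightarrow> s \<le> t \<Longrightarrow> B \<in> sets (F s) \<Longrightarrow>
      (\<integral>\<^sup>+\<omega>. ennreal (V t \<omega> - V s \<omega>) * indicator B \<omega> \<partial>M) =
      emeasure M {\<omega> \<in> space M. \<omega> \<in> B \<and> ennreal s < \<rho> \<omega> \<and> \<rho> \<omega> \<le> ennreal t}"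
  shows "dual_predictable_projection M (progressive_enlargement M F \<rho>) (jump_process \<rho>) V"
proof -
  let ?G = "progressive_enlargement M F \<rho>"
  interpret G: complete_filtration M ?G by (rule complete_filtration_enlargement)
  have "AE \<omega> in M. increasing_path (\<lambda>t. V t \<omega>) \<and> V 0 \<omega> = 0 \<and> \<rho> \<omega> < \<infinity> \<and>
      (\<forall>t\<ge>enn2real (\<rho> \<omega>). V t \<omega> = V (enn2real (\<rho> \<omega>)) \<omega>)"
    using path V0 stop \<rho>_AE(2) by auto
  then obtain N where N: "N \<in> null_sets M" "\<And>\<omega>. \<omega> \<in> space M \<Longrightarrow> \<omega> \<notin> N \<Longrightarrow>
      increasing_path (\<lambda>t. V t \<omega>) \<and> V 0 \<omega> = 0 \<and> \<rho> \<omega> < \<infinity> \<and>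
      (\<forall>t\<ge>enn2real (\<rho> \<omega>). V t \<omega> = V (enn2real (\<rho> \<omega>)) \<omega>)"
    using AE_E_null by blast
  define W where "W t \<omega> = (if \<omega> \<in> N then 0 else V t \<omega>)" for t \<omega>
  have W_eq: "AE \<omega> in M. \<forall>t. W t \<omega> = V t \<omega>"
    by (rule AE_I'[OF N(1)]) (auto simp: W_def)
  have V_adapted: "adapted ?G V"
    using G.optional_adapted[OF G.predictable_measurable_optional[OF V]] .
  have W_meas: "W t \<in> borel_measurable M" if "0 \<le> t" for t
  proof -
    have "V t \<in> borel_measurable (?G t)" using V_adapted that by (simp add: adapted_def)
    then have "W t \<in> borel_measurable (?G t)"
      by (rule G.measurable_F_cong_AE[OF _ _ that]) (use W_eq in auto)
    then show ?thesis by (rule G.measurable_F_M[OF _ that])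
  qed
  have W_path: "increasing_path (\<lambda>t. W t \<omega>)" "W 0 \<omega> = 0" "\<exists>K. \<forall>t\<ge>0. W t \<omega> \<le> K"
    if \<omega>: "\<omega> \<in> space M" for \<omega>
  proof -
    have N2: "increasing_path (\<lambda>t. V t \<omega>)" "V 0 \<omega> = 0" if "\<omega> \<notin> N" using N(2)[OF \<omega> that] by blast+
    show "increasing_path (\<lambda>t. W t \<omega>)"
    proof (cases "\<omega> \<in> N")
      case False
      then show ?thesis using N2 by (simp add: W_def)
    qed (simp add: W_def increasing_path_def mono_on_def)
    show "W 0 \<omega> = 0" using N2 by (simp add: W_def)
    show "\<exists>K. \<forall>t\<ge>0. W t \<omega> \<le> K"
    proof (cases "\<omega> \<in> N")
      case False': False
      have "V t \<omega> \<le> V (enn2real (\<rho> \<omega>)) \<omega>" if "0 \<le> t" for t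
      proof (cases "t \<le> enn2real (\<rho> \<omega>)")
        case True
        then show ?thesis using N2(1)[OF False'] that by (simp add: increasing_path_def mono_on_def)
      next
        case False
        have "\<forall>t\<ge>enn2real (\<rho> \<omega>). V t \<omega> = V (enn2real (\<rho> \<omega>)) \<omega>" using N(2)[OF \<omega> False'] by blast
        then have "V t \<omega> = V (enn2real (\<rho> \<omega>)) \<omega>" using False by (meson linear)
        then show ?thesis by (rule eq_refl)
      qed
      then show ?thesis using False' by (simp add: W_def) blast
    next
      case True
      then show ?thesis by (intro exI[of _ 0]) (simp add: W_def)
    qed
  qed
  have W_incr: "(\<integral>\<^sup>+\<omega>. ennreal (W t \<omega> - W s \<omega>) * indicator B \<omega> \<partial>M) =
      emeasure M {\<omega> \<in> space M. \<omega> \<in> B \<and> ennreal s < \<rho> \<omega> \<and> \<rho> \<omega> \<le> ennreal t}"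
    if s: "0 \<le> s" "s \<le> t" and B: "B \<in> sets (?G s)" for s t B
  proof -
    obtain B' where B': "B' \<in> sets (F s)"
        "\<And>\<omega>. \<omega> \<in> space M \<Longrightarrow> ennreal s < \<rho> \<omega> \<Longrightarrow> \<omega> \<in> B \<longleftrightarrow> \<omega> \<in> B'"
      using enlargement_trace[OF B s(1)] by blast
    have *: "W t \<omega> = W s \<omega>" if "\<omega> \<in> space M" "\<rho> \<omega> \<le> ennreal s" "\<omega> \<notin> N" for \<omega>
    proof -
      have "enn2real (\<rho> \<omega>) \<le> s" using enn2real_mono[OF that(2)] s(1) by simp
      have "\<forall>t\<ge>enn2real (\<rho> \<omega>). V t \<omega> = V (enn2real (\<rho> \<omega>)) \<omega>" using N(2)[OF that(1,3)] by blast
      then have "V t \<omega> = V (enn2real (\<rho> \<omega>)) \<omega>" "V s \<omega> = V (enn2real (\<rho> \<omega>)) \<omega>"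
        using \<open>enn2real (\<rho> \<omega>) \<le> s\<close> s(2) by (meson order_trans)+
      then show ?thesis by (simp add: W_def)
    qed
    have "(\<integral>\<^sup>+\<omega>. ennreal (W t \<omega> - W s \<omega>) * indicator B \<omega> \<partial>M) =
        (\<integral>\<^sup>+\<omega>. ennreal (V t \<omega> - V s \<omega>) * indicator B' \<omega> \<partial>M)"
    proof (rule nn_integral_cong_AE)
      show "AE \<omega> in M. ennreal (W t \<omega> - W s \<omega>) * indicator B \<omega> =
          ennreal (V t \<omega> - V s \<omega>) * indicator B' \<omega>"
      proof (rule AE_I'[OF N(1)], rule subsetI, rule ccontr)
        fix \<omega> assume \<omega>: "\<omega> \<in> {\<omega> \<in> space M. ennreal (W t \<omega> - W s \<omega>) * indicator B \<omega> \<noteq>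
          ennreal (V t \<omega> - V s \<omega>) * indicator B' \<omega>}" "\<omega> \<notin> N"
        then show False
          using B'(2)[of \<omega>] *[of \<omega>] by (cases "ennreal s < \<rho> \<omega>") (auto simp: W_def indicator_def not_less)
      qed
    qed
    also have "\<dots> = emeasure M {\<omega> \<in> space M. \<omega> \<in> B' \<and> ennreal s < \<rho> \<omega> \<and> \<rho> \<omega> \<le> ennreal t}"
      by (rule incr[OF s B'(1)])
    also have "{\<omega> \<in> space M. \<omega> \<in> B' \<and> ennreal s < \<rho> \<omega> \<and> \<rho> \<omega> \<le> ennreal t} =
        {\<omega> \<in> space M. \<omega> \<in> B \<and> ennreal s < \<rho> \<omega> \<and> \<rho> \<omega> \<le> ennreal t}"
      using B'(2) by blast
    finally show ?thesis .
  qed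
  show ?thesis
    unfolding dual_predictable_projection_def dual_projection_def
  proof (intro conjI allI impI V path)
    fix X :: "real \<Rightarrow> 'a \<Rightarrow> ennreal"
    assume X: "(\<lambda>(t, \<omega>). X t \<omega>) \<in> borel_measurable (predictable_sigma M ?G)"
    have "(\<integral>\<^sup>+\<omega>. stieltjes_integral X V \<omega> \<partial>M) = (\<integral>\<^sup>+\<omega>. stieltjes_integral X W \<omega> \<partial>M)"
    proof (rule nn_integral_cong_AE)
      show "AE \<omega> in M. stieltjes_integral X V \<omega> = stieltjes_integral X W \<omega>"
        using W_eq by (rule eventually_mono) (simp add: stieltjes_integral_def cong: if_cong)
    qed
    also have "\<dots> = (\<integral>\<^sup>+\<omega>. stieltjes_integral X (jump_process \<rho>) \<omega> \<partial>M)"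
      by (rule G.stieltjes_predictable[OF W_meas W_path \<rho> \<rho>_AE(1) finite_measure_axioms W_incr X])
    finally show "(\<integral>\<^sup>+\<omega>. stieltjes_integral X V \<omega> \<partial>M) =
        (\<integral>\<^sup>+\<omega>. stieltjes_integral X (jump_process \<rho>) \<omega> \<partial>M)" .
  qed
qed

end

end

section \<open>Stopping times and first passage times\<close>

text \<open>The infimum of the empty set in \<open>ennreal\<close> is infinity, so a path that never
  satisfies \<open>P\<close> from \<open>q\<close> on is hit at infinity.\<close>

definition hitting_time :: "(real \<Rightarrow> 'a \<Rightarrow> bool) \<Rightarrow> real \<Rightarrow> 'a \<Rightarrow> ennreal" where
  "hitting_time P q \<omega> = Inf {ennreal r | r. q \<le> r \<and> P r \<omega>}"

lemma hitting_time_less_iff: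
  "hitting_time P q \<omega> < ennreal t \<longleftrightarrow> (\<exists>r. q \<le> r \<and> P r \<omega> \<and> ennreal r < ennreal t)"
  by (auto simp: hitting_time_def Inf_less_iff)

context usual_filtered_prob_space
begin

text \<open>Right-continuity of \<open>F\<close>: for \<open>r > t\<close> the event
  \<open>T \<le> t\<close> is the intersection of the events \<open>T < t + 1 / Suc (n + m)\<close>,
  where the shift \<open>m\<close> is chosen so large that all of them belong to
  \<open>F r\<close>.\<close>

lemma stopping_time_extI:
  assumes "\<And>t. 0 < t \<Longrightarrow> {\<omega> \<in> space M. T \<omega> < ennreal t} \<in> sets (F t)"
  shows "stopping_time_ext M F T"
  unfolding stopping_time_ext_def
proof (intro allI impI)
  fix t :: real assume t: "0 \<le> t"
  show "{\<omega> \<in> space M. T \<omega> \<le> ennreal t} \<in> sets (F t)"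
  proof (rule sets_F_right[OF t])
    fix r assume r: "t < r"
    then obtain m where m: "1 / real (Suc m) < r - t" using nat_approx_posE[of "r - t"] by auto
    have "{\<omega> \<in> space M. T \<omega> < ennreal (t + 1 / Suc (n + m))} \<in> sets (F r)" for n
    proof -
      have "1 / real (Suc (n + m)) \<le> 1 / real (Suc m)" by (simp add: field_simps)
      moreover have "0 < t + 1 / real (Suc (n + m))" using t by (intro add_nonneg_pos) auto
      ultimately show ?thesis using m
        by (intro sets_F_mono[OF assms[of "t + 1 / real (Suc (n + m))"]]) simp_all
    qed
    then have "(\<Inter>n. {\<omega> \<in> space M. T \<omega> < ennreal (t + 1 / Suc (n + m))}) \<in> sets (F r)"
      by (intro sets.countable_INT image_subsetI UNIV_not_empty)
    also have "(\<Inter>n. {\<omega> \<in> space M. T \<omega> < ennreal (t + 1 / Suc (n + m))}) = {\<omega> \<in> space M. T \<omega> \<le> ennreal t}"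
    proof (intro set_eqI iffI)
      fix \<omega> assume \<omega>: "\<omega> \<in> (\<Inter>n. {\<omega> \<in> space M. T \<omega> < ennreal (t + 1 / Suc (n + m))})"
      then have fin: "T \<omega> < ennreal (t + 1 / Suc (n + m))" for n by blast
      obtain x where x: "T \<omega> = ennreal x" "0 \<le> x" using fin[of 0] by (cases "T \<omega>") auto
      have "x \<le> t"
      proof (rule ccontr)
        assume "\<not> x \<le> t"
        then obtain k where k: "1 / real (Suc k) < x - t" using nat_approx_posE[of "x - t"] by auto
        have "1 / real (Suc (k + m)) \<le> 1 / real (Suc k)" by (simp add: field_simps)
        moreover have "x < t + 1 / real (Suc (k + m))" using fin[of k] x by (simp add: ennreal_less_iff)
        ultimately show False using k by simp
      qed
      then show "\<omega> \<in> {\<omega> \<in> space M. T \<omega> \<le> ennreal t}" using \<omega> x t by auto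
    next
      fix \<omega> assume \<omega>: "\<omega> \<in> {\<omega> \<in> space M. T \<omega> \<le> ennreal t}"
      have "ennreal t < ennreal (t + 1 / real (Suc (n + m)))" for n
        using t by (simp add: ennreal_less_iff)
      then show "\<omega> \<in> (\<Inter>n. {\<omega> \<in> space M. T \<omega> < ennreal (t + 1 / Suc (n + m))})"
        using \<omega> by (auto intro: le_less_trans)
    qed
    finally show "{\<omega> \<in> space M. T \<omega> \<le> ennreal t} \<in> sets (F r)" .
  qed
qed

text \<open>Since \<open>P\<close> persists for a while to the right of each time at which it holds,
  it is detected at rational times, and the event of a hit before \<open>t\<close> becomes a
  countable union.\<close>

lemma stopping_time_hitting_time:
  assumes q: "0 \<le> q"
    and P_meas: "\<And>r. 0 \<le> r \<Longrightarrow> {\<omega> \<in> space M. P r \<omega>} \<in> sets (F r)"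
    and open_right: "\<And>r \<omega>. \<omega> \<in> space M \<Longrightarrow> q \<le> r \<Longrightarrow> P r \<omega> \<Longrightarrow> \<exists>s>r. \<forall>u. r < u \<longrightarrow> u < s \<longrightarrow> P u \<omega>"
  shows "stopping_time_ext M F (hitting_time P q)"
proof (rule stopping_time_extI)
  fix t :: real assume t: "0 < t"
  have "{\<omega> \<in> space M. hitting_time P q \<omega> < ennreal t} =
      (\<Union>r\<in>{r \<in> \<rat>. q \<le> r \<and> r < t}. {\<omega> \<in> space M. P r \<omega>})"
  proof (intro set_eqI iffI)
    fix \<omega> assume \<omega>: "\<omega> \<in> {\<omega> \<in> space M. hitting_time P q \<omega> < ennreal t}"
    then obtain r where r: "q \<le> r" "P r \<omega>" "r < t"
      using q by (auto simp: hitting_time_less_iff ennreal_less_iff)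
    obtain s where s: "r < s" "\<And>u. r < u \<Longrightarrow> u < s \<Longrightarrow> P u \<omega>"
      using open_right[OF _ r(1,2)] \<omega> by blast
    obtain u where u: "u \<in> \<rat>" "r < u" "u < min s t" using Rats_dense_in_real[of r "min s t"] s(1) r(3) by auto
    then show "\<omega> \<in> (\<Union>r\<in>{r \<in> \<rat>. q \<le> r \<and> r < t}. {\<omega> \<in> space M. P r \<omega>})"
      using s(2)[of u] r(1) \<omega> by (intro UN_I[of u]) auto
  next
    fix \<omega> assume "\<omega> \<in> (\<Union>r\<in>{r \<in> \<rat>. q \<le> r \<and> r < t}. {\<omega> \<in> space M. P r \<omega>})"
    then show "\<omega> \<in> {\<omega> \<in> space M. hitting_time P q \<omega> < ennreal t}"
      using q by (auto simp: hitting_time_less_iff ennreal_less_iff)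
  qed
  also have "\<dots> \<in> sets (F t)"
  proof (intro sets.countable_UN')
    show "countable {r \<in> \<rat>. q \<le> r \<and> r < t}" by (rule countable_subset[OF _ countable_rat]) auto
    show "(\<lambda>r. {\<omega> \<in> space M. P r \<omega>}) ` {r \<in> \<rat>. q \<le> r \<and> r < t} \<subseteq> sets (F t)"
      using q by (intro image_subsetI sets_F_mono[OF P_meas]) auto
  qed
  finally show "{\<omega> \<in> space M. hitting_time P q \<omega> < ennreal t} \<in> sets (F t)" .
qed

lemma avoids_AE:
  assumes "avoids_stopping_times M F \<rho>" "\<rho> \<in> borel_measurable M" "stopping_time_ext M F T"
  shows "AE \<omega> in M. \<rho> \<omega> \<noteq> T \<omega>"
proof -
  have T: "T \<in> borel_measurable M"
  proof (rule borel_measurableI_le)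
    fix x :: ennreal
    show "{\<omega> \<in> space M. T \<omega> \<le> x} \<in> sets M"
    proof (cases x)
      case (real r)
      then have "{\<omega> \<in> space M. T \<omega> \<le> x} \<in> sets (F r)" using assms(3) by (simp add: stopping_time_ext_def)
      then show ?thesis using real by (intro sets_F[of r])
    qed simp
  qed
  have "{\<omega> \<in> space M. \<rho> \<omega> = T \<omega>} \<in> sets M" using assms(2) T by measurable
  moreover have "measure M {\<omega> \<in> space M. \<rho> \<omega> = T \<omega>} = 0"
    using assms(1,3) by (simp add: avoids_stopping_times_def)
  ultimately have "{\<omega> \<in> space M. \<rho> \<omega> = T \<omega>} \<in> null_sets M" by (simp add: null_sets_def emeasure_eq_measure)
  then show ?thesis by (rule AE_I') auto
qed

lemma avoids_const:
  assumes "avoids_stopping_times M F \<rho>" "\<rho> \<in> borel_measurable M"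
  shows "AE \<omega> in M. \<rho> \<omega> \<noteq> c"
proof -
  have "{\<omega> \<in> space M. c \<le> ennreal t} \<in> sets (F t)" if "0 \<le> t" for t
      proof (cases "c \<le> ennreal t")
    case True
    then show ?thesis using space_in_F[OF that] by simp
  qed simp
  then have "stopping_time_ext M F (\<lambda>_. c)" unfolding stopping_time_ext_def by (intro allI impI)
  from avoids_AE[OF assms this] show ?thesis .
qed

end

section \<open>Stieltjes kernels\<close>

lemma emeasure_increasing_path_Iic:
  assumes v: "increasing_path v"
  shows "emeasure (interval_measure (\<lambda>t. if t < 0 then 0 else v t)) {..b} = ennreal (if b < 0 then 0 else v b)"
proof -
  let ?\<nu> = "interval_measure (\<lambda>t. if t < 0 then 0 else v t)"
  have "emeasure ?\<nu> {- real (Suc m)<..b} = ennreal (if b < 0 then 0 else v b)" for m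
    using increasing_path_extension[OF v] v
    by (subst emeasure_interval_measure_Ioc_eq)
       (auto simp: mono_def increasing_path_def)
  moreover have "emeasure ?\<nu> (\<Union>m. {- real (Suc m)<..b}) = (SUP m. emeasure ?\<nu> {- real (Suc m)<..b})"
    by (intro SUP_emeasure_incseq[symmetric]) (auto simp: incseq_def)
  moreover have "(\<Union>m. {- real (Suc m)<..b}) = {..b}"
  proof (intro set_eqI iffI)
    fix x assume "x \<in> {..b}"
    moreover obtain m :: nat where "- x < real m" using reals_Archimedean2 by blast
    ultimately show "x \<in> (\<Union>m. {- real (Suc m)<..b})" by (intro UN_I[of m]) auto
  qed auto
  ultimately show ?thesis by simp
qed

text \<open>Truncation at time \<open>n\<close> and division by \<open>1 + V n\<close> turn the Stieltjes measures into a
  kernel of subprobability measures.\<close>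

lemma stieltjes_kernel_measurable:
  fixes V :: "real \<Rightarrow> 'a \<Rightarrow> real"
  defines "\<nu> \<equiv> \<lambda>\<omega>. interval_measure (\<lambda>t. if t < 0 then 0 else V t \<omega>)"
  assumes V: "\<And>t. 0 \<le> t \<Longrightarrow> V t \<in> borel_measurable M"
    and path: "\<And>\<omega>. \<omega> \<in> space M \<Longrightarrow> increasing_path (\<lambda>t. V t \<omega>)"
    and C: "C \<in> sets (borel \<Otimes>\<^sub>M M)"
  shows "(\<lambda>\<omega>. emeasure (\<nu> \<omega>) {t. (t, \<omega>) \<in> C}) \<in> borel_measurable M"
proof -
  have sets_\<nu> [measurable_cong]: "sets (\<nu> \<omega>) = sets borel" for \<omega> by (simp add: \<nu>_def)
  define K where "K n \<omega> = scale_measure (1 / (1 + ennreal (V (real n) \<omega>))) (density (\<nu> \<omega>) (indicator {..real n}))"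
    for n :: nat and \<omega>
  have sets_K: "sets (K n \<omega>) = sets borel" for n \<omega> by (simp add: K_def sets_\<nu>)
  have emeasure_K: "emeasure (K n \<omega>) A = 1 / (1 + ennreal (V (real n) \<omega>)) * emeasure (\<nu> \<omega>) (A \<inter> {..real n})"
    if "A \<in> sets borel" for A n \<omega>
  proof -
    have "emeasure (density (\<nu> \<omega>) (indicator {..real n})) A = emeasure (\<nu> \<omega>) (A \<inter> {..real n})"
    proof -
      have "emeasure (density (\<nu> \<omega>) (indicator {..real n})) A =
          (\<integral>\<^sup>+t. indicator {..real n} t * indicator A t \<partial>\<nu> \<omega>)"
        using that by (intro emeasure_density) (auto simp: sets_\<nu>)
      also have "\<dots> = (\<integral>\<^sup>+t. indicator (A \<inter> {..real n}) t \<partial>\<nu> \<omega>)"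
        by (intro nn_integral_cong) (auto split: split_indicator)
      also have "\<dots> = emeasure (\<nu> \<omega>) (A \<inter> {..real n})"
        using that by (intro nn_integral_indicator) (auto simp: sets_\<nu>)
      finally show ?thesis .
    qed
    then show ?thesis by (simp add: K_def)
  qed
  have c_meas: "(\<lambda>\<omega>. 1 / (1 + ennreal (V (real n) \<omega>))) \<in> borel_measurable M" for n :: nat
    using V[of "real n"] by measurable
  have Iic_meas: "(\<lambda>\<omega>. emeasure (\<nu> \<omega>) {..b}) \<in> borel_measurable M" for b
  proof -
    have "(\<lambda>\<omega>. ennreal (if b < 0 then 0 else V b \<omega>)) \<in> borel_measurable M"
      using V[of b] by (cases "b < 0") auto
    then show ?thesis
      by (rule measurable_cong[THEN iffD1, rotated])
         (simp add: \<nu>_def emeasure_increasing_path_Iic[OF path])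
  qed
  have K_meas: "K n \<in> measurable M (subprob_algebra borel)" for n
  proof (rule measurable_subprob_algebra_generated)
    show "sets (borel :: real measure) = sigma_sets UNIV (range (\<lambda>b::real. {..b}))"
      by (subst borel_eq_atMost) simp
    show "Int_stable (range (\<lambda>b::real. {..b}))"
    proof (rule Int_stableI)
      fix A B :: "real set" assume "A \<in> range atMost" "B \<in> range atMost"
      then obtain a b where "A = {..a}" "B = {..b}" by blast
      then have "A \<inter> B = {..min a b}" by auto
      then show "A \<inter> B \<in> range atMost" by blast
    qed
    show "subprob_space (K n \<omega>)" if \<omega>: "\<omega> \<in> space M" for \<omega>
    proof (rule subprob_spaceI)
      have "emeasure (K n \<omega>) UNIV = 1 / (1 + ennreal (V (real n) \<omega>)) * ennreal (V (real n) \<omega>)"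
        by (simp add: emeasure_K) (simp add: \<nu>_def emeasure_increasing_path_Iic[OF path[OF \<omega>]])
      also have "\<dots> \<le> 1"
        by (simp add: ennreal_times_divide mult.commute divide_le_posI_ennreal add_pos_nonneg)
      finally show "emeasure (K n \<omega>) (space (K n \<omega>)) \<le> 1"
        using sets_eq_imp_space_eq[OF sets_K[of n \<omega>]] by simp
      show "space (K n \<omega>) \<noteq> {}" using sets_eq_imp_space_eq[OF sets_K[of n \<omega>]] by simp
    qed
    show "(\<lambda>\<omega>. emeasure (K n \<omega>) A) \<in> borel_measurable M" if A_range: "A \<in> range atMost" for A
    proof -
      obtain a where A: "A = {..a}" using A_range by blast
      have "{..a} \<inter> {..real n} = {..min a (real n)}" by auto
      then show ?thesis using c_meas Iic_meas
        by (simp add: A emeasure_K)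
    qed
    show "(\<lambda>\<omega>. emeasure (K n \<omega>) UNIV) \<in> borel_measurable M"
      using c_meas Iic_meas by (simp add: emeasure_K)
  qed (auto simp: sets_K)
  have sect: "{t. (t, \<omega>) \<in> C} \<in> sets borel" for \<omega>
    using sets_Pair2[OF C, of \<omega>] by (simp add: vimage_def)
  have "(SIGMA \<omega>:space M. {t. (t, \<omega>) \<in> C}) \<in> sets (M \<Otimes>\<^sub>M borel)"
  proof -
    have "(\<lambda>(\<omega>, t). (t, \<omega>)) -` C \<inter> space (M \<Otimes>\<^sub>M (borel :: real measure)) \<in> sets (M \<Otimes>\<^sub>M borel)"
      by (rule measurable_sets[OF measurable_pair_swap' C])
    also have "(\<lambda>(\<omega>, t). (t, \<omega>)) -` C \<inter> space (M \<Otimes>\<^sub>M (borel :: real measure)) =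
        (SIGMA \<omega>:space M. {t. (t, \<omega>) \<in> C})"
      by (auto simp: space_pair_measure)
    finally show ?thesis .
  qed
  from emeasure_measurable_subprob_algebra2[OF this K_meas]
  have "(\<lambda>\<omega>. (1 + ennreal (V (real n) \<omega>)) * emeasure (K n \<omega>) {t. (t, \<omega>) \<in> C}) \<in> borel_measurable M" for n
    using V[of "real n"] by (intro borel_measurable_times_ennreal borel_measurable_add measurable_const) auto
  then have "(\<lambda>\<omega>. SUP n. (1 + ennreal (V (real n) \<omega>)) * emeasure (K n \<omega>) {t. (t, \<omega>) \<in> C}) \<in> borel_measurable M"
    by (intro borel_measurable_SUP) auto
  moreover have "(1 + ennreal (V (real n) \<omega>)) * emeasure (K n \<omega>) {t. (t, \<omega>) \<in> C} =
      emeasure (\<nu> \<omega>) ({t. (t, \<omega>) \<in> C} \<inter> {..real n})" for n \<omega>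
  proof -
    have "(1 + ennreal (V (real n) \<omega>)) * (1 / (1 + ennreal (V (real n) \<omega>))) = 1"
      by (subst ennreal_times_divide) (simp add: ennreal_divide_self add_pos_nonneg)
    then show ?thesis by (simp add: emeasure_K[OF sect] mult.assoc[symmetric])
  qed
  moreover have "(SUP n. emeasure (\<nu> \<omega>) ({t. (t, \<omega>) \<in> C} \<inter> {..real n})) = emeasure (\<nu> \<omega>) {t. (t, \<omega>) \<in> C}" for \<omega>
  proof -
    have "(SUP n. emeasure (\<nu> \<omega>) ({t. (t, \<omega>) \<in> C} \<inter> {..real n})) =
        emeasure (\<nu> \<omega>) (\<Union>n. {t. (t, \<omega>) \<in> C} \<inter> {..real n})"
      using sect by (intro SUP_emeasure_incseq) (auto simp: incseq_def sets_\<nu>)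
    also have "(\<Union>n. {t. (t, \<omega>) \<in> C} \<inter> {..real n}) = {t. (t, \<omega>) \<in> C}"
      using real_arch_simple by auto
    finally show ?thesis .
  qed
  ultimately show ?thesis by simp
qed

section \<open>Jumps of increasing processes\<close>

text \<open>If the jump at \<open>r\<close> is larger than \<open>1 / Suc k\<close>, a rational
  \<open>q\<close> close enough below \<open>r\<close> leaves a rise of at most
  \<open>1 / Suc k\<close> between \<open>q\<close> and \<open>r\<close>. Then \<open>r\<close> is
  the point at which the rise since \<open>q\<close> exceeds \<open>1 / Suc k\<close>. Two countable
  parameters thus capture every jump of every increasing path.\<close>

lemma increasing_jump_first_passage:
  fixes v :: "real \<Rightarrow> real"
  assumes v: "mono_on {0..} v" and r: "0 < r" and disc: "\<not> continuous (at_left r) v"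
  obtains q k where "q \<in> \<rat>" "0 \<le> q" "q < r" "\<And>s. q \<le> s \<Longrightarrow> s < r \<Longrightarrow> v s \<le> v q + 1 / real (Suc k)"
    "v q + 1 / real (Suc k) < v r"
proof -
  have mono: "v s \<le> v t" if "0 \<le> s" "s \<le> t" for s t using v that by (auto simp: mono_on_def)
  have "\<exists>e>0. \<forall>q. 0 \<le> q \<longrightarrow> q < r \<longrightarrow> v q < v r - e"
  proof (rule ccontr)
    assume "\<not> ?thesis"
    then have *: "\<And>e. 0 < e \<Longrightarrow> \<exists>q. 0 \<le> q \<and> q < r \<and> v r - e \<le> v q" by (meson not_less)
    have "(v \<longlongrightarrow> v r) (at_left r)"
    proof (rule tendstoI)
      fix e :: real assume "0 < e"
      then obtain q where q: "0 \<le> q" "q < r" "v r - e / 2 \<le> v q" using *[of "e / 2"] by auto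
      have "dist (v x) (v r) < e" if "q < x" "x < r" for x
        using mono[of q x] mono[of x r] that q \<open>0 < e\<close> by (auto simp: dist_real_def)
      then show "eventually (\<lambda>x. dist (v x) (v r) < e) (at_left r)"
        using q(2) by (auto simp: eventually_at_left_field)
    qed
    then show False using disc by (simp add: continuous_within)
  qed
  then obtain e where e: "0 < e" "\<And>q. 0 \<le> q \<Longrightarrow> q < r \<Longrightarrow> v q < v r - e" by blast
  obtain k where k: "1 / real (Suc k) < e" using nat_approx_posE[OF e(1)] by blast
  \<comment> \<open>The left limit of the increasing path at \<open>r\<close>, written as a
    supremum.\<close>
  define L where "L = (SUP s\<in>{0..<r}. v s)"
  have bdd: "bdd_above (v ` {0..<r})" by (rule bdd_aboveI[of _ "v r"]) (auto intro: mono)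
  have "L - 1 / real (Suc k) < L" by simp
  then obtain q' where q': "q' \<in> {0..<r}" "L - 1 / real (Suc k) < v q'"
    unfolding L_def using r bdd by (subst (asm) less_cSUP_iff) auto
  obtain q where q: "q \<in> \<rat>" "q' < q" "q < r" using Rats_dense_in_real[of q' r] q'(1) by auto
  have q0: "0 \<le> q" using q q' by auto
  show ?thesis
  proof
    show "q \<in> \<rat>" "0 \<le> q" "q < r" using q q0 by auto
    have Lq: "L < v q + 1 / real (Suc k)" using mono[of q' q] q q' by auto
    show "v s \<le> v q + 1 / real (Suc k)" if "q \<le> s" "s < r" for s
    proof -
      have "v s \<le> L" unfolding L_def using that q0 by (intro cSUP_upper bdd) auto
      then show ?thesis using Lq by linarith
    qed
    show "v q + 1 / real (Suc k) < v r" using e(2)[OF q0 q(3)] k by linarith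
  qed
qed

text \<open>The condition \<open>q \<le> r\<close> is repeated inside the predicate because the
  event has to belong to \<open>F r\<close> for all \<open>r\<close>, and before \<open>q\<close>
  the value \<open>V q\<close> is not known.\<close>

definition first_passage :: "(real \<Rightarrow> 'a \<Rightarrow> real) \<Rightarrow> real \<Rightarrow> real \<Rightarrow> 'a \<Rightarrow> ennreal" where
  "first_passage V q e = hitting_time (\<lambda>r \<omega>. q \<le> r \<and> V q \<omega> + e < V r \<omega>) q"

lemma first_passage_jump:
  assumes v: "mono_on {0..} (\<lambda>t. V t \<omega>)" and r: "0 < r" and disc: "\<not> continuous (at_left r) (\<lambda>t. V t \<omega>)"
  obtains q k where "q \<in> \<rat>" "0 \<le> q" "first_passage V q (1 / real (Suc k)) \<omega> = ennreal r"
proof -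
  obtain q k where q: "q \<in> \<rat>" "0 \<le> q" "q < r"
      and le: "\<And>s. q \<le> s \<Longrightarrow> s < r \<Longrightarrow> V s \<omega> \<le> V q \<omega> + 1 / real (Suc k)"
      and gt: "V q \<omega> + 1 / real (Suc k) < V r \<omega>"
    using increasing_jump_first_passage[OF assms] by blast
  have "first_passage V q (1 / real (Suc k)) \<omega> = ennreal r"
    unfolding first_passage_def hitting_time_def
  proof (rule antisym)
    show "Inf {ennreal s |s. q \<le> s \<and> q \<le> s \<and> V q \<omega> + 1 / real (Suc k) < V s \<omega>} \<le> ennreal r"
      using q gt by (intro Inf_lower) auto
    show "ennreal r \<le> Inf {ennreal s |s. q \<le> s \<and> q \<le> s \<and> V q \<omega> + 1 / real (Suc k) < V s \<omega>}"
    proof (rule Inf_greatest)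
      fix x assume "x \<in> {ennreal s |s. q \<le> s \<and> q \<le> s \<and> V q \<omega> + 1 / real (Suc k) < V s \<omega>}"
      then obtain s where "x = ennreal s" "q \<le> s" "V q \<omega> + 1 / real (Suc k) < V s \<omega>" by blast
      then show "ennreal r \<le> x" using le[of s] by (intro ennreal_leI[of r s, folded \<open>x = ennreal s\<close>]) linarith
    qed
  qed
  then show ?thesis using that q by blast
qed

context usual_filtered_prob_space
begin

lemma stopping_time_first_passage:
  assumes V: "adapted F V" and path: "\<And>\<omega>. \<omega> \<in> space M \<Longrightarrow> mono_on {0..} (\<lambda>t. V t \<omega>)" and q: "0 \<le> q"
  shows "stopping_time_ext M F (first_passage V q e)"
  unfolding first_passage_def
proof (rule stopping_time_hitting_time[OF q])
  fix r :: real assume r: "0 \<le> r"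
  show "{\<omega> \<in> space M. q \<le> r \<and> V q \<omega> + e < V r \<omega>} \<in> sets (F r)"
  proof (cases "q \<le> r")
    case True
    have "V q \<in> borel_measurable (F r)"
      by (rule measurable_F_mono[OF _ q True]) (use V q in \<open>simp add: adapted_def\<close>)
    moreover have "V r \<in> borel_measurable (F r)" using V r by (simp add: adapted_def)
    ultimately have "{\<omega> \<in> space (F r). V q \<omega> + e < V r \<omega>} \<in> sets (F r)" by measurable
    then show ?thesis using True by (simp add: space_F r)
  qed simp
next
  fix r \<omega> assume \<omega>: "\<omega> \<in> space M" and r: "q \<le> r" "q \<le> r \<and> V q \<omega> + e < V r \<omega>"
  have "V r \<omega> \<le> V u \<omega>" if "r < u" for u
    using path[OF \<omega>] q r(1) that by (auto simp: mono_on_def)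
  then show "\<exists>s>r. \<forall>u. r < u \<longrightarrow> u < s \<longrightarrow> q \<le> u \<and> V q \<omega> + e < V u \<omega>"
    using r(2) by (intro exI[of _ "r + 1"]) (auto intro: less_le_trans)
qed

text \<open>All jump times of an adapted increasing process are among countably many first passage
  times, each of which is avoided; so \<rho> is almost surely no jump time of the process.\<close>

lemma AE_avoids_first_passage:
  assumes \<rho>: "avoids_stopping_times M F \<rho>" "\<rho> \<in> borel_measurable M"
    and V: "adapted F V" "\<And>\<omega>. \<omega> \<in> space M \<Longrightarrow> mono_on {0..} (\<lambda>t. V t \<omega>)"
  shows "AE \<omega> in M. 0 < \<rho> \<omega> \<and> \<rho> \<omega> < \<infinity> \<and> continuous (at_left (enn2real (\<rho> \<omega>))) (\<lambda>t. V t \<omega>)"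
proof -
  have "AE \<omega> in M. \<forall>q\<in>\<rat> \<inter> {0..}. \<forall>k::nat. \<rho> \<omega> \<noteq> first_passage V q (1 / real (Suc k)) \<omega>"
  proof (subst AE_ball_countable)
    show "countable (\<rat> \<inter> {0::real..})" using countable_rat by (rule countable_subset[rotated]) auto
    show "\<forall>q\<in>\<rat> \<inter> {0..}. AE \<omega> in M. \<forall>k::nat. \<rho> \<omega> \<noteq> first_passage V q (1 / real (Suc k)) \<omega>"
      using stopping_time_first_passage[OF V] avoids_AE[OF \<rho>] by (auto simp: AE_all_countable)
  qed
  moreover have "AE \<omega> in M. \<rho> \<omega> \<noteq> 0" "AE \<omega> in M. \<rho> \<omega> \<noteq> \<infinity>" by (rule avoids_const[OF \<rho>])+
  moreover have "AE \<omega> in M. \<omega> \<in> space M" by (rule AE_space)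
  ultimately show ?thesis
  proof eventually_elim
    case (elim \<omega>)
    then have fin: "0 < \<rho> \<omega>" "\<rho> \<omega> < \<infinity>" by (auto simp: zero_less_iff_neq_zero less_top)
    have "continuous (at_left (enn2real (\<rho> \<omega>))) (\<lambda>t. V t \<omega>)"
    proof (rule ccontr)
      assume disc: "\<not> ?thesis"
      have "0 < enn2real (\<rho> \<omega>)" using fin by (simp add: enn2real_positive_iff less_top)
      then obtain q k where "q \<in> \<rat>" "0 \<le> q" "first_passage V q (1 / real (Suc k)) \<omega> = ennreal (enn2real (\<rho> \<omega>))"
        using first_passage_jump[of V \<omega>, OF V(2)[OF elim(4)] _ disc] by blast
      moreover from this have "\<rho> \<omega> \<noteq> first_passage V q (1 / real (Suc k)) \<omega>" using elim(1) by blast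
      ultimately show False using fin by (simp add: less_top)
    qed
    then show ?case using fin by blast
  qed
qed

end

section \<open>Atoms of the Stieltjes measure and jumps of the path\<close>

lemma emeasure_increasing_path_neg:
  assumes v: "increasing_path v"
  shows "emeasure (interval_measure (\<lambda>t. if t < 0 then 0 else v t)) {..<0} = 0"
proof -
  let ?\<nu> = "interval_measure (\<lambda>t. if t < 0 then 0 else v t)"
  have "{.. - 1 / real (Suc n)} \<in> null_sets ?\<nu>" for n
    using emeasure_increasing_path_Iic[OF v, of "- 1 / real (Suc n)"] by (simp add: null_sets_def)
  then have N: "(\<Union>n. {.. - 1 / real (Suc n)}) \<in> null_sets ?\<nu>" by (rule null_sets_UN)
  have sub: "{..<0::real} \<subseteq> (\<Union>n. {.. - 1 / real (Suc n)})"
  proof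
    fix x :: real assume "x \<in> {..<0}"
    then obtain n where "1 / real (Suc n) < - x" using nat_approx_posE[of "- x"] by auto
    then show "x \<in> (\<Union>n. {.. - 1 / real (Suc n)})" by (intro UN_I[of n]) auto
  qed
  have "{..<0::real} \<in> null_sets ?\<nu>" by (rule null_sets_subset[OF N _ sub]) simp
  then show ?thesis by (rule null_setsD1)
qed

lemma increasing_path_zero_if_null:
  assumes v: "increasing_path v" and "emeasure (interval_measure (\<lambda>t. if t < 0 then 0 else v t)) {0} = 0"
  shows "v 0 = 0"
proof -
  let ?\<nu> = "interval_measure (\<lambda>t. if t < 0 then 0 else v t)"
  have "emeasure ?\<nu> ({..<0} \<union> {0}) = emeasure ?\<nu> {..<0} + emeasure ?\<nu> {0}"
    by (intro plus_emeasure[symmetric]) auto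
  moreover have "{..<0} \<union> {0} = {..0::real}" by auto
  ultimately have "ennreal (v 0) = 0"
    using emeasure_increasing_path_Iic[OF v, of 0] emeasure_increasing_path_neg[OF v] assms(2) by simp
  then show ?thesis using v by (simp add: increasing_path_def)
qed

text \<open>The mass at \<open>r\<close> is the limit of the masses of intervals shrinking to
  \<open>r\<close> from the left. For a jump at \<open>r\<close> these stay above \<eta>, the excess
  of \<open>v r\<close> over the bound \<open>v q + 1 / Suc k\<close> that holds on
  \<open>{q..<r}\<close>.\<close>

lemma increasing_path_left_continuous_if_null:
  assumes v: "increasing_path v" and r: "0 < r"
    and null: "emeasure (interval_measure (\<lambda>t. if t < 0 then 0 else v t)) {r} = 0"
  shows "continuous (at_left r) v"
proof (rule ccontr)
  let ?\<nu> = "interval_measure (\<lambda>t. if t < 0 then 0 else v t)"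
  assume disc: "\<not> ?thesis"
  have "mono_on {0..} v" using v by (simp add: increasing_path_def)
  then obtain q k where "q \<in> \<rat>" and q: "0 \<le> q" "q < r"
    and le: "\<And>s. q \<le> s \<Longrightarrow> s < r \<Longrightarrow> v s \<le> v q + 1 / real (Suc k)" and gt: "v q + 1 / real (Suc k) < v r"
    using increasing_jump_first_passage[OF _ r disc] by blast
  define \<eta> where "\<eta> = v r - (v q + 1 / real (Suc k))"
  define s where "s n = max q (r - 1 / real (Suc n))" for n
  have s: "q \<le> s n" "s n < r" "0 \<le> s n" for n using q by (simp_all add: s_def le_max_iff_disj)
  have \<nu>_s: "emeasure ?\<nu> {s n<..r} = ennreal (v r - v (s n))" for n
    using s(2)[of n] s(3)[of n] by (intro emeasure_increasing_path_Ioc[OF v]) auto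
  have s_inc: "s m \<le> s n" if "m \<le> n" for m n
  proof -
    have "1 / real (Suc n) \<le> 1 / real (Suc m)" using that by (simp add: field_simps)
    then show ?thesis by (auto simp: s_def)
  qed
  have "ennreal \<eta> \<le> emeasure ?\<nu> {s n<..r}" for n
    unfolding \<nu>_s \<eta>_def using le[OF s(1,2)[of n]] by (intro ennreal_leI) linarith
  moreover have "(INF n. emeasure ?\<nu> {s n<..r}) = emeasure ?\<nu> (\<Inter>n. {s n<..r})"
  proof (rule INF_emeasure_decseq)
    show "decseq (\<lambda>n. {s n<..r})"
      unfolding decseq_def
    proof (intro allI impI)
      fix m n :: nat assume "m \<le> n"
      then show "{s n<..r} \<subseteq> {s m<..r}" using s_inc[of m n] by auto
    qed
  qed (simp_all add: \<nu>_s image_subset_iff)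
  ultimately have "ennreal \<eta> \<le> emeasure ?\<nu> (\<Inter>n. {s n<..r})"
    using INF_greatest[of UNIV "ennreal \<eta>" "\<lambda>n. emeasure ?\<nu> {s n<..r}"] by simp
  also have "(\<Inter>n. {s n<..r}) = {r}"
  proof (intro set_eqI iffI)
    fix x assume x: "x \<in> (\<Inter>n. {s n<..r})"
    have "x = r"
    proof (rule ccontr)
      assume "x \<noteq> r"
      then have "0 < r - x" using x by auto
      then obtain n where "1 / real (Suc n) < r - x" using nat_approx_posE by blast
      then have "x < s n" by (auto simp: s_def)
      moreover have "s n < x" using x by auto
      ultimately show False by simp
    qed
    then show "x \<in> {r}" by simp
  qed (use s(2) in auto)
  finally show False using gt null by (simp add: \<eta>_def)
qed

section \<open>Optional sets attached to stopping times and to left accumulation points\<close>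

context usual_filtered_prob_space
begin

text \<open>The graph is the region from \<open>T\<close> on without the region strictly after
  \<open>T\<close>. The former comes from an adapted cadlag indicator; the latter is the union of
  the strips \<open>{q<..}\<close> above the events \<open>T \<le> q\<close> over rational
  \<open>q\<close>.\<close>

lemma stopping_time_graph_optional:
  assumes T: "stopping_time_ext M F T"
  shows "{(t, \<omega>). 0 \<le> t \<and> \<omega> \<in> space M \<and> T \<omega> = ennreal t} \<in> sets (optional_sigma M F)"
proof -
  define X where "X t \<omega> = (if T \<omega> \<le> ennreal t then 1 else 0 :: real)" for t \<omega>
  have T_le: "{\<omega> \<in> space M. T \<omega> \<le> ennreal t} \<in> sets (F t)" if "0 \<le> t" for t
    using T that by (simp add: stopping_time_ext_def)
  have "adapted F X"
    unfolding adapted_def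
  proof (intro allI impI)
    fix t :: real assume t: "0 \<le> t"
    have "indicator {\<omega> \<in> space M. T \<omega> \<le> ennreal t} \<in> borel_measurable (F t)"
      using T_le[OF t] by (rule borel_measurable_indicator)
    then show "X t \<in> borel_measurable (F t)"
      by (rule measurable_cong[THEN iffD1, rotated]) (simp add: X_def space_F t indicator_def)
  qed
  moreover have "cadlag M X"
    unfolding cadlag_def
  proof
    fix \<omega>
    show "cadlag_path (\<lambda>t. X t \<omega>)"
    proof (cases "T \<omega>")
      case (real r)
      show ?thesis
      \<comment> \<open>For \<open>T \<omega> = 0\<close> the path equals \<open>1\<close> at
        negative times as well, since \<open>ennreal\<close> maps these to \<open>0\<close>; it is
        then constant rather than a step.\<close>
      proof (cases "r = 0")
        case True
        then show ?thesis using real by (auto simp: X_def cadlag_path_def intro: tendsto_const)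
      next
        case False
        then have "(\<lambda>t. X t \<omega>) = (\<lambda>t. if r \<le> t then 1 else 0)"
          using real by (auto simp: X_def ennreal_le_iff2 fun_eq_iff)
        then show ?thesis using cadlag_path_Ici[of r 1] by simp
      qed
    next
      case top
      then show ?thesis by (auto simp: X_def cadlag_path_def top_unique intro: tendsto_const) 
    qed
  qed
  ultimately have "{(t, \<omega>). 0 \<le> t \<and> \<omega> \<in> space M \<and> X t \<omega> \<in> {1}} \<in> sets (optional_sigma M F)"
    unfolding optional_sigma_def by (intro process_in_sigma) auto
  moreover have "(\<Union>q\<in>\<rat> \<inter> {0..}. {q<..} \<times> {\<omega> \<in> space M. T \<omega> \<le> ennreal q}) \<in> sets (optional_sigma M F)"
  proof (rule sets.countable_UN')
    show "countable (\<rat> \<inter> {0::real..})" using countable_rat by (rule countable_subset[rotated]) auto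
    show "(\<lambda>q. {q<..} \<times> {\<omega> \<in> space M. T \<omega> \<le> ennreal q}) ` (\<rat> \<inter> {0..}) \<subseteq> sets (optional_sigma M F)"
      by (intro image_subsetI Ioi_times_optional T_le) auto
  qed
  ultimately have "{(t, \<omega>). 0 \<le> t \<and> \<omega> \<in> space M \<and> X t \<omega> \<in> {1}} -
      (\<Union>q\<in>\<rat> \<inter> {0..}. {q<..} \<times> {\<omega> \<in> space M. T \<omega> \<le> ennreal q}) \<in> sets (optional_sigma M F)"
    by (rule sets.Diff)
  also have "{(t, \<omega>). 0 \<le> t \<and> \<omega> \<in> space M \<and> X t \<omega> \<in> {1}} -
      (\<Union>q\<in>\<rat> \<inter> {0..}. {q<..} \<times> {\<omega> \<in> space M. T \<omega> \<le> ennreal q}) =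
      {(t, \<omega>). 0 \<le> t \<and> \<omega> \<in> space M \<and> T \<omega> = ennreal t}"
  proof (intro set_eqI iffI)
    fix z assume z: "z \<in> {(t, \<omega>). 0 \<le> t \<and> \<omega> \<in> space M \<and> X t \<omega> \<in> {1}} -
      (\<Union>q\<in>\<rat> \<inter> {0..}. {q<..} \<times> {\<omega> \<in> space M. T \<omega> \<le> ennreal q})"
    obtain t \<omega> where zt: "z = (t, \<omega>)" by (cases z)
    have 0: "0 \<le> t" "X t \<omega> \<in> {1}" "\<omega> \<in> space M"
      "(t, \<omega>) \<notin> (\<Union>q\<in>\<rat> \<inter> {0..}. {q<..} \<times> {\<omega> \<in> space M. T \<omega> \<le> ennreal q})"
      using DiffD1[OF z] DiffD2[OF z] unfolding zt by blast+
    then have le: "T \<omega> \<le> ennreal t" by (auto simp: X_def split: if_splits)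
    then obtain x where x: "T \<omega> = ennreal x" "0 \<le> x" by (cases "T \<omega>") (auto simp: top_unique)
    have "x = t"
    proof (rule ccontr)
      assume "x \<noteq> t"
      then have "x < t" using le x 0(1) by simp
      then obtain q where q: "q \<in> \<rat>" "x < q" "q < t" using Rats_dense_in_real by blast
      have "(t, \<omega>) \<in> {q<..} \<times> {\<omega> \<in> space M. T \<omega> \<le> ennreal q}"
        using q 0(3) x by simp
      moreover have "q \<in> \<rat> \<inter> {0..}" using q x by simp
      ultimately show False using 0(4) by blast
    qed
    then show "z \<in> {(t, \<omega>). 0 \<le> t \<and> \<omega> \<in> space M \<and> T \<omega> = ennreal t}" using x 0 zt by simp
  next
    fix z assume "z \<in> {(t, \<omega>). 0 \<le> t \<and> \<omega> \<in> space M \<and> T \<omega> = ennreal t}"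
    then show "z \<in> {(t, \<omega>). 0 \<le> t \<and> \<omega> \<in> space M \<and> X t \<omega> \<in> {1}} -
      (\<Union>q\<in>\<rat> \<inter> {0..}. {q<..} \<times> {\<omega> \<in> space M. T \<omega> \<le> ennreal q})"
      by (auto simp: X_def)
  qed
  finally show ?thesis .
qed

text \<open>The event is the projection of a piece of \<Gamma> that is measurable for the product of
  the Borel sets with \<open>F t\<close>. The projection theorem is applied to \<open>M\<close>
  restricted to \<open>F t\<close>, which is complete because \<open>F t\<close> contains the null
  sets of \<open>M\<close> and their subsets.\<close>

lemma section_meets_interval:
  assumes \<Gamma>: "\<Gamma> \<in> sets (optional_sigma M F)" and p: "0 \<le> p" and t: "0 \<le> t"
  shows "{\<omega> \<in> space M. \<exists>s. p < s \<and> s < t \<and> (s, \<omega>) \<in> \<Gamma>} \<in> sets (F t)"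
proof -
  let ?N = "restr_to_subalg M (F t)"
  have sub: "subalgebra M (F t)" by (rule subalgebra_F[OF t])
  have sets_N: "sets ?N = sets (F t)" by (rule sets_restr_to_subalg[OF sub])
  have fin: "finite_measure ?N" by (rule finite_measure_restr_to_subalg[OF sub finite_measure_axioms])
  have compl: "complete_measure ?N"
  proof
    fix A B assume "B \<subseteq> A" "A \<in> null_sets ?N"
    then have "A \<in> null_sets M" by (simp add: null_sets_restr_to_subalg[OF sub])
    from null_subset_F[OF \<open>B \<subseteq> A\<close> this t] show "B \<in> sets ?N" by (simp add: sets_N)
  qed
  have sets_pair: "sets (borel \<Otimes>\<^sub>M ?N) = sets (borel \<Otimes>\<^sub>M F t)"
    by (rule sets_pair_measure_cong[OF refl sets_N])
  have "\<Gamma> \<inter> {..<t} \<times> UNIV \<inter> {p<..} \<times> space M \<in> sets (borel \<Otimes>\<^sub>M F t)"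
    using space_in_F[OF t] by (intro sets.Int optional_progressive[OF \<Gamma> t] pair_measureI) auto
  then have "snd ` (\<Gamma> \<inter> {..<t} \<times> UNIV \<inter> {p<..} \<times> space M) \<in> sets ?N"
    by (intro measurable_projection fin compl) (simp only: sets_pair)
  moreover have "snd ` (\<Gamma> \<inter> {..<t} \<times> UNIV \<inter> {p<..} \<times> space M) =
      {\<omega> \<in> space M. \<exists>s. p < s \<and> s < t \<and> (s, \<omega>) \<in> \<Gamma>}" by force
  ultimately show ?thesis by (simp add: sets_N)
qed

text \<open>That points of \<Gamma> lie within \<open>1 / Suc n\<close> to the left of
  \<open>t\<close> is expressed by a rational \<open>p < t < p + 1 / Suc n\<close> such that
  \<Gamma> meets the interval from \<open>p\<close> to \<open>t\<close>. For fixed \<open>p\<close>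
  the latter is a countable union of strips \<open>{q<..}\<close> above events of
  \<open>F q\<close>. Rational \<open>p \<ge> 0\<close> forces the restriction to
  \<open>0 < s\<close>.\<close>

lemma left_accumulation_optional:
  assumes \<Gamma>: "\<Gamma> \<in> sets (optional_sigma M F)"
  shows "{(t, \<omega>). \<omega> \<in> space M \<and> (\<forall>n. \<exists>s. t - 1 / real (Suc n) < s \<and> 0 < s \<and> s < t \<and> (s, \<omega>) \<in> \<Gamma>)}
    \<in> sets (optional_sigma M F)"
proof -
  define Q :: "real set" where "Q = \<rat> \<inter> {0..}"
  have Q: "countable Q" unfolding Q_def using countable_rat by (rule countable_subset[rotated]) auto
  define D where "D p = (\<Union>q\<in>Q. {q<..} \<times> {\<omega> \<in> space M. \<exists>s. p < s \<and> s < q \<and> (s, \<omega>) \<in> \<Gamma>})" for p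
  have D: "D p \<in> sets (optional_sigma M F)" if "p \<in> Q" for p
    unfolding D_def
  proof (rule sets.countable_UN'[OF Q])
    show "(\<lambda>q. {q<..} \<times> {\<omega> \<in> space M. \<exists>s. p < s \<and> s < q \<and> (s, \<omega>) \<in> \<Gamma>}) ` Q \<subseteq> sets (optional_sigma M F)"
      using that by (intro image_subsetI Ioi_times_optional section_meets_interval[OF \<Gamma>]) (auto simp: Q_def)
  qed
  have D_iff: "(t, \<omega>) \<in> D p \<longleftrightarrow> \<omega> \<in> space M \<and> (\<exists>s. p < s \<and> s < t \<and> (s, \<omega>) \<in> \<Gamma>)" if "0 \<le> p" for p t \<omega>
  proof
    assume "\<omega> \<in> space M \<and> (\<exists>s. p < s \<and> s < t \<and> (s, \<omega>) \<in> \<Gamma>)"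
    then obtain s where s: "\<omega> \<in> space M" "p < s" "s < t" "(s, \<omega>) \<in> \<Gamma>" by blast
    obtain q where q: "q \<in> \<rat>" "s < q" "q < t" using Rats_dense_in_real[OF s(3)] by blast
    then have "q \<in> Q" using s that by (simp add: Q_def)
    then show "(t, \<omega>) \<in> D p" using s q by (auto simp: D_def)
  qed (auto simp: D_def)
  have strip: "{p<..<p + 1 / real (Suc n)} \<times> space M \<in> sets (optional_sigma M F)" if "p \<in> Q" for p n
  proof -
    have p: "0 \<le> p" "0 \<le> p + 1 / real (Suc n)" using that by (auto simp: Q_def add_nonneg_nonneg)
    have "{p<..} \<times> space M - {p + 1 / real (Suc n)..} \<times> space M \<in> sets (optional_sigma M F)"
      using p by (intro sets.Diff Ioi_times_optional Ici_times_optional space_in_F)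
    moreover have "{p<..} \<times> space M - {p + 1 / real (Suc n)..} \<times> space M =
        {p<..<p + 1 / real (Suc n)} \<times> space M" by auto
    ultimately show ?thesis by simp
  qed
  have "(\<Inter>n. \<Union>p\<in>Q. {p<..<p + 1 / real (Suc n)} \<times> space M \<inter> D p) \<in> sets (optional_sigma M F)"
  proof (intro sets.countable_INT image_subsetI UNIV_not_empty)
    fix n
    show "(\<Union>p\<in>Q. {p<..<p + 1 / real (Suc n)} \<times> space M \<inter> D p) \<in> sets (optional_sigma M F)"
      by (rule sets.countable_UN'[OF Q]) (intro image_subsetI sets.Int strip D)
  qed
  also have "(\<Inter>n. \<Union>p\<in>Q. {p<..<p + 1 / real (Suc n)} \<times> space M \<inter> D p) =
      {(t, \<omega>). \<omega> \<in> space M \<and> (\<forall>n. \<exists>s. t - 1 / real (Suc n) < s \<and> 0 < s \<and> s < t \<and> (s, \<omega>) \<in> \<Gamma>)}"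
  proof (intro set_eqI iffI)
    fix z assume z: "z \<in> (\<Inter>n. \<Union>p\<in>Q. {p<..<p + 1 / real (Suc n)} \<times> space M \<inter> D p)"
    obtain t \<omega> where zt: "z = (t, \<omega>)" by (cases z)
    note * = z[unfolded zt]
    have "\<exists>p\<in>Q. p < t \<and> t < p + 1 / real (Suc n) \<and> \<omega> \<in> space M \<and> (t, \<omega>) \<in> D p" for n
    proof -
      have "(t, \<omega>) \<in> (\<Union>p\<in>Q. {p<..<p + 1 / real (Suc n)} \<times> space M \<inter> D p)"
        using * by (rule INT_D) simp
      then show ?thesis by (auto simp del: of_nat_Suc)
    qed
    then obtain p where p: "\<And>n. p n \<in> Q" "\<And>n. t < p n + 1 / real (Suc n)" "\<omega> \<in> space M" "\<And>n. (t, \<omega>) \<in> D (p n)"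
      by metis
    have "\<exists>s. t - 1 / real (Suc n) < s \<and> 0 < s \<and> s < t \<and> (s, \<omega>) \<in> \<Gamma>" for n
    proof -
      have "0 \<le> p n" using p(1)[of n] by (simp add: Q_def)
      moreover from this obtain s where "p n < s" "s < t" "(s, \<omega>) \<in> \<Gamma>" using p(4)[of n] D_iff by blast
      ultimately show ?thesis using p(2)[of n] by (intro exI[of _ s]) simp
    qed
    then show "z \<in> {(t, \<omega>). \<omega> \<in> space M \<and>
        (\<forall>n. \<exists>s. t - 1 / real (Suc n) < s \<and> 0 < s \<and> s < t \<and> (s, \<omega>) \<in> \<Gamma>)}"
      unfolding zt using p(3) by (intro CollectI case_prodI conjI allI)
  next
    fix z assume z: "z \<in> {(t, \<omega>). \<omega> \<in> space M \<and>
        (\<forall>n. \<exists>s. t - 1 / real (Suc n) < s \<and> 0 < s \<and> s < t \<and> (s, \<omega>) \<in> \<Gamma>)}"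
    obtain t \<omega> where zt: "z = (t, \<omega>)" by (cases z)
    have \<omega>: "\<omega> \<in> space M"
      and *: "\<forall>n. \<exists>s. t - 1 / real (Suc n) < s \<and> 0 < s \<and> s < t \<and> (s, \<omega>) \<in> \<Gamma>"
      using z unfolding zt by blast+
    show "z \<in> (\<Inter>n. \<Union>p\<in>Q. {p<..<p + 1 / real (Suc n)} \<times> space M \<inter> D p)"
      unfolding zt
    proof (rule INT_I)
      fix n
      obtain s where s: "t - 1 / real (Suc n) < s" "0 < s" "s < t" "(s, \<omega>) \<in> \<Gamma>" using * by blast
      then obtain p where p: "p \<in> \<rat>" "max 0 (t - 1 / real (Suc n)) < p" "p < s"
        using Rats_dense_in_real[of "max 0 (t - 1 / real (Suc n))" s] by auto
      then have pQ: "p \<in> Q" by (simp add: Q_def)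
      have "(t, \<omega>) \<in> D p" using D_iff[of p] p s \<omega> by auto
      then show "(t, \<omega>) \<in> (\<Union>p\<in>Q. {p<..<p + 1 / real (Suc n)} \<times> space M \<inter> D p)"
        using p s \<omega> by (intro UN_I[OF pQ]) auto
    qed
  qed
  finally show ?thesis .
qed

section \<open>Honest times\<close>

text \<open>Applied to indicators, the dual optional projection says that the expected mass of
  \<open>dA\<close> on an optional set is the probability that the graph of \<open>g\<close> passes
  through it (\<open>key\<close>). Optional sets missed by this graph therefore carry no mass of
  \<open>dA\<close> (\<open>null\<close>). Initial value, continuity and constancy after
  \<open>g\<close> all result from choosing suitable sets.\<close>

lemma honest_time_projection:
  assumes honest: "honest_time M F g" and avoids: "avoids_stopping_times M F g"
    and proj: "dual_optional_projection M F (jump_process g) A"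
  shows "dual_predictable_projection M (progressive_enlargement M F g) (jump_process g) A"
proof -
  obtain \<Gamma> where \<Gamma>: "\<Gamma> \<in> sets (optional_sigma M F)"
    and g_Sup: "\<And>\<omega>. \<omega> \<in> space M \<Longrightarrow> g \<omega> = Sup {ennreal t | t. (t, \<omega>) \<in> \<Gamma>}"
    and g: "g \<in> borel_measurable M"
    using honest unfolding honest_time_def random_time_def by blast
  have A_opt: "(\<lambda>(t, \<omega>). A t \<omega>) \<in> borel_measurable (optional_sigma M F)"
    and A_path: "AE \<omega> in M. increasing_path (\<lambda>t. A t \<omega>)"
    and A_proj: "\<And>X. (\<lambda>(t, \<omega>). X t \<omega>) \<in> borel_measurable (optional_sigma M F) \<Longrightarrow>
      (\<integral>\<^sup>+\<omega>. stieltjes_integral X A \<omega> \<partial>M) = (\<integral>\<^sup>+\<omega>. stieltjes_integral X (jump_process g) \<omega> \<partial>M)"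
    using proj unfolding dual_optional_projection_def dual_projection_def by blast+
  have A_adapted: "adapted F A" by (rule optional_adapted[OF A_opt])
  obtain N where N: "N \<in> null_sets M" "\<And>\<omega>. \<omega> \<in> space M \<Longrightarrow> \<omega> \<notin> N \<Longrightarrow> increasing_path (\<lambda>t. A t \<omega>)"
    using AE_E_null[OF A_path] by blast
  define W where "W t \<omega> = (if \<omega> \<in> N then 0 else A t \<omega>)" for t \<omega>
  have W_eq: "AE \<omega> in M. \<forall>t. W t \<omega> = A t \<omega>"
    by (rule AE_I'[OF N(1)]) (auto simp: W_def)
  have W_adapted: "adapted F W"
    unfolding adapted_def
  proof (intro allI impI)
    fix t :: real assume t: "0 \<le> t"
    show "W t \<in> borel_measurable (F t)"
      by (rule measurable_F_cong_AE[of "A t", OF _ _ t]) (use A_adapted t W_eq in \<open>auto simp: adapted_def\<close>)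
  qed
  have W_meas: "W t \<in> borel_measurable M" if "0 \<le> t" for t
    by (rule measurable_F_M[OF _ that]) (use W_adapted that in \<open>simp add: adapted_def\<close>)
  have W_path: "increasing_path (\<lambda>t. W t \<omega>)" if "\<omega> \<in> space M" for \<omega>
    using N(2)[OF that] by (cases "\<omega> \<in> N") (simp_all add: W_def increasing_path_def mono_on_def)
  have W_mono: "mono_on {0..} (\<lambda>t. W t \<omega>)" if "\<omega> \<in> space M" for \<omega>
    using W_path[OF that] by (simp add: increasing_path_def)
  define \<nu> where "\<nu> \<omega> = interval_measure (\<lambda>t. if t < 0 then 0 else W t \<omega>)" for \<omega>
  have key: "(\<integral>\<^sup>+\<omega>. emeasure (\<nu> \<omega>) {t. (t, \<omega>) \<in> C} \<partial>M) =
      emeasure M {\<omega> \<in> space M. g \<omega> < \<infinity> \<and> (enn2real (g \<omega>), \<omega>) \<in> C}"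
    if C: "C \<in> sets (optional_sigma M F)" for C
  proof -
    define X where "X t \<omega> = (indicator C (t, \<omega>) :: ennreal)" for t \<omega>
    have "(\<lambda>(t, \<omega>). X t \<omega>) = indicator C" by (auto simp: X_def)
    then have X: "(\<lambda>(t, \<omega>). X t \<omega>) \<in> borel_measurable (optional_sigma M F)" using C by simp
    have "(\<integral>\<^sup>+\<omega>. emeasure (\<nu> \<omega>) {t. (t, \<omega>) \<in> C} \<partial>M) = (\<integral>\<^sup>+\<omega>. stieltjes_integral X A \<omega> \<partial>M)"
    proof (rule nn_integral_cong_AE)
      show "AE \<omega> in M. emeasure (\<nu> \<omega>) {t. (t, \<omega>) \<in> C} = stieltjes_integral X A \<omega>"
        using W_eq
      proof eventually_elim
        case (elim \<omega>)
        then have "stieltjes_integral X A \<omega> = (\<integral>\<^sup>+t. X t \<omega> * indicator {0..} t \<partial>\<nu> \<omega>)"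
          by (simp add: stieltjes_integral_def \<nu>_def cong: if_cong)
        also have "\<dots> = (\<integral>\<^sup>+t. indicator {t. (t, \<omega>) \<in> C} t \<partial>\<nu> \<omega>)"
          using sets.sets_into_space[OF C] by (intro nn_integral_cong) (auto simp: X_def indicator_def)
        also have "\<dots> = emeasure (\<nu> \<omega>) {t. (t, \<omega>) \<in> C}"
          using optional_time_section[OF C] by (intro nn_integral_indicator) (simp add: \<nu>_def)
        finally show ?case by simp
      qed
    qed
    also have "\<dots> = (\<integral>\<^sup>+\<omega>. stieltjes_integral X (jump_process g) \<omega> \<partial>M)" by (rule A_proj[OF X])
    also have "\<dots> = (\<integral>\<^sup>+\<omega>. indicator {\<omega> \<in> space M. g \<omega> < \<infinity> \<and> (enn2real (g \<omega>), \<omega>) \<in> C} \<omega> \<partial>M)"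
    proof (rule nn_integral_cong)
      fix \<omega> assume \<omega>: "\<omega> \<in> space M"
      show "stieltjes_integral X (jump_process g) \<omega> =
          indicator {\<omega> \<in> space M. g \<omega> < \<infinity> \<and> (enn2real (g \<omega>), \<omega>) \<in> C} \<omega>"
        using stieltjes_integral_jump_process[of X \<omega> g, OF optional_time_section_measurable[OF X \<omega>]] \<omega>
        by (simp add: X_def indicator_def)
    qed
    also have "\<dots> = emeasure M {\<omega> \<in> space M. g \<omega> < \<infinity> \<and> (enn2real (g \<omega>), \<omega>) \<in> C}"
      by (rule nn_integral_indicator[OF random_time_graph[OF optional_pair[OF C] g]])
    finally show ?thesis .
  qed
  have null: "AE \<omega> in M. emeasure (\<nu> \<omega>) {t. (t, \<omega>) \<in> C} = 0"
    if C: "C \<in> sets (optional_sigma M F)" and "AE \<omega> in M. \<not> (g \<omega> < \<infinity> \<and> (enn2real (g \<omega>), \<omega>) \<in> C)" for C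
  proof -
    have "emeasure M {\<omega> \<in> space M. g \<omega> < \<infinity> \<and> (enn2real (g \<omega>), \<omega>) \<in> C} = 0"
      by (rule emeasure_eq_0_AE[OF that(2)])
    moreover have "(\<lambda>\<omega>. emeasure (\<nu> \<omega>) {t. (t, \<omega>) \<in> C}) \<in> borel_measurable M"
      unfolding \<nu>_def by (rule stieltjes_kernel_measurable[OF W_meas W_path optional_pair[OF C]])
    ultimately show ?thesis using key[OF C] by (simp add: nn_integral_0_iff_AE)
  qed
  have g_pos: "AE \<omega> in M. g \<omega> \<noteq> 0" and g_fin: "AE \<omega> in M. g \<omega> < \<infinity>"
    using avoids_const[OF avoids g, of 0] avoids_const[OF avoids g, of \<infinity>] by (auto simp: less_top)
  have W0: "AE \<omega> in M. W 0 \<omega> = 0"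
  proof -
    have "{0} \<times> space M \<in> sets (optional_sigma M F)"
      using predictable_subset_optional space_in_F[of 0]
      by (auto simp: sets_predictable_sigma predictable_rectangles_def intro!: subsetD[OF predictable_subset_optional] sigma_sets.Basic)
    moreover have "AE \<omega> in M. \<not> (g \<omega> < \<infinity> \<and> (enn2real (g \<omega>), \<omega>) \<in> {0} \<times> space M)"
      using g_pos by eventually_elim (auto simp: enn2real_eq_0_iff)
    ultimately have "AE \<omega> in M. emeasure (\<nu> \<omega>) {t. (t, \<omega>) \<in> {0} \<times> space M} = 0" by (rule null)
    then show ?thesis using AE_space
    proof eventually_elim
      case (elim \<omega>)
      then have "emeasure (\<nu> \<omega>) {0} = 0" by simp
      then show ?case unfolding \<nu>_def by (rule increasing_path_zero_if_null[OF W_path[OF elim(2)]])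
    qed
  qed
  \<comment> \<open>The null sets here are the graphs of all first passage times of
    \<open>W\<close>: \<open>g\<close> avoids each of them, so \<open>dW\<close> has no mass on
    them. This excludes jumps at every time, not only at \<open>g\<close>.\<close>
  have W_left: "AE \<omega> in M. \<forall>r>0. continuous (at_left r) (\<lambda>t. W t \<omega>)"
  proof -
    have "AE \<omega> in M. \<forall>q\<in>\<rat> \<inter> {0..}. \<forall>k::nat.
        emeasure (\<nu> \<omega>) {t. (t, \<omega>) \<in> {(t, \<omega>). 0 \<le> t \<and> \<omega> \<in> space M \<and>
          first_passage W q (1 / real (Suc k)) \<omega> = ennreal t}} = 0"
    proof (subst AE_ball_countable)
      show "countable (\<rat> \<inter> {0::real..})" using countable_rat by (rule countable_subset[rotated]) auto
      show "\<forall>q\<in>\<rat> \<inter> {0..}. AE \<omega> in M. \<forall>k::nat.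
        emeasure (\<nu> \<omega>) {t. (t, \<omega>) \<in> {(t, \<omega>). 0 \<le> t \<and> \<omega> \<in> space M \<and>
          first_passage W q (1 / real (Suc k)) \<omega> = ennreal t}} = 0"
      proof (intro ballI, subst AE_all_countable, rule allI)
        fix q k assume q: "q \<in> \<rat> \<inter> {0::real..}"
        have T: "stopping_time_ext M F (first_passage W q (1 / real (Suc k)))"
          using q by (intro stopping_time_first_passage W_adapted W_mono) auto
        show "AE \<omega> in M. emeasure (\<nu> \<omega>) {t. (t, \<omega>) \<in> {(t, \<omega>). 0 \<le> t \<and> \<omega> \<in> space M \<and>
          first_passage W q (1 / real (Suc k)) \<omega> = ennreal t}} = 0"
        proof (rule null[OF stopping_time_graph_optional[OF T]])
          show "AE \<omega> in M. \<not> (g \<omega> < \<infinity> \<and> (enn2real (g \<omega>), \<omega>) \<in> {(t, \<omega>). 0 \<le> t \<and> \<omega> \<in> space M \<and>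
            first_passage W q (1 / real (Suc k)) \<omega> = ennreal t})"
            using avoids_AE[OF avoids g T] by eventually_elim (auto simp: less_top)
        qed
      qed
    qed
    then show ?thesis using AE_space
    proof eventually_elim
      case (elim \<omega>)
      show ?case
      proof (intro allI impI, rule ccontr)
        fix r :: real assume r: "0 < r" and disc: "\<not> continuous (at_left r) (\<lambda>t. W t \<omega>)"
        obtain q k where q: "q \<in> \<rat>" "0 \<le> q" and T: "first_passage W q (1 / real (Suc k)) \<omega> = ennreal r"
          using first_passage_jump[of W \<omega>, OF W_mono[OF elim(2)] r disc] by blast
        have "emeasure (\<nu> \<omega>) {t. (t, \<omega>) \<in> {(t, \<omega>). 0 \<le> t \<and> \<omega> \<in> space M \<and>
          first_passage W q (1 / real (Suc k)) \<omega> = ennreal t}} = 0"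
          using elim(1) q by blast
        moreover have "{t. (t, \<omega>) \<in> {(t, \<omega>). 0 \<le> t \<and> \<omega> \<in> space M \<and>
          first_passage W q (1 / real (Suc k)) \<omega> = ennreal t}} = {r}"
          using r elim(2) by (auto simp: T simp del: of_nat_Suc)
        ultimately have "emeasure (\<nu> \<omega>) {r} = 0" by (simp only:)
        then show False
          using increasing_path_left_continuous_if_null[OF W_path[OF elim(2)] r] disc by (simp add: \<nu>_def)
      qed
    qed
  qed
  define E where "E = {(t, \<omega>). \<omega> \<in> space M \<and>
      (\<forall>n. \<exists>s. t - 1 / real (Suc n) < s \<and> 0 < s \<and> s < t \<and> (s, \<omega>) \<in> \<Gamma>)}"
  have E: "E \<in> sets (optional_sigma M F)" unfolding E_def by (rule left_accumulation_optional[OF \<Gamma>])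
  have \<Gamma>_le: "ennreal t \<le> g \<omega>" if "(t, \<omega>) \<in> \<Gamma>" "\<omega> \<in> space M" for t \<omega>
    unfolding g_Sup[OF that(2)] using that(1) by (intro Sup_upper) blast
  have E_le: "ennreal t \<le> g \<omega>" if tE: "(t, \<omega>) \<in> E" and \<omega>: "\<omega> \<in> space M" for t \<omega>
  proof (cases "g \<omega>")
    case (real x)
    have "t - 1 / real (Suc n) < x" for n
    proof -
      obtain s where s: "t - 1 / real (Suc n) < s" "0 < s" "(s, \<omega>) \<in> \<Gamma>" using tE by (auto simp: E_def)
      then have "s \<le> x" using \<Gamma>_le[OF s(3) \<omega>] real by simp
      then show ?thesis using s(1) by simp
    qed
    then have "t \<le> x"
      using nat_approx_posE[of "t - x"] by (metis diff_gt_0_iff_gt diff_less_eq less_diff_eq linorder_not_le order_less_asym add.commute)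
    then show ?thesis using real by (simp add: ennreal_leI)
  qed simp
  \<comment> \<open>A positive finite supremum is either attained by a point of \<Gamma> or
    approached by smaller positive points of \<Gamma>, in which case it belongs to
    \<open>E\<close>.\<close>
  have g_in: "(enn2real (g \<omega>), \<omega>) \<in> \<Gamma> \<union> E" if \<omega>: "\<omega> \<in> space M" and pos: "g \<omega> \<noteq> 0" and fin: "g \<omega> < \<infinity>" for \<omega>
  proof (rule ccontr)
    assume "\<not> ?thesis"
    then have not\<Gamma>: "(enn2real (g \<omega>), \<omega>) \<notin> \<Gamma>" and notE: "(enn2real (g \<omega>), \<omega>) \<notin> E" by auto
    obtain x where x: "g \<omega> = ennreal x" "0 < x" using pos fin by (cases "g \<omega>") (auto simp: less_le)
    have "\<exists>s. x - 1 / real (Suc n) < s \<and> 0 < s \<and> s < x \<and> (s, \<omega>) \<in> \<Gamma>" for n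
    proof -
      define m where "m = max 0 (x - 1 / real (Suc n))"
      have m: "0 \<le> m" "m < x" "x - 1 / real (Suc n) \<le> m" using x(2) by (simp_all add: m_def)
      have "ennreal m < g \<omega>" using x m by (simp add: ennreal_less_iff)
      then obtain s where s: "(s, \<omega>) \<in> \<Gamma>" "ennreal m < ennreal s"
        unfolding g_Sup[OF \<omega>] less_Sup_iff by blast
      then have s': "m < s" using m by (simp add: ennreal_less_iff)
      have "s \<le> x" using \<Gamma>_le[OF s(1) \<omega>] x by simp
      moreover have "s \<noteq> x" using s(1) not\<Gamma> x by auto
      ultimately have "s < x" by simp
      moreover have "x - 1 / real (Suc n) < s" "0 < s" using s' m by linarith+
      ultimately show ?thesis using s(1) by blast
    qed
    then have "(x, \<omega>) \<in> E" using \<omega> by (simp add: E_def)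
    then show False using notE x by simp
  qed
  have W_stop: "AE \<omega> in M. \<forall>t\<ge>enn2real (g \<omega>). W t \<omega> = W (enn2real (g \<omega>)) \<omega>"
  proof -
    have top: "{0..} \<times> space M \<in> sets (optional_sigma M F)" using sets.top[of "optional_sigma M F"] by simp
    have "AE \<omega> in M. \<not> (g \<omega> < \<infinity> \<and> (enn2real (g \<omega>), \<omega>) \<in> {0..} \<times> space M - (\<Gamma> \<union> E))"
      using g_pos g_fin AE_space by eventually_elim (use g_in in auto)
    then have "AE \<omega> in M. emeasure (\<nu> \<omega>) {t. (t, \<omega>) \<in> {0..} \<times> space M - (\<Gamma> \<union> E)} = 0"
      by (intro null sets.Diff sets.Un top \<Gamma> E)
    then show ?thesis using AE_space g_fin
    proof eventually_elim
      case (elim \<omega>)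
      show ?case
      proof (intro allI impI)
        fix t assume t: "enn2real (g \<omega>) \<le> t"
        have sub: "{enn2real (g \<omega>)<..t} \<subseteq> {t. (t, \<omega>) \<in> {0..} \<times> space M - (\<Gamma> \<union> E)}"
        proof
          fix s assume s: "s \<in> {enn2real (g \<omega>)<..t}"
          then have "g \<omega> < ennreal s" using elim(3) by (cases "g \<omega>") (auto simp: ennreal_less_iff)
          then have "(s, \<omega>) \<notin> \<Gamma> \<union> E" using \<Gamma>_le[of s \<omega>] E_le[of s \<omega>] elim(2) by auto
          moreover have "0 \<le> s"
            using s order_trans[OF enn2real_nonneg[of "g \<omega>"], of s] by simp
          ultimately show "s \<in> {t. (t, \<omega>) \<in> {0..} \<times> space M - (\<Gamma> \<union> E)}" using elim(2) by simp
        qed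
        have "{t. (t, \<omega>) \<in> {0..} \<times> space M - (\<Gamma> \<union> E)} \<in> sets (\<nu> \<omega>)"
          using optional_time_section[OF sets.Diff[OF top sets.Un[OF \<Gamma> E]]] by (simp add: \<nu>_def)
        from emeasure_mono[OF sub this] have "emeasure (\<nu> \<omega>) {enn2real (g \<omega>)<..t} = 0" using elim(1) by simp
        then have "ennreal (W t \<omega> - W (enn2real (g \<omega>)) \<omega>) = 0"
          using emeasure_increasing_path_Ioc[OF W_path[OF elim(2)] _ t] by (simp add: \<nu>_def)
        moreover have "W (enn2real (g \<omega>)) \<omega> \<le> W t \<omega>"
          by (rule mono_onD[OF W_mono[OF elim(2)] _ _ t]) (use order_trans[OF enn2real_nonneg t] in simp_all)
        ultimately show "W t \<omega> = W (enn2real (g \<omega>)) \<omega>" by simp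
      qed
    qed
  qed
  have W_incr: "(\<integral>\<^sup>+\<omega>. ennreal (W t \<omega> - W s \<omega>) * indicator B \<omega> \<partial>M) =
      emeasure M {\<omega> \<in> space M. \<omega> \<in> B \<and> ennreal s < g \<omega> \<and> g \<omega> \<le> ennreal t}"
    if s: "0 \<le> s" "s \<le> t" and B: "B \<in> sets (F s)" for s t B
  proof -
    have "{s<..t} \<times> B \<in> predictable_rectangles M F"
      using s B unfolding predictable_rectangles_def by blast
    then have C: "{s<..t} \<times> B \<in> sets (optional_sigma M F)"
      using predictable_subset_optional by (auto simp: sets_predictable_sigma intro: sigma_sets.Basic)
    have "(\<integral>\<^sup>+\<omega>. ennreal (W t \<omega> - W s \<omega>) * indicator B \<omega> \<partial>M) =
        (\<integral>\<^sup>+\<omega>. emeasure (\<nu> \<omega>) {u. (u, \<omega>) \<in> {s<..t} \<times> B} \<partial>M)"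
    proof (rule nn_integral_cong)
      fix \<omega> assume "\<omega> \<in> space M"
      from emeasure_increasing_path_Ioc[OF W_path[OF this] s]
      show "ennreal (W t \<omega> - W s \<omega>) * indicator B \<omega> = emeasure (\<nu> \<omega>) {u. (u, \<omega>) \<in> {s<..t} \<times> B}"
        by (cases "\<omega> \<in> B") (simp_all add: \<nu>_def greaterThanAtMost_def greaterThan_def atMost_def Collect_conj_eq)
    qed
    also have "\<dots> = emeasure M {\<omega> \<in> space M. g \<omega> < \<infinity> \<and> (enn2real (g \<omega>), \<omega>) \<in> {s<..t} \<times> B}"
      by (rule key[OF C])
    also have "{\<omega> \<in> space M. g \<omega> < \<infinity> \<and> (enn2real (g \<omega>), \<omega>) \<in> {s<..t} \<times> B} =
        {\<omega> \<in> space M. \<omega> \<in> B \<and> ennreal s < g \<omega> \<and> g \<omega> \<le> ennreal t}"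
    proof (rule Collect_cong, rule conj_cong[OF refl])
      fix \<omega>
      show "(g \<omega> < \<infinity> \<and> (enn2real (g \<omega>), \<omega>) \<in> {s<..t} \<times> B) = (\<omega> \<in> B \<and> ennreal s < g \<omega> \<and> g \<omega> \<le> ennreal t)"
        using s by (cases "g \<omega>") (auto simp: top_unique ennreal_less_iff)
    qed
    finally show ?thesis .
  qed
  let ?G = "progressive_enlargement M F g"
  interpret G: complete_filtration M ?G by (rule complete_filtration_enlargement[OF g])
  \<comment> \<open>\<open>A\<close> is given as an optional process of \<open>F\<close> only;
    almost sure left-continuity is what makes it predictable for the enlargement.\<close>
  have A_pred: "(\<lambda>(t, \<omega>). A t \<omega>) \<in> borel_measurable (predictable_sigma M ?G)"
  proof (rule G.AE_caglad_predictable)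
    show "adapted ?G A"
      unfolding adapted_def
    proof (intro allI impI)
      fix t :: real assume t: "0 \<le> t"
      show "A t \<in> borel_measurable (?G t)"
        by (rule measurable_from_subalg[of "?G t" "F t"])
           (use t A_adapted F_subset_enlargement[OF g t] in
             \<open>simp_all add: subalgebra_def space_enlargement[OF g] space_F adapted_def\<close>)
    qed
    show "AE \<omega> in M. caglad_path (\<lambda>t. A t \<omega>)"
      using W_left W_eq A_path
    proof eventually_elim
      case (elim \<omega>)
      then have "(\<lambda>t. W t \<omega>) = (\<lambda>t. A t \<omega>)" by auto
      then show ?case using elim(1,3)
        by (auto simp: caglad_path_def increasing_path_def continuous_within)
    qed
    fix B :: "real set" assume B: "B \<in> sets borel"
    have "(\<lambda>(t, \<omega>). A t \<omega>) -` B \<inter> space (optional_sigma M F) \<in> sets (borel \<Otimes>\<^sub>M M)"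
      by (rule optional_pair[OF measurable_sets[OF A_opt B]])
    also have "(\<lambda>(t, \<omega>). A t \<omega>) -` B \<inter> space (optional_sigma M F) =
        {(t, \<omega>). 0 \<le> t \<and> \<omega> \<in> space M \<and> A t \<omega> \<in> B}" by auto
    finally show "{(t, \<omega>). 0 \<le> t \<and> \<omega> \<in> space M \<and> A t \<omega> \<in> B} \<in> sets (borel \<Otimes>\<^sub>M M)" .
  qed
  show ?thesis
  proof (rule dual_predictable_projection_enlargementI[OF g g_pos g_fin A_pred A_path])
    show "AE \<omega> in M. A 0 \<omega> = 0" using W0 W_eq by eventually_elim simp
    show "AE \<omega> in M. \<forall>t\<ge>enn2real (g \<omega>). A t \<omega> = A (enn2real (g \<omega>)) \<omega>"
      using W_stop W_eq
    proof eventually_elim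
      case (elim \<omega>)
      then have "(\<lambda>t. W t \<omega>) = (\<lambda>t. A t \<omega>)" by auto
      then show ?case using elim(1) by metis
    qed
    fix s t :: real and B assume s: "0 \<le> s" "s \<le> t" and B: "B \<in> sets (F s)"
    have "(\<integral>\<^sup>+\<omega>. ennreal (A t \<omega> - A s \<omega>) * indicator B \<omega> \<partial>M) =
        (\<integral>\<^sup>+\<omega>. ennreal (W t \<omega> - W s \<omega>) * indicator B \<omega> \<partial>M)"
    proof (rule nn_integral_cong_AE)
      show "AE \<omega> in M. ennreal (A t \<omega> - A s \<omega>) * indicator B \<omega> = ennreal (W t \<omega> - W s \<omega>) * indicator B \<omega>"
        using W_eq by eventually_elim simp
    qed
    then show "(\<integral>\<^sup>+\<omega>. ennreal (A t \<omega> - A s \<omega>) * indicator B \<omega> \<partial>M) =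
        emeasure M {\<omega> \<in> space M. \<omega> \<in> B \<and> ennreal s < g \<omega> \<and> g \<omega> \<le> ennreal t}"
      using W_incr[OF s B] by simp
  qed
qed

end

section \<open>Regularization of martingales\<close>

text \<open>The anchor of a sequence moves to the current value whenever it is further away than \<open>e\<close>.
  For a martingale, \<open>e\<^sup>2\<close> times the number of moves plus the squared distance to the anchor
  is dominated in expectation by the second moment, which replaces the upcrossing inequality.\<close>

fun anchor :: "real \<Rightarrow> (nat \<Rightarrow> real) \<Rightarrow> nat \<Rightarrow> real" where
  "anchor e f 0 = f 0"
| "anchor e f (Suc i) = (if e < \<bar>f (Suc i) - anchor e f i\<bar> then f (Suc i) else anchor e f i)"

fun anchor_moves :: "real \<Rightarrow> (nat \<Rightarrow> real) \<Rightarrow> nat \<Rightarrow> nat" where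
  "anchor_moves e f 0 = 0"
| "anchor_moves e f (Suc i) = anchor_moves e f i + (if e < \<bar>f (Suc i) - anchor e f i\<bar> then 1 else 0)"

lemma anchor_close: "0 \<le> e \<Longrightarrow> \<bar>f i - anchor e f i\<bar> \<le> e"
  by (cases i) auto

lemma anchor_moves_mono: "i \<le> j \<Longrightarrow> anchor_moves e f i \<le> anchor_moves e f j"
  by (induction j rule: dec_induct) auto

lemma anchor_const: "i \<le> j \<Longrightarrow> anchor_moves e f j = anchor_moves e f i \<Longrightarrow> anchor e f j = anchor e f i"
proof (induction j rule: dec_induct)
  case (step j)
  have "anchor_moves e f i \<le> anchor_moves e f j" using step.hyps by (intro anchor_moves_mono) simp
  then show ?case using step by (auto split: if_splits)
qed simp

text \<open>If the anchor did not move between \<open>i\<close> and \<open>j\<close>, both values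
  would lie within \<open>e\<close> of the same anchor.\<close>

lemma anchor_moves_oscillation:
  assumes "0 \<le> e" "i \<le> j" "2 * e < \<bar>f j - f i\<bar>"
  shows "Suc (anchor_moves e f i) \<le> anchor_moves e f j"
proof (rule ccontr)
  assume "\<not> ?thesis"
  with anchor_moves_mono[OF assms(2), of e f] have "anchor_moves e f j = anchor_moves e f i" by simp
  then have "anchor e f j = anchor e f i" by (rule anchor_const[OF assms(2)])
  then show False using anchor_close[OF assms(1), of f i] anchor_close[OF assms(1), of f j] assms(3) by simp
qed

text \<open>Being one of the past values, the anchor inherits their bounds.\<close>

lemma anchor_between: "anchor e f i \<in> f ` {..i}"
  by (induction i) (auto simp: atMost_Suc)

text \<open>A move costs \<open>e\<^sup>2\<close> but resets to \<open>0\<close> a squared distance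
  that was larger than \<open>e\<^sup>2\<close>.\<close>

lemma anchor_energy_step:
  "e\<^sup>2 * anchor_moves e f (Suc i) + (f (Suc i) - anchor e f (Suc i))\<^sup>2 \<le>
   e\<^sup>2 * anchor_moves e f i + (f (Suc i) - anchor e f i)\<^sup>2" if "0 \<le> e"
proof (cases "e < \<bar>f (Suc i) - anchor e f i\<bar>")
  case True
  then have "e\<^sup>2 \<le> (f (Suc i) - anchor e f i)\<^sup>2" using that by (simp add: abs_le_square_iff[symmetric])
  then show ?thesis using True by (simp add: algebra_simps)
qed simp

lemma dyadicsI: "real i / 2 ^ n \<in> dyadics" unfolding dyadics_def by blast

lemma dyadics_nonneg: "q \<in> dyadics \<Longrightarrow> 0 \<le> (q :: real)" by (auto simp: dyadics_def)

lemma countable_dyadics: "countable (dyadics :: real set)"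
  unfolding dyadics_def by (intro countable_UN) auto

lemma dyadics_refine: "(q :: real) \<in> dyadics \<Longrightarrow> \<exists>n0. \<forall>n\<ge>n0. \<exists>i::nat. q = real i / 2 ^ n"
proof -
  assume "q \<in> dyadics"
  then obtain i n0 where q: "q = real i / 2 ^ n0" by (auto simp: dyadics_def)
  have "q = real (i * 2 ^ (n - n0)) / 2 ^ n" if "n0 \<le> n" for n
    using that by (simp add: q field_simps power_add[symmetric])
  then show ?thesis by blast
qed

text \<open>\<open>Q\<close> is a family of intervals shrinking to one side of a point; the two cases of \<open>sub\<close>
  serve right and left limits.\<close>

lemma anchor_moves_unbounded:
  fixes f :: "real \<Rightarrow> real"
  assumes e: "0 \<le> e"
    and osc: "\<And>u v. Q u v \<Longrightarrow> \<exists>p\<in>dyadics. \<exists>q\<in>dyadics. u < p \<and> p < q \<and> q < v \<and> 2 * e < \<bar>f q - f p\<bar> \<and> (Q u p \<or> Q q v)"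
  shows "Q u v \<Longrightarrow> \<exists>n0. \<forall>n\<ge>n0. \<exists>i j. i \<le> j \<and> u < real i / 2 ^ n \<and> real j / 2 ^ n < v \<and>
    anchor_moves e (\<lambda>i. f (real i / 2 ^ n)) i + k \<le> anchor_moves e (\<lambda>i. f (real i / 2 ^ n)) j"
proof (induction k arbitrary: u v)
  case 0
  obtain p q where p: "p \<in> dyadics" "u < p" "p < q" "q < v" using osc[OF 0] by blast
  obtain n0 where n0: "\<And>n. n0 \<le> n \<Longrightarrow> \<exists>i::nat. p = real i / 2 ^ n" using dyadics_refine[OF p(1)] by blast
  have "\<exists>i j. i \<le> j \<and> u < real i / 2 ^ n \<and> real j / 2 ^ n < v \<and>
    anchor_moves e (\<lambda>i. f (real i / 2 ^ n)) i + 0 \<le> anchor_moves e (\<lambda>i. f (real i / 2 ^ n)) j" if n: "n0 \<le> n" for n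
  proof -
    obtain i :: nat where "p = real i / 2 ^ n" using n0[OF n] by blast
    then show ?thesis using p by (intro exI[of _ i]) simp
  qed
  then show ?case by blast
next
  case (Suc k)
  obtain p q where p: "p \<in> dyadics" "q \<in> dyadics" and pq: "u < p" "p < q" "q < v" "2 * e < \<bar>f q - f p\<bar>"
    and Q: "Q u p \<or> Q q v" using osc[OF Suc.prems] by blast
  obtain n1 where n1: "\<And>n. n1 \<le> n \<Longrightarrow> \<exists>i::nat. p = real i / 2 ^ n" using dyadics_refine[OF p(1)] by blast
  obtain n2 where n2: "\<And>n. n2 \<le> n \<Longrightarrow> \<exists>i::nat. q = real i / 2 ^ n" using dyadics_refine[OF p(2)] by blast
  define c where "c n = anchor_moves e (\<lambda>i. f (real i / 2 ^ n))" for n :: nat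
  have c_mono: "c n i \<le> c n j" if "i \<le> j" for i j n using anchor_moves_mono[OF that] by (simp add: c_def)
  have le: "i \<le> j" if "real i / 2 ^ n < real j / 2 ^ n" for i j n :: nat
    using that by (simp add: divide_less_cancel)
  have jump: "Suc (c n a) \<le> c n b" if "p = real a / 2 ^ n" "q = real b / 2 ^ n" for n a b
    unfolding c_def using that pq le[of a n b] by (intro anchor_moves_oscillation[OF e]) auto
  \<comment> \<open>The oscillation between \<open>p\<close> and \<open>q\<close> forces one move.
    The interval of the family that remains on one side of it supplies \<open>k\<close> more by
    induction, and monotonicity of the count adds them up on any grid fine enough to contain all the
    points.\<close>
  show ?case
    using Q
  proof
    assume "Q u p"
    from Suc.IH[OF this] obtain n0 where n0: "\<And>n. n0 \<le> n \<Longrightarrow>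
      \<exists>i j. i \<le> j \<and> u < real i / 2 ^ n \<and> real j / 2 ^ n < p \<and> c n i + k \<le> c n j"
      unfolding c_def by blast
    have "\<exists>i j. i \<le> j \<and> u < real i / 2 ^ n \<and> real j / 2 ^ n < v \<and> c n i + Suc k \<le> c n j"
      if n: "max n0 (max n1 n2) \<le> n" for n
    proof -
      obtain i j where ij: "i \<le> j" "u < real i / 2 ^ n" "real j / 2 ^ n < p" "c n i + k \<le> c n j"
        using n0[of n] n by auto
      obtain a :: nat where a: "p = real a / 2 ^ n" using n1[of n] n by auto
      obtain b :: nat where b: "q = real b / 2 ^ n" using n2[of n] n by auto
      have "j \<le> a" "a \<le> b" using ij(3) pq(2) le[of j n a] le[of a n b] by (auto simp: a b)
      then have "c n i + Suc k \<le> c n b" "i \<le> b" using jump[OF a b] c_mono[of j a n] ij by auto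
      then show ?thesis using ij(2) pq(3) b by blast
    qed
    then show ?thesis unfolding c_def by blast
  next
    assume "Q q v"
    from Suc.IH[OF this] obtain n0 where n0: "\<And>n. n0 \<le> n \<Longrightarrow>
      \<exists>i j. i \<le> j \<and> q < real i / 2 ^ n \<and> real j / 2 ^ n < v \<and> c n i + k \<le> c n j"
      unfolding c_def by blast
    have "\<exists>i j. i \<le> j \<and> u < real i / 2 ^ n \<and> real j / 2 ^ n < v \<and> c n i + Suc k \<le> c n j"
      if n: "max n0 (max n1 n2) \<le> n" for n
    proof -
      obtain i j where ij: "i \<le> j" "q < real i / 2 ^ n" "real j / 2 ^ n < v" "c n i + k \<le> c n j"
        using n0[of n] n by auto
      obtain a :: nat where a: "p = real a / 2 ^ n" using n1[of n] n by auto
      obtain b :: nat where b: "q = real b / 2 ^ n" using n2[of n] n by auto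
      have "b \<le> i" "a \<le> b" using ij(2) pq(2) le[of b n i] le[of a n b] by (auto simp: a b)
      then have "c n a + Suc k \<le> c n j" "a \<le> j" using jump[OF a b] c_mono[of b i n] ij by auto
      then show ?thesis using ij(3) pq(1) a by blast
    qed
    then show ?thesis unfolding c_def by blast
  qed
qed

text \<open>Strictly above \<open>r\<close> even if \<open>r\<close> is a grid point (for
  \<open>r \<ge> 0\<close>), so that limits along these points are genuine right limits.\<close>

definition dyadic_above :: "nat \<Rightarrow> real \<Rightarrow> real" where
  "dyadic_above n r = real (nat \<lfloor>r * 2 ^ n\<rfloor> + 1) / 2 ^ n"

text \<open>The last grid point strictly before \<open>r\<close> if \<open>r > 0\<close>; for
  \<open>r \<le> 0\<close> the conversion \<open>nat\<close> yields the default
  \<open>0\<close>.\<close>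

definition dyadic_below :: "nat \<Rightarrow> real \<Rightarrow> real" where
  "dyadic_below n r = real (nat (\<lceil>r * 2 ^ n\<rceil> - 1)) / 2 ^ n"

lemma dyadic_above: "0 \<le> r \<Longrightarrow> r < dyadic_above n r" "0 \<le> r \<Longrightarrow> dyadic_above n r \<le> r + (1/2) ^ n"
  "dyadic_above n r \<in> dyadics"
proof -
  show "dyadic_above n r \<in> dyadics" unfolding dyadic_above_def by (rule dyadicsI)
  assume r: "0 \<le> r"
  then have eq: "real (nat \<lfloor>r * 2 ^ n\<rfloor> + 1) = real_of_int \<lfloor>r * 2 ^ n\<rfloor> + 1" by simp
  have "real_of_int \<lfloor>r * 2 ^ n\<rfloor> \<le> r * 2 ^ n" "r * 2 ^ n < real_of_int \<lfloor>r * 2 ^ n\<rfloor> + 1" by linarith+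
  then show "r < dyadic_above n r" "dyadic_above n r \<le> r + (1/2) ^ n"
    unfolding dyadic_above_def eq by (simp_all add: field_simps)
qed

lemma dyadic_below: "0 < r \<Longrightarrow> dyadic_below n r < r" "0 < r \<Longrightarrow> r - (1/2) ^ n \<le> dyadic_below n r"
  "dyadic_below n r \<in> dyadics"
proof -
  show "dyadic_below n r \<in> dyadics" unfolding dyadic_below_def by (rule dyadicsI)
  assume r: "0 < r"
  then have "0 < \<lceil>r * 2 ^ n\<rceil>" by (simp add: less_ceiling_iff)
  then have eq: "real (nat (\<lceil>r * 2 ^ n\<rceil> - 1)) = real_of_int \<lceil>r * 2 ^ n\<rceil> - 1" by simp
  have "real_of_int \<lceil>r * 2 ^ n\<rceil> - 1 < r * 2 ^ n" "r * 2 ^ n \<le> real_of_int \<lceil>r * 2 ^ n\<rceil>" by linarith+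
  then show "dyadic_below n r < r" "r - (1/2) ^ n \<le> dyadic_below n r"
    unfolding dyadic_below_def eq by (simp_all add: field_simps)
qed

lemma dyadic_above_tendsto: "0 \<le> r \<Longrightarrow> (\<lambda>n. dyadic_above n r) \<longlonglongrightarrow> r"
proof (rule tendsto_sandwich)
  show "(\<lambda>_. r) \<longlonglongrightarrow> r" by simp
  show "(\<lambda>n. r + (1/2) ^ n) \<longlonglongrightarrow> r" by (rule tendsto_eq_intros LIMSEQ_power_zero | simp)+
qed (use dyadic_above in \<open>auto intro: always_eventually less_imp_le\<close>)

lemma dyadic_below_tendsto: "0 < r \<Longrightarrow> (\<lambda>n. dyadic_below n r) \<longlonglongrightarrow> r"
proof (rule tendsto_sandwich)
  show "(\<lambda>n. r - (1/2) ^ n) \<longlonglongrightarrow> r" by (rule tendsto_eq_intros LIMSEQ_power_zero | simp)+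
  show "(\<lambda>_. r) \<longlonglongrightarrow> r" by simp
qed (use dyadic_below in \<open>auto intro: always_eventually less_imp_le\<close>)

text \<open>The bound is asked for infinitely many grids only, which is what a finite limes inferior
  provides. The index \<open>n * 2 ^ n\<close> is time \<open>n\<close> on the \<open>n\<close>-th
  grid, so the horizon grows along with the resolution.\<close>

definition dyadic_regular :: "(real \<Rightarrow> real) \<Rightarrow> bool" where
  "dyadic_regular f \<longleftrightarrow> (\<forall>k::nat. \<exists>K. \<exists>\<^sub>F n in sequentially.
     anchor_moves (1 / real (Suc k)) (\<lambda>i. f (real i / 2 ^ n)) (n * 2 ^ n) \<le> K)"

text \<open>Oscillations that persist in a shrinking family force more than \<open>K\<close> moves
  on every sufficiently fine grid, and they take place before the horizon as soon as
  \<open>n\<close> exceeds the right end \<open>v\<close>.\<close>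

lemma dyadic_regular_no_oscillation:
  assumes f: "dyadic_regular f" and Q: "Q u v"
    and osc: "\<And>u v. Q u v \<Longrightarrow> \<exists>p\<in>dyadics. \<exists>q\<in>dyadics. u < p \<and> p < q \<and> q < v \<and>
      2 * (1 / real (Suc k)) < \<bar>f q - f p\<bar> \<and> (Q u p \<or> Q q v)"
  shows False
proof -
  obtain K where K: "\<exists>\<^sub>F n in sequentially.
      anchor_moves (1 / real (Suc k)) (\<lambda>i. f (real i / 2 ^ n)) (n * 2 ^ n) \<le> K"
    using f unfolding dyadic_regular_def by blast
  obtain n0 where n0: "\<And>n. n0 \<le> n \<Longrightarrow> \<exists>i j. i \<le> j \<and> u < real i / 2 ^ n \<and> real j / 2 ^ n < v \<and>
      anchor_moves (1 / real (Suc k)) (\<lambda>i. f (real i / 2 ^ n)) i + Suc K \<le>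
      anchor_moves (1 / real (Suc k)) (\<lambda>i. f (real i / 2 ^ n)) j"
    using anchor_moves_unbounded[of "1 / real (Suc k)" Q f u v "Suc K", OF _ osc Q] by auto
  obtain m :: nat where m: "v \<le> real m" using real_arch_simple by blast
  obtain n where n: "max n0 m \<le> n"
      "anchor_moves (1 / real (Suc k)) (\<lambda>i. f (real i / 2 ^ n)) (n * 2 ^ n) \<le> K"
    using K unfolding frequently_sequentially by blast
  obtain i j where ij: "real j / 2 ^ n < v"
      "anchor_moves (1 / real (Suc k)) (\<lambda>i. f (real i / 2 ^ n)) i + Suc K \<le>
      anchor_moves (1 / real (Suc k)) (\<lambda>i. f (real i / 2 ^ n)) j"
    using n0[of n] n(1) by auto
  have "real j / 2 ^ n \<le> real n" using ij(1) m n(1) by linarith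
  then have "real j \<le> real (n * 2 ^ n)" by (simp add: field_simps)
  then have "j \<le> n * 2 ^ n" by (simp only: of_nat_le_iff)
  from anchor_moves_mono[OF this, of "1 / real (Suc k)" "\<lambda>i. f (real i / 2 ^ n)"] show False
    using ij(2) n(2) by simp
qed

text \<open>If the Cauchy criterion failed to the right of \<open>r\<close>, every interval with
  left end \<open>r\<close> would contain an oscillation above \<open>e\<close>, and the part of it
  before that oscillation again has left end \<open>r\<close>. Choosing
  \<open>1 / Suc k < e / 2\<close> matches the factor \<open>2\<close> lost by the anchor.\<close>

lemma dyadic_regular_right_limit:
  assumes f: "dyadic_regular f" and r: "0 \<le> r"
  obtains l where "(\<lambda>n. f (dyadic_above n r)) \<longlonglongrightarrow> l"
    "\<And>e. 0 < e \<Longrightarrow> \<exists>s>r. \<forall>p\<in>dyadics. r < p \<longrightarrow> p < s \<longrightarrow> \<bar>f p - l\<bar> \<le> e"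
proof -
  have close: "\<exists>s>r. \<forall>p\<in>dyadics. \<forall>q\<in>dyadics. r < p \<longrightarrow> p < q \<longrightarrow> q < s \<longrightarrow> \<bar>f q - f p\<bar> \<le> e" if e: "0 < e" for e
  proof (rule ccontr)
    assume not: "\<not> ?thesis"
    obtain k where k: "1 / real (Suc k) < e / 2" using nat_approx_posE[of "e / 2"] e by auto
    define Q where "Q u v \<longleftrightarrow> u = r \<and> r < v" for u v
    show False
    proof (rule dyadic_regular_no_oscillation[OF f, of Q r "r + 1" k])
      show "Q r (r + 1)" by (simp add: Q_def)
      fix u v assume uv: "Q u v"
      then have "u = r" "r < v" by (simp_all add: Q_def)
      then obtain p q where "p \<in> dyadics" "q \<in> dyadics" "r < p" "p < q" "q < v" "\<not> \<bar>f q - f p\<bar> \<le> e"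
        using not by blast
      then show "\<exists>p\<in>dyadics. \<exists>q\<in>dyadics. u < p \<and> p < q \<and> q < v \<and>
          2 * (1 / real (Suc k)) < \<bar>f q - f p\<bar> \<and> (Q u p \<or> Q q v)"
        using \<open>u = r\<close> k by (intro bexI[of _ p] bexI[of _ q]) (simp_all add: Q_def)
    qed
  qed
  have close': "\<exists>s>r. \<forall>p\<in>dyadics. \<forall>q\<in>dyadics. r < p \<longrightarrow> r < q \<longrightarrow> p < s \<longrightarrow> q < s \<longrightarrow> \<bar>f q - f p\<bar> \<le> e"
    if e: "0 < e" for e
  proof -
    obtain s where s: "r < s" "\<And>p q. p \<in> dyadics \<Longrightarrow> q \<in> dyadics \<Longrightarrow> r < p \<Longrightarrow> p < q \<Longrightarrow> q < s \<Longrightarrow> \<bar>f q - f p\<bar> \<le> e"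
      using close[OF e] by blast
    have "\<bar>f q - f p\<bar> \<le> e" if "p \<in> dyadics" "q \<in> dyadics" "r < p" "r < q" "p < s" "q < s" for p q
      using s(2)[of p q] s(2)[of q p] that e by (cases p q rule: linorder_cases) (auto simp: abs_minus_commute)
    then show ?thesis using s(1) by blast
  qed
  have ev: "eventually (\<lambda>n. dyadic_above n r < s) sequentially" if "r < s" for s
    using order_tendstoD(2)[OF dyadic_above_tendsto[OF r] that] .
  have "Cauchy (\<lambda>n. f (dyadic_above n r))"
  proof (rule metric_CauchyI)
    fix e :: real assume e: "0 < e"
    obtain s where s: "r < s" "\<And>p q. p \<in> dyadics \<Longrightarrow> q \<in> dyadics \<Longrightarrow> r < p \<Longrightarrow> r < q \<Longrightarrow> p < s \<Longrightarrow> q < s \<Longrightarrow> \<bar>f q - f p\<bar> \<le> e / 2"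
      using close'[of "e / 2"] e by auto
    obtain N where N: "\<And>n. N \<le> n \<Longrightarrow> dyadic_above n r < s" using ev[OF s(1)] unfolding eventually_sequentially by blast
    have "dist (f (dyadic_above m r)) (f (dyadic_above n r)) < e" if "N \<le> m" "N \<le> n" for m n
      using s(2)[of "dyadic_above n r" "dyadic_above m r"] dyadic_above(1)[OF r, of m] dyadic_above(1)[OF r, of n] dyadic_above(3) N that e by (simp add: dist_real_def)
    then show "\<exists>N. \<forall>m\<ge>N. \<forall>n\<ge>N. dist (f (dyadic_above m r)) (f (dyadic_above n r)) < e" by blast
  qed
  then obtain l where l: "(\<lambda>n. f (dyadic_above n r)) \<longlonglongrightarrow> l" by (auto simp: Cauchy_convergent_iff convergent_def)
  show ?thesis
  proof (rule that[OF l])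
    fix e :: real assume e: "0 < e"
    obtain s where s: "r < s" "\<And>p q. p \<in> dyadics \<Longrightarrow> q \<in> dyadics \<Longrightarrow> r < p \<Longrightarrow> r < q \<Longrightarrow> p < s \<Longrightarrow> q < s \<Longrightarrow> \<bar>f q - f p\<bar> \<le> e"
      using close'[OF e] by blast
    have "\<bar>f p - l\<bar> \<le> e" if p: "p \<in> dyadics" "r < p" "p < s" for p
    proof (rule tendsto_upperbound)
      show "(\<lambda>n. \<bar>f p - f (dyadic_above n r)\<bar>) \<longlonglongrightarrow> \<bar>f p - l\<bar>" by (intro tendsto_intros l)
      show "eventually (\<lambda>n. \<bar>f p - f (dyadic_above n r)\<bar> \<le> e) sequentially"
        using ev[OF s(1)] by eventually_elim (use s(2) p dyadic_above r in auto)
    qed simp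
    then show "\<exists>s>r. \<forall>p\<in>dyadics. r < p \<longrightarrow> p < s \<longrightarrow> \<bar>f p - l\<bar> \<le> e" using s(1) by blast
  qed
qed

text \<open>The mirror image: here the intervals share their right end \<open>r\<close>, and the
  part after an oscillation belongs to the family again.\<close>

lemma dyadic_regular_left_limit:
  assumes f: "dyadic_regular f" and r: "0 < r"
  obtains l where "\<And>e. 0 < e \<Longrightarrow> \<exists>s<r. \<forall>p\<in>dyadics. s < p \<longrightarrow> p < r \<longrightarrow> \<bar>f p - l\<bar> \<le> e"
proof -
  have close: "\<exists>s<r. \<forall>p\<in>dyadics. \<forall>q\<in>dyadics. s < p \<longrightarrow> p < q \<longrightarrow> q < r \<longrightarrow> \<bar>f q - f p\<bar> \<le> e" if e: "0 < e" for e
  proof (rule ccontr)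
    assume not: "\<not> ?thesis"
    obtain k where k: "1 / real (Suc k) < e / 2" using nat_approx_posE[of "e / 2"] e by auto
    define Q where "Q u v \<longleftrightarrow> v = r \<and> u < r" for u v
    show False
    proof (rule dyadic_regular_no_oscillation[OF f, of Q "r - 1" r k])
      show "Q (r - 1) r" by (simp add: Q_def)
      fix u v assume uv: "Q u v"
      then have "v = r" "u < r" by (simp_all add: Q_def)
      then obtain p q where "p \<in> dyadics" "q \<in> dyadics" "u < p" "p < q" "q < r" "\<not> \<bar>f q - f p\<bar> \<le> e"
        using not by blast
      then show "\<exists>p\<in>dyadics. \<exists>q\<in>dyadics. u < p \<and> p < q \<and> q < v \<and>
          2 * (1 / real (Suc k)) < \<bar>f q - f p\<bar> \<and> (Q u p \<or> Q q v)"
        using \<open>v = r\<close> k by (intro bexI[of _ p] bexI[of _ q]) (simp_all add: Q_def)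
    qed
  qed
  have close': "\<exists>s<r. \<forall>p\<in>dyadics. \<forall>q\<in>dyadics. s < p \<longrightarrow> s < q \<longrightarrow> p < r \<longrightarrow> q < r \<longrightarrow> \<bar>f q - f p\<bar> \<le> e"
    if e: "0 < e" for e
  proof -
    obtain s where s: "s < r" "\<And>p q. p \<in> dyadics \<Longrightarrow> q \<in> dyadics \<Longrightarrow> s < p \<Longrightarrow> p < q \<Longrightarrow> q < r \<Longrightarrow> \<bar>f q - f p\<bar> \<le> e"
      using close[OF e] by blast
    have "\<bar>f q - f p\<bar> \<le> e" if "p \<in> dyadics" "q \<in> dyadics" "s < p" "s < q" "p < r" "q < r" for p q
      using s(2)[of p q] s(2)[of q p] that e by (cases p q rule: linorder_cases) (auto simp: abs_minus_commute)
    then show ?thesis using s(1) by blast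
  qed
  have ev: "eventually (\<lambda>n. s < dyadic_below n r) sequentially" if "s < r" for s
    using order_tendstoD(1)[OF dyadic_below_tendsto[OF r] that] .
  have "Cauchy (\<lambda>n. f (dyadic_below n r))"
  proof (rule metric_CauchyI)
    fix e :: real assume e: "0 < e"
    obtain s where s: "s < r" "\<And>p q. p \<in> dyadics \<Longrightarrow> q \<in> dyadics \<Longrightarrow> s < p \<Longrightarrow> s < q \<Longrightarrow> p < r \<Longrightarrow> q < r \<Longrightarrow> \<bar>f q - f p\<bar> \<le> e / 2"
      using close'[of "e / 2"] e by auto
    obtain N where N: "\<And>n. N \<le> n \<Longrightarrow> s < dyadic_below n r" using ev[OF s(1)] unfolding eventually_sequentially by blast
    have "dist (f (dyadic_below m r)) (f (dyadic_below n r)) < e" if "N \<le> m" "N \<le> n" for m n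
      using s(2)[of "dyadic_below n r" "dyadic_below m r"] dyadic_below(1)[OF r, of m] dyadic_below(1)[OF r, of n] dyadic_below(3) N that e by (simp add: dist_real_def)
    then show "\<exists>N. \<forall>m\<ge>N. \<forall>n\<ge>N. dist (f (dyadic_below m r)) (f (dyadic_below n r)) < e" by blast
  qed
  then obtain l where l: "(\<lambda>n. f (dyadic_below n r)) \<longlonglongrightarrow> l" by (auto simp: Cauchy_convergent_iff convergent_def)
  show ?thesis
  proof (rule that)
    fix e :: real assume e: "0 < e"
    obtain s where s: "s < r" "\<And>p q. p \<in> dyadics \<Longrightarrow> q \<in> dyadics \<Longrightarrow> s < p \<Longrightarrow> s < q \<Longrightarrow> p < r \<Longrightarrow> q < r \<Longrightarrow> \<bar>f q - f p\<bar> \<le> e"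
      using close'[OF e] by blast
    have "\<bar>f p - l\<bar> \<le> e" if p: "p \<in> dyadics" "s < p" "p < r" for p
    proof (rule tendsto_upperbound)
      show "(\<lambda>n. \<bar>f p - f (dyadic_below n r)\<bar>) \<longlonglongrightarrow> \<bar>f p - l\<bar>" by (intro tendsto_intros l)
      show "eventually (\<lambda>n. \<bar>f p - f (dyadic_below n r)\<bar> \<le> e) sequentially"
        using ev[OF s(1)] by eventually_elim (use s(2) p dyadic_below r in auto)
    qed simp
    then show "\<exists>s<r. \<forall>p\<in>dyadics. s < p \<longrightarrow> p < r \<longrightarrow> \<bar>f p - l\<bar> \<le> e" using s(1) by blast
  qed
qed

lemma dyadic_regular_cadlag:
  assumes f: "dyadic_regular f"
    and y: "\<And>r. 0 \<le> r \<Longrightarrow> (\<lambda>n. f (dyadic_above n r)) \<longlonglongrightarrow> y r"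
  shows "cadlag_path y"
proof -
  \<comment> \<open>A bound for \<open>f\<close> at the dyadic points of an interval passes to
    \<open>y\<close> on it. The left end may be included but not the right one, because
    \<open>y r\<close> only depends on values of \<open>f\<close> after \<open>r\<close>.\<close>
  have below: "\<bar>y r - c\<bar> \<le> e" if "0 \<le> r" "a \<le> r" "r < b" "\<And>p. p \<in> dyadics \<Longrightarrow> a < p \<Longrightarrow> p < b \<Longrightarrow> \<bar>f p - c\<bar> \<le> e"
    for r a b c e
  proof (rule tendsto_upperbound)
    show "(\<lambda>n. \<bar>f (dyadic_above n r) - c\<bar>) \<longlonglongrightarrow> \<bar>y r - c\<bar>" by (intro tendsto_intros y that(1))
    show "eventually (\<lambda>n. \<bar>f (dyadic_above n r) - c\<bar> \<le> e) sequentially"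
      using order_tendstoD(2)[OF dyadic_above_tendsto[OF that(1)] that(3)]
    proof eventually_elim
      case (elim n)
      show ?case using dyadic_above(1)[OF that(1), of n] that(2) elim
        by (intro that(4) dyadic_above(3)) auto
    qed
  qed simp
  show ?thesis
    unfolding cadlag_path_def
  proof (intro conjI allI impI)
    fix t :: real assume t: "0 \<le> t"
    show "continuous (at_right t) y"
      unfolding continuous_within
    proof (rule tendstoI)
      fix e :: real assume e: "0 < e"
      obtain l where l: "(\<lambda>n. f (dyadic_above n t)) \<longlonglongrightarrow> l"
        "\<And>e. 0 < e \<Longrightarrow> \<exists>s>t. \<forall>p\<in>dyadics. t < p \<longrightarrow> p < s \<longrightarrow> \<bar>f p - l\<bar> \<le> e"
        using dyadic_regular_right_limit[OF f t] by blast
      have "l = y t" using LIMSEQ_unique[OF l(1) y[OF t]] .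
      with l(2)[of "e / 2"] e obtain s where s: "t < s" "\<And>p. p \<in> dyadics \<Longrightarrow> t < p \<Longrightarrow> p < s \<Longrightarrow> \<bar>f p - y t\<bar> \<le> e / 2"
        by auto
      have "dist (y r) (y t) < e" if "t < r" "r < s" for r
        using below[of r t s "y t" "e / 2"] s(2) that t e by (simp add: dist_real_def)
      then show "eventually (\<lambda>x. dist (y x) (y t) < e) (at_right t)"
        using s(1) by (auto simp: eventually_at_right_field)
    qed
  next
    fix t :: real assume t: "0 < t"
    obtain l where l: "\<And>e. 0 < e \<Longrightarrow> \<exists>s<t. \<forall>p\<in>dyadics. s < p \<longrightarrow> p < t \<longrightarrow> \<bar>f p - l\<bar> \<le> e"
      using dyadic_regular_left_limit[OF f t] by blast
    have "(y \<longlongrightarrow> l) (at_left t)"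
    proof (rule tendstoI)
      fix e :: real assume e: "0 < e"
      obtain s where s: "s < t" "\<And>p. p \<in> dyadics \<Longrightarrow> s < p \<Longrightarrow> p < t \<Longrightarrow> \<bar>f p - l\<bar> \<le> e / 2"
        using l[of "e / 2"] e by auto
      have "dist (y r) l < e" if "max s 0 < r" "r < t" for r
        using below[of r s t l "e / 2"] s(2) that e by (simp add: dist_real_def)
      then show "eventually (\<lambda>x. dist (y x) l < e) (at_left t)"
        using s(1) t by (auto simp: eventually_at_left_field intro!: exI[of _ "max s 0"])
    qed
    then show "\<exists>l. (y \<longlongrightarrow> l) (at_left t)" by blast
  qed
qed

section \<open>Cadlag versions of martingales closed by a variable with values in the unit
  interval\<close>

context usual_filtered_prob_space
begin

lemma sigma_finite_subalgebra_F: "0 \<le> t \<Longrightarrow> sigma_finite_subalgebra M (F t)"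
  by (intro finite_measure_subalgebra_is_sigma_finite finite_measure_subalgebra.intro
      finite_measure_subalgebra_axioms.intro finite_measure_axioms subalgebra_F)

lemma integrable_bounded:
  fixes f :: "'a \<Rightarrow> real"
  assumes "f \<in> borel_measurable M" "\<And>\<omega>. \<bar>f \<omega>\<bar> \<le> K"
  shows "integrable M f"
  using assms by (intro integrable_const_bound[of _ K]) auto

lemma
  fixes \<tau> :: "'a \<Rightarrow> ennreal"
  assumes [measurable]: "\<tau> \<in> borel_measurable M"
  shows indicator_le_time_measurable:
      "(indicator {\<omega>. \<tau> \<omega> \<le> ennreal t} :: 'a \<Rightarrow> 'b :: {zero_neq_one, topological_space}) \<in> borel_measurable M"
    and indicator_gt_time_measurable:
      "(indicator {\<omega>. ennreal t < \<tau> \<omega>} :: 'a \<Rightarrow> 'b) \<in> borel_measurable M"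
proof -
  have "(\<lambda>\<omega>. if \<tau> \<omega> \<le> ennreal t then 1 else 0 :: 'b) \<in> borel_measurable M" by measurable
  then show "(indicator {\<omega>. \<tau> \<omega> \<le> ennreal t} :: 'a \<Rightarrow> 'b) \<in> borel_measurable M"
    by (simp add: indicator_def[abs_def] of_bool_def)
  have "(\<lambda>\<omega>. if ennreal t < \<tau> \<omega> then 1 else 0 :: 'b) \<in> borel_measurable M" by measurable
  then show "(indicator {\<omega>. ennreal t < \<tau> \<omega>} :: 'a \<Rightarrow> 'b) \<in> borel_measurable M"
    by (simp add: indicator_def[abs_def] of_bool_def)
qed

lemma integral_cond_exp_version:
  fixes a y \<xi> :: "'a \<Rightarrow> real"
  assumes t: "0 \<le> t" and y: "AE \<omega> in M. y \<omega> = real_cond_exp M (F t) \<xi> \<omega>" "y \<in> borel_measurable M"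
    and \<xi>: "\<xi> \<in> borel_measurable M" "\<And>\<omega>. \<bar>\<xi> \<omega>\<bar> \<le> L"
    and a: "a \<in> borel_measurable (F t)" "\<And>\<omega>. \<bar>a \<omega>\<bar> \<le> K"
  shows "(\<integral>\<omega>. a \<omega> * y \<omega> \<partial>M) = (\<integral>\<omega>. a \<omega> * \<xi> \<omega> \<partial>M)"
proof -
  interpret S: sigma_finite_subalgebra M "F t" by (rule sigma_finite_subalgebra_F[OF t])
  have aM[measurable]: "a \<in> borel_measurable M" by (rule measurable_F_M[OF a(1) t])
  note y(2)[measurable] \<xi>(1)[measurable]
  have "\<bar>a \<omega> * \<xi> \<omega>\<bar> \<le> K * L" for \<omega>
    unfolding abs_mult using a(2)[of \<omega>] \<xi>(2)[of \<omega>] by (intro mult_mono) auto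
  then have int: "integrable M (\<lambda>\<omega>. a \<omega> * \<xi> \<omega>)" by (intro integrable_bounded[of _ "K * L"]) auto
  have "(\<integral>\<omega>. a \<omega> * y \<omega> \<partial>M) = (\<integral>\<omega>. a \<omega> * real_cond_exp M (F t) \<xi> \<omega> \<partial>M)"
    using y(1) by (intro integral_cong_AE) auto
  also have "\<dots> = (\<integral>\<omega>. a \<omega> * \<xi> \<omega> \<partial>M)"
    by (rule S.real_cond_exp_intg(2)[OF int a(1) \<xi>(1)])
  finally show ?thesis .
qed

lemma cond_exp_versionI:
  fixes y \<xi> :: "'a \<Rightarrow> real"
  assumes t: "0 \<le> t" and y: "y \<in> borel_measurable (F t)" "\<And>\<omega>. \<bar>y \<omega>\<bar> \<le> K"
    and \<xi>: "\<xi> \<in> borel_measurable M" "\<And>\<omega>. \<bar>\<xi> \<omega>\<bar> \<le> L"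
    and eq: "\<And>B. B \<in> sets (F t) \<Longrightarrow> (\<integral>\<omega>. indicator B \<omega> * y \<omega> \<partial>M) = (\<integral>\<omega>. indicator B \<omega> * \<xi> \<omega> \<partial>M)"
  shows "AE \<omega> in M. real_cond_exp M (F t) \<xi> \<omega> = y \<omega>"
proof -
  interpret S: sigma_finite_subalgebra M "F t" by (rule sigma_finite_subalgebra_F[OF t])
  show ?thesis
  proof (rule S.real_cond_exp_charact)
    show "integrable M \<xi>" by (rule integrable_bounded[OF \<xi>])
    show "integrable M y" by (rule integrable_bounded[OF measurable_F_M[OF y(1) t] y(2)])
    show "y \<in> borel_measurable (F t)" by fact
    fix B assume "B \<in> sets (F t)"
    from eq[OF this] show "set_lebesgue_integral M B \<xi> = set_lebesgue_integral M B y"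
      by (simp add: set_lebesgue_integral_def)
  qed
qed

context
  fixes \<xi> :: "'a \<Rightarrow> real"
  assumes \<xi>: "\<xi> \<in> borel_measurable M" "\<And>\<omega>. 0 \<le> \<xi> \<omega> \<and> \<xi> \<omega> \<le> 1"
begin

text \<open>Clipping makes the bounds hold for every time and path at once, whereas the conditional
  expectations satisfy them only outside null sets that depend on \<open>t\<close>.\<close>

definition clipped_cond_exp :: "real \<Rightarrow> 'a \<Rightarrow> real" where
  "clipped_cond_exp t \<omega> = max 0 (min 1 (real_cond_exp M (F t) \<xi> \<omega>))"

lemma \<xi>_abs: "\<bar>\<xi> \<omega>\<bar> \<le> 1"
  using \<xi>(2)[of \<omega>] by simp

lemma clipped_bounds: "0 \<le> clipped_cond_exp t \<omega>" "clipped_cond_exp t \<omega> \<le> 1"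
  by (simp_all add: clipped_cond_exp_def)

lemma clipped_measurable: "clipped_cond_exp t \<in> borel_measurable (F t)"
  unfolding clipped_cond_exp_def by measurable

lemma clipped_measurable_M: "0 \<le> t \<Longrightarrow> clipped_cond_exp t \<in> borel_measurable M"
  by (rule measurable_F_M[OF clipped_measurable])

lemma clipped_AE:
  assumes t: "0 \<le> t"
  shows "AE \<omega> in M. clipped_cond_exp t \<omega> = real_cond_exp M (F t) \<xi> \<omega>"
proof -
  interpret S: sigma_finite_subalgebra M "F t" by (rule sigma_finite_subalgebra_F[OF t])
  have int: "integrable M \<xi>" by (rule integrable_bounded[OF \<xi>(1) \<xi>_abs])
  have "AE \<omega> in M. 0 \<le> real_cond_exp M (F t) \<xi> \<omega>"
    by (rule S.real_cond_exp_ge_c[OF int]) (use \<xi>(2) in auto)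
  moreover have "AE \<omega> in M. real_cond_exp M (F t) \<xi> \<omega> \<le> 1"
    by (rule S.real_cond_exp_le_c[OF int]) (use \<xi>(2) in auto)
  ultimately show ?thesis by eventually_elim (simp add: clipped_cond_exp_def)
qed

lemma integral_clipped:
  assumes "0 \<le> t" "a \<in> borel_measurable (F t)" "\<And>\<omega>. \<bar>a \<omega>\<bar> \<le> K"
  shows "(\<integral>\<omega>. a \<omega> * clipped_cond_exp t \<omega> \<partial>M) = (\<integral>\<omega>. a \<omega> * \<xi> \<omega> \<partial>M)"
  by (rule integral_cond_exp_version[OF assms(1) clipped_AE[OF assms(1)] clipped_measurable_M[OF assms(1)]
      \<xi>(1) \<xi>_abs assms(2,3)])

text \<open>The anchor at step \<open>i\<close> is known at time \<open>i\<close>, so by the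
  martingale property its product with the next value has the same mean as with the present one.
  Replacing the present value by the next one thus raises the mean squared distance exactly by the
  growth of the second moment. The sum telescopes and is bounded by \<open>1\<close> because all
  values lie in the unit interval.\<close>

lemma anchor_energy:
  assumes e: "0 < e"
  shows "integrable M (\<lambda>\<omega>. real (anchor_moves e (\<lambda>i. clipped_cond_exp (real i / 2 ^ n) \<omega>) j))"
    and "e\<^sup>2 * (\<integral>\<omega>. real (anchor_moves e (\<lambda>i. clipped_cond_exp (real i / 2 ^ n) \<omega>) j) \<partial>M) \<le> 1"
proof -
  define m where "m i \<omega> = clipped_cond_exp (real i / 2 ^ n) \<omega>" for i \<omega>
  define a where "a i \<omega> = anchor e (\<lambda>i. m i \<omega>) i" for i \<omega>
  define c where "c i \<omega> = anchor_moves e (\<lambda>i. m i \<omega>) i" for i \<omega>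
  have m_F: "m i \<in> borel_measurable (F (real i / 2 ^ n))" for i
    unfolding m_def[abs_def] by (rule clipped_measurable)
  have m_M[measurable]: "m i \<in> borel_measurable M" for i by (rule measurable_F_M[OF m_F]) simp
  have m_bd: "0 \<le> m i \<omega>" "m i \<omega> \<le> 1" for i \<omega> unfolding m_def by (rule clipped_bounds)+
  have a_bd: "0 \<le> a i \<omega>" "a i \<omega> \<le> 1" for i \<omega>
    using anchor_between[of e "\<lambda>i. m i \<omega>" i] m_bd unfolding a_def by auto
  have a_F: "a i \<in> borel_measurable (F (real i / 2 ^ n))" for i
  proof (induction i)
    case 0
    show ?case using m_F[of 0] by (simp add: a_def[abs_def])
  next
    case (Suc i)
    have [measurable]: "a i \<in> borel_measurable (F (real (Suc i) / 2 ^ n))"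
      by (rule measurable_F_mono[OF Suc.IH]) (simp_all add: divide_right_mono)
    have [measurable]: "m (Suc i) \<in> borel_measurable (F (real (Suc i) / 2 ^ n))" by (rule m_F)
    have eq: "a (Suc i) = (\<lambda>\<omega>. if e < \<bar>m (Suc i) \<omega> - a i \<omega>\<bar> then m (Suc i) \<omega> else a i \<omega>)"
      by (simp add: a_def fun_eq_iff)
    show ?case unfolding eq by measurable
  qed
  have a_M[measurable]: "a i \<in> borel_measurable M" for i by (rule measurable_F_M[OF a_F]) simp
  have c_M[measurable]: "(\<lambda>\<omega>. real (c i \<omega>)) \<in> borel_measurable M" for i
  proof (induction i)
    case (Suc i)
    have eq: "(\<lambda>\<omega>. real (c (Suc i) \<omega>)) = (\<lambda>\<omega>. real (c i \<omega>) + (if e < \<bar>m (Suc i) \<omega> - a i \<omega>\<bar> then 1 else 0))"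
      by (simp add: c_def a_def fun_eq_iff)
    note Suc.IH[measurable]
    show ?case unfolding eq by measurable
  qed (simp add: c_def)
  have c_bd: "c i \<omega> \<le> i" for i \<omega>
    by (induction i) (auto simp: c_def)
  have sq_bd: "\<bar>(x - y)\<^sup>2\<bar> \<le> (1::real)" if "0 \<le> x" "x \<le> 1" "0 \<le> y" "y \<le> 1" for x y
    using that abs_square_le_1[of "x - y"] by auto
  have sq1: "\<bar>x\<^sup>2\<bar> \<le> (1::real)" if "0 \<le> x" "x \<le> 1" for x using sq_bd[of x 0] that by simp
  have int_c: "integrable M (\<lambda>\<omega>. e\<^sup>2 * real (c i \<omega>))" for i
    using c_bd[of i] by (intro integrable_bounded[of _ "e\<^sup>2 * real i"]) (auto simp: abs_mult intro!: mult_left_mono)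
  have int_sq: "integrable M (\<lambda>\<omega>. (m i \<omega> - a j \<omega>)\<^sup>2)" for i j
    by (intro integrable_bounded[of _ 1] sq_bd m_bd a_bd) measurable
  have int_m: "integrable M (\<lambda>\<omega>. (m i \<omega>)\<^sup>2)" for i
    by (intro integrable_bounded[of _ 1] sq1 m_bd) measurable
  have int_am: "integrable M (\<lambda>\<omega>. a i \<omega> * m j \<omega>)" for i j
    using m_bd a_bd by (intro integrable_bounded[of _ 1]) (auto simp: abs_mult intro!: mult_le_one)
  have int_a: "integrable M (\<lambda>\<omega>. (a i \<omega>)\<^sup>2)" for i
    by (intro integrable_bounded[of _ 1] sq1 a_bd) measurable
  have expand: "(\<integral>\<omega>. (m i \<omega> - a j \<omega>)\<^sup>2 \<partial>M) =
      (\<integral>\<omega>. (m i \<omega>)\<^sup>2 \<partial>M) - 2 * (\<integral>\<omega>. a j \<omega> * m i \<omega> \<partial>M) + (\<integral>\<omega>. (a j \<omega>)\<^sup>2 \<partial>M)" for i j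
  proof -
    have "(\<integral>\<omega>. (m i \<omega> - a j \<omega>)\<^sup>2 \<partial>M) = (\<integral>\<omega>. (m i \<omega>)\<^sup>2 - 2 * (a j \<omega> * m i \<omega>) + (a j \<omega>)\<^sup>2 \<partial>M)"
      by (simp add: power2_diff algebra_simps)
    also have "\<dots> = (\<integral>\<omega>. (m i \<omega>)\<^sup>2 \<partial>M) - 2 * (\<integral>\<omega>. a j \<omega> * m i \<omega> \<partial>M) + (\<integral>\<omega>. (a j \<omega>)\<^sup>2 \<partial>M)"
      using int_m int_am int_a by simp
    finally show ?thesis .
  qed
  \<comment> \<open>Both sides of the martingale comparison are reduced to the closing variable, so
    the mean of \<open>a i * m j\<close> does not depend on \<open>j \<ge> i\<close>.\<close>
  have cross: "(\<integral>\<omega>. a i \<omega> * m j \<omega> \<partial>M) = (\<integral>\<omega>. a i \<omega> * \<xi> \<omega> \<partial>M)" if "i \<le> j" for i j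
    unfolding m_def
  proof (rule integral_clipped)
    show "a i \<in> borel_measurable (F (real j / 2 ^ n))"
      by (rule measurable_F_mono[OF a_F]) (use that in \<open>simp_all add: divide_right_mono\<close>)
    show "\<bar>a i \<omega>\<bar> \<le> 1" for \<omega> using a_bd[of i \<omega>] by simp
  qed simp
  have "(\<integral>\<omega>. e\<^sup>2 * c j \<omega> + (m j \<omega> - a j \<omega>)\<^sup>2 \<partial>M) \<le> (\<integral>\<omega>. (m j \<omega>)\<^sup>2 \<partial>M)"
  proof (induction j)
    case 0
    show ?case by (simp add: c_def a_def)
  next
    case (Suc j)
    have "(\<integral>\<omega>. e\<^sup>2 * c (Suc j) \<omega> + (m (Suc j) \<omega> - a (Suc j) \<omega>)\<^sup>2 \<partial>M) \<le>
        (\<integral>\<omega>. e\<^sup>2 * c j \<omega> + (m (Suc j) \<omega> - a j \<omega>)\<^sup>2 \<partial>M)"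
    proof (intro integral_mono Bochner_Integration.integrable_add int_c int_sq)
      show "e\<^sup>2 * c (Suc j) \<omega> + (m (Suc j) \<omega> - a (Suc j) \<omega>)\<^sup>2 \<le> e\<^sup>2 * c j \<omega> + (m (Suc j) \<omega> - a j \<omega>)\<^sup>2" for \<omega>
        using anchor_energy_step[of e "\<lambda>i. m i \<omega>" j, OF less_imp_le[OF e]] unfolding c_def a_def .
    qed
    also have "\<dots> = (\<integral>\<omega>. e\<^sup>2 * c j \<omega> + (m j \<omega> - a j \<omega>)\<^sup>2 \<partial>M) +
        ((\<integral>\<omega>. (m (Suc j) \<omega>)\<^sup>2 \<partial>M) - (\<integral>\<omega>. (m j \<omega>)\<^sup>2 \<partial>M))"
      using int_c int_sq expand[of "Suc j" j] expand[of j j] cross[of j j] cross[of j "Suc j"] by simp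
    also have "\<dots> \<le> (\<integral>\<omega>. (m (Suc j) \<omega>)\<^sup>2 \<partial>M)" using Suc.IH by simp
    finally show ?case .
  qed
  also have "(\<integral>\<omega>. (m j \<omega>)\<^sup>2 \<partial>M) \<le> (\<integral>\<omega>. 1 \<partial>M)"
    using abs_le_D1[OF sq1[OF m_bd]] int_m by (intro integral_mono) auto
  also have "(\<integral>\<omega>. e\<^sup>2 * c j \<omega> + (m j \<omega> - a j \<omega>)\<^sup>2 \<partial>M) =
      e\<^sup>2 * (\<integral>\<omega>. c j \<omega> \<partial>M) + (\<integral>\<omega>. (m j \<omega> - a j \<omega>)\<^sup>2 \<partial>M)"
    using int_c int_sq by simp
  finally have "e\<^sup>2 * (\<integral>\<omega>. c j \<omega> \<partial>M) + (\<integral>\<omega>. (m j \<omega> - a j \<omega>)\<^sup>2 \<partial>M) \<le> 1"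
    by (simp add: prob_space)
  moreover have "0 \<le> (\<integral>\<omega>. (m j \<omega> - a j \<omega>)\<^sup>2 \<partial>M)" by simp
  ultimately have "e\<^sup>2 * (\<integral>\<omega>. c j \<omega> \<partial>M) \<le> 1" by linarith
  then show "e\<^sup>2 * (\<integral>\<omega>. real (anchor_moves e (\<lambda>i. clipped_cond_exp (real i / 2 ^ n) \<omega>) j) \<partial>M) \<le> 1"
    by (simp only: c_def m_def)
  have "integrable M (\<lambda>\<omega>. real (c j \<omega>))"
    using c_bd[of j] by (intro integrable_bounded[of _ "real j"]) auto
  then show "integrable M (\<lambda>\<omega>. real (anchor_moves e (\<lambda>i. clipped_cond_exp (real i / 2 ^ n) \<omega>) j))"
    by (simp only: c_def m_def)
qed

lemma anchor_moves_expectation: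
  assumes e: "0 < e"
  shows "(\<integral>\<^sup>+\<omega>. ennreal (real (anchor_moves e (\<lambda>i. clipped_cond_exp (real i / 2 ^ n) \<omega>) j)) \<partial>M) \<le> ennreal (1 / e\<^sup>2)"
proof -
  have "(\<integral>\<^sup>+\<omega>. ennreal (real (anchor_moves e (\<lambda>i. clipped_cond_exp (real i / 2 ^ n) \<omega>) j)) \<partial>M) =
      ennreal (\<integral>\<omega>. real (anchor_moves e (\<lambda>i. clipped_cond_exp (real i / 2 ^ n) \<omega>) j) \<partial>M)"
    by (rule nn_integral_eq_integral[OF anchor_energy(1)[OF e]]) simp
  also have "\<dots> \<le> ennreal (1 / e\<^sup>2)"
    using anchor_energy(2)[OF e, of n j] e by (intro ennreal_leI) (simp add: field_simps)
  finally show ?thesis .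
qed

text \<open>The mean number of moves is at most \<open>1 / e\<^sup>2\<close>, uniformly in the grid
  and the horizon; by Fatou's lemma the limes inferior of the counts along the grids is almost
  surely finite.\<close>

lemma AE_dyadic_regular: "AE \<omega> in M. dyadic_regular (\<lambda>q. clipped_cond_exp q \<omega>)"
  unfolding dyadic_regular_def AE_all_countable
proof
  fix k :: nat
  define e where "e = 1 / real (Suc k)"
  have e: "0 < e" by (simp add: e_def)
  define C where "C n \<omega> = anchor_moves e (\<lambda>i. clipped_cond_exp (real i / 2 ^ n) \<omega>) (n * 2 ^ n)" for n \<omega>
  have C_meas[measurable]: "(\<lambda>\<omega>. ennreal (real (C n \<omega>))) \<in> borel_measurable M" for n
    using borel_measurable_integrable[OF anchor_energy(1)[OF e, of n "n * 2 ^ n"]]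
    unfolding C_def by (rule measurable_compose[OF _ measurable_ennreal])
  have "(\<integral>\<^sup>+\<omega>. liminf (\<lambda>n. ennreal (real (C n \<omega>))) \<partial>M) \<le> liminf (\<lambda>n. \<integral>\<^sup>+\<omega>. ennreal (real (C n \<omega>)) \<partial>M)"
    by (rule nn_integral_liminf) (rule C_meas)
  also have "\<dots> \<le> limsup (\<lambda>n. \<integral>\<^sup>+\<omega>. ennreal (real (C n \<omega>)) \<partial>M)"
    by (rule Liminf_le_Limsup) simp
  also have "\<dots> \<le> ennreal (1 / e\<^sup>2)"
    unfolding C_def by (intro Limsup_bounded always_eventually allI anchor_moves_expectation[OF e])
  finally have "(\<integral>\<^sup>+\<omega>. liminf (\<lambda>n. ennreal (real (C n \<omega>))) \<partial>M) \<noteq> \<infinity>"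
    by (auto simp: top_unique)
  then have "AE \<omega> in M. liminf (\<lambda>n. ennreal (real (C n \<omega>))) \<noteq> \<infinity>"
    by (intro nn_integral_PInf_AE) measurable
  then show "AE \<omega> in M. \<exists>K. \<exists>\<^sub>F n in sequentially.
      anchor_moves (1 / real (Suc k)) (\<lambda>i. clipped_cond_exp (real i / 2 ^ n) \<omega>) (n * 2 ^ n) \<le> K"
  proof eventually_elim
    case (elim \<omega>)
    then obtain x where x: "liminf (\<lambda>n. ennreal (real (C n \<omega>))) = ennreal x" "0 \<le> x"
      by (cases "liminf (\<lambda>n. ennreal (real (C n \<omega>)))") auto
    obtain K :: nat where K: "x < real K" using reals_Archimedean2 by blast
    have "\<exists>\<^sub>F n in sequentially. C n \<omega> \<le> K"
    proof (rule ccontr)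
      assume "\<not> ?thesis"
      then have "eventually (\<lambda>n. K < C n \<omega>) sequentially" by (simp add: not_frequently not_le)
      then have "eventually (\<lambda>n. ennreal (real K) \<le> ennreal (real (C n \<omega>))) sequentially"
        by eventually_elim (intro ennreal_leI, simp)
      then have "ennreal (real K) \<le> liminf (\<lambda>n. ennreal (real (C n \<omega>)))" by (rule Liminf_bounded)
      then show False using x K by simp
    qed
    then show ?case unfolding C_def e_def by blast
  qed
qed

end

text \<open>The version consists of the right limits along dyadic points, set to \<open>0\<close> on
  the paths without regularity. It projects correctly because \<open>B\<close> in \<open>F t\<close>
  is known at all later dyadic times, where the integrals over \<open>B\<close> equal that of \<xi>;
  dominated convergence takes them to the limit.\<close>

theorem cadlag_version:
  fixes \<xi> :: "'a \<Rightarrow> real"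
  assumes \<xi>: "\<xi> \<in> borel_measurable M" "\<And>\<omega>. 0 \<le> \<xi> \<omega> \<and> \<xi> \<omega> \<le> 1"
  obtains Y where "adapted F Y" "cadlag M Y" "\<And>t \<omega>. 0 \<le> Y t \<omega> \<and> Y t \<omega> \<le> 1"
    "\<And>t. 0 \<le> t \<Longrightarrow> AE \<omega> in M. Y t \<omega> = real_cond_exp M (F t) \<xi> \<omega>"
proof -
  define m where "m = clipped_cond_exp \<xi>"
  obtain N where N: "N \<in> null_sets M" "\<And>\<omega>. \<omega> \<in> space M \<Longrightarrow> \<omega> \<notin> N \<Longrightarrow> dyadic_regular (\<lambda>q. m q \<omega>)"
    using AE_E_null[OF AE_dyadic_regular[OF \<xi>]] unfolding m_def by blast
  define good where "good = space M - N"
  define Y where "Y t \<omega> = (if \<omega> \<in> good \<and> 0 \<le> t then lim (\<lambda>n. m (dyadic_above n t) \<omega>) else 0)" for t \<omega>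
  have m_bd: "0 \<le> m q \<omega>" "m q \<omega> \<le> 1" for q \<omega>
    unfolding m_def by (rule clipped_bounds[OF \<xi>])+
  have Y_lim: "(\<lambda>n. m (dyadic_above n t) \<omega>) \<longlonglongrightarrow> Y t \<omega>" if t: "0 \<le> t" and \<omega>: "\<omega> \<in> good" for t \<omega>
  proof -
    have "dyadic_regular (\<lambda>q. m q \<omega>)" using N(2) \<omega> by (simp add: good_def)
    then obtain l where l: "(\<lambda>n. m (dyadic_above n t) \<omega>) \<longlonglongrightarrow> l"
      using dyadic_regular_right_limit[OF _ t] by blast
    then show ?thesis using \<omega> using t by (simp add: Y_def limI)
  qed
  have Y_lim_ind: "(\<lambda>n. indicator good \<omega> * m (dyadic_above n t) \<omega>) \<longlonglongrightarrow> Y t \<omega>" if t: "0 \<le> t" for t \<omega>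
    using Y_lim[OF t, of \<omega>] by (cases "\<omega> \<in> good") (simp_all add: Y_def)
  have Y_bd: "0 \<le> Y t \<omega> \<and> Y t \<omega> \<le> 1" for t \<omega>
  proof (cases "\<omega> \<in> good \<and> 0 \<le> t")
    case True
    then have "(\<lambda>n. m (dyadic_above n t) \<omega>) \<longlonglongrightarrow> Y t \<omega>" by (intro Y_lim) auto
    then show ?thesis using m_bd by (auto intro: LIMSEQ_le_const LIMSEQ_le_const2)
  next
    case False
    then show ?thesis unfolding Y_def by (subst if_not_P) auto
  qed
  have good_F: "good \<in> sets (F t)" if "0 \<le> t" for t
    using sets.Diff[OF space_in_F[OF that] null_subset_F[OF order_refl N(1) that]] by (simp add: good_def)
  have AE_good: "AE \<omega> in M. \<omega> \<in> good"
    using N(1) by (intro AE_I'[of N]) (auto simp: good_def)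
  have adapted: "adapted F Y"
    unfolding adapted_def
  proof (intro allI impI)
    fix t :: real assume t: "0 \<le> t"
    show "Y t \<in> borel_measurable (F t)"
    \<comment> \<open>The limit at \<open>t\<close> uses times after \<open>t\<close>. For each
      \<open>s > t\<close> these eventually lie before \<open>s\<close>, so the limit is known at
      \<open>s\<close>, and by right-continuity of \<open>F\<close> at \<open>t\<close>.\<close>
    proof (rule measurable_F_right[OF t])
      fix s assume s: "t < s"
      obtain n0 where n0: "\<And>n. n0 \<le> n \<Longrightarrow> dyadic_above n t < s"
        using order_tendstoD(2)[OF dyadic_above_tendsto[OF t] s] unfolding eventually_sequentially by blast
      show "Y t \<in> borel_measurable (F s)"
      proof (rule borel_measurable_LIMSEQ_real)
        show "(\<lambda>n. indicator good \<omega> * m (dyadic_above (n + n0) t) \<omega>) \<longlonglongrightarrow> Y t \<omega>" for \<omega>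
          using LIMSEQ_ignore_initial_segment[OF Y_lim_ind[OF t], of \<omega> n0] .
        fix n
        have "m (dyadic_above (n + n0) t) \<in> borel_measurable (F s)"
          unfolding m_def
          by (rule measurable_F_mono[OF clipped_measurable[OF \<xi>]])
             (use n0[of "n + n0"] dyadic_above(1)[OF t, of "n + n0"] t in auto)
        moreover have "good \<in> sets (F s)" using good_F t s by simp
        ultimately show "(\<lambda>\<omega>. indicator good \<omega> * m (dyadic_above (n + n0) t) \<omega>) \<in> borel_measurable (F s)"
          by measurable
      qed
    qed
  qed
  have cadlag: "cadlag M Y"
    unfolding cadlag_def
  proof
    fix \<omega> assume \<omega>: "\<omega> \<in> space M"
    show "cadlag_path (\<lambda>t. Y t \<omega>)"
    proof (cases "\<omega> \<in> good")
      case True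
      then show ?thesis using N(2) Y_lim
        by (intro dyadic_regular_cadlag[of "\<lambda>q. m q \<omega>"]) (auto simp: good_def)
    next
      case False
      then show ?thesis by (auto simp: Y_def cadlag_path_def intro: tendsto_const)
    qed
  qed
  have version: "AE \<omega> in M. Y t \<omega> = real_cond_exp M (F t) \<xi> \<omega>" if t: "0 \<le> t" for t
  proof -
    have "AE \<omega> in M. real_cond_exp M (F t) \<xi> \<omega> = Y t \<omega>"
    proof (rule cond_exp_versionI[OF t _ _ \<xi>(1) \<xi>_abs[OF \<xi>]])
      show Y_F: "Y t \<in> borel_measurable (F t)" using adapted t by (simp add: adapted_def)
      show "\<bar>Y t \<omega>\<bar> \<le> 1" for \<omega> using Y_bd[of t \<omega>] by simp
      fix B assume B: "B \<in> sets (F t)"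
      have BM[measurable]: "B \<in> sets M" by (rule sets_F[OF t B])
      have [measurable]: "Y t \<in> borel_measurable M" by (rule measurable_F_M[OF Y_F t])
      have [measurable]: "m (dyadic_above n t) \<in> borel_measurable M" for n
        unfolding m_def using dyadics_nonneg[OF dyadic_above(3)] by (rule clipped_measurable_M[OF \<xi>])
      have "(\<lambda>n. \<integral>\<omega>. indicator B \<omega> * m (dyadic_above n t) \<omega> \<partial>M) \<longlonglongrightarrow> (\<integral>\<omega>. indicator B \<omega> * Y t \<omega> \<partial>M)"
      proof (rule integral_dominated_convergence[where w = "\<lambda>_. 1"])
        show "AE \<omega> in M. (\<lambda>n. indicator B \<omega> * m (dyadic_above n t) \<omega>) \<longlonglongrightarrow> indicator B \<omega> * Y t \<omega>"
          using AE_good by eventually_elim (intro tendsto_intros Y_lim[OF t])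
        show "AE \<omega> in M. norm (indicator B \<omega> * m (dyadic_above n t) \<omega>) \<le> 1" for n
          using m_bd by (intro AE_I2) (auto simp: indicator_def)
      qed simp_all
      moreover have "(\<integral>\<omega>. indicator B \<omega> * m (dyadic_above n t) \<omega> \<partial>M) = (\<integral>\<omega>. indicator B \<omega> * \<xi> \<omega> \<partial>M)" for n
        unfolding m_def
      proof (rule integral_clipped[OF \<xi>])
        show "0 \<le> dyadic_above n t" using dyadic_above(1)[OF t, of n] t by simp
        have "B \<in> sets (F (dyadic_above n t))"
          by (rule sets_F_mono[OF B t]) (use dyadic_above(1)[OF t, of n] in simp)
        then show "indicator B \<in> borel_measurable (F (dyadic_above n t))" by simp
        show "\<bar>indicator B \<omega>\<bar> \<le> (1::real)" for \<omega> by (simp add: indicator_def)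
      qed
      ultimately show "(\<integral>\<omega>. indicator B \<omega> * Y t \<omega> \<partial>M) = (\<integral>\<omega>. indicator B \<omega> * \<xi> \<omega> \<partial>M)"
        by (simp add: LIMSEQ_const_iff)
    qed
    then show ?thesis by eventually_elim simp
  qed
  show ?thesis by (rule that[OF adapted cadlag Y_bd version])
qed

end

section \<open>Pseudo-stopping times\<close>

lemma cadlag_path_stopped:
  assumes y: "cadlag_path y" and s: "0 \<le> s"
  shows "cadlag_path (\<lambda>r. y (min r s))"
  unfolding cadlag_path_def
proof (intro conjI allI impI)
  fix t :: real assume t: "0 \<le> t"
  show "continuous (at_right t) (\<lambda>r. y (min r s))"
  proof (cases "t < s")
    case True
    have "(y \<longlongrightarrow> y t) (at_right t)" using y t by (auto simp: cadlag_path_def continuous_within)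
    moreover have "eventually (\<lambda>r. y r = y (min r s)) (at_right t)"
      using True by (auto simp: eventually_at_right_field intro!: exI[of _ s])
    ultimately have "((\<lambda>r. y (min r s)) \<longlongrightarrow> y t) (at_right t)" by (rule Lim_transform_eventually)
    then show ?thesis using True by (simp add: continuous_within)
  next
    case False
    then show ?thesis by (intro continuous_at_right_const[of t "t + 1"]) auto
  qed
next
  fix t :: real assume t: "0 < t"
  show "\<exists>l. ((\<lambda>r. y (min r s)) \<longlongrightarrow> l) (at_left t)"
  proof (cases "t \<le> s")
    case True
    obtain l where l: "(y \<longlongrightarrow> l) (at_left t)" using y t by (auto simp: cadlag_path_def)
    moreover have "eventually (\<lambda>r. y r = y (min r s)) (at_left t)"
      using True by (auto simp: eventually_at_left_field intro!: exI[of _ "t - 1"])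
    ultimately show ?thesis by (blast intro: Lim_transform_eventually)
  next
    case False
    then show ?thesis by (intro exI[of _ "y s"] tendsto_at_left_const[of s]) auto
  qed
qed

lemma cadlag_path_eq_if_eq_on_Rats:
  assumes "cadlag_path x" "cadlag_path y" "\<And>q. q \<in> \<rat> \<Longrightarrow> 0 \<le> q \<Longrightarrow> x q = y q" "0 \<le> t"
  shows "x t = y t"
proof -
  have cont: "(x \<longlongrightarrow> x t) (at_right t)" "(y \<longlongrightarrow> y t) (at_right t)"
    using assms(1,2,4) by (auto simp: cadlag_path_def continuous_within)
  have "\<forall>n::nat. \<exists>q\<in>\<rat>. t < q \<and> q < t + 1 / real (Suc n)"
    using Rats_dense_in_real[of t] by (auto simp del: of_nat_Suc)
  then obtain q where q: "\<And>n::nat. q n \<in> \<rat>" "\<And>n. t < q n" "\<And>n. q n < t + 1 / real (Suc n)" by metis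
  have "q \<longlonglongrightarrow> t"
  proof (rule tendsto_sandwich)
    show "(\<lambda>_. t) \<longlonglongrightarrow> t" by simp
    have "(\<lambda>n. t + 1 / real (Suc n)) \<longlonglongrightarrow> t + 0" by (intro tendsto_intros LIMSEQ_Suc[OF lim_1_over_n])
    then show "(\<lambda>n. t + 1 / real (Suc n)) \<longlonglongrightarrow> t" by simp
  qed (use q in \<open>auto intro!: always_eventually less_imp_le simp del: of_nat_Suc\<close>)
  then have "filterlim q (at_right t) sequentially"
    using q(2) by (auto simp: filterlim_at intro!: always_eventually)
  from filterlim_compose[OF cont(1) this] filterlim_compose[OF cont(2) this]
  have "(\<lambda>n. x (q n)) \<longlonglongrightarrow> x t" "(\<lambda>n. y (q n)) \<longlonglongrightarrow> y t" .
  moreover have "x (q n) = y (q n)" for n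
    using q(2)[of n] assms(4) by (intro assms(3) q(1)) simp
  ultimately show ?thesis by (auto intro: LIMSEQ_unique)
qed

lemma cadlag_path_le_if_le_on_Rats:
  assumes "cadlag_path x" "cadlag_path y" "0 \<le> t" "t < b"
    and le: "\<And>q. q \<in> \<rat> \<Longrightarrow> t < q \<Longrightarrow> q < b \<Longrightarrow> x q \<le> y q"
  shows "x t \<le> y t"
proof -
  have cont: "(x \<longlongrightarrow> x t) (at_right t)" "(y \<longlongrightarrow> y t) (at_right t)"
    using assms(1-3) by (auto simp: cadlag_path_def continuous_within)
  show ?thesis
  proof (rule ccontr)
    assume "\<not> ?thesis"
    then have "0 < x t - y t" by simp
    moreover have "((\<lambda>s. x s - y s) \<longlongrightarrow> x t - y t) (at_right t)" by (intro tendsto_intros cont)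
    ultimately have "eventually (\<lambda>s. 0 < x s - y s) (at_right t)" by (rule order_tendstoD(1)[rotated])
    then obtain c where c: "t < c" "\<And>s. t < s \<Longrightarrow> s < c \<Longrightarrow> 0 < x s - y s"
      by (auto simp: eventually_at_right_field)
    obtain q where "q \<in> \<rat>" "t < q" "q < min b c" using Rats_dense_in_real[of t "min b c"] assms(4) c(1) by auto
    then show False using c(2)[of q] le[of q] by simp
  qed
qed

context usual_filtered_prob_space
begin

lemma cadlag_process_at_measurable:
  assumes Y: "adapted F Y" "cadlag M Y" and T: "T \<in> borel_measurable M" "\<And>\<omega>. 0 \<le> T \<omega>"
  shows "(\<lambda>\<omega>. Y (T \<omega>) \<omega>) \<in> borel_measurable M"
proof (rule measurableI)
  fix B :: "real set" assume B: "B \<in> sets borel"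
  have "{(t, \<omega>). 0 \<le> t \<and> \<omega> \<in> space M \<and> Y t \<omega> \<in> B} \<in> sets (optional_sigma M F)"
    unfolding optional_sigma_def using Y B by (intro process_in_sigma) auto
  then have C: "{(t, \<omega>). 0 \<le> t \<and> \<omega> \<in> space M \<and> Y t \<omega> \<in> B} \<in> sets (borel \<Otimes>\<^sub>M M)" by (rule optional_pair)
  have "(\<lambda>\<omega>. (T \<omega>, \<omega>)) \<in> measurable M (borel \<Otimes>\<^sub>M M)" using T(1) by measurable
  from measurable_sets[OF this C]
  have "(\<lambda>\<omega>. (T \<omega>, \<omega>)) -` {(t, \<omega>). 0 \<le> t \<and> \<omega> \<in> space M \<and> Y t \<omega> \<in> B} \<inter> space M \<in> sets M" .
  also have "(\<lambda>\<omega>. (T \<omega>, \<omega>)) -` {(t, \<omega>). 0 \<le> t \<and> \<omega> \<in> space M \<and> Y t \<omega> \<in> B} \<inter> space M =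
      (\<lambda>\<omega>. Y (T \<omega>) \<omega>) -` B \<inter> space M" using T(2) by auto
  finally show "(\<lambda>\<omega>. Y (T \<omega>) \<omega>) -` B \<inter> space M \<in> sets M" .
qed simp

text \<open>The variable \<xi> closes the martingale \<open>Y\<close>. The bounds are required
  everywhere and not almost surely, so that \<open>Y\<close> may be evaluated at random times and
  has a supremum bounded by \<open>1\<close>, as membership in H1 demands.\<close>

definition unit_version :: "('a \<Rightarrow> real) \<Rightarrow> (real \<Rightarrow> 'a \<Rightarrow> real) \<Rightarrow> bool" where
  "unit_version \<xi> Y \<longleftrightarrow> \<xi> \<in> borel_measurable M \<and> (\<forall>\<omega>. 0 \<le> \<xi> \<omega> \<and> \<xi> \<omega> \<le> 1) \<and> adapted F Y \<and> cadlag M Y \<and>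
     (\<forall>t \<omega>. 0 \<le> Y t \<omega> \<and> Y t \<omega> \<le> 1) \<and> (\<forall>t\<ge>0. AE \<omega> in M. Y t \<omega> = real_cond_exp M (F t) \<xi> \<omega>)"

lemma unit_version_ex:
  assumes "\<xi> \<in> borel_measurable M" "\<And>\<omega>. 0 \<le> \<xi> \<omega> \<and> \<xi> \<omega> \<le> 1"
  shows "\<exists>Y. unit_version \<xi> Y"
  using cadlag_version[OF assms] assms unfolding unit_version_def by metis

lemma unit_versionD:
  assumes "unit_version \<xi> Y"
  shows "\<xi> \<in> borel_measurable M" "0 \<le> \<xi> \<omega>" "\<xi> \<omega> \<le> 1" "adapted F Y" "cadlag M Y" "0 \<le> Y t \<omega>" "Y t \<omega> \<le> 1"
    "0 \<le> t \<Longrightarrow> AE \<omega> in M. Y t \<omega> = real_cond_exp M (F t) \<xi> \<omega>"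
    "0 \<le> t \<Longrightarrow> Y t \<in> borel_measurable (F t)" "0 \<le> t \<Longrightarrow> Y t \<in> borel_measurable M"
proof -
  show 9: "Y t \<in> borel_measurable (F t)" if "0 \<le> t" using assms that by (simp add: unit_version_def adapted_def)
  show "Y t \<in> borel_measurable M" if "0 \<le> t" by (rule measurable_F_M[OF 9[OF that] that])
qed (use assms in \<open>simp_all add: unit_version_def\<close>)

lemma unit_version_at_measurable:
  assumes Y: "unit_version \<xi> Y" and T: "T \<in> borel_measurable M" "\<And>\<omega>. 0 \<le> T \<omega>"
  shows "(\<lambda>\<omega>. Y (T \<omega>) \<omega>) \<in> borel_measurable M"
  by (rule cadlag_process_at_measurable[OF unit_versionD(4,5)[OF Y] T])

lemma unit_version_integral:
  assumes Y: "unit_version \<xi> Y" and t: "0 \<le> t" and a: "a \<in> borel_measurable (F t)" "\<And>\<omega>. \<bar>a \<omega>\<bar> \<le> K"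
  shows "(\<integral>\<omega>. a \<omega> * Y t \<omega> \<partial>M) = (\<integral>\<omega>. a \<omega> * \<xi> \<omega> \<partial>M)"
proof (rule integral_cond_exp_version[OF t unit_versionD(8)[OF Y t] unit_versionD(10)[OF Y t] unit_versionD(1)[OF Y] _ a])
  show "\<bar>\<xi> \<omega>\<bar> \<le> 1" for \<omega> using unit_versionD(2,3)[OF Y, of \<omega>] by simp
qed

lemma unit_version_martingale:
  assumes Y: "unit_version \<xi> Y" and s: "0 \<le> s" "s \<le> t"
  shows "AE \<omega> in M. real_cond_exp M (F s) (Y t) \<omega> = Y s \<omega>"
proof (rule cond_exp_versionI[OF s(1)])
  have t: "0 \<le> t" using s by simp
  show "Y s \<in> borel_measurable (F s)" "Y t \<in> borel_measurable M" using unit_versionD[OF Y] s t by auto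
  show "\<bar>Y s \<omega>\<bar> \<le> 1" "\<bar>Y t \<omega>\<bar> \<le> 1" for \<omega> using unit_versionD(6,7)[OF Y] by auto
  fix B assume B: "B \<in> sets (F s)"
  have "B \<in> sets (F t)" by (rule sets_F_mono[OF B s])
  then show "(\<integral>\<omega>. indicator B \<omega> * Y s \<omega> \<partial>M) = (\<integral>\<omega>. indicator B \<omega> * Y t \<omega> \<partial>M)"
    using B by (subst (1 2) unit_version_integral[OF Y, of _ _ 1]) (auto simp: s t indicator_def)
qed

lemma unit_version_stopped_H1:
  assumes Y: "unit_version \<xi> Y" and s: "0 \<le> s"
  shows "H1_martingale M F (\<lambda>r. Y (min r s))"
  unfolding H1_martingale_def martingale_def
proof (intro conjI allI impI)
  have Y_abs: "\<bar>Y u \<omega>\<bar> \<le> 1" for u \<omega>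
    using unit_versionD(6)[OF Y, of u \<omega>] unit_versionD(7)[OF Y, of u \<omega>] by simp
  have meas: "Y (min t s) \<in> borel_measurable (F t)" if "0 \<le> t" for t
    by (rule measurable_F_mono[OF unit_versionD(9)[OF Y]]) (use that s in auto)
  then show "adapted F (\<lambda>r. Y (min r s))" by (simp add: adapted_def)
  show int: "integrable M (Y (min t s))" if "0 \<le> t" for t
    by (rule integrable_bounded[OF unit_versionD(10)[OF Y] Y_abs]) (use that s in simp)
  show "cadlag M (\<lambda>r. Y (min r s))"
    unfolding cadlag_def
  proof
    fix \<omega> assume "\<omega> \<in> space M"
    then have "cadlag_path (\<lambda>t. Y t \<omega>)" using unit_versionD(5)[OF Y] by (simp add: cadlag_def)
    from cadlag_path_stopped[OF this s] show "cadlag_path (\<lambda>r. Y (min r s) \<omega>)" .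
  qed
  have "(\<integral>\<^sup>+\<omega>. (SUP t\<in>{0..}. ennreal \<bar>Y (min t s) \<omega>\<bar>) \<partial>M) \<le> (\<integral>\<^sup>+\<omega>. 1 \<partial>M)"
    using ennreal_leI[OF Y_abs] by (intro nn_integral_mono SUP_least) simp
  also have "\<dots> < \<infinity>" by (simp add: emeasure_space_1)
  finally show "(\<integral>\<^sup>+\<omega>. (SUP t\<in>{0..}. ennreal \<bar>Y (min t s) \<omega>\<bar>) \<partial>M) < \<infinity>" .
  fix u t :: real assume u: "0 \<le> u \<and> u \<le> t"
  show "AE \<omega> in M. real_cond_exp M (F u) (Y (min t s)) \<omega> = Y (min u s) \<omega>"
  proof (cases "u \<le> s")
    case True
    then have "min u s = u" "u \<le> min t s" using u by auto
    then show ?thesis using unit_version_martingale[OF Y, of u "min t s"] u by simp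
  next
    case False
    then have eq: "min t s = s" "min u s = s" using u by auto
    interpret S: sigma_finite_subalgebra M "F u" by (rule sigma_finite_subalgebra_F) (use u in simp)
    show ?thesis unfolding eq
      using int[of t] meas[of u] u s by (intro S.real_cond_exp_F_meas) (auto simp: eq)
  qed
qed

text \<open>The martingale is stopped at a deterministic level \<open>s\<close> before it is
  evaluated at \<tau>. Comparing two levels later isolates the contribution of \<tau> between
  them.\<close>

lemma pseudo_stopped_expectation:
  assumes \<tau>: "pseudo_stopping_time M F \<tau>" "AE \<omega> in M. \<tau> \<omega> < \<infinity>" and Y: "unit_version \<xi> Y" and s: "0 \<le> s"
  shows "(\<integral>\<omega>. Y (min (enn2real (\<tau> \<omega>)) s) \<omega> \<partial>M) = (\<integral>\<omega>. \<xi> \<omega> \<partial>M)"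
proof -
  let ?X = "\<lambda>r. Y (min r s)"
  have \<tau>_meas[measurable]: "\<tau> \<in> borel_measurable M" using \<tau>(1) by (simp add: pseudo_stopping_time_def random_time_def)
  have "(\<integral>\<omega>. at_random_time ?X \<tau> \<omega> \<partial>M) = (\<integral>\<omega>. ?X 0 \<omega> \<partial>M)"
    using \<tau>(1) unit_version_stopped_H1[OF Y s] unfolding pseudo_stopping_time_def by blast
  also have "(\<integral>\<omega>. ?X 0 \<omega> \<partial>M) = (\<integral>\<omega>. \<xi> \<omega> \<partial>M)"
    using unit_version_integral[OF Y, of 0 "\<lambda>_. 1" 1] s by (simp add: min_absorb1)
  finally have "(\<integral>\<omega>. at_random_time ?X \<tau> \<omega> \<partial>M) = (\<integral>\<omega>. \<xi> \<omega> \<partial>M)" .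
  moreover have "(\<integral>\<omega>. at_random_time ?X \<tau> \<omega> \<partial>M) = (\<integral>\<omega>. Y (min (enn2real (\<tau> \<omega>)) s) \<omega> \<partial>M)"
  proof -
    \<comment> \<open>With \<open>M\<close> as a constant filtration, completeness transfers
      measurability along almost sure equality to \<open>at_random_time\<close>, whose value on
      infinite \<tau> is a limit.\<close>
    interpret C: complete_filtration M "\<lambda>_. M"
      by unfold_locales (auto simp: subalgebra_def)
    have meas: "(\<lambda>\<omega>. Y (min (enn2real (\<tau> \<omega>)) s) \<omega>) \<in> borel_measurable M"
      using s by (intro unit_version_at_measurable[OF Y]) auto
    have ae: "AE \<omega> in M. Y (min (enn2real (\<tau> \<omega>)) s) \<omega> = at_random_time ?X \<tau> \<omega>"
      using \<tau>(2) by eventually_elim (auto simp: at_random_time_def)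
    from C.measurable_F_cong_AE[OF meas ae order_refl]
    have "at_random_time ?X \<tau> \<in> borel_measurable M" .
    then show ?thesis using ae meas by (intro integral_cong_AE) auto
  qed
  ultimately show ?thesis by simp
qed

text \<open>The increasing process \<open>1 - Z\<close> of a pseudo-stopping time, with all exceptional paths removed.\<close>

definition regular_compensator :: "('a \<Rightarrow> ennreal) \<Rightarrow> (real \<Rightarrow> 'a \<Rightarrow> real) \<Rightarrow> bool" where
  "regular_compensator \<tau> D \<longleftrightarrow> adapted F D \<and>
     (\<forall>\<omega>\<in>space M. increasing_path (\<lambda>t. D t \<omega>) \<and> cadlag_path (\<lambda>t. D t \<omega>) \<and> D 0 \<omega> = 0) \<and>
     (\<forall>t \<omega>. 0 \<le> D t \<omega> \<and> D t \<omega> \<le> 1) \<and>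
     (\<forall>t\<ge>0. AE \<omega> in M. D t \<omega> = real_cond_exp M (F t) (indicator {\<omega>. \<tau> \<omega> \<le> ennreal t}) \<omega>) \<and>
     (\<forall>\<xi> Y s t. unit_version \<xi> Y \<longrightarrow> 0 \<le> s \<longrightarrow> s \<le> t \<longrightarrow>
       (\<integral>\<omega>. indicator {\<omega>. ennreal s < \<tau> \<omega> \<and> \<tau> \<omega> \<le> ennreal t} \<omega> * Y (enn2real (\<tau> \<omega>)) \<omega> \<partial>M) =
       (\<integral>\<omega>. \<xi> \<omega> * (D t \<omega> - D s \<omega>) \<partial>M))"

lemma clamp_cadlag_path:
  assumes "cadlag_path z"
  shows "cadlag_path (\<lambda>t. 1 - max 0 (min 1 (z t)))"
  unfolding cadlag_path_def
proof (intro conjI allI impI)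
  fix t :: real assume t: "0 \<le> t"
  then have "(z \<longlongrightarrow> z t) (at_right t)" using assms by (simp add: cadlag_path_def continuous_within)
  then show "continuous (at_right t) (\<lambda>t. 1 - max 0 (min 1 (z t)))"
    unfolding continuous_within by (intro tendsto_intros)
next
  fix t :: real assume t: "0 < t"
  then obtain l where "(z \<longlongrightarrow> l) (at_left t)" using assms by (auto simp: cadlag_path_def)
  then have "((\<lambda>t. 1 - max 0 (min 1 (z t))) \<longlongrightarrow> 1 - max 0 (min 1 l)) (at_left t)" by (intro tendsto_intros)
  then show "\<exists>l. ((\<lambda>t. 1 - max 0 (min 1 (z t))) \<longlongrightarrow> l) (at_left t)" by blast
qed

text \<open>For finite \<tau>, the value of \<open>Y\<close> at \<tau> on
  \<open>s < \<tau> \<le> t\<close> is the difference of \<open>Y\<close> at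
  \<open>min \<tau> t\<close> and at \<open>min \<tau> s\<close>, plus \<open>Y s\<close> on
  \<open>s < \<tau>\<close>, minus \<open>Y t\<close> on \<open>t < \<tau>\<close>. The two stopped
  values have the same mean by the pseudo-stopping property; the two others are rewritten through
  \<xi> and \<open>1 - C\<close>. This gives the duality with \<xi>, from which monotonicity
  follows.\<close>

lemma regular_compensator_ex:
  assumes \<tau>: "pseudo_stopping_time M F \<tau>" and \<tau>_AE: "AE \<omega> in M. 0 < \<tau> \<omega>" "AE \<omega> in M. \<tau> \<omega> < \<infinity>"
    and Z: "azema_supermartingale M F \<tau> Z"
  obtains D where "regular_compensator \<tau> D" "AE \<omega> in M. \<forall>t\<ge>0. D t \<omega> = 1 - Z t \<omega>"
proof -
  have \<tau>_meas[measurable]: "\<tau> \<in> borel_measurable M" using \<tau> by (simp add: pseudo_stopping_time_def random_time_def)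
  have Z_adapted: "adapted F Z" and Z_cadlag: "cadlag M Z"
    and Z_AE: "\<And>t. 0 \<le> t \<Longrightarrow> AE \<omega> in M. Z t \<omega> = real_cond_exp M (F t) (indicator {\<omega>. ennreal t < \<tau> \<omega>}) \<omega>"
    using Z by (auto simp: azema_supermartingale_def)
  \<comment> \<open>Clamping secures the bounds on every path; almost surely it changes nothing,
    since \<open>Z t\<close> is a conditional probability.\<close>
  define C where "C t \<omega> = 1 - max 0 (min 1 (Z t \<omega>))" for t \<omega>
  have C_bd: "0 \<le> C t \<omega>" "C t \<omega> \<le> 1" for t \<omega> by (simp_all add: C_def)
  have C_F: "C t \<in> borel_measurable (F t)" if "0 \<le> t" for t
    using Z_adapted that unfolding C_def[abs_def] adapted_def by (intro borel_measurable_diff borel_measurable_max borel_measurable_min) auto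
  have C_M: "C t \<in> borel_measurable M" if "0 \<le> t" for t by (rule measurable_F_M[OF C_F[OF that] that])
  have C_cadlag: "cadlag_path (\<lambda>t. C t \<omega>)" if "\<omega> \<in> space M" for \<omega>
    using Z_cadlag that unfolding C_def by (intro clamp_cadlag_path) (simp add: cadlag_def)
  let ?gt = "\<lambda>t. {\<omega>. ennreal t < \<tau> \<omega>}"
  have ind_meas: "(\<lambda>\<omega>. indicator (?gt t) \<omega> :: real) \<in> borel_measurable M" for t
    by (rule indicator_gt_time_measurable[OF \<tau>_meas])
  have ind_int: "integrable M (\<lambda>\<omega>. indicator (?gt t) \<omega> :: real)" for t
    by (rule integrable_bounded[OF ind_meas, of _ 1]) (simp add: indicator_def)
  have Z_C: "AE \<omega> in M. Z t \<omega> = 1 - C t \<omega>" if t: "0 \<le> t" for t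
  proof -
    interpret S: sigma_finite_subalgebra M "F t" by (rule sigma_finite_subalgebra_F[OF t])
    have "AE \<omega> in M. 0 \<le> real_cond_exp M (F t) (indicator (?gt t)) \<omega>"
      by (rule S.real_cond_exp_ge_c[OF ind_int]) (auto simp: indicator_def)
    moreover have "AE \<omega> in M. real_cond_exp M (F t) (indicator (?gt t)) \<omega> \<le> 1"
      by (rule S.real_cond_exp_le_c[OF ind_int]) (auto simp: indicator_def)
    ultimately show ?thesis using Z_AE[OF t] by eventually_elim (simp add: C_def)
  qed
  have C_proj: "(\<integral>\<omega>. a \<omega> * (1 - C t \<omega>) \<partial>M) = (\<integral>\<omega>. a \<omega> * indicator (?gt t) \<omega> \<partial>M)"
    if t: "0 \<le> t" and a: "a \<in> borel_measurable (F t)" "\<And>\<omega>. \<bar>a \<omega>\<bar> \<le> K" for t a K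
  proof (rule integral_cond_exp_version[OF t _ _ ind_meas _ a])
    show "AE \<omega> in M. 1 - C t \<omega> = real_cond_exp M (F t) (indicator (?gt t)) \<omega>"
      using Z_C[OF t] Z_AE[OF t] by eventually_elim simp
    show "(\<lambda>\<omega>. 1 - C t \<omega>) \<in> borel_measurable M" using C_M[OF t] by simp
    show "\<bar>indicator (?gt t) \<omega>\<bar> \<le> (1::real)" for \<omega> by (simp add: indicator_def)
  qed
  have C_pseudo: "(\<integral>\<omega>. indicator {\<omega>. ennreal s < \<tau> \<omega> \<and> \<tau> \<omega> \<le> ennreal t} \<omega> * Y (enn2real (\<tau> \<omega>)) \<omega> \<partial>M) =
       (\<integral>\<omega>. \<xi> \<omega> * (C t \<omega> - C s \<omega>) \<partial>M)"
    if Y: "unit_version \<xi> Y" and s: "0 \<le> s" "s \<le> t" for \<xi> Y s t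
  proof -
    have t: "0 \<le> t" using s by simp
    have Y_abs: "\<bar>Y u \<omega>\<bar> \<le> 1" for u \<omega>
      using unit_versionD(6)[OF Y, of u \<omega>] unit_versionD(7)[OF Y, of u \<omega>] by simp
    have \<xi>_abs: "\<bar>\<xi> \<omega>\<bar> \<le> 1" for \<omega>
      using unit_versionD(2)[OF Y, of \<omega>] unit_versionD(3)[OF Y, of \<omega>] by simp
    have C_abs: "\<bar>1 - C u \<omega>\<bar> \<le> 1" for u \<omega> using C_bd[of u \<omega>] by simp
    note [measurable] = unit_versionD(1)[OF Y] C_M[OF s(1)] C_M[OF t] unit_versionD(10)[OF Y s(1)] unit_versionD(10)[OF Y t] ind_meas
    have intm: "integrable M (\<lambda>\<omega>. Y (min (enn2real (\<tau> \<omega>)) u) \<omega>)" if "0 \<le> u" for u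
      by (rule integrable_bounded[OF unit_version_at_measurable[OF Y] Y_abs]) (use that in auto)
    have inti: "integrable M (\<lambda>\<omega>. indicator (?gt v) \<omega> * Y u \<omega>)" if "0 \<le> u" for u v
    proof (rule integrable_bounded[of _ 1])
      show "(\<lambda>\<omega>. indicator (?gt v) \<omega> * Y u \<omega>) \<in> borel_measurable M"
        using ind_meas unit_versionD(10)[OF Y that] by (intro borel_measurable_times)
      show "\<bar>indicator (?gt v) \<omega> * Y u \<omega>\<bar> \<le> 1" for \<omega> using Y_abs[of u \<omega>] by (simp add: indicator_def)
    qed
    \<comment> \<open>Two projections at the same time \<open>u\<close>: the indicator of
      \<open>u < \<tau>\<close> becomes \<open>1 - C u\<close> because \<open>Y u\<close> is known
      at \<open>u\<close>, and \<open>Y u\<close> becomes \<xi> because \<open>1 - C u\<close> is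
      known at \<open>u\<close>.\<close>
    have swap: "(\<integral>\<omega>. indicator (?gt u) \<omega> * Y u \<omega> \<partial>M) = (\<integral>\<omega>. \<xi> \<omega> * (1 - C u \<omega>) \<partial>M)" if u: "0 \<le> u" for u
    proof -
      have "(\<integral>\<omega>. indicator (?gt u) \<omega> * Y u \<omega> \<partial>M) = (\<integral>\<omega>. Y u \<omega> * (1 - C u \<omega>) \<partial>M)"
        using C_proj[OF u unit_versionD(9)[OF Y u] Y_abs] by (simp add: mult.commute)
      also have "\<dots> = (\<integral>\<omega>. (1 - C u \<omega>) * \<xi> \<omega> \<partial>M)"
        using unit_version_integral[OF Y u _ C_abs] C_F[OF u] by (simp add: mult.commute)
      finally show ?thesis by (simp add: mult.commute)
    qed
    have "AE \<omega> in M. indicator {\<omega>. ennreal s < \<tau> \<omega> \<and> \<tau> \<omega> \<le> ennreal t} \<omega> * Y (enn2real (\<tau> \<omega>)) \<omega> =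
        Y (min (enn2real (\<tau> \<omega>)) t) \<omega> - Y (min (enn2real (\<tau> \<omega>)) s) \<omega> +
        indicator (?gt s) \<omega> * Y s \<omega> - indicator (?gt t) \<omega> * Y t \<omega>"
      using \<tau>_AE(2)
    proof eventually_elim
      case (elim \<omega>)
      then obtain x where x: "\<tau> \<omega> = ennreal x" "0 \<le> x" by (cases "\<tau> \<omega>") auto
      show ?case using s x
        by (cases "x \<le> s"; cases "x \<le> t") (auto simp: indicator_def ennreal_less_iff not_le)
    qed
    then have "(\<integral>\<omega>. indicator {\<omega>. ennreal s < \<tau> \<omega> \<and> \<tau> \<omega> \<le> ennreal t} \<omega> * Y (enn2real (\<tau> \<omega>)) \<omega> \<partial>M) =
        (\<integral>\<omega>. Y (min (enn2real (\<tau> \<omega>)) t) \<omega> - Y (min (enn2real (\<tau> \<omega>)) s) \<omega> +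
        indicator (?gt s) \<omega> * Y s \<omega> - indicator (?gt t) \<omega> * Y t \<omega> \<partial>M)"
    proof (intro integral_cong_AE)
      have 1: "(\<lambda>\<omega>. Y (enn2real (\<tau> \<omega>)) \<omega>) \<in> borel_measurable M"
        by (rule unit_version_at_measurable[OF Y]) auto
      have 2: "(\<lambda>\<omega>. indicator (?gt s) \<omega> * (1 - indicator (?gt t) \<omega>) * Y (enn2real (\<tau> \<omega>)) \<omega>) \<in> borel_measurable M"
        by (intro borel_measurable_times borel_measurable_diff ind_meas 1) simp
      have "(\<lambda>\<omega>. indicator (?gt s) \<omega> * (1 - indicator (?gt t) \<omega>) * Y (enn2real (\<tau> \<omega>)) \<omega>) =
          (\<lambda>\<omega>. indicator {\<omega>. ennreal s < \<tau> \<omega> \<and> \<tau> \<omega> \<le> ennreal t} \<omega> * Y (enn2real (\<tau> \<omega>)) \<omega>)"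
        by (auto simp: indicator_def fun_eq_iff)
      with 2 show "(\<lambda>\<omega>. indicator {\<omega>. ennreal s < \<tau> \<omega> \<and> \<tau> \<omega> \<le> ennreal t} \<omega> * Y (enn2real (\<tau> \<omega>)) \<omega>) \<in> borel_measurable M"
        by simp
    qed (use intm[OF s(1)] intm[OF t] inti[OF s(1)] inti[OF t] in \<open>auto intro!: borel_measurable_add borel_measurable_diff\<close>)
    also have "\<dots> = (\<integral>\<omega>. Y (min (enn2real (\<tau> \<omega>)) t) \<omega> \<partial>M) - (\<integral>\<omega>. Y (min (enn2real (\<tau> \<omega>)) s) \<omega> \<partial>M) +
        (\<integral>\<omega>. indicator (?gt s) \<omega> * Y s \<omega> \<partial>M) - (\<integral>\<omega>. indicator (?gt t) \<omega> * Y t \<omega> \<partial>M)"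
      using intm[OF s(1)] intm[OF t] inti[OF s(1)] inti[OF t] by simp
    also have "\<dots> = (\<integral>\<omega>. \<xi> \<omega> * (1 - C s \<omega>) \<partial>M) - (\<integral>\<omega>. \<xi> \<omega> * (1 - C t \<omega>) \<partial>M)"
      using pseudo_stopped_expectation[OF \<tau> \<tau>_AE(2) Y s(1)] pseudo_stopped_expectation[OF \<tau> \<tau>_AE(2) Y t]
        swap[OF s(1)] swap[OF t] by simp
    also have "\<dots> = (\<integral>\<omega>. \<xi> \<omega> * (1 - C s \<omega>) - \<xi> \<omega> * (1 - C t \<omega>) \<partial>M)"
    proof (rule Bochner_Integration.integral_diff[symmetric])
      have "integrable M (\<lambda>\<omega>. \<xi> \<omega> * (1 - C u \<omega>))" if [measurable]: "C u \<in> borel_measurable M" for u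
      proof (rule integrable_bounded[of _ 1])
        show "\<bar>\<xi> \<omega> * (1 - C u \<omega>)\<bar> \<le> 1" for \<omega>
          using \<xi>_abs[of \<omega>] C_abs[of u \<omega>] by (simp only: abs_mult) (intro mult_le_one, auto)
      qed measurable
      then show "integrable M (\<lambda>\<omega>. \<xi> \<omega> * (1 - C s \<omega>))" "integrable M (\<lambda>\<omega>. \<xi> \<omega> * (1 - C t \<omega>))"
        using C_M s t by auto
    qed
    finally show ?thesis by (simp add: algebra_simps)
  qed
  have C_mono: "AE \<omega> in M. C s \<omega> \<le> C t \<omega>" if s: "0 \<le> s" "s \<le> t" for s t
  proof -
    have t: "0 \<le> t" using s by simp
    note [measurable] = C_M[OF s(1)] C_M[OF t]
    \<comment> \<open>The test variable is the indicator of the event on which \<open>C\<close>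
      decreases from \<open>s\<close> to \<open>t\<close>. The duality equates the mean of a
      nonnegative variable, since \<open>Y \<ge> 0\<close>, with the mean of a nonpositive one, so
      the event is null.\<close>
    define \<xi> where "\<xi> \<omega> = (if C t \<omega> < C s \<omega> then 1 else 0 :: real)" for \<omega>
    have "\<xi> \<in> borel_measurable M" unfolding \<xi>_def[abs_def] by measurable
    moreover have "0 \<le> \<xi> \<omega> \<and> \<xi> \<omega> \<le> 1" for \<omega> by (simp add: \<xi>_def)
    ultimately obtain Y where Y: "unit_version \<xi> Y" using unit_version_ex by blast
    have int: "integrable M (\<lambda>\<omega>. \<xi> \<omega> * (C s \<omega> - C t \<omega>))"
    proof (rule integrable_bounded[of _ 1])
      show "(\<lambda>\<omega>. \<xi> \<omega> * (C s \<omega> - C t \<omega>)) \<in> borel_measurable M" unfolding \<xi>_def by measurable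
      show "\<bar>\<xi> \<omega> * (C s \<omega> - C t \<omega>)\<bar> \<le> 1" for \<omega>
        using C_bd[of s \<omega>] C_bd[of t \<omega>] by (auto simp: \<xi>_def)
    qed
    have "0 \<le> (\<integral>\<omega>. indicator {\<omega>. ennreal s < \<tau> \<omega> \<and> \<tau> \<omega> \<le> ennreal t} \<omega> * Y (enn2real (\<tau> \<omega>)) \<omega> \<partial>M)"
      using unit_versionD(6)[OF Y] by (intro integral_nonneg_AE AE_I2) (auto simp: indicator_def)
    also have "\<dots> = (\<integral>\<omega>. - (\<xi> \<omega> * (C s \<omega> - C t \<omega>)) \<partial>M)"
      by (subst C_pseudo[OF Y s]) (simp add: algebra_simps)
    finally have "(\<integral>\<omega>. \<xi> \<omega> * (C s \<omega> - C t \<omega>) \<partial>M) \<le> 0" by simp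
    moreover have nn: "AE \<omega> in M. 0 \<le> \<xi> \<omega> * (C s \<omega> - C t \<omega>)" by (rule AE_I2) (simp add: \<xi>_def)
    moreover have "0 \<le> (\<integral>\<omega>. \<xi> \<omega> * (C s \<omega> - C t \<omega>) \<partial>M)" by (rule integral_nonneg_AE[OF nn])
    ultimately have "(\<integral>\<omega>. \<xi> \<omega> * (C s \<omega> - C t \<omega>) \<partial>M) = 0" by simp
    then have "AE \<omega> in M. \<xi> \<omega> * (C s \<omega> - C t \<omega>) = 0"
      using integral_nonneg_eq_0_iff_AE[OF int nn] by simp
    then show ?thesis by eventually_elim (auto simp: \<xi>_def split: if_splits)
  qed
  have C_0: "AE \<omega> in M. C 0 \<omega> = 0"
  proof -
    have "(\<integral>\<omega>. 1 * (1 - C 0 \<omega>) \<partial>M) = (\<integral>\<omega>. 1 * indicator (?gt 0) \<omega> \<partial>M)"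
      by (rule C_proj[of 0 "\<lambda>_. 1" 1]) auto
    also have "\<dots> = (\<integral>\<omega>. 1 \<partial>M)"
    proof (rule integral_cong_AE)
      show "AE \<omega> in M. 1 * indicator (?gt 0) \<omega> = (1::real)"
        using \<tau>_AE(1) by eventually_elim (simp add: indicator_def)
    qed (use ind_meas[of 0] in auto)
    also have "\<dots> = 1" by (simp add: prob_space)
    finally have "(\<integral>\<omega>. 1 - C 0 \<omega> \<partial>M) = 1" by simp
    moreover have int: "integrable M (C 0)"
      by (rule integrable_bounded[OF C_M[OF order_refl], of 1]) (use C_bd in auto)
    ultimately have "(\<integral>\<omega>. C 0 \<omega> \<partial>M) = 0" by (simp add: prob_space)
    then show ?thesis using integral_nonneg_eq_0_iff_AE[OF int] C_bd by auto
  qed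
  have "AE \<omega> in M. (\<forall>s\<in>\<rat> \<inter> {0..}. \<forall>t\<in>\<rat> \<inter> {0..}. s \<le> t \<longrightarrow> C s \<omega> \<le> C t \<omega>)"
  proof (subst AE_ball_countable)
    show cQ: "countable (\<rat> \<inter> {0::real..})" using countable_rat by (rule countable_subset[rotated]) auto
    show "\<forall>s\<in>\<rat> \<inter> {0..}. AE \<omega> in M. \<forall>t\<in>\<rat> \<inter> {0..}. s \<le> t \<longrightarrow> C s \<omega> \<le> C t \<omega>"
      using C_mono by (subst AE_ball_countable[OF cQ]) auto
  qed
  moreover have "AE \<omega> in M. \<forall>t\<in>\<rat> \<inter> {0..}. Z t \<omega> = 1 - C t \<omega>"
  proof (subst AE_ball_countable)
    show "countable (\<rat> \<inter> {0::real..})" using countable_rat by (rule countable_subset[rotated]) auto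
  qed (use Z_C in auto)
  ultimately have "AE \<omega> in M. (\<forall>s\<in>\<rat> \<inter> {0..}. \<forall>t\<in>\<rat> \<inter> {0..}. s \<le> t \<longrightarrow> C s \<omega> \<le> C t \<omega>) \<and> C 0 \<omega> = 0 \<and>
      (\<forall>t\<in>\<rat> \<inter> {0..}. Z t \<omega> = 1 - C t \<omega>)"
    using C_0 by eventually_elim blast
  then obtain N where N: "N \<in> null_sets M" and good: "\<And>\<omega>. \<omega> \<in> space M \<Longrightarrow> \<omega> \<notin> N \<Longrightarrow>
      (\<forall>s\<in>\<rat> \<inter> {0..}. \<forall>t\<in>\<rat> \<inter> {0..}. s \<le> t \<longrightarrow> C s \<omega> \<le> C t \<omega>) \<and> C 0 \<omega> = 0 \<and>
      (\<forall>t\<in>\<rat> \<inter> {0..}. Z t \<omega> = 1 - C t \<omega>)"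
    using AE_E_null by blast
  define D where "D t \<omega> = (if \<omega> \<in> N then 0 else C t \<omega>)" for t \<omega>
  have D_eq: "AE \<omega> in M. \<forall>t. D t \<omega> = C t \<omega>"
    by (rule AE_I'[OF N]) (auto simp: D_def)
  have D_path: "increasing_path (\<lambda>t. D t \<omega>) \<and> cadlag_path (\<lambda>t. D t \<omega>) \<and> D 0 \<omega> = 0" if \<omega>: "\<omega> \<in> space M" for \<omega>
  proof (cases "\<omega> \<in> N")
    case True
    then show ?thesis by (auto simp: D_def increasing_path_def mono_on_def cadlag_path_def intro: tendsto_const)
  next
    case False
    have cad: "cadlag_path (\<lambda>t. C t \<omega>)" by (rule C_cadlag[OF \<omega>])
    have Q_mono: "C s \<omega> \<le> C t \<omega>" if "s \<in> \<rat>" "t \<in> \<rat>" "0 \<le> s" "s \<le> t" for s t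
      using good[OF \<omega> False] that by auto
    have mono: "C s \<omega> \<le> C t \<omega>" if st: "0 \<le> s" "s < t" for s t
    proof -
      have 1: "C s \<omega> \<le> C q \<omega>" if "q \<in> \<rat>" "s < q" for q
      proof (rule cadlag_path_le_if_le_on_Rats[OF cad _ st(1) that(2), of "\<lambda>_. C q \<omega>"])
        show "cadlag_path (\<lambda>_. C q \<omega>)" by (auto simp: cadlag_path_def intro: tendsto_const)
      qed (use Q_mono that st in auto)
      show ?thesis
      proof (rule cadlag_path_le_if_le_on_Rats[OF _ cad, of "\<lambda>_. C s \<omega>" t "t + 1"])
        show "cadlag_path (\<lambda>_. C s \<omega>)" by (auto simp: cadlag_path_def intro: tendsto_const)
      qed (use 1 st in auto)
    qed
    have "mono_on {0..} (\<lambda>t. C t \<omega>)"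
      by (rule mono_onI) (use mono in \<open>auto simp: le_less\<close>)
    then show ?thesis using False good[OF \<omega> False] cad
      by (simp add: D_def increasing_path_def cadlag_path_def)
  qed
  have D_Z: "AE \<omega> in M. \<forall>t\<ge>0. D t \<omega> = 1 - Z t \<omega>"
    using D_eq AE_space AE_not_in[OF N]
  proof eventually_elim
    case (elim \<omega>)
    show ?case
    proof (intro allI impI)
      fix t :: real assume t: "0 \<le> t"
      have "cadlag_path (\<lambda>t. Z t \<omega>)" using Z_cadlag elim(2) by (simp add: cadlag_def)
      moreover have "cadlag_path (\<lambda>t. 1 - C t \<omega>)"
        using C_cadlag[OF elim(2)] clamp_cadlag_path[of "\<lambda>t. C t \<omega>"] C_bd by (simp add: max_absorb2 min_absorb2)
      ultimately have "Z t \<omega> = 1 - C t \<omega>"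
        by (rule cadlag_path_eq_if_eq_on_Rats[OF _ _ _ t]) (use good[OF elim(2)] elim(3) in auto)
      then show "D t \<omega> = 1 - Z t \<omega>" using elim(1) by simp
    qed
  qed
  have "regular_compensator \<tau> D"
    unfolding regular_compensator_def
  proof (intro conjI allI impI ballI)
    show "adapted F D"
      unfolding adapted_def
    proof (intro allI impI)
      fix t :: real assume t: "0 \<le> t"
      show "D t \<in> borel_measurable (F t)"
        by (rule measurable_F_cong_AE[OF C_F[OF t] _ t]) (use D_eq in auto)
    qed
    show "0 \<le> D t \<omega>" "D t \<omega> \<le> 1" for t \<omega> using C_bd by (auto simp: D_def)
    fix t :: real assume t: "0 \<le> t"
    have le_eq: "indicator {\<omega>. \<tau> \<omega> \<le> ennreal t} \<omega> = (1::real) - indicator (?gt t) \<omega>" for \<omega>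
      by (auto simp: indicator_def)
    have "AE \<omega> in M. real_cond_exp M (F t) (indicator {\<omega>. \<tau> \<omega> \<le> ennreal t}) \<omega> = C t \<omega>"
    proof (rule cond_exp_versionI[OF t C_F[OF t]])
      show "\<bar>C t \<omega>\<bar> \<le> 1" for \<omega> using C_bd[of t \<omega>] by simp
      show "(\<lambda>\<omega>. indicator {\<omega>. \<tau> \<omega> \<le> ennreal t} \<omega> :: real) \<in> borel_measurable M"
        unfolding le_eq using ind_meas[of t] by simp
      show "\<bar>indicator {\<omega>. \<tau> \<omega> \<le> ennreal t} \<omega>\<bar> \<le> (1::real)" for \<omega> by (simp add: indicator_def)
      fix B assume B: "B \<in> sets (F t)"
      have BM: "B \<in> sets M" by (rule sets_F[OF t B])
      have intB: "integrable M (\<lambda>\<omega>. indicator B \<omega> :: real)" using BM by (intro integrable_bounded[of _ 1]) (auto simp: indicator_def)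
      have i1: "integrable M (\<lambda>\<omega>. indicator B \<omega> * (1 - C t \<omega>))"
        using C_bd[of t] C_M[OF t] BM by (intro integrable_bounded[of _ 1]) (auto simp: indicator_def abs_le_iff)
      have i2: "integrable M (\<lambda>\<omega>. indicator B \<omega> * indicator (?gt t) \<omega> :: real)"
        using ind_meas[of t] BM by (intro integrable_bounded[of _ 1] borel_measurable_times) (auto simp: indicator_def)
      have "(\<integral>\<omega>. indicator B \<omega> * C t \<omega> \<partial>M) = (\<integral>\<omega>. indicator B \<omega> - indicator B \<omega> * (1 - C t \<omega>) \<partial>M)"
        by (simp add: algebra_simps)
      also have "\<dots> = (\<integral>\<omega>. indicator B \<omega> \<partial>M) - (\<integral>\<omega>. indicator B \<omega> * (1 - C t \<omega>) \<partial>M)"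
        by (rule Bochner_Integration.integral_diff[OF intB i1])
      also have "(\<integral>\<omega>. indicator B \<omega> * (1 - C t \<omega>) \<partial>M) = (\<integral>\<omega>. indicator B \<omega> * indicator (?gt t) \<omega> \<partial>M)"
        by (rule C_proj[OF t, of _ 1]) (use B in \<open>auto simp: indicator_def\<close>)
      also have "(\<integral>\<omega>. indicator B \<omega> \<partial>M) - (\<integral>\<omega>. indicator B \<omega> * (indicator (?gt t) \<omega> :: real) \<partial>M) =
          (\<integral>\<omega>. indicator B \<omega> - indicator B \<omega> * indicator (?gt t) \<omega> \<partial>M)"
        by (rule Bochner_Integration.integral_diff[OF intB i2, symmetric])
      also have "\<dots> = (\<integral>\<omega>. indicator B \<omega> * indicator {\<omega>. \<tau> \<omega> \<le> ennreal t} \<omega> \<partial>M)"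
        unfolding le_eq by (simp add: algebra_simps)
      finally show "(\<integral>\<omega>. indicator B \<omega> * C t \<omega> \<partial>M) = (\<integral>\<omega>. indicator B \<omega> * indicator {\<omega>. \<tau> \<omega> \<le> ennreal t} \<omega> \<partial>M)" .
    qed
    then show "AE \<omega> in M. D t \<omega> = real_cond_exp M (F t) (indicator {\<omega>. \<tau> \<omega> \<le> ennreal t}) \<omega>"
      using D_eq by eventually_elim simp
  next
    fix \<xi> Y and s t :: real assume Y: "unit_version \<xi> Y" and s: "0 \<le> s" "s \<le> t"
    have t: "0 \<le> t" using s by simp
    have "(\<integral>\<omega>. \<xi> \<omega> * (C t \<omega> - C s \<omega>) \<partial>M) = (\<integral>\<omega>. \<xi> \<omega> * (D t \<omega> - D s \<omega>) \<partial>M)"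
    proof (rule integral_cong_AE)
      note [measurable] = unit_versionD(1)[OF Y] C_M[OF s(1)] C_M[OF t]
      have [measurable]: "N \<in> sets M" using N by auto
      show "(\<lambda>\<omega>. \<xi> \<omega> * (C t \<omega> - C s \<omega>)) \<in> borel_measurable M" by measurable
      show "(\<lambda>\<omega>. \<xi> \<omega> * (D t \<omega> - D s \<omega>)) \<in> borel_measurable M" unfolding D_def by measurable
      show "AE \<omega> in M. \<xi> \<omega> * (C t \<omega> - C s \<omega>) = \<xi> \<omega> * (D t \<omega> - D s \<omega>)"
        using D_eq by eventually_elim simp
    qed
    then show "(\<integral>\<omega>. indicator {\<omega>. ennreal s < \<tau> \<omega> \<and> \<tau> \<omega> \<le> ennreal t} \<omega> * Y (enn2real (\<tau> \<omega>)) \<omega> \<partial>M) =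
       (\<integral>\<omega>. \<xi> \<omega> * (D t \<omega> - D s \<omega>) \<partial>M)"
      using C_pseudo[OF Y s] by simp
  qed (use D_path in auto)
  then show ?thesis using that D_Z by blast
qed

end

section \<open>Left continuity of the compensator\<close>

lemma dyadic_above_const:
  assumes "0 \<le> r" "r \<le> s" "s < dyadic_above n r"
  shows "dyadic_above n s = dyadic_above n r"
proof -
  have eq: "real (nat \<lfloor>r * 2 ^ n\<rfloor> + 1) = real_of_int \<lfloor>r * 2 ^ n\<rfloor> + 1" using assms(1) by simp
  have "s * 2 ^ n < real_of_int \<lfloor>r * 2 ^ n\<rfloor> + 1"
    using assms(3) unfolding dyadic_above_def eq by (simp add: field_simps)
  moreover have "real_of_int \<lfloor>r * 2 ^ n\<rfloor> \<le> s * 2 ^ n"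
    by (rule order_trans[OF of_int_floor_le mult_right_mono[OF assms(2)]]) simp
  ultimately have "\<lfloor>s * 2 ^ n\<rfloor> = \<lfloor>r * 2 ^ n\<rfloor>" by (intro floor_unique)
  then show ?thesis by (simp add: dyadic_above_def)
qed

lemma dyadic_above_cell:
  assumes "real j / 2 ^ n \<le> r" "r < real (Suc j) / 2 ^ n"
  shows "dyadic_above n r = real (Suc j) / 2 ^ n"
proof -
  have "\<lfloor>r * 2 ^ n\<rfloor> = int j" using assms by (intro floor_unique) (auto simp: field_simps)
  then show ?thesis by (simp add: dyadic_above_def)
qed

lemma dyadic_above_antimono:
  assumes "0 \<le> r"
  shows "dyadic_above (Suc n) r \<le> dyadic_above n r"
proof -
  have "r * 2 ^ Suc n < 2 * (real_of_int \<lfloor>r * 2 ^ n\<rfloor> + 1)" by simp linarith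
  then have "\<lfloor>r * 2 ^ Suc n\<rfloor> < 2 * (\<lfloor>r * 2 ^ n\<rfloor> + 1)" by (simp add: floor_less_iff)
  then have "\<lfloor>r * 2 ^ Suc n\<rfloor> + 1 \<le> 2 * (\<lfloor>r * 2 ^ n\<rfloor> + 1)" by linarith
  then have "real_of_int (\<lfloor>r * 2 ^ Suc n\<rfloor> + 1) \<le> real_of_int (2 * (\<lfloor>r * 2 ^ n\<rfloor> + 1))" by (simp only: of_int_le_iff)
  then have "real_of_int \<lfloor>r * 2 ^ Suc n\<rfloor> + 1 \<le> 2 * (real_of_int \<lfloor>r * 2 ^ n\<rfloor> + 1)" by (simp only: of_int_add of_int_mult of_int_1 of_int_numeral)
  then have "(real_of_int \<lfloor>r * 2 ^ Suc n\<rfloor> + 1) / 2 ^ Suc n \<le> 2 * (real_of_int \<lfloor>r * 2 ^ n\<rfloor> + 1) / 2 ^ Suc n"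
    by (rule divide_right_mono) simp
  also have "\<dots> = (real_of_int \<lfloor>r * 2 ^ n\<rfloor> + 1) / 2 ^ n" by (simp add: field_simps)
  finally show ?thesis using assms by (simp add: dyadic_above_def add.commute)
qed

context usual_filtered_prob_space
begin

lemma stopping_time_less:
  assumes T: "stopping_time_ext M F T" and t: "0 \<le> t"
  shows "{\<omega> \<in> space M. T \<omega> < ennreal t} \<in> sets (F t)"
proof -
  have "{\<omega> \<in> space M. T \<omega> < ennreal t} = (\<Union>q\<in>\<rat> \<inter> {0..<t}. {\<omega> \<in> space M. T \<omega> \<le> ennreal q})"
  proof (intro set_eqI iffI)
    fix \<omega> assume \<omega>: "\<omega> \<in> {\<omega> \<in> space M. T \<omega> < ennreal t}"
    then obtain x where x: "T \<omega> = ennreal x" "0 \<le> x" by (cases "T \<omega>") auto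
    then have "x < t" using \<omega> by (simp add: ennreal_less_iff)
    then obtain q where "q \<in> \<rat>" "x < q" "q < t" using Rats_dense_in_real by blast
    then show "\<omega> \<in> (\<Union>q\<in>\<rat> \<inter> {0..<t}. {\<omega> \<in> space M. T \<omega> \<le> ennreal q})"
      using x \<omega> by (intro UN_I[of q]) (auto intro: ennreal_leI)
  next
    fix \<omega> assume "\<omega> \<in> (\<Union>q\<in>\<rat> \<inter> {0..<t}. {\<omega> \<in> space M. T \<omega> \<le> ennreal q})"
    then obtain q where "0 \<le> q" "q < t" "\<omega> \<in> space M" "T \<omega> \<le> ennreal q" by auto
    moreover from this have "ennreal q < ennreal t" by (simp add: ennreal_less_iff)
    ultimately show "\<omega> \<in> {\<omega> \<in> space M. T \<omega> < ennreal t}" by (auto intro: le_less_trans)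
  qed
  also have "\<dots> \<in> sets (F t)"
  proof (rule sets.countable_UN')
    show "countable (\<rat> \<inter> {0..<t})" using countable_rat by (rule countable_subset[rotated]) auto
    show "(\<lambda>q. {\<omega> \<in> space M. T \<omega> \<le> ennreal q}) ` (\<rat> \<inter> {0..<t}) \<subseteq> sets (F t)"
    proof (rule image_subsetI)
      fix q assume q: "q \<in> \<rat> \<inter> {0..<t}"
      then have "{\<omega> \<in> space M. T \<omega> \<le> ennreal q} \<in> sets (F q)" using T by (simp add: stopping_time_ext_def)
      then show "{\<omega> \<in> space M. T \<omega> \<le> ennreal q} \<in> sets (F t)" by (rule sets_F_mono) (use q in auto)
    qed
  qed
  finally show ?thesis .
qed

text \<open>If \<open>U n\<close> is the conditional probability that \<open>\<tau>\<close> occurs before the next point of the \<open>n\<close>-th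
  dyadic grid, then sampling at the first passage time \<open>S\<close> over \<open>\<delta>\<close> bounds \<open>\<delta> P(S < R)\<close> by the
  probability that \<open>\<tau>\<close> lies between \<open>S\<close> and the next grid point. The latter events shrink to
  \<open>\<tau> = sup S\<close>, which avoidance excludes.\<close>

lemma first_passage_vanishes:
  fixes \<tau> :: "'a \<Rightarrow> ennreal" and U :: "nat \<Rightarrow> real \<Rightarrow> 'a \<Rightarrow> real" and R :: nat
  defines "ind \<equiv> \<lambda>d \<omega>. indicator {\<omega>. \<tau> \<omega> \<le> ennreal d} \<omega> :: real"
  assumes \<tau>[measurable]: "\<tau> \<in> borel_measurable M" and avoids: "avoids_stopping_times M F \<tau>"
    and U_bd: "\<And>n r \<omega>. 0 \<le> U n r \<omega> \<and> U n r \<omega> \<le> 1"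
    and U_F: "\<And>n r. 0 \<le> r \<Longrightarrow> U n r \<in> borel_measurable (F r)"
    and U_right: "\<And>n r \<omega>. 0 \<le> r \<Longrightarrow> \<omega> \<in> space M \<Longrightarrow> ((\<lambda>r. U n r \<omega>) \<longlongrightarrow> U n r \<omega>) (at_right r)"
    and U_dec: "\<And>n r \<omega>. 0 \<le> r \<Longrightarrow> \<omega> \<in> space M \<Longrightarrow> U (Suc n) r \<omega> \<le> U n r \<omega>"
    and proj: "\<And>n q J. 0 \<le> q \<Longrightarrow> J \<in> sets (F q) \<Longrightarrow>
      (\<integral>\<omega>. indicator J \<omega> * U n q \<omega> \<partial>M) = (\<integral>\<omega>. indicator J \<omega> * (ind (dyadic_above n q) \<omega> - ind q \<omega>) \<partial>M)"
    and \<delta>: "0 < \<delta>"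
  shows "(\<lambda>n. \<integral>\<omega>. indicator {\<omega> \<in> space M. \<exists>r. 0 \<le> r \<and> r < real R \<and> \<delta> < U n r \<omega>} \<omega> \<partial>M) \<longlonglongrightarrow> (0::real)"
    and "{\<omega> \<in> space M. \<exists>r. 0 \<le> r \<and> r < real R \<and> \<delta> < U n r \<omega>} \<in> sets M"
proof -
  define S where "S n = hitting_time (\<lambda>r \<omega>. \<delta> < U n r \<omega>) 0" for n
  have S_stop: "stopping_time_ext M F (S n)" for n
    unfolding S_def
  proof (rule stopping_time_hitting_time[OF order_refl])
    fix r :: real assume r: "0 \<le> r"
    have "{\<omega> \<in> space (F r). \<delta> < U n r \<omega>} \<in> sets (F r)" using U_F[OF r, of n] by measurable
    then show "{\<omega> \<in> space M. \<delta> < U n r \<omega>} \<in> sets (F r)" by (simp add: space_F r)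
  next
    fix r \<omega> assume "\<omega> \<in> space M" "0 \<le> r" "\<delta> < U n r \<omega>"
    from order_tendstoD(1)[OF U_right[OF this(2,1)] this(3)]
    show "\<exists>s>r. \<forall>u. r < u \<longrightarrow> u < s \<longrightarrow> \<delta> < U n u \<omega>" by (auto simp: eventually_at_right_field)
  qed
  have S_less_iff: "S n \<omega> < ennreal (real R) \<longleftrightarrow> (\<exists>r. 0 \<le> r \<and> r < real R \<and> \<delta> < U n r \<omega>)" for n \<omega>
    unfolding S_def hitting_time_less_iff by (auto simp: ennreal_less_iff)
  have S_mono: "S n \<omega> \<le> S n' \<omega>" if "n \<le> n'" and \<omega>: "\<omega> \<in> space M" for n n' \<omega>
    using that(1)
  proof (induction n' rule: dec_induct)
    case (step n')
    have "S n' \<omega> \<le> S (Suc n') \<omega>"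
      unfolding S_def hitting_time_def using U_dec[OF _ \<omega>] by (intro Inf_superset_mono) (force intro: less_le_trans)
    then show ?case using step.IH by (rule order_trans[rotated])
  qed simp
  have U_S: "\<delta> \<le> U n x \<omega>" if S: "S n \<omega> = ennreal x" and x: "0 \<le> x" and \<omega>: "\<omega> \<in> space M" for n \<omega> x
  proof (rule ccontr)
    assume "\<not> ?thesis"
    then have lt: "U n x \<omega> < \<delta>" by simp
    from order_tendstoD(2)[OF U_right[OF x \<omega>] lt]
    obtain c where c: "x < c" "\<And>u. x < u \<Longrightarrow> u < c \<Longrightarrow> U n u \<omega> < \<delta>" by (auto simp: eventually_at_right_field)
    have "hitting_time (\<lambda>r \<omega>. \<delta> < U n r \<omega>) 0 \<omega> < ennreal c" using S x c(1) by (simp add: S_def[symmetric] ennreal_less_iff)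
    then obtain r where r: "0 \<le> r" "\<delta> < U n r \<omega>" "r < c" unfolding hitting_time_less_iff by (auto simp: ennreal_less_iff)
    have "S n \<omega> \<le> ennreal r" unfolding S_def hitting_time_def using r by (intro Inf_lower) auto
    then have "x \<le> r" using S r by simp
    then show False using c(2)[of r] r lt by (cases "x = r") auto
  qed
  have ind_meas[measurable]: "ind d \<in> borel_measurable M" for d
    unfolding ind_def by (rule indicator_le_time_measurable[OF \<tau>])
  have ind_bd: "0 \<le> ind d \<omega>" "ind d \<omega> \<le> 1" for d \<omega> by (auto simp: ind_def indicator_def)
  define B where "B n = {\<omega> \<in> space M. S n \<omega> < ennreal (real R)}" for n
  have B_M[measurable]: "B n \<in> sets M" for n
    using sets_F[OF _ stopping_time_less[OF S_stop]] by (simp add: B_def)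
  have U_M[measurable]: "U n q \<in> borel_measurable M" if "0 \<le> q" for n q by (rule measurable_F_M[OF U_F[OF that] that])
  define \<sigma> where "\<sigma> n \<omega> = enn2real (S n \<omega>)" for n \<omega>
  have \<sigma>: "0 \<le> \<sigma> n \<omega>" for n \<omega> by (simp add: \<sigma>_def)
  have S_\<sigma>: "S n \<omega> = ennreal (\<sigma> n \<omega>)" if "\<omega> \<in> B n" for n \<omega>
    using that by (auto simp: B_def \<sigma>_def less_top[symmetric] dest: less_trans[OF _ ennreal_less_top])
  \<comment> \<open>The event that the passage time \<open>S n\<close> lies in the
    \<open>j\<close>-th cell of the \<open>k\<close>-th grid, which is known at the right end of
    that cell. Replacing the passage time by this right end leaves finitely many values below
    \<open>R\<close>, so \<open>proj\<close> can be summed. The grid index \<open>k\<close> only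
    approximates the passage time and tends to infinity while \<open>n\<close> is fixed.\<close>
  define J where "J n k j = {\<omega> \<in> space M. S n \<omega> < ennreal (real (Suc j) / 2 ^ k)} - {\<omega> \<in> space M. S n \<omega> < ennreal (real j / 2 ^ k)}"
    for n k j :: nat
  have J_F: "J n k j \<in> sets (F (real (Suc j) / 2 ^ k))" for n k j
    unfolding J_def
  proof (rule sets.Diff)
    show "{\<omega> \<in> space M. S n \<omega> < ennreal (real (Suc j) / 2 ^ k)} \<in> sets (F (real (Suc j) / 2 ^ k))"
      by (rule stopping_time_less[OF S_stop]) simp
    show "{\<omega> \<in> space M. S n \<omega> < ennreal (real j / 2 ^ k)} \<in> sets (F (real (Suc j) / 2 ^ k))"
      by (rule sets_F_mono[OF stopping_time_less[OF S_stop]]) (auto intro: divide_right_mono)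
  qed
  have J_M: "J n k j \<in> sets M" for n k j by (rule sets_F[OF _ J_F]) simp
  have J_iff: "\<omega> \<in> J n k j \<longleftrightarrow> j = nat \<lfloor>\<sigma> n \<omega> * 2 ^ k\<rfloor>" if \<omega>: "\<omega> \<in> B n" for n k j \<omega>
  proof -
    have "\<omega> \<in> J n k j \<longleftrightarrow> real j / 2 ^ k \<le> \<sigma> n \<omega> \<and> \<sigma> n \<omega> < real (Suc j) / 2 ^ k"
      using \<omega> \<sigma>[of n \<omega>] by (auto simp: J_def S_\<sigma>[OF \<omega>] B_def ennreal_less_iff not_less simp del: of_nat_Suc)
    also have "\<dots> \<longleftrightarrow> \<lfloor>\<sigma> n \<omega> * 2 ^ k\<rfloor> = int j"
      by (simp add: floor_eq_iff field_simps)
    also have "\<dots> \<longleftrightarrow> j = nat \<lfloor>\<sigma> n \<omega> * 2 ^ k\<rfloor>" using \<sigma>[of n \<omega>] by auto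
    finally show ?thesis .
  qed
  have cells: "indicator (B n) \<omega> * f (dyadic_above k (\<sigma> n \<omega>)) =
      (\<Sum>j<R * 2 ^ k. indicator (J n k j) \<omega> * f (real (Suc j) / 2 ^ k))"
    if \<omega>: "\<omega> \<in> space M" for f :: "real \<Rightarrow> real" and n k \<omega>
  proof (cases "\<omega> \<in> B n")
    case True
    define j0 where "j0 = nat \<lfloor>\<sigma> n \<omega> * 2 ^ k\<rfloor>"
    have "\<sigma> n \<omega> < real R" using True \<sigma>[of n \<omega>] by (simp add: B_def S_\<sigma>[OF True] ennreal_less_iff)
    then have "\<sigma> n \<omega> * 2 ^ k < real (R * 2 ^ k)" by simp
    then have "\<lfloor>\<sigma> n \<omega> * 2 ^ k\<rfloor> < int (R * 2 ^ k)" by (simp add: floor_less_iff)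
    then have j0: "j0 < R * 2 ^ k" unfolding j0_def using \<sigma>[of n \<omega>] by (simp add: nat_less_iff)
    have "(\<Sum>j<R * 2 ^ k. indicator (J n k j) \<omega> * f (real (Suc j) / 2 ^ k)) =
        (\<Sum>j<R * 2 ^ k. if j = j0 then f (real (Suc j) / 2 ^ k) else 0)"
      by (intro sum.cong refl) (simp add: indicator_def J_iff[OF True] j0_def)
    also have "\<dots> = f (real (Suc j0) / 2 ^ k)" using j0 by (simp add: sum.delta)
    also have "real (Suc j0) / 2 ^ k = dyadic_above k (\<sigma> n \<omega>)" by (simp add: dyadic_above_def j0_def)
    finally show ?thesis using True by simp
  next
    case False
    have "\<omega> \<notin> J n k j" if "j < R * 2 ^ k" for j
    proof
      assume "\<omega> \<in> J n k j"
      then have "S n \<omega> < ennreal (real (Suc j) / 2 ^ k)" by (simp add: J_def)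
      also have "real (Suc j) \<le> real (R * 2 ^ k)" using that by (simp only: of_nat_le_iff Suc_le_eq)
      then have "ennreal (real (Suc j) / 2 ^ k) \<le> ennreal (real R)" by (intro ennreal_leI) (simp add: field_simps)
      finally show False using False \<omega> by (simp add: B_def)
    qed
    then show ?thesis using False by simp
  qed
  define h where "h n q \<omega> = ind (dyadic_above n q) \<omega> - ind q \<omega>" for n q \<omega>
  have h_M[measurable]: "h n q \<in> borel_measurable M" for n q unfolding h_def by measurable
  have h_bd: "\<bar>h n q \<omega>\<bar> \<le> 1" for n q \<omega> using ind_bd[of "dyadic_above n q" \<omega>] ind_bd[of q \<omega>] by (simp add: h_def)
  have U_abs: "\<bar>U n q \<omega>\<bar> \<le> 1" for n q \<omega> using U_bd[of n q \<omega>] by simp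
  have grid_nonneg: "0 \<le> real (Suc j) / 2 ^ k" for j k by simp
  have grid: "(\<integral>\<omega>. indicator (B n) \<omega> * U n (dyadic_above k (\<sigma> n \<omega>)) \<omega> \<partial>M) =
      (\<integral>\<omega>. indicator (B n) \<omega> * h n (dyadic_above k (\<sigma> n \<omega>)) \<omega> \<partial>M)" for n k
  proof -
    have int1: "integrable M (\<lambda>\<omega>. indicator (J n k j) \<omega> * U n (real (Suc j) / 2 ^ k) \<omega>)" for j
    proof (rule integrable_bounded[of _ 1])
      show "(\<lambda>\<omega>. indicator (J n k j) \<omega> * U n (real (Suc j) / 2 ^ k) \<omega>) \<in> borel_measurable M"
        by (intro borel_measurable_times borel_measurable_indicator J_M U_M) simp
    qed (use U_abs in \<open>auto simp: indicator_def\<close>)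
    have int2: "integrable M (\<lambda>\<omega>. indicator (J n k j) \<omega> * h n (real (Suc j) / 2 ^ k) \<omega>)" for j
    proof (rule integrable_bounded[of _ 1])
      show "(\<lambda>\<omega>. indicator (J n k j) \<omega> * h n (real (Suc j) / 2 ^ k) \<omega>) \<in> borel_measurable M"
        by (intro borel_measurable_times borel_measurable_indicator J_M h_M)
    qed (use h_bd in \<open>auto simp: indicator_def\<close>)
    have "(\<integral>\<omega>. indicator (B n) \<omega> * U n (dyadic_above k (\<sigma> n \<omega>)) \<omega> \<partial>M) =
        (\<integral>\<omega>. (\<Sum>j<R * 2 ^ k. indicator (J n k j) \<omega> * U n (real (Suc j) / 2 ^ k) \<omega>) \<partial>M)"
      by (intro Bochner_Integration.integral_cong refl cells)
    also have "\<dots> = (\<Sum>j<R * 2 ^ k. \<integral>\<omega>. indicator (J n k j) \<omega> * U n (real (Suc j) / 2 ^ k) \<omega> \<partial>M)"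
      by (rule Bochner_Integration.integral_sum[OF int1])
    also have "\<dots> = (\<Sum>j<R * 2 ^ k. \<integral>\<omega>. indicator (J n k j) \<omega> * h n (real (Suc j) / 2 ^ k) \<omega> \<partial>M)"
      unfolding h_def by (intro sum.cong refl proj grid_nonneg J_F)
    also have "\<dots> = (\<integral>\<omega>. (\<Sum>j<R * 2 ^ k. indicator (J n k j) \<omega> * h n (real (Suc j) / 2 ^ k) \<omega>) \<partial>M)"
      by (rule Bochner_Integration.integral_sum[OF int2, symmetric])
    also have "\<dots> = (\<integral>\<omega>. indicator (B n) \<omega> * h n (dyadic_above k (\<sigma> n \<omega>)) \<omega> \<partial>M)"
      by (intro Bochner_Integration.integral_cong refl cells[symmetric])
    finally show ?thesis .
  qed
  have meas_U: "(\<lambda>\<omega>. indicator (B n) \<omega> * U n (dyadic_above k (\<sigma> n \<omega>)) \<omega>) \<in> borel_measurable M" for n k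
  proof -
    have "(\<lambda>\<omega>. \<Sum>j<R * 2 ^ k. indicator (J n k j) \<omega> * U n (real (Suc j) / 2 ^ k) \<omega>) \<in> borel_measurable M"
      by (intro borel_measurable_sum borel_measurable_times borel_measurable_indicator J_M U_M) simp
    then show ?thesis by (rule measurable_cong[THEN iffD1, rotated]) (rule cells[symmetric])
  qed
  have meas_h: "(\<lambda>\<omega>. indicator (B n) \<omega> * h n (dyadic_above k (\<sigma> n \<omega>)) \<omega>) \<in> borel_measurable M" for n k
  proof -
    have "(\<lambda>\<omega>. \<Sum>j<R * 2 ^ k. indicator (J n k j) \<omega> * h n (real (Suc j) / 2 ^ k) \<omega>) \<in> borel_measurable M"
      by (intro borel_measurable_sum borel_measurable_times borel_measurable_indicator J_M h_M)
    then show ?thesis by (rule measurable_cong[THEN iffD1, rotated]) (rule cells[symmetric])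
  qed
  have above: "filterlim (\<lambda>k. dyadic_above k r) (at_right r) sequentially" if "0 \<le> r" for r
    using dyadic_above_tendsto[OF that] dyadic_above(1)[OF that]
    by (auto simp: filterlim_at less_imp_neq[THEN not_sym] intro!: always_eventually)
  have lim_U: "(\<lambda>k. indicator (B n) \<omega> * U n (dyadic_above k (\<sigma> n \<omega>)) \<omega>) \<longlonglongrightarrow> indicator (B n) \<omega> * U n (\<sigma> n \<omega>) \<omega>"
    if "\<omega> \<in> space M" for n \<omega>
    by (intro tendsto_intros filterlim_compose[OF U_right[OF \<sigma> that] above[OF \<sigma>]])
  \<comment> \<open>The function \<open>h n\<close> is right-continuous in time: the next point of
    the \<open>n\<close>-th grid does not change just after the passage time, and the indicator of
    \<open>\<tau> \<le> r\<close> is right-continuous in \<open>r\<close>.\<close>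
  have lim_h: "(\<lambda>k. indicator (B n) \<omega> * h n (dyadic_above k (\<sigma> n \<omega>)) \<omega>) \<longlonglongrightarrow> indicator (B n) \<omega> * h n (\<sigma> n \<omega>) \<omega>"
    for n \<omega>
  proof (intro tendsto_intros tendsto_eventually)
    let ?r = "\<sigma> n \<omega>"
    have 1: "eventually (\<lambda>k. dyadic_above k ?r < dyadic_above n ?r) sequentially"
      by (rule order_tendstoD(2)[OF dyadic_above_tendsto[OF \<sigma>] dyadic_above(1)[OF \<sigma>]])
    have 2: "eventually (\<lambda>k. ind (dyadic_above k ?r) \<omega> = ind ?r \<omega>) sequentially"
    proof (cases "\<tau> \<omega> \<le> ennreal ?r")
      case True
      have "\<tau> \<omega> \<le> ennreal (dyadic_above k ?r)" for k
        using dyadic_above(1)[OF \<sigma>, of n \<omega> k] by (intro order_trans[OF True ennreal_leI]) simp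
      then show ?thesis using True by (simp add: ind_def)
    next
      case False
      have "eventually (\<lambda>k. \<not> \<tau> \<omega> \<le> ennreal (dyadic_above k ?r)) sequentially"
      proof (cases "\<tau> \<omega>")
        case (real x)
        then have "?r < x" using False \<sigma>[of n \<omega>] by (auto simp: not_le ennreal_less_iff)
        from order_tendstoD(2)[OF dyadic_above_tendsto[OF \<sigma>] this]
        show ?thesis
        proof eventually_elim
          case (elim k)
          have "0 \<le> dyadic_above k ?r" using dyadic_above(1)[OF \<sigma>, of n \<omega> k] \<sigma>[of n \<omega>] by linarith
          then show ?case using elim real by (simp add: not_le ennreal_less_iff)
        qed
      qed (simp add: top_unique)
      then show ?thesis by eventually_elim (use False in \<open>simp add: ind_def\<close>)
    qed
    show "eventually (\<lambda>k. h n (dyadic_above k ?r) \<omega> = h n ?r \<omega>) sequentially"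
      using 1 2
    proof eventually_elim
      case (elim k)
      have "dyadic_above n (dyadic_above k ?r) = dyadic_above n ?r"
        using dyadic_above(1)[OF \<sigma>, of n \<omega> k] elim(1) by (intro dyadic_above_const[OF \<sigma>]) auto
      then show ?case using elim(2) by (simp add: h_def)
    qed
  qed
  have lim_meas_U: "(\<lambda>\<omega>. indicator (B n) \<omega> * U n (\<sigma> n \<omega>) \<omega>) \<in> borel_measurable M" for n
    by (rule borel_measurable_LIMSEQ_real[OF lim_U meas_U])
  have lim_meas_h: "(\<lambda>\<omega>. indicator (B n) \<omega> * h n (\<sigma> n \<omega>) \<omega>) \<in> borel_measurable M" for n
    by (rule borel_measurable_LIMSEQ_real[OF lim_h meas_h])
  have sampled: "(\<integral>\<omega>. indicator (B n) \<omega> * U n (\<sigma> n \<omega>) \<omega> \<partial>M) = (\<integral>\<omega>. indicator (B n) \<omega> * h n (\<sigma> n \<omega>) \<omega> \<partial>M)" for n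
  proof (rule LIMSEQ_unique)
    show "(\<lambda>k. \<integral>\<omega>. indicator (B n) \<omega> * U n (dyadic_above k (\<sigma> n \<omega>)) \<omega> \<partial>M) \<longlonglongrightarrow> (\<integral>\<omega>. indicator (B n) \<omega> * U n (\<sigma> n \<omega>) \<omega> \<partial>M)"
      by (rule integral_dominated_convergence[OF lim_meas_U meas_U, where w = "\<lambda>_. 1"])
         (use lim_U U_abs in \<open>auto simp: indicator_def\<close>)
    show "(\<lambda>k. \<integral>\<omega>. indicator (B n) \<omega> * U n (dyadic_above k (\<sigma> n \<omega>)) \<omega> \<partial>M) \<longlonglongrightarrow> (\<integral>\<omega>. indicator (B n) \<omega> * h n (\<sigma> n \<omega>) \<omega> \<partial>M)"
      unfolding grid
      by (rule integral_dominated_convergence[OF lim_meas_h meas_h, where w = "\<lambda>_. 1"])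
         (use lim_h h_bd in \<open>auto simp: indicator_def\<close>)
  qed
  \<comment> \<open>By right-continuity \<open>U n\<close> is still at least \<delta> at the passage
    time itself. The sampled identity turns this into a lower bound for the probability that \<tau>
    lies between the passage time and the next grid point.\<close>
  have lower: "\<delta> * (\<integral>\<omega>. indicator (B n) \<omega> \<partial>M) \<le> (\<integral>\<omega>. indicator (B n) \<omega> * h n (\<sigma> n \<omega>) \<omega> \<partial>M)" for n
  proof -
    have "\<delta> * (\<integral>\<omega>. indicator (B n) \<omega> \<partial>M) = (\<integral>\<omega>. \<delta> * indicator (B n) \<omega> \<partial>M)" by simp
    also have "\<dots> \<le> (\<integral>\<omega>. indicator (B n) \<omega> * U n (\<sigma> n \<omega>) \<omega> \<partial>M)"
    proof (rule integral_mono)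
      show "integrable M (\<lambda>\<omega>. \<delta> * indicator (B n) \<omega>)"
        using \<delta> by (intro integrable_bounded[of _ \<delta>]) (auto simp: indicator_def)
      show "integrable M (\<lambda>\<omega>. indicator (B n) \<omega> * U n (\<sigma> n \<omega>) \<omega>)"
        using U_abs by (intro integrable_bounded[OF lim_meas_U, of n 1]) (auto simp: indicator_def)
      show "\<delta> * indicator (B n) \<omega> \<le> indicator (B n) \<omega> * U n (\<sigma> n \<omega>) \<omega>" if "\<omega> \<in> space M" for \<omega>
        using U_S[OF S_\<sigma> \<sigma> that] by (cases "\<omega> \<in> B n") auto
    qed
    finally show ?thesis unfolding sampled .
  qed
  define T where "T \<omega> = (SUP n. S n \<omega>)" for \<omega>
  have T_stop: "stopping_time_ext M F T"
    unfolding stopping_time_ext_def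
  proof (intro allI impI)
    fix t :: real assume t: "0 \<le> t"
    have "{\<omega> \<in> space M. T \<omega> \<le> ennreal t} = (\<Inter>n. {\<omega> \<in> space M. S n \<omega> \<le> ennreal t})"
      by (auto simp: T_def SUP_le_iff)
    also have "\<dots> \<in> sets (F t)"
      using S_stop t by (intro sets.countable_INT image_subsetI UNIV_not_empty) (simp add: stopping_time_ext_def)
    finally show "{\<omega> \<in> space M. T \<omega> \<le> ennreal t} \<in> sets (F t)" .
  qed
  \<comment> \<open>The passage times increase to \<open>T\<close> because \<open>U\<close>
    decreases in \<open>n\<close>. If \<open>T < \<tau>\<close>, the windows of length
    \<open>(1/2) ^ n\<close> eventually end before \<tau>; if \<open>\<tau> < T\<close>, the passage
    times eventually exceed \<tau>. Only \<open>\<tau> = T\<close> could keep \<tau> in the windows,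
    and this is avoided.\<close>
  have "AE \<omega> in M. (\<lambda>n. indicator (B n) \<omega> * h n (\<sigma> n \<omega>) \<omega>) \<longlonglongrightarrow> 0"
    using avoids_AE[OF avoids \<tau> T_stop] avoids_const[OF avoids \<tau>, of \<infinity>] AE_space
  proof eventually_elim
    case (elim \<omega>)
    then obtain x where x: "\<tau> \<omega> = ennreal x" "0 \<le> x" by (cases "\<tau> \<omega>") auto
    have zero: "indicator (B n) \<omega> * h n (\<sigma> n \<omega>) \<omega> = 0"
      if "\<not> (S n \<omega> < \<tau> \<omega> \<and> \<tau> \<omega> \<le> S n \<omega> + ennreal ((1/2) ^ n))" for n
    proof (cases "\<omega> \<in> B n")
      case True
      note S = S_\<sigma>[OF True]
      have le: "dyadic_above n (\<sigma> n \<omega>) \<le> \<sigma> n \<omega> + (1/2) ^ n" by (rule dyadic_above(2)[OF \<sigma>])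
      have gt: "\<sigma> n \<omega> < dyadic_above n (\<sigma> n \<omega>)" by (rule dyadic_above(1)[OF \<sigma>])
      have "\<not> (\<sigma> n \<omega> < x \<and> x \<le> \<sigma> n \<omega> + (1/2) ^ n)"
        using that x \<sigma>[of n \<omega>] by (simp add: S ennreal_plus[symmetric] ennreal_less_iff del: ennreal_plus)
      then have "\<not> (\<sigma> n \<omega> < x \<and> x \<le> dyadic_above n (\<sigma> n \<omega>))" using le by auto
      moreover have "0 \<le> dyadic_above n (\<sigma> n \<omega>)" using gt \<sigma>[of n \<omega>] by linarith
      ultimately show ?thesis using gt \<sigma>[of n \<omega>] x by (auto simp: h_def ind_def indicator_def not_less)
    qed simp
    have "eventually (\<lambda>n. \<not> (S n \<omega> < \<tau> \<omega> \<and> \<tau> \<omega> \<le> S n \<omega> + ennreal ((1/2) ^ n))) sequentially"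
    proof (cases "T \<omega> < \<tau> \<omega>")
      case True
      then obtain y where y: "T \<omega> = ennreal y" "0 \<le> y" by (cases "T \<omega>") auto
      have "y < x" using True x y by (simp add: ennreal_less_iff)
      have "(\<lambda>n. (1/2) ^ n :: real) \<longlonglongrightarrow> 0" by (rule LIMSEQ_power_zero) simp
      from order_tendstoD(2)[OF this, of "x - y"] \<open>y < x\<close>
      have "eventually (\<lambda>n. (1/2) ^ n < x - y) sequentially" by simp
      then show ?thesis
      proof eventually_elim
        case (elim n)
        have "S n \<omega> \<le> ennreal y" unfolding y(1)[symmetric] T_def by (rule SUP_upper) simp
        then have "S n \<omega> + ennreal ((1/2) ^ n) \<le> ennreal y + ennreal ((1/2) ^ n)" by (rule add_right_mono)
        also have "\<dots> = ennreal (y + (1/2) ^ n)" using y by (simp add: ennreal_plus)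
        also have "\<dots> < ennreal x" using elim y \<open>y < x\<close> by (intro ennreal_lessI) auto
        finally show ?case using x by (simp add: not_le)
      qed
    next
      case False
      then have "\<tau> \<omega> < T \<omega>" using elim(1) by (simp add: not_less less_le)
      then obtain n0 where n0: "\<tau> \<omega> < S n0 \<omega>" by (auto simp: T_def less_SUP_iff)
      have "\<not> S n \<omega> < \<tau> \<omega>" if "n0 \<le> n" for n
        using S_mono[OF that elim(3)] n0 by (auto simp: not_less)
      then show ?thesis unfolding eventually_sequentially by blast
    qed
    then have "eventually (\<lambda>n. indicator (B n) \<omega> * h n (\<sigma> n \<omega>) \<omega> = 0) sequentially"
      by eventually_elim (rule zero)
    then show ?case by (rule tendsto_eventually)
  qed
  then have "(\<lambda>n. \<integral>\<omega>. indicator (B n) \<omega> * h n (\<sigma> n \<omega>) \<omega> \<partial>M) \<longlonglongrightarrow> (\<integral>\<omega>. 0 \<partial>M)"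
    by (intro integral_dominated_convergence[where w = "\<lambda>_. 1"] lim_meas_h)
       (use h_bd in \<open>auto simp: indicator_def\<close>)
  then have lim: "(\<lambda>n. (\<integral>\<omega>. indicator (B n) \<omega> * h n (\<sigma> n \<omega>) \<omega> \<partial>M) / \<delta>) \<longlonglongrightarrow> 0"
    by (simp add: tendsto_divide_zero)
  have "(\<lambda>n. \<integral>\<omega>. indicator (B n) \<omega> \<partial>M) \<longlonglongrightarrow> (0::real)"
  proof (rule tendsto_sandwich[OF _ _ tendsto_const lim])
    show "eventually (\<lambda>n. 0 \<le> (\<integral>\<omega>. indicator (B n) \<omega> \<partial>M :: real)) sequentially" by simp
    show "eventually (\<lambda>n. (\<integral>\<omega>. indicator (B n) \<omega> \<partial>M) \<le> (\<integral>\<omega>. indicator (B n) \<omega> * h n (\<sigma> n \<omega>) \<omega> \<partial>M) / \<delta>) sequentially"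
      using lower \<delta> by (intro always_eventually allI) (simp add: pos_le_divide_eq mult.commute)
  qed
  then show "(\<lambda>n. \<integral>\<omega>. indicator {\<omega> \<in> space M. \<exists>r. 0 \<le> r \<and> r < real R \<and> \<delta> < U n r \<omega>} \<omega> \<partial>M) \<longlonglongrightarrow> (0::real)"
    by (simp only: B_def S_less_iff)
  show "{\<omega> \<in> space M. \<exists>r. 0 \<le> r \<and> r < real R \<and> \<delta> < U n r \<omega>} \<in> sets M"
    using B_M[of n] by (simp only: B_def S_less_iff)
qed

end

lemma dyadic_below_cell:
  assumes "real j / 2 ^ n < r" "r \<le> real (Suc j) / 2 ^ n"
  shows "dyadic_below n r = real j / 2 ^ n"
proof -
  have "\<lceil>r * 2 ^ n\<rceil> = int (Suc j)" using assms by (intro ceiling_unique) (auto simp: field_simps)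
  then show ?thesis by (simp add: dyadic_below_def)
qed

lemma dyadic_below_cellE:
  assumes "0 < r"
  obtains j where "real j / 2 ^ n < r" "r \<le> real (Suc j) / 2 ^ n" "dyadic_below n r = real j / 2 ^ n"
proof -
  define j where "j = nat (\<lceil>r * 2 ^ n\<rceil> - 1)"
  have eq: "dyadic_below n r = real j / 2 ^ n" by (simp add: dyadic_below_def j_def)
  have "real j / 2 ^ n < r" "r - (1/2) ^ n \<le> real j / 2 ^ n"
    using dyadic_below(1,2)[OF assms, of n] by (simp_all add: eq)
  moreover from this have "r \<le> real (Suc j) / 2 ^ n" by (simp add: add_divide_distrib power_one_over)
  ultimately show ?thesis using that eq by blast
qed

context usual_filtered_prob_space
begin

lemma regular_compensatorD:
  assumes "regular_compensator \<tau> D"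
  shows "0 \<le> t \<Longrightarrow> D t \<in> borel_measurable (F t)" "0 \<le> t \<Longrightarrow> D t \<in> borel_measurable M"
    "\<omega> \<in> space M \<Longrightarrow> mono_on {0..} (\<lambda>t. D t \<omega>)" "\<omega> \<in> space M \<Longrightarrow> cadlag_path (\<lambda>t. D t \<omega>)"
    "\<omega> \<in> space M \<Longrightarrow> D 0 \<omega> = 0" "0 \<le> D t \<omega>" "D t \<omega> \<le> 1" "adapted F D" "cadlag M D"
    "0 \<le> t \<Longrightarrow> AE \<omega> in M. D t \<omega> = real_cond_exp M (F t) (indicator {\<omega>. \<tau> \<omega> \<le> ennreal t}) \<omega>"
proof -
  show F: "D t \<in> borel_measurable (F t)" if "0 \<le> t"
    using assms that by (simp add: regular_compensator_def adapted_def)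
  show "D t \<in> borel_measurable M" if "0 \<le> t" by (rule measurable_F_M[OF F[OF that] that])
qed (use assms in \<open>simp_all add: regular_compensator_def increasing_path_def cadlag_def\<close>)

lemma regular_compensator_integral:
  assumes D: "regular_compensator \<tau> D" and \<tau>: "\<tau> \<in> borel_measurable M"
    and t: "0 \<le> t" and a: "a \<in> borel_measurable (F t)" "\<And>\<omega>. \<bar>a \<omega>\<bar> \<le> K"
  shows "(\<integral>\<omega>. a \<omega> * D t \<omega> \<partial>M) = (\<integral>\<omega>. a \<omega> * indicator {\<omega>. \<tau> \<omega> \<le> ennreal t} \<omega> \<partial>M)"
  by (rule integral_cond_exp_version[OF t regular_compensatorD(10)[OF D t] regular_compensatorD(2)[OF D t]
      indicator_le_time_measurable[OF \<tau>] _ a, of 1]) (simp add: indicator_def)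

text \<open>\<open>D r\<close> is the conditional probability of \<open>\<tau> \<le> r\<close> and
  \<open>m d r\<close> that of \<open>\<tau> \<le> d\<close>, so the order is inherited from the
  events. Rational times and dyadic \<open>d\<close> give one common null set; right-continuity
  extends the order to real \<open>r\<close>, provided that rational times remain between
  \<open>r\<close> and \<open>d\<close>, whence \<open>r < d\<close>.\<close>

lemma compensator_martingales:
  assumes D: "regular_compensator \<tau> D" and \<tau>: "\<tau> \<in> borel_measurable M"
  obtains m N where "\<And>d. unit_version (indicator {\<omega>. \<tau> \<omega> \<le> ennreal d}) (m d)" "N \<in> null_sets M"
    "\<And>\<omega> d r. \<omega> \<in> space M \<Longrightarrow> \<omega> \<notin> N \<Longrightarrow> d \<in> dyadics \<Longrightarrow> 0 \<le> r \<Longrightarrow> r < d \<Longrightarrow> D r \<omega> \<le> m d r \<omega>"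
    "\<And>\<omega> d d' r. \<omega> \<in> space M \<Longrightarrow> \<omega> \<notin> N \<Longrightarrow> d \<in> dyadics \<Longrightarrow> d' \<in> dyadics \<Longrightarrow> 0 \<le> r \<Longrightarrow> r < d \<Longrightarrow> d \<le> d' \<Longrightarrow>
      m d r \<omega> \<le> m d' r \<omega>"
proof -
  let ?ind = "\<lambda>d. indicator {\<omega>. \<tau> \<omega> \<le> ennreal d} :: 'a \<Rightarrow> real"
  have meas: "?ind d \<in> borel_measurable M" for d by (rule indicator_le_time_measurable[OF \<tau>])
  have "\<forall>d. \<exists>Y. unit_version (?ind d) Y"
    by (intro allI unit_version_ex meas) (simp add: indicator_def)
  then obtain m where m: "\<And>d. unit_version (?ind d) (m d)" by metis
  have mono: "AE \<omega> in M. real_cond_exp M (F q) (?ind d) \<omega> \<le> real_cond_exp M (F q) (?ind d') \<omega>"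
    if "0 \<le> q" "d \<le> d'" for q d d'
  proof -
    interpret S: sigma_finite_subalgebra M "F q" by (rule sigma_finite_subalgebra_F[OF that(1)])
    have "ennreal d \<le> ennreal d'" by (rule ennreal_leI[OF that(2)])
    then show ?thesis
      by (intro S.real_cond_exp_mono integrable_bounded[of _ 1] meas AE_I2)
         (auto simp: indicator_def intro: order_trans)
  qed
  have "AE \<omega> in M. \<forall>(d, d', q)\<in>dyadics \<times> dyadics \<times> (\<rat> \<inter> {0..}). q \<le> d \<longrightarrow> d \<le> d' \<longrightarrow>
      D q \<omega> \<le> m d q \<omega> \<and> m d q \<omega> \<le> m d' q \<omega>"
  proof (rule AE_ball_countable[THEN iffD2], safe)
    show "countable ((dyadics :: real set) \<times> (dyadics :: real set) \<times> (\<rat> \<inter> {0::real..}))"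
      by (intro countable_SIGMA countable_dyadics countable_Int1 countable_rat)
    fix d d' q :: real assume q: "0 \<le> q"
    show "AE \<omega> in M. q \<le> d \<longrightarrow> d \<le> d' \<longrightarrow> D q \<omega> \<le> m d q \<omega> \<and> m d q \<omega> \<le> m d' q \<omega>"
    proof (cases "q \<le> d \<and> d \<le> d'")
      case True
      from mono[OF q True[THEN conjunct1]] mono[OF q True[THEN conjunct2]] regular_compensatorD(10)[OF D q]
        unit_versionD(8)[OF m q, of d] unit_versionD(8)[OF m q, of d']
      show ?thesis by eventually_elim simp
    qed auto
  qed
  then obtain N where N: "N \<in> null_sets M" "\<And>\<omega>. \<omega> \<in> space M \<Longrightarrow> \<omega> \<notin> N \<Longrightarrow>
      \<forall>(d, d', q)\<in>dyadics \<times> dyadics \<times> (\<rat> \<inter> {0..}). q \<le> d \<longrightarrow> d \<le> d' \<longrightarrow>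
      D q \<omega> \<le> m d q \<omega> \<and> m d q \<omega> \<le> m d' q \<omega>"
    using AE_E_null by blast
  have good: "D q \<omega> \<le> m d q \<omega> \<and> m d q \<omega> \<le> m d' q \<omega>"
    if "\<omega> \<in> space M" "\<omega> \<notin> N" "d \<in> dyadics" "d' \<in> dyadics" "q \<in> \<rat>" "0 \<le> q" "q \<le> d" "d \<le> d'" for \<omega> d d' q
    using bspec[OF N(2)[OF that(1,2)], of "(d, d', q)"] that(3-8) by simp
  have cad: "cadlag_path (\<lambda>t. m d t \<omega>)" if "\<omega> \<in> space M" for d \<omega>
    using unit_versionD(5)[OF m] that by (simp add: cadlag_def)
  show ?thesis
  proof (rule that[OF m N(1)])
    fix \<omega> and d r :: real assume \<omega>: "\<omega> \<in> space M" "\<omega> \<notin> N" and d: "d \<in> dyadics" and r: "0 \<le> r" "r < d"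
    show "D r \<omega> \<le> m d r \<omega>"
      by (rule cadlag_path_le_if_le_on_Rats[OF regular_compensatorD(4)[OF D \<omega>(1)] cad[OF \<omega>(1)] r])
         (use good[OF \<omega> d d] r in auto)
  next
    fix \<omega> and d d' r :: real assume \<omega>: "\<omega> \<in> space M" "\<omega> \<notin> N" and d: "d \<in> dyadics" "d' \<in> dyadics"
      and r: "0 \<le> r" "r < d" "d \<le> d'"
    show "m d r \<omega> \<le> m d' r \<omega>"
      by (rule cadlag_path_le_if_le_on_Rats[OF cad[OF \<omega>(1)] cad[OF \<omega>(1)] r(1,2)])
         (use good[OF \<omega> d] r in auto)
  qed
qed

text \<open>With \<open>x = D t\<close> and \<open>y = D s\<close> the square is
  \<open>(x - y) * x - y * (x - y)\<close>. In the former product \<open>x\<close> is replaced by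
  the indicator of \<open>\<tau> \<le> t\<close>, and the duality with closed martingales applies.
  In the latter \<open>y\<close> is already known at \<open>s\<close>, so the increment of
  \<open>D\<close> is replaced by that of the jump.\<close>

lemma compensator_square_integral:
  assumes D: "regular_compensator \<tau> D" and \<tau>[measurable]: "\<tau> \<in> borel_measurable M"
    and Y: "unit_version (indicator {\<omega>. \<tau> \<omega> \<le> ennreal t}) Y" and s: "0 \<le> s" "s \<le> t"
  shows "(\<integral>\<omega>. (D t \<omega> - D s \<omega>)\<^sup>2 \<partial>M) =
    (\<integral>\<omega>. indicator {\<omega>. ennreal s < \<tau> \<omega> \<and> \<tau> \<omega> \<le> ennreal t} \<omega> * (Y (enn2real (\<tau> \<omega>)) \<omega> - D s \<omega>) \<partial>M)"
proof -
  let ?ind = "\<lambda>d. indicator {\<omega>. \<tau> \<omega> \<le> ennreal d} :: 'a \<Rightarrow> real"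
  let ?J = "indicator {\<omega>. ennreal s < \<tau> \<omega> \<and> \<tau> \<omega> \<le> ennreal t} :: 'a \<Rightarrow> real"
  have t: "0 \<le> t" using s by simp
  have J: "?J \<omega> = ?ind t \<omega> - ?ind s \<omega>" for \<omega>
    using ennreal_leI[OF s(2)] by (auto simp: indicator_def not_less)
  note meas[measurable] = regular_compensatorD(2)[OF D s(1)] regular_compensatorD(2)[OF D t]
    indicator_le_time_measurable[OF \<tau>, of s] indicator_le_time_measurable[OF \<tau>, of t]
  have J_meas[measurable]: "?J \<in> borel_measurable M"
  proof -
    have "(\<lambda>\<omega>. ?ind t \<omega> - ?ind s \<omega>) \<in> borel_measurable M" by measurable
    then show ?thesis unfolding J[symmetric] .
  qed
  have DtF: "D t \<in> borel_measurable (F t)" "D s \<in> borel_measurable (F s)" and DsF: "D s \<in> borel_measurable (F t)"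
    using regular_compensatorD(1)[OF D] s t measurable_F_mono[OF regular_compensatorD(1)[OF D s(1)] s] by auto
  have bd: "\<bar>D u \<omega>\<bar> \<le> 1" "\<bar>D u \<omega> - D v \<omega>\<bar> \<le> 1" "\<bar>?ind u \<omega>\<bar> \<le> 1" "\<bar>?J \<omega>\<bar> \<le> 1" for u v \<omega>
    using regular_compensatorD(6,7)[OF D, of u \<omega>] regular_compensatorD(6,7)[OF D, of v \<omega>]
    by (simp_all add: indicator_def)
  have prod_bd: "\<bar>x * y\<bar> \<le> 1" if "\<bar>x\<bar> \<le> 1" "\<bar>y\<bar> \<le> 1" for x y :: real
    unfolding abs_mult using that by (intro mult_le_one) auto
  have Y_meas[measurable]: "(\<lambda>\<omega>. Y (enn2real (\<tau> \<omega>)) \<omega>) \<in> borel_measurable M"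
    by (rule unit_version_at_measurable[OF Y]) auto
  have Y_bd: "\<bar>Y u \<omega>\<bar> \<le> 1" for u \<omega> using unit_versionD(6,7)[OF Y, of u \<omega>] by simp
  have Fdiff: "(\<lambda>\<omega>. D t \<omega> - D s \<omega>) \<in> borel_measurable (F t)" using DtF DsF by simp
  have 1: "(\<integral>\<omega>. (D t \<omega> - D s \<omega>) * D t \<omega> \<partial>M) = (\<integral>\<omega>. ?J \<omega> * Y (enn2real (\<tau> \<omega>)) \<omega> \<partial>M)"
  proof -
    have "(\<integral>\<omega>. (D t \<omega> - D s \<omega>) * D t \<omega> \<partial>M) = (\<integral>\<omega>. (D t \<omega> - D s \<omega>) * ?ind t \<omega> \<partial>M)"
      by (rule regular_compensator_integral[OF D \<tau> t Fdiff bd(2)])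
    also have "\<dots> = (\<integral>\<omega>. ?ind t \<omega> * (D t \<omega> - D s \<omega>) \<partial>M)" by (simp add: mult.commute)
    \<comment> \<open>The last conjunct of \<open>regular_compensator\<close>, with the indicator of
      \<open>\<tau> \<le> t\<close> as closing variable.\<close>
    also have "\<dots> = (\<integral>\<omega>. ?J \<omega> * Y (enn2real (\<tau> \<omega>)) \<omega> \<partial>M)"
      by (rule D[unfolded regular_compensator_def, THEN conjunct2, THEN conjunct2, THEN conjunct2, THEN conjunct2,
            rule_format, OF Y s, symmetric])
    finally show ?thesis .
  qed
  have 2: "(\<integral>\<omega>. D s \<omega> * (D t \<omega> - D s \<omega>) \<partial>M) = (\<integral>\<omega>. ?J \<omega> * D s \<omega> \<partial>M)"
  proof -
    have "(\<integral>\<omega>. D s \<omega> * (D t \<omega> - D s \<omega>) \<partial>M) = (\<integral>\<omega>. D s \<omega> * D t \<omega> - D s \<omega> * D s \<omega> \<partial>M)"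
      by (simp only: right_diff_distrib)
    also have "\<dots> = (\<integral>\<omega>. D s \<omega> * D t \<omega> \<partial>M) - (\<integral>\<omega>. D s \<omega> * D s \<omega> \<partial>M)"
      by (intro Bochner_Integration.integral_diff integrable_bounded[of _ 1] prod_bd bd) measurable
    also have "(\<integral>\<omega>. D s \<omega> * D t \<omega> \<partial>M) = (\<integral>\<omega>. D s \<omega> * ?ind t \<omega> \<partial>M)"
      by (rule regular_compensator_integral[OF D \<tau> t DsF bd(1)])
    also have "(\<integral>\<omega>. D s \<omega> * D s \<omega> \<partial>M) = (\<integral>\<omega>. D s \<omega> * ?ind s \<omega> \<partial>M)"
      by (rule regular_compensator_integral[OF D \<tau> s(1) DtF(2) bd(1)])
    also have "(\<integral>\<omega>. D s \<omega> * ?ind t \<omega> \<partial>M) - (\<integral>\<omega>. D s \<omega> * ?ind s \<omega> \<partial>M) =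
        (\<integral>\<omega>. D s \<omega> * ?ind t \<omega> - D s \<omega> * ?ind s \<omega> \<partial>M)"
      by (intro Bochner_Integration.integral_diff[symmetric] integrable_bounded[of _ 1] prod_bd bd) measurable
    also have "\<dots> = (\<integral>\<omega>. ?J \<omega> * D s \<omega> \<partial>M)" unfolding J by (simp add: algebra_simps)
    finally show ?thesis .
  qed
  have "(\<integral>\<omega>. (D t \<omega> - D s \<omega>)\<^sup>2 \<partial>M) = (\<integral>\<omega>. (D t \<omega> - D s \<omega>) * D t \<omega> - D s \<omega> * (D t \<omega> - D s \<omega>) \<partial>M)"
    by (simp add: power2_eq_square algebra_simps)
  also have "\<dots> = (\<integral>\<omega>. (D t \<omega> - D s \<omega>) * D t \<omega> \<partial>M) - (\<integral>\<omega>. D s \<omega> * (D t \<omega> - D s \<omega>) \<partial>M)"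
    by (intro Bochner_Integration.integral_diff integrable_bounded[of _ 1] prod_bd bd) measurable
  also have "\<dots> = (\<integral>\<omega>. ?J \<omega> * Y (enn2real (\<tau> \<omega>)) \<omega> - ?J \<omega> * D s \<omega> \<partial>M)"
    unfolding 1 2
    by (intro Bochner_Integration.integral_diff[symmetric] integrable_bounded[of _ 1] prod_bd bd Y_bd) measurable
  finally show ?thesis by (simp add: right_diff_distrib)
qed

end

context usual_filtered_prob_space
begin

text \<open>The martingale \<open>m d\<close> closes at the indicator of \<open>\<tau> \<le> d\<close>, so \<open>E (D t - D s)\<^sup>2\<close> over a cell of the
  dyadic grid equals the mean of \<open>m t - D s\<close> at \<open>\<tau>\<close>, for \<open>\<tau>\<close> in that cell. Both parts of
  \<open>m t - D s = (m t - D) + (D - D s)\<close> are small at \<open>\<tau>\<close>, hence the quadratic variation of \<open>D\<close> vanishes.\<close>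

lemma AE_compensator_left_continuous_upto:
  fixes R :: nat
  assumes D: "regular_compensator \<tau> D" and avoids: "avoids_stopping_times M F \<tau>"
    and \<tau>[measurable]: "\<tau> \<in> borel_measurable M"
  shows "AE \<omega> in M. \<forall>r. 0 < r \<longrightarrow> r \<le> real R \<longrightarrow> continuous (at_left r) (\<lambda>t. D t \<omega>)"
proof -
  let ?ind = "\<lambda>d. indicator {\<omega>. \<tau> \<omega> \<le> ennreal d} :: 'a \<Rightarrow> real"
  obtain m N where m: "\<And>d. unit_version (?ind d) (m d)" and N: "N \<in> null_sets M"
    and Dm: "\<And>\<omega> d r. \<omega> \<in> space M \<Longrightarrow> \<omega> \<notin> N \<Longrightarrow> d \<in> dyadics \<Longrightarrow> 0 \<le> r \<Longrightarrow> r < d \<Longrightarrow> D r \<omega> \<le> m d r \<omega>"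
    and mm: "\<And>\<omega> d d' r. \<omega> \<in> space M \<Longrightarrow> \<omega> \<notin> N \<Longrightarrow> d \<in> dyadics \<Longrightarrow> d' \<in> dyadics \<Longrightarrow> 0 \<le> r \<Longrightarrow> r < d \<Longrightarrow>
      d \<le> d' \<Longrightarrow> m d r \<omega> \<le> m d' r \<omega>"
    by (rule compensator_martingales[OF D \<tau>]) blast
  have m_cad: "((\<lambda>r. m d r \<omega>) \<longlongrightarrow> m d r \<omega>) (at_right r)" if "\<omega> \<in> space M" "0 \<le> r" for d r \<omega>
    using unit_versionD(5)[OF m, of d] that by (simp add: cadlag_def cadlag_path_def continuous_within)
  have D_cad: "((\<lambda>r. D r \<omega>) \<longlongrightarrow> D r \<omega>) (at_right r)" if "\<omega> \<in> space M" "0 \<le> r" for r \<omega>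
    using regular_compensatorD(4)[OF D that(1)] that by (simp add: cadlag_path_def continuous_within)
  have m_bd: "0 \<le> m d r \<omega>" "m d r \<omega> \<le> 1" for d r \<omega>
    using unit_versionD(6,7)[OF m, of d r \<omega>] by auto
  have D_bd: "0 \<le> D r \<omega>" "D r \<omega> \<le> 1" for r \<omega>
    using regular_compensatorD(6,7)[OF D, of r \<omega>] by auto
  have D_mono: "D s \<omega> \<le> D t \<omega>" if "\<omega> \<in> space M" "0 \<le> s" "s \<le> t" for s t \<omega>
    using mono_onD[OF regular_compensatorD(3)[OF D that(1)], of s t] that by simp
  \<comment> \<open>The conditional probability that \<tau> falls between \<open>r\<close> and the
    next grid point. Setting it to \<open>0\<close> on \<open>N\<close> makes its bounds and its
    monotonicity in \<open>n\<close> hold on all paths. Between grid points it follows a single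
    martingale minus \<open>D\<close>, hence it is right-continuous.\<close>
  define U where "U n r \<omega> = (if \<omega> \<in> space M \<and> \<omega> \<notin> N \<and> 0 \<le> r then m (dyadic_above n r) r \<omega> - D r \<omega> else 0)"
    for n r \<omega>
  define C where "C \<delta> n = {\<omega> \<in> space M. \<exists>r. 0 \<le> r \<and> r < real R \<and> \<delta> < U n r \<omega>}" for \<delta> n
  have U_bd: "0 \<le> U n r \<omega> \<and> U n r \<omega> \<le> 1" for n r \<omega>
  proof (cases "\<omega> \<in> space M \<and> \<omega> \<notin> N \<and> 0 \<le> r")
    case True
    then have "D r \<omega> \<le> m (dyadic_above n r) r \<omega>" by (intro Dm dyadic_above) auto
    moreover have "m (dyadic_above n r) r \<omega> \<le> 1" "0 \<le> D r \<omega>" by (rule m_bd D_bd)+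
    ultimately show ?thesis using True by (simp add: U_def)
  qed (auto simp: U_def)
  have U_AE: "AE \<omega> in M. m (dyadic_above n r) r \<omega> - D r \<omega> = U n r \<omega>" if "0 \<le> r" for n r
    using AE_space AE_not_in[OF N] by eventually_elim (simp add: U_def that)
  have U_F: "U n r \<in> borel_measurable (F r)" if r: "0 \<le> r" for n r
    by (rule measurable_F_cong_AE[OF _ U_AE[OF r] r])
       (intro borel_measurable_diff unit_versionD(9)[OF m r] regular_compensatorD(1)[OF D r])
  have U_right: "((\<lambda>r. U n r \<omega>) \<longlongrightarrow> U n r \<omega>) (at_right r)" if r: "0 \<le> r" and \<omega>: "\<omega> \<in> space M" for n r \<omega>
  proof (cases "\<omega> \<in> N")
    case False
    have "((\<lambda>s. m (dyadic_above n r) s \<omega> - D s \<omega>) \<longlongrightarrow> U n r \<omega>) (at_right r)"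
      using False \<omega> r by (simp add: U_def tendsto_diff[OF m_cad D_cad])
    moreover have "eventually (\<lambda>s. m (dyadic_above n r) s \<omega> - D s \<omega> = U n s \<omega>) (at_right r)"
      unfolding eventually_at_right_field
    proof (intro exI[of _ "dyadic_above n r"] conjI allI impI)
      fix s assume "r < s" "s < dyadic_above n r"
      then show "m (dyadic_above n r) s \<omega> - D s \<omega> = U n s \<omega>"
        using dyadic_above_const[OF r, of s n] False \<omega> r by (simp add: U_def)
    qed (rule dyadic_above(1)[OF r])
    ultimately show ?thesis by (rule Lim_transform_eventually)
  qed (simp add: U_def)
  have U_dec: "U (Suc n) r \<omega> \<le> U n r \<omega>" if r: "0 \<le> r" and \<omega>: "\<omega> \<in> space M" for n r \<omega>
    using mm[OF \<omega> _ dyadic_above(3) dyadic_above(3) r dyadic_above(1)[OF r] dyadic_above_antimono[OF r], of n]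
      r \<omega> by (simp add: U_def)
  have U_proj: "(\<integral>\<omega>. indicator J \<omega> * U n q \<omega> \<partial>M) = (\<integral>\<omega>. indicator J \<omega> * (?ind (dyadic_above n q) \<omega> - ?ind q \<omega>) \<partial>M)"
    if q: "0 \<le> q" and J: "J \<in> sets (F q)" for n q J
  proof -
    let ?d = "dyadic_above n q"
    note [measurable] = sets_F[OF q J] measurable_F_M[OF U_F[OF q] q] unit_versionD(10)[OF m q] regular_compensatorD(2)[OF D q]
      indicator_le_time_measurable[OF \<tau>]
    have JF: "(indicator J :: 'a \<Rightarrow> real) \<in> borel_measurable (F q)" using J by measurable
    have J1: "\<bar>indicator J \<omega> :: real\<bar> \<le> 1" for \<omega> by (simp add: indicator_def)
    have "(\<integral>\<omega>. indicator J \<omega> * U n q \<omega> \<partial>M) = (\<integral>\<omega>. indicator J \<omega> * m ?d q \<omega> - indicator J \<omega> * D q \<omega> \<partial>M)"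
    proof (rule integral_cong_AE)
      show "AE \<omega> in M. indicator J \<omega> * U n q \<omega> = indicator J \<omega> * m ?d q \<omega> - indicator J \<omega> * D q \<omega>"
        using U_AE[OF q, of n] by eventually_elim (simp add: right_diff_distrib[symmetric])
    qed measurable
    also have "\<dots> = (\<integral>\<omega>. indicator J \<omega> * m ?d q \<omega> \<partial>M) - (\<integral>\<omega>. indicator J \<omega> * D q \<omega> \<partial>M)"
      using m_bd D_bd by (intro Bochner_Integration.integral_diff integrable_bounded[of _ 1]) (auto simp: indicator_def)
    also have "\<dots> = (\<integral>\<omega>. indicator J \<omega> * ?ind ?d \<omega> \<partial>M) - (\<integral>\<omega>. indicator J \<omega> * ?ind q \<omega> \<partial>M)"
      by (simp only: unit_version_integral[OF m q JF J1] regular_compensator_integral[OF D \<tau> q JF J1])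
    also have "\<dots> = (\<integral>\<omega>. indicator J \<omega> * ?ind ?d \<omega> - indicator J \<omega> * ?ind q \<omega> \<partial>M)"
      by (intro Bochner_Integration.integral_diff[symmetric] integrable_bounded[of _ 1]) (auto simp: indicator_def)
    finally show ?thesis
      by (simp only: right_diff_distrib)
  qed
  have vanish: "(\<lambda>n. \<integral>\<omega>. indicator (C \<delta> n) \<omega> \<partial>M) \<longlonglongrightarrow> (0::real)" "C \<delta> n \<in> sets M" if "0 < \<delta>" for \<delta> n
    unfolding C_def by (rule first_passage_vanishes[OF \<tau> avoids U_bd U_F U_right U_dec U_proj that]; assumption)+
  define Q where "Q n \<omega> = (\<Sum>i<R * 2 ^ n. (D (real (Suc i) / 2 ^ n) \<omega> - D (real i / 2 ^ n) \<omega>)\<^sup>2)" for n \<omega>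
  define J where "J n i = {\<omega>. ennreal (real i / 2 ^ n) < \<tau> \<omega> \<and> \<tau> \<omega> \<le> ennreal (real (Suc i) / 2 ^ n)}" for n i :: nat
  define H where "H n i \<omega> = indicator (J n i) \<omega> * (m (real (Suc i) / 2 ^ n) (enn2real (\<tau> \<omega>)) \<omega> - D (real i / 2 ^ n) \<omega>)"
    for n i \<omega>
  \<comment> \<open>The rise of \<open>D\<close> from the last grid point strictly before \<tau> up
    to \<tau>, the second part of the increment of the martingale over \<open>D\<close> at the left
    end of the cell.\<close>
  define e where "e n \<omega> = indicator {\<omega>. \<tau> \<omega> \<le> ennreal (real R)} \<omega> *
      (D (enn2real (\<tau> \<omega>)) \<omega> - D (dyadic_below n (enn2real (\<tau> \<omega>))) \<omega>)" for n \<omega>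
  have D_M[measurable]: "D t \<in> borel_measurable M" if "0 \<le> t" for t by (rule regular_compensatorD(2)[OF D that])
  have sq_meas: "(\<lambda>\<omega>. (D (real (Suc i) / 2 ^ n) \<omega> - D (real i / 2 ^ n) \<omega>)\<^sup>2) \<in> borel_measurable M" for n i
    by (intro borel_measurable_power borel_measurable_diff D_M) auto
  have sq_int: "integrable M (\<lambda>\<omega>. (D (real (Suc i) / 2 ^ n) \<omega> - D (real i / 2 ^ n) \<omega>)\<^sup>2)" for n i
  proof (rule integrable_bounded[OF sq_meas, of _ _ 1])
    fix \<omega>
    have "\<bar>D (real (Suc i) / 2 ^ n) \<omega> - D (real i / 2 ^ n) \<omega>\<bar> \<le> 1"
      using D_bd[of "real (Suc i) / 2 ^ n" \<omega>] D_bd[of "real i / 2 ^ n" \<omega>] by (simp del: of_nat_Suc)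
    then show "\<bar>(D (real (Suc i) / 2 ^ n) \<omega> - D (real i / 2 ^ n) \<omega>)\<^sup>2\<bar> \<le> 1"
      by (simp add: abs_square_le_1 del: of_nat_Suc)
  qed
  have Q_int: "integrable M (Q n)" for n
    unfolding Q_def using sq_int by (intro Bochner_Integration.integrable_sum)
  have J_meas: "(indicator (J n i) :: 'a \<Rightarrow> real) \<in> borel_measurable M" for n i
  proof -
    have "(\<lambda>\<omega>. if ennreal (real i / 2 ^ n) < \<tau> \<omega> \<and> \<tau> \<omega> \<le> ennreal (real (Suc i) / 2 ^ n) then 1 else 0 :: real) \<in> borel_measurable M"
      by measurable
    then show ?thesis by (simp add: J_def indicator_def[abs_def] of_bool_def del: of_nat_Suc)
  qed
  have H_int: "integrable M (H n i)" for n i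
  proof (rule integrable_bounded[of _ 1])
    show "H n i \<in> borel_measurable M"
      unfolding H_def[abs_def]
      by (intro borel_measurable_times J_meas borel_measurable_diff D_M unit_version_at_measurable[OF m]) auto
    fix \<omega>
    show "\<bar>H n i \<omega>\<bar> \<le> 1"
      using m_bd[of "real (Suc i) / 2 ^ n" "enn2real (\<tau> \<omega>)" \<omega>] D_bd[of "real i / 2 ^ n" \<omega>]
      by (simp add: H_def indicator_def abs_le_iff del: of_nat_Suc)
  qed
  have Q_H: "(\<integral>\<omega>. Q n \<omega> \<partial>M) = (\<integral>\<omega>. (\<Sum>i<R * 2 ^ n. H n i \<omega>) \<partial>M)" for n
  proof -
    have "(\<integral>\<omega>. Q n \<omega> \<partial>M) = (\<Sum>i<R * 2 ^ n. \<integral>\<omega>. (D (real (Suc i) / 2 ^ n) \<omega> - D (real i / 2 ^ n) \<omega>)\<^sup>2 \<partial>M)"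
      unfolding Q_def by (rule Bochner_Integration.integral_sum[OF sq_int])
    also have "\<dots> = (\<Sum>i<R * 2 ^ n. \<integral>\<omega>. H n i \<omega> \<partial>M)"
      unfolding H_def J_def
      by (intro sum.cong refl compensator_square_integral[OF D \<tau> m]) (auto intro: divide_right_mono)
    finally show ?thesis by (simp only: Bochner_Integration.integral_sum[OF H_int])
  qed
  have e_meas: "e n \<in> borel_measurable M" for n
    unfolding e_def[abs_def]
  proof (intro borel_measurable_times borel_measurable_diff indicator_le_time_measurable[OF \<tau>]
      cadlag_process_at_measurable[OF regular_compensatorD(8,9)[OF D]])
    show "(\<lambda>\<omega>. dyadic_below n (enn2real (\<tau> \<omega>))) \<in> borel_measurable M" unfolding dyadic_below_def by measurable
  qed (auto simp: dyadic_below_def)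
  have e_bd: "\<bar>e n \<omega>\<bar> \<le> 1" for n \<omega>
    using D_bd[of "enn2real (\<tau> \<omega>)" \<omega>] D_bd[of "dyadic_below n (enn2real (\<tau> \<omega>))" \<omega>]
    by (simp add: e_def indicator_def abs_le_iff)
  \<comment> \<open>Avoiding the first passage times of \<open>D\<close> gives left-continuity at
    the single time \<tau>; this suffices for \<open>e n\<close> to vanish, and continuity at all
    times is deduced from the squares.\<close>
  have first: "AE \<omega> in M. 0 < \<tau> \<omega> \<and> \<tau> \<omega> < \<infinity> \<and> continuous (at_left (enn2real (\<tau> \<omega>))) (\<lambda>t. D t \<omega>)"
    by (rule AE_avoids_first_passage[OF avoids \<tau> regular_compensatorD(8)[OF D] regular_compensatorD(3)[OF D]])
  have "AE \<omega> in M. (\<lambda>n. e n \<omega>) \<longlonglongrightarrow> 0"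
    using first
  proof eventually_elim
    case (elim \<omega>)
    then obtain x where x: "\<tau> \<omega> = ennreal x" "0 < x" by (cases "\<tau> \<omega>") auto
    have "filterlim (\<lambda>n. dyadic_below n x) (at_left x) sequentially"
      using dyadic_below_tendsto[OF x(2)] dyadic_below(1)[OF x(2)]
      by (auto simp: filterlim_at less_imp_neq intro!: always_eventually)
    moreover have "((\<lambda>t. D t \<omega>) \<longlongrightarrow> D x \<omega>) (at_left x)" using elim x by (simp add: continuous_within)
    ultimately have "(\<lambda>n. D (dyadic_below n x) \<omega>) \<longlonglongrightarrow> D x \<omega>" by (rule filterlim_compose[rotated])
    then have "(\<lambda>n. indicator {\<omega>. \<tau> \<omega> \<le> ennreal (real R)} \<omega> * (D x \<omega> - D (dyadic_below n x) \<omega>)) \<longlonglongrightarrow>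
        indicator {\<omega>. \<tau> \<omega> \<le> ennreal (real R)} \<omega> * (D x \<omega> - D x \<omega>)" by (intro tendsto_intros)
    then show ?case using x by (simp add: e_def)
  qed
  then have "(\<lambda>n. \<integral>\<omega>. e n \<omega> \<partial>M) \<longlonglongrightarrow> (\<integral>\<omega>. 0 \<partial>M)"
    using e_bd by (intro integral_dominated_convergence[where w = "\<lambda>_. 1"] e_meas) auto
  then have e_lim: "(\<lambda>n. \<integral>\<omega>. e n \<omega> \<partial>M) \<longlonglongrightarrow> 0" by simp
  \<comment> \<open>The cells in \<open>J\<close> are closed on the right, while
    \<open>dyadic_above\<close> uses cells closed on the left. Since \<tau> is almost surely no grid
    point, the two conventions agree at \<tau>, and the right end of its cell is the next grid
    point.\<close>
  have not_dyadic: "AE \<omega> in M. \<forall>d\<in>dyadics. \<tau> \<omega> \<noteq> ennreal d"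
    by (rule AE_ball_countable[OF countable_dyadics, THEN iffD2]) (use avoids_const[OF avoids \<tau>] in auto)
  have bound: "AE \<omega> in M. (\<Sum>i<R * 2 ^ n. H n i \<omega>) \<le> \<delta> + indicator (C \<delta> n) \<omega> + e n \<omega>" if \<delta>: "0 < \<delta>" for \<delta> n
    using first not_dyadic AE_space AE_not_in[OF N]
  proof eventually_elim
    case (elim \<omega>)
    then obtain x where x: "\<tau> \<omega> = ennreal x" "0 < x" by (cases "\<tau> \<omega>") auto
    obtain j where j: "real j / 2 ^ n < x" "x \<le> real (Suc j) / 2 ^ n" "dyadic_below n x = real j / 2 ^ n"
      by (rule dyadic_below_cellE[OF x(2)])
    have x_ne: "x \<noteq> d" if "d \<in> dyadics" for d using elim(2) that x by auto
    have lt: "x < real (Suc j) / 2 ^ n" using j(2) x_ne[OF dyadicsI[of "Suc j" n]] by simp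
    have J_iff: "\<omega> \<in> J n i \<longleftrightarrow> i = j" for i
    proof
      assume "\<omega> \<in> J n i"
      then have i: "real i / 2 ^ n < x" "x \<le> real (Suc i) / 2 ^ n"
        using x by (auto simp: J_def ennreal_less_iff simp del: of_nat_Suc)
      have "dyadic_below n x = real i / 2 ^ n" by (rule dyadic_below_cell[OF i])
      then show "i = j" using j(3) by simp
    qed (use j x in \<open>auto simp: J_def ennreal_less_iff intro!: ennreal_leI simp del: of_nat_Suc\<close>)
    have sum: "(\<Sum>i<R * 2 ^ n. H n i \<omega>) = (if j < R * 2 ^ n then m (real (Suc j) / 2 ^ n) x \<omega> - D (real j / 2 ^ n) \<omega> else 0)"
    proof -
      have "(\<Sum>i<R * 2 ^ n. H n i \<omega>) =
          (\<Sum>i<R * 2 ^ n. if i = j then m (real (Suc i) / 2 ^ n) x \<omega> - D (real i / 2 ^ n) \<omega> else 0)"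
        using x by (intro sum.cong refl) (simp add: H_def indicator_def J_iff del: of_nat_Suc)
      then show ?thesis by (simp add: sum.delta del: of_nat_Suc)
    qed
    show ?case
    proof (cases "j < R * 2 ^ n")
      case True
      then have "real (Suc j) \<le> real R * 2 ^ n"
        using of_nat_le_iff[of "Suc j" "R * 2 ^ n", where 'a = real] by (simp del: of_nat_Suc)
      then have "real (Suc j) / 2 ^ n \<le> real R" by (simp add: divide_le_eq del: of_nat_Suc)
      then have "x < real R" using lt by linarith
      then have e: "e n \<omega> = D x \<omega> - D (real j / 2 ^ n) \<omega>" using x j(3) by (simp add: e_def)
      have "dyadic_above n x = real (Suc j) / 2 ^ n" using j(1) lt by (intro dyadic_above_cell) auto
      then have U: "m (real (Suc j) / 2 ^ n) x \<omega> = U n x \<omega> + D x \<omega>" using elim x by (simp add: U_def)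
      have "U n x \<omega> \<le> \<delta> + indicator (C \<delta> n) \<omega>"
      proof (cases "\<delta> < U n x \<omega>")
        case True
        then have "\<omega> \<in> C \<delta> n" using \<open>x < real R\<close> x elim(3) by (auto simp: C_def intro!: exI[of _ x])
        then show ?thesis using U_bd[of n x \<omega>] \<delta> by simp
      qed (auto simp: indicator_def)
      then show ?thesis unfolding sum U e using True by simp
    next
      case False
      have "real j / 2 ^ n \<ge> 0" by simp
      then have "0 \<le> e n \<omega>" using D_mono[OF elim(3), of "real j / 2 ^ n" x] j(1,3) x by (simp add: e_def)
      then show ?thesis unfolding sum using False \<delta> by simp
    qed
  qed
  have Q_nonneg: "0 \<le> Q n \<omega>" for n \<omega> by (simp add: Q_def sum_nonneg)
  have "(\<lambda>n. \<integral>\<omega>. norm (Q n \<omega>) \<partial>M) \<longlonglongrightarrow> 0"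
  proof (rule tendstoI)
    fix \<epsilon> :: real assume \<epsilon>: "0 < \<epsilon>"
    \<comment> \<open>One third for each term of \<open>bound\<close>: the level \<delta>, the
      probability of \<open>C \<delta> n\<close> and the mean of \<open>e n\<close>.\<close>
    define \<delta> where "\<delta> = \<epsilon> / 3"
    have \<delta>: "0 < \<delta>" using \<epsilon> by (simp add: \<delta>_def)
    show "eventually (\<lambda>n. dist (\<integral>\<omega>. norm (Q n \<omega>) \<partial>M) 0 < \<epsilon>) sequentially"
      using order_tendstoD(2)[OF vanish(1)[OF \<delta>] \<delta>] order_tendstoD(2)[OF e_lim \<delta>]
    proof eventually_elim
      case (elim n)
      note C_M = vanish(2)[OF \<delta>, of n]
      have int: "integrable M (\<lambda>\<omega>. indicator (C \<delta> n) \<omega> :: real)"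
        using C_M by (intro integrable_bounded[of _ 1]) (auto simp: indicator_def)
      have int_e: "integrable M (e n)" by (rule integrable_bounded[OF e_meas e_bd])
      have "(\<integral>\<omega>. Q n \<omega> \<partial>M) \<le> (\<integral>\<omega>. \<delta> + indicator (C \<delta> n) \<omega> + e n \<omega> \<partial>M)"
        unfolding Q_H using H_int int int_e bound[OF \<delta>] by (intro integral_mono_AE) auto
      also have "\<dots> = \<delta> + (\<integral>\<omega>. indicator (C \<delta> n) \<omega> \<partial>M) + (\<integral>\<omega>. e n \<omega> \<partial>M)"
        using int int_e by (simp add: prob_space)
      finally have "(\<integral>\<omega>. Q n \<omega> \<partial>M) < \<epsilon>" using elim by (simp add: \<delta>_def)
      moreover have "0 \<le> (\<integral>\<omega>. Q n \<omega> \<partial>M)" by (simp add: Q_nonneg)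
      ultimately show ?case by (simp add: Q_nonneg dist_real_def)
    qed
  qed
  then obtain p where p: "strict_mono p" "AE \<omega> in M. (\<lambda>n. Q (p n) \<omega>) \<longlonglongrightarrow> 0"
    using tendsto_L1_AE_subseq[of M Q, OF Q_int] by blast
  show ?thesis
    using p(2) AE_space
  proof eventually_elim
    case (elim \<omega>)
    show ?case
    proof (intro allI impI, rule ccontr)
      fix r assume r: "0 < r" "r \<le> real R" and "\<not> continuous (at_left r) (\<lambda>t. D t \<omega>)"
      then obtain q k where q: "0 \<le> q" "q < r" "\<And>s. q \<le> s \<Longrightarrow> s < r \<Longrightarrow> D s \<omega> \<le> D q \<omega> + 1 / real (Suc k)"
          "D q \<omega> + 1 / real (Suc k) < D r \<omega>"
        using increasing_jump_first_passage[OF regular_compensatorD(3)[OF D elim(2)]] by metis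
      \<comment> \<open>On every fine grid the cell around \<open>r\<close> starts after
        \<open>q\<close> and ends at or after \<open>r\<close>, so a jump at \<open>r\<close>
        contributes at least \<open>\<eta>\<^sup>2\<close> to \<open>Q n\<close>. This contradicts
        the almost sure convergence of \<open>Q\<close> to \<open>0\<close> along a
        subsequence.\<close>
      define \<eta> where "\<eta> = D r \<omega> - (D q \<omega> + 1 / real (Suc k))"
      have \<eta>: "0 < \<eta>" using q(4) by (simp add: \<eta>_def)
      have "eventually (\<lambda>n. \<eta>\<^sup>2 \<le> Q n \<omega>) sequentially"
        using order_tendstoD(1)[OF dyadic_below_tendsto[OF r(1)] q(2)]
      proof eventually_elim
        case (elim n)
        obtain j where j: "real j / 2 ^ n < r" "r \<le> real (Suc j) / 2 ^ n" "dyadic_below n r = real j / 2 ^ n"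
          by (rule dyadic_below_cellE[OF r(1)])
        have "real j < real R * 2 ^ n" using j(1) r(2) by (simp add: divide_less_eq) (meson less_le_trans mult_right_mono zero_le_numeral zero_le_power)
        then have jR: "j < R * 2 ^ n" using of_nat_less_iff[of j "R * 2 ^ n", where 'a = real] by simp
        have "\<eta> \<le> D (real (Suc j) / 2 ^ n) \<omega> - D (real j / 2 ^ n) \<omega>"
          using q(3)[of "real j / 2 ^ n"] D_mono[OF \<open>\<omega> \<in> space M\<close> _ j(2)] r elim j(1,3) by (simp add: \<eta>_def del: of_nat_Suc)
        then have "\<eta>\<^sup>2 \<le> (D (real (Suc j) / 2 ^ n) \<omega> - D (real j / 2 ^ n) \<omega>)\<^sup>2" using \<eta> by (intro power_mono) auto
        also have "\<dots> \<le> Q n \<omega>" unfolding Q_def using jR by (intro member_le_sum) auto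
        finally show ?case .
      qed
      then have "eventually (\<lambda>n. \<eta>\<^sup>2 \<le> Q (p n) \<omega>) sequentially"
        by (rule eventually_compose_filterlim[OF _ filterlim_subseq[OF p(1)]])
      from tendsto_lowerbound[OF elim(1) this] have "\<eta>\<^sup>2 \<le> 0" by simp
      then show False using \<eta> by simp
    qed
  qed
qed

lemma AE_compensator_left_continuous:
  assumes "regular_compensator \<tau> D" "avoids_stopping_times M F \<tau>" "\<tau> \<in> borel_measurable M"
  shows "AE \<omega> in M. \<forall>r>0. continuous (at_left r) (\<lambda>t. D t \<omega>)"
proof -
  have "AE \<omega> in M. \<forall>R::nat. \<forall>r. 0 < r \<longrightarrow> r \<le> real R \<longrightarrow> continuous (at_left r) (\<lambda>t. D t \<omega>)"
    using AE_compensator_left_continuous_upto[OF assms] by (simp add: AE_all_countable)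
  then show ?thesis by eventually_elim (use real_arch_simple in blast)
qed

end

section \<open>The logarithm of the conditional survival probability\<close>

text \<open>The inequality \<open>ln x \<le> x - 1\<close> at \<open>x = a / b\<close>, multiplied
  by \<open>b\<close>. Here \<open>a\<close> is the earlier and \<open>b\<close> the later value of
  the decreasing function.\<close>

lemma log_increment_le:
  fixes a b :: real
  assumes "0 \<le> b" "b \<le> a"
  shows "b * max 0 (ln (1 / b) - ln (1 / a)) \<le> a - b"
proof (cases "b = 0")
  case False
  then have pos: "0 < b" "0 < a" using assms by auto
  have "ln (1 / b) - ln (1 / a) = ln (a / b)" using pos by (simp add: ln_div)
  also have "\<dots> \<le> a / b - 1" using pos by (intro ln_le_minus_one) simp
  finally have "b * (ln (1 / b) - ln (1 / a)) \<le> b * (a / b - 1)" using pos by (intro mult_left_mono) auto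
  also have "\<dots> = a - b" using pos by (simp add: field_simps)
  finally show ?thesis using assms by (auto simp: max_def)
qed (use assms in simp)

text \<open>The same inequality for the logarithm, now at \<open>b / a\<close>. The price is the
  error \<open>(a - b)\<^sup>2 / a\<close>, which small increments alone do not control when
  \<open>a\<close> is close to \<open>0\<close>.\<close>

lemma log_increment_ge:
  fixes a b :: real
  assumes "0 \<le> b" "b \<le> a"
  shows "a - b - (a - b)\<^sup>2 / a \<le> b * max 0 (ln (1 / b) - ln (1 / a))"
proof (cases "b = 0")
  case True
  then show ?thesis by (simp add: power2_eq_square)
next
  case False
  then have pos: "0 < b" "0 < a" using assms by auto
  have "ln (b / a) \<le> b / a - 1" using pos by (intro ln_le_minus_one) simp
  then have "1 - b / a \<le> ln (1 / b) - ln (1 / a)" using pos by (simp add: ln_div)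
  then have "b * (1 - b / a) \<le> b * max 0 (ln (1 / b) - ln (1 / a))" using pos by (intro mult_left_mono) auto
  moreover have "a - b - (a - b)\<^sup>2 / a = b * (1 - b / a)" using pos by (simp add: field_simps power2_eq_square)
  ultimately show ?thesis by simp
qed

text \<open>The error is split at the level \<eta>. Above it the denominator helps; below it the
  error is at most the increment, which is an increment of the function capped at \<eta>. Summed
  along a decreasing function, the capped increments amount to at most \<eta>, however close to
  \<open>0\<close> the function comes.\<close>

lemma square_increment_le:
  fixes a b \<delta> \<eta> :: real
  assumes "0 \<le> b" "b \<le> a" "a - b \<le> \<delta>" "0 < \<eta>"
  shows "(a - b)\<^sup>2 / a \<le> \<delta> / \<eta> * (a - b) + (min a \<eta> - min b \<eta>)"
proof (cases "\<eta> \<le> a")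
  case True
  have "(a - b) * (a - b) / a \<le> \<delta> * (a - b) / \<eta>"
    using assms True by (intro frac_le mult_right_mono mult_nonneg_nonneg) auto
  moreover have "min b \<eta> \<le> min a \<eta>" using assms by auto
  ultimately show ?thesis by (simp add: power2_eq_square)
next
  case False
  have "(a - b)\<^sup>2 / a \<le> a - b"
  proof (cases "a = 0")
    case False
    then have "0 < a" using assms by simp
    have "(a - b) * (a - b) \<le> (a - b) * a" using assms by (intro mult_left_mono) auto
    then show ?thesis using \<open>0 < a\<close> by (simp add: divide_le_eq power2_eq_square)
  qed (use assms in simp)
  moreover have "0 \<le> \<delta> / \<eta> * (a - b)" using assms by (intro mult_nonneg_nonneg divide_nonneg_nonneg) auto
  moreover have "min a \<eta> = a" "min b \<eta> = b" using False assms by auto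
  ultimately show ?thesis by linarith
qed

context
  fixes s t :: real
  assumes st: "0 \<le> s" "s \<le> t"
begin

definition grid :: "nat \<Rightarrow> nat \<Rightarrow> real" where
  "grid n i = s + (t - s) * (real i / 2 ^ n)"

lemma grid_0: "grid n 0 = s" and grid_top: "grid n (2 ^ n) = t"
  by (simp_all add: grid_def)

lemma grid_mono: "i \<le> j \<Longrightarrow> grid n i \<le> grid n j"
  unfolding grid_def using st by (intro add_left_mono mult_left_mono divide_right_mono) auto

lemma grid_ge: "s \<le> grid n i" using grid_mono[of 0 i n] by (simp add: grid_0)

lemma grid_nonneg: "0 \<le> grid n i" using grid_ge[of n i] st by simp

lemma grid_le: "i \<le> 2 ^ n \<Longrightarrow> grid n i \<le> t" using grid_mono[of i "2 ^ n" n] by (simp add: grid_top)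

lemma grid_Suc: "grid n (Suc i) = grid n i + (t - s) / 2 ^ n"
  by (simp add: grid_def add_divide_distrib algebra_simps)

lemma grid_mesh: "(\<lambda>n. (t - s) / 2 ^ n) \<longlonglongrightarrow> 0"
proof -
  have "(\<lambda>n. (t - s) * (1/2) ^ n) \<longlonglongrightarrow> (t - s) * 0" by (intro tendsto_mult_left LIMSEQ_power_zero) simp
  then show ?thesis by (simp add: power_one_over)
qed

text \<open>A Riemann-Stieltjes sum for the integral of \<open>z\<close> against \<open>ln (1 / z)\<close>; the maximum takes care of
  the junk value \<open>ln (1 / 0) = 0\<close>, which makes an increment negative when \<open>z\<close> reaches \<open>0\<close>.\<close>

definition log_sum :: "(real \<Rightarrow> real) \<Rightarrow> nat \<Rightarrow> real" where
  "log_sum z n = (\<Sum>i<2 ^ n. z (grid n (Suc i)) * max 0 (ln (1 / z (grid n (Suc i))) - ln (1 / z (grid n i))))"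

lemma log_sum_le:
  assumes anti: "\<And>x y. 0 \<le> x \<Longrightarrow> x \<le> y \<Longrightarrow> z y \<le> z x" and nonneg: "\<And>x. 0 \<le> z x"
  shows "log_sum z n \<le> z s - z t"
proof -
  have "log_sum z n \<le> (\<Sum>i<2 ^ n. z (grid n i) - z (grid n (Suc i)))"
    unfolding log_sum_def by (intro sum_mono log_increment_le nonneg anti grid_nonneg grid_mono) simp
  also have "\<dots> = z s - z t" by (simp only: sum_lessThan_telescope'[of "\<lambda>i. z (grid n i)"] grid_0 grid_top)
  finally show ?thesis .
qed

lemma log_sum_tendsto:
  assumes anti: "\<And>x y. 0 \<le> x \<Longrightarrow> x \<le> y \<Longrightarrow> z y \<le> z x" and bd: "\<And>x. 0 \<le> z x \<and> z x \<le> 1"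
    and cont: "continuous_on {0..} z"
  shows "log_sum z \<longlonglongrightarrow> z s - z t"
proof (rule LIMSEQ_I)
  fix \<epsilon> :: real assume \<epsilon>: "0 < \<epsilon>"
  \<comment> \<open>With a modulus of continuity \<open>\<eta>\<^sup>2\<close> the factor
    \<open>\<delta> / \<eta>\<close> of the error estimate is \<eta>. The total error is then at
    most \<open>2 * \<eta>\<close>, which stays below \<epsilon>.\<close>
  define \<eta> where "\<eta> = \<epsilon> / 3"
  have \<eta>: "0 < \<eta>" using \<epsilon> by (simp add: \<eta>_def)
  have "uniformly_continuous_on {s..t} z"
    by (intro compact_uniformly_continuous continuous_on_subset[OF cont]) (use st in auto)
  then obtain d where d: "0 < d" "\<And>x y. x \<in> {s..t} \<Longrightarrow> y \<in> {s..t} \<Longrightarrow> dist y x < d \<Longrightarrow> dist (z y) (z x) < \<eta>\<^sup>2"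
    unfolding uniformly_continuous_on_def using \<eta> by (metis zero_less_power)
  from order_tendstoD(2)[OF grid_mesh d(1)]
  obtain n0 where n0: "\<And>n. n0 \<le> n \<Longrightarrow> (t - s) / 2 ^ n < d" by (auto simp: eventually_sequentially)
  show "\<exists>no. \<forall>n\<ge>no. norm (log_sum z n - (z s - z t)) < \<epsilon>"
  proof (intro exI[of _ n0] allI impI)
    fix n assume n: "n0 \<le> n"
    let ?a = "\<lambda>i. z (grid n i)" and ?b = "\<lambda>i. z (grid n (Suc i))"
    have close: "?a i - ?b i \<le> \<eta>\<^sup>2" if "i < 2 ^ n" for i
    proof -
      have "dist (grid n (Suc i)) (grid n i) < d" using n0[OF n] st by (simp add: grid_Suc dist_real_def)
      then have "dist (?b i) (?a i) < \<eta>\<^sup>2" using that by (intro d(2)) (auto intro: grid_ge grid_le)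
      then show ?thesis by (simp add: dist_real_def abs_less_iff)
    qed
    have "z s - z t - (\<eta>\<^sup>2 / \<eta> * (z s - z t) + (min (z s) \<eta> - min (z t) \<eta>)) =
        (\<Sum>i<2 ^ n. ?a i - ?b i) - (\<eta>\<^sup>2 / \<eta> * (\<Sum>i<2 ^ n. ?a i - ?b i) + (\<Sum>i<2 ^ n. min (?a i) \<eta> - min (?b i) \<eta>))"
      by (simp only: sum_lessThan_telescope'[of "\<lambda>i. z (grid n i)"]
          sum_lessThan_telescope'[of "\<lambda>i. min (z (grid n i)) \<eta>"] grid_0 grid_top)
    also have "\<dots> = (\<Sum>i<2 ^ n. (?a i - ?b i) - (\<eta>\<^sup>2 / \<eta> * (?a i - ?b i) + (min (?a i) \<eta> - min (?b i) \<eta>)))"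
      by (simp only: sum.distrib sum_subtractf sum_distrib_left[symmetric])
    also have "\<dots> \<le> log_sum z n"
      unfolding log_sum_def
    proof (rule sum_mono)
      fix i assume "i \<in> {..<(2::nat) ^ n}"
      then have i: "i < 2 ^ n" by simp
      have b: "0 \<le> ?b i" "?b i \<le> ?a i" using bd anti[OF grid_nonneg grid_mono[of i "Suc i" n]] by auto
      show "(?a i - ?b i) - (\<eta>\<^sup>2 / \<eta> * (?a i - ?b i) + (min (?a i) \<eta> - min (?b i) \<eta>)) \<le>
          ?b i * max 0 (ln (1 / ?b i) - ln (1 / ?a i))"
        using log_increment_ge[OF b] square_increment_le[OF b close[OF i] \<eta>] by linarith
    qed
    finally have lower: "z s - z t - (\<eta>\<^sup>2 / \<eta> * (z s - z t) + (min (z s) \<eta> - min (z t) \<eta>)) \<le> log_sum z n" .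
    have "z s - z t \<le> 1" using bd[of s] bd[of t] by simp
    then have "\<eta>\<^sup>2 / \<eta> * (z s - z t) \<le> \<eta>" using mult_left_mono[of "z s - z t" 1 \<eta>] \<eta> by (simp add: power2_eq_square)
    moreover have "min (z s) \<eta> - min (z t) \<eta> \<le> \<eta>" using bd[of t] \<eta> by auto
    ultimately have "z s - z t - 2 * \<eta> \<le> log_sum z n" using lower by linarith
    moreover have "log_sum z n \<le> z s - z t" by (rule log_sum_le) (use anti bd in auto)
    ultimately show "norm (log_sum z n - (z s - z t)) < \<epsilon>" using \<epsilon> by (simp add: \<eta>_def abs_less_iff)
  qed
qed

text \<open>Only cells that end strictly before \<open>x\<close> are counted. With \<open>x\<close>
  the value of \<tau>, this condition is an event \<open>u < \<tau>\<close> at the right end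
  \<open>u\<close> of the cell, whose conditional probability is the factor \<open>z\<close> at the
  right end in \<open>log_sum\<close>.\<close>

definition before_sum :: "(real \<Rightarrow> real) \<Rightarrow> real \<Rightarrow> nat \<Rightarrow> real" where
  "before_sum v x n = (\<Sum>i<2 ^ n. if grid n (Suc i) < x then v (grid n (Suc i)) - v (grid n i) else 0)"

text \<open>The counted cells form an initial segment of the grid, so the sum telescopes up to the
  last grid point \<open>p\<close> before \<open>x\<close>, which is within one mesh of
  \<open>min t x\<close>.\<close>

lemma before_sum_eq:
  assumes x: "s < x"
  obtains p where "s \<le> p" "p \<le> min t x" "min t x - (t - s) / 2 ^ n \<le> p" "before_sum v x n = v p - v s"
proof -
  define A where "A = {i. i \<le> 2 ^ n \<and> grid n i < x}"
  define J where "J = Max A"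
  have A: "finite A" "0 \<in> A" using x by (auto simp: A_def grid_0)
  have J: "J \<in> A" unfolding J_def using A by (intro Max_in) auto
  have J_max: "i \<le> J" if "i \<le> 2 ^ n" "grid n i < x" for i
    unfolding J_def using A(1) that by (intro Max_ge) (auto simp: A_def)
  have JN: "J \<le> 2 ^ n" "grid n J < x" using J by (auto simp: A_def)
  have "min t x - (t - s) / 2 ^ n \<le> grid n J"
  proof (cases "J = 2 ^ n")
    case True
    have "0 \<le> (t - s) / 2 ^ n" using st by simp
    then show ?thesis unfolding True grid_top by linarith
  next
    case False
    then have "\<not> grid n (Suc J) < x" using J_max[of "Suc J"] JN by auto
    then show ?thesis by (simp add: grid_Suc)
  qed
  moreover have "before_sum v x n = v (grid n J) - v s"
  proof -
    have "before_sum v x n = (\<Sum>i<2 ^ n. v (grid n (min (Suc i) J)) - v (grid n (min i J)))"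
      unfolding before_sum_def
    proof (rule sum.cong[OF refl])
      fix i assume "i \<in> {..<(2::nat) ^ n}"
      then have i: "Suc i \<le> 2 ^ n" by simp
      show "(if grid n (Suc i) < x then v (grid n (Suc i)) - v (grid n i) else 0) =
          v (grid n (min (Suc i) J)) - v (grid n (min i J))"
      proof (cases "grid n (Suc i) < x")
        case True
        then show ?thesis using J_max[OF i True] by (simp add: min_absorb1)
      next
        case False
        then have "\<not> Suc i \<le> J" using grid_mono[of "Suc i" J n] JN by auto
        then show ?thesis using False by (simp add: min_absorb2)
      qed
    qed
    also have "\<dots> = v (grid n (min (2 ^ n) J)) - v (grid n (min 0 J))"
      by (rule sum_lessThan_telescope)
    finally show ?thesis using JN by (simp add: grid_0 min_absorb2)
  qed
  moreover have "s \<le> grid n J" "grid n J \<le> min t x" using grid_ge grid_le[OF JN(1)] JN(2) by auto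
  ultimately show ?thesis using that by blast
qed

lemma
  assumes x: "0 \<le> x" and mono: "mono_on {0..x} v"
  shows before_sum_le: "before_sum v x n \<le> v (min t x) - v (min s x)"
    and before_sum_tendsto: "continuous_on {0..x} v \<Longrightarrow> before_sum v x \<longlonglongrightarrow> v (min t x) - v (min s x)"
proof -
  have "before_sum v x n = 0" if "x \<le> s" for n
    unfolding before_sum_def
  proof (intro sum.neutral ballI)
    fix i
    have "\<not> grid n (Suc i) < x" using grid_ge[of n "Suc i"] that by linarith
    then show "(if grid n (Suc i) < x then v (grid n (Suc i)) - v (grid n i) else 0) = 0" by simp
  qed
  note zero = this
  have min_s: "min s x = s" if "s < x" using that by simp
  show "before_sum v x n \<le> v (min t x) - v (min s x)"
  proof (cases "s < x")
    case True
    obtain p where p: "s \<le> p" "p \<le> min t x" "before_sum v x n = v p - v s" by (rule before_sum_eq[OF True])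
    have "v p \<le> v (min t x)" using p st x by (intro mono_onD[OF mono]) auto
    then show ?thesis using p(3) True by (simp add: min_s)
  next
    case False
    then show ?thesis using zero st by (simp add: min_absorb2)
  qed
  assume cont: "continuous_on {0..x} v"
  show "before_sum v x \<longlonglongrightarrow> v (min t x) - v (min s x)"
  proof (cases "s < x")
    case True
    have "\<forall>n. \<exists>p. s \<le> p \<and> p \<le> min t x \<and> min t x - (t - s) / 2 ^ n \<le> p \<and> before_sum v x n = v p - v s"
    proof
      fix n
      show "\<exists>p. s \<le> p \<and> p \<le> min t x \<and> min t x - (t - s) / 2 ^ n \<le> p \<and> before_sum v x n = v p - v s"
        by (rule before_sum_eq[OF True, of n v]) blast
    qed
    from choice[OF this] obtain p where p: "\<And>n. s \<le> p n" "\<And>n. p n \<le> min t x"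
        "\<And>n. min t x - (t - s) / 2 ^ n \<le> p n" "\<And>n. before_sum v x n = v (p n) - v s" by blast
    have "p \<longlonglongrightarrow> min t x"
    proof (rule tendsto_sandwich)
      show "(\<lambda>n. min t x - (t - s) / 2 ^ n) \<longlonglongrightarrow> min t x"
        using tendsto_diff[OF tendsto_const grid_mesh, of "min t x"] by simp
      show "(\<lambda>_. min t x) \<longlonglongrightarrow> min t x" by (rule tendsto_const)
      show "eventually (\<lambda>n. min t x - (t - s) / 2 ^ n \<le> p n) sequentially" by (intro always_eventually allI p(3))
      show "eventually (\<lambda>n. p n \<le> min t x) sequentially" by (intro always_eventually allI p(2))
    qed
    moreover have "min t x \<in> {0..x}" using st x by simp
    moreover have "p n \<in> {0..x}" for n
      using p(1)[of n] p(2)[of n] st(1) by simp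
    then have "eventually (\<lambda>n. p n \<in> {0..x}) sequentially" by (intro always_eventually allI)
    ultimately have "(\<lambda>n. v (p n)) \<longlonglongrightarrow> v (min t x)"
      by (rule continuous_on_tendsto_compose[OF cont])
    then have "(\<lambda>n. v (p n) - v s) \<longlonglongrightarrow> v (min t x) - v s" by (rule tendsto_diff[OF _ tendsto_const])
    moreover have "before_sum v x = (\<lambda>n. v (p n) - v s)" by (rule ext) (rule p(4))
    ultimately show ?thesis using True by (simp add: min_s)
  next
    case False
    then have "before_sum v x = (\<lambda>_. 0)" using zero by auto
    then show ?thesis using False st by (simp add: min_absorb2)
  qed
qed

end

section \<open>Paths of the stopped logarithm\<close>

lemma continuous_on_Ici_if_cadlag:
  assumes "cadlag_path d" "\<And>r. 0 < r \<Longrightarrow> continuous (at_left r) d"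
  shows "continuous_on {0..} d"
  unfolding continuous_on_eq_continuous_within
proof
  fix r :: real assume "r \<in> {0..}"
  then have right: "continuous (at_right r) d" using assms(1) by (simp add: cadlag_path_def)
  show "continuous (at r within {0..}) d"
  proof (cases "r = 0")
    case True
    then show ?thesis using right by (simp add: at_within_Ici_at_right)
  next
    case False
    then have "continuous (at_left r) d" using \<open>r \<in> {0..}\<close> by (intro assms(2)) simp
    then have "continuous (at r) d" using right by (simp add: continuous_at_split)
    then show ?thesis by (rule continuous_at_imp_continuous_within)
  qed
qed

lemma continuous_paths:
  assumes "continuous_on UNIV v"
  shows "caglad_path v" and "\<And>t. continuous (at_right t) v"
proof -
  have at: "continuous (at t) v" for t using assms by (simp add: continuous_on_eq_continuous_at)
  show right: "continuous (at_right t) v" for t by (rule continuous_at_imp_continuous_within[OF at])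
  have "continuous (at_left t) v" for t by (rule continuous_at_imp_continuous_within[OF at])
  then show "caglad_path v" using right unfolding caglad_path_def continuous_within by blast
qed

text \<open>Up to \<open>x\<close> the argument of the logarithm stays positive, as \<open>d\<close>
  is increasing and \<open>d x < 1\<close>. The inner maximum continues the path constantly to
  negative times, so one-sided continuity at \<open>0\<close> follows from continuity on the whole
  line.\<close>

lemma stopped_log_path:
  fixes d :: "real \<Rightarrow> real"
  assumes mono: "mono_on {0..} d" and cont: "continuous_on {0..} d" and x: "0 \<le> x" "d x < 1"
  shows "continuous_on UNIV (\<lambda>t. ln (1 / (1 - d (min (max 0 t) x))))"
    and "\<And>s t. s \<le> t \<Longrightarrow> ln (1 / (1 - d (min (max 0 s) x))) \<le> ln (1 / (1 - d (min (max 0 t) x)))"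
proof -
  have less: "d (min (max 0 t) x) < 1" for t
    using mono_onD[OF mono, of "min (max 0 t) x" x] x by auto
  have clamp: "continuous_on UNIV (\<lambda>t. min (max 0 t) x)" by (intro continuous_intros)
  have "continuous_on UNIV (\<lambda>t. d (min (max 0 t) x))"
    by (rule continuous_on_compose2[OF cont clamp]) (use x in auto)
  then show "continuous_on UNIV (\<lambda>t. ln (1 / (1 - d (min (max 0 t) x))))"
    using less by (intro continuous_intros) (auto simp: less_imp_neq[THEN not_sym])
  fix s t :: real assume "s \<le> t"
  then have "d (min (max 0 s) x) \<le> d (min (max 0 t) x)" using x by (intro mono_onD[OF mono]) auto
  then show "ln (1 / (1 - d (min (max 0 s) x))) \<le> ln (1 / (1 - d (min (max 0 t) x)))"
    using less[of s] less[of t] by (simp add: ln_div)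
qed

context usual_filtered_prob_space
begin

lemma integrable_indicator_bounded:
  fixes f :: "'a \<Rightarrow> real"
  assumes [measurable]: "A \<in> sets M" "f \<in> borel_measurable M" and f: "\<And>\<omega>. \<bar>f \<omega>\<bar> \<le> 1"
  shows "integrable M (\<lambda>\<omega>. indicator A \<omega> * f \<omega>)"
proof (rule integrable_bounded[of _ 1])
  show "\<bar>indicator A \<omega> * f \<omega>\<bar> \<le> 1" for \<omega> using f[of \<omega>] by (auto simp: indicator_def)
qed measurable

text \<open>Where \<open>D s\<close> equals \<open>1\<close>, the event \<open>s < \<tau>\<close>
  has conditional probability \<open>0\<close>, so almost surely \<tau> is not later than any
  rational time at which \<open>D\<close> has reached \<open>1\<close>. If \<open>D\<close> were
  \<open>1\<close> at \<tau>, the first time \<open>T\<close> with this property would satisfy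
  \<open>T \<le> \<tau>\<close>, and even \<open>T < \<tau>\<close> by avoidance; a rational time in
  between then gives a contradiction.\<close>

lemma AE_compensator_less_1:
  assumes D: "regular_compensator \<tau> D" and avoids: "avoids_stopping_times M F \<tau>"
    and \<tau>[measurable]: "\<tau> \<in> borel_measurable M"
  shows "AE \<omega> in M. D (enn2real (\<tau> \<omega>)) \<omega> < 1"
proof -
  define T where "T = hitting_time (\<lambda>r \<omega>. 1 \<le> D r \<omega>) 0"
  have mono: "D s \<omega> \<le> D t \<omega>" if "\<omega> \<in> space M" "0 \<le> s" "s \<le> t" for s t \<omega>
    using mono_onD[OF regular_compensatorD(3)[OF D that(1)], of s t] that by simp
  have set_F: "{\<omega> \<in> space M. 1 \<le> D r \<omega>} \<in> sets (F r)" if r: "0 \<le> r" for r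
  proof -
    have "{\<omega> \<in> space (F r). 1 \<le> D r \<omega>} \<in> sets (F r)" using regular_compensatorD(1)[OF D r] by measurable
    then show ?thesis by (simp add: space_F r)
  qed
  have T: "stopping_time_ext M F T"
    unfolding T_def
  proof (rule stopping_time_hitting_time[OF order_refl set_F])
    fix r \<omega> assume "\<omega> \<in> space M" "0 \<le> r" "1 \<le> D r \<omega>"
    then have "\<forall>u. r < u \<longrightarrow> u < r + 1 \<longrightarrow> 1 \<le> D u \<omega>" using mono[of \<omega> r] by (meson less_imp_le order_trans)
    then show "\<exists>s>r. \<forall>u. r < u \<longrightarrow> u < s \<longrightarrow> 1 \<le> D u \<omega>" by (intro exI[of _ "r + 1"]) simp
  qed
  have before: "AE \<omega> in M. 1 \<le> D s \<omega> \<longrightarrow> \<tau> \<omega> \<le> ennreal s" if s: "0 \<le> s" for s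
  proof -
    let ?a = "indicator {\<omega> \<in> space M. 1 \<le> D s \<omega>} :: 'a \<Rightarrow> real"
    let ?ind = "indicator {\<omega>. \<tau> \<omega> \<le> ennreal s} :: 'a \<Rightarrow> real"
    note [measurable] = indicator_le_time_measurable[OF \<tau>, of s] sets_F[OF s set_F[OF s]] regular_compensatorD(2)[OF D s]
    have a: "?a \<in> borel_measurable (F s)" using set_F[OF s] by measurable
    have a1: "?a \<omega> * D s \<omega> = ?a \<omega>" for \<omega>
      using regular_compensatorD(7)[OF D, of s \<omega>] by (auto simp: indicator_def)
    have int2: "integrable M (\<lambda>\<omega>. ?a \<omega> * ?ind \<omega>)"
      by (intro integrable_indicator_bounded sets_F[OF s set_F[OF s]] indicator_le_time_measurable[OF \<tau>]) (simp add: indicator_def)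
    have int1: "integrable M ?a"
      using integrable_indicator_bounded[OF sets_F[OF s set_F[OF s]], of "\<lambda>_. 1"] by simp
    have int3: "integrable M (\<lambda>\<omega>. ?a \<omega> - ?a \<omega> * ?ind \<omega>)" by (intro Bochner_Integration.integrable_diff int1 int2)
    have "(\<integral>\<omega>. ?a \<omega> * D s \<omega> \<partial>M) = (\<integral>\<omega>. ?a \<omega> * ?ind \<omega> \<partial>M)"
      by (rule regular_compensator_integral[OF D \<tau> s a, of 1]) (simp add: indicator_def)
    then have "(\<integral>\<omega>. ?a \<omega> - ?a \<omega> * ?ind \<omega> \<partial>M) = 0"
      unfolding a1 by (simp only: Bochner_Integration.integral_diff[OF int1 int2] diff_self)
    moreover have "AE \<omega> in M. 0 \<le> ?a \<omega> - ?a \<omega> * ?ind \<omega>" by (simp add: indicator_def)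
    ultimately have "AE \<omega> in M. ?a \<omega> - ?a \<omega> * ?ind \<omega> = 0"
      using integral_nonneg_eq_0_iff_AE[OF int3] by blast
    then show ?thesis using AE_space by eventually_elim (auto simp: indicator_def split: if_splits)
  qed
  have "AE \<omega> in M. \<forall>s\<in>\<rat> \<inter> {0..}. 1 \<le> D s \<omega> \<longrightarrow> \<tau> \<omega> \<le> ennreal s"
    by (rule AE_ball_countable[THEN iffD2]) (use before in \<open>auto intro: countable_Int1 countable_rat\<close>)
  then show ?thesis
    using avoids_AE[OF avoids \<tau> T] avoids_const[OF avoids \<tau>, of \<infinity>] AE_space
  proof eventually_elim
    case (elim \<omega>)
    then obtain x where x: "\<tau> \<omega> = ennreal x" "0 \<le> x" by (cases "\<tau> \<omega>") auto
    have "\<not> 1 \<le> D x \<omega>"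
    proof
      assume "1 \<le> D x \<omega>"
      then have "T \<omega> \<le> \<tau> \<omega>" unfolding T_def hitting_time_def x(1) using x(2) by (intro Inf_lower) auto
      then have "hitting_time (\<lambda>r \<omega>. 1 \<le> D r \<omega>) 0 \<omega> < ennreal x" using elim(2) x(1) by (simp add: T_def)
      then obtain r where r: "0 \<le> r" "1 \<le> D r \<omega>" "r < x" unfolding hitting_time_less_iff by (auto simp: ennreal_less_iff)
      obtain q where q: "q \<in> \<rat>" "r < q" "q < x" using Rats_dense_in_real[OF r(3)] by blast
      have "1 \<le> D q \<omega>" using mono[OF elim(4) r(1), of q] q r by simp
      then have "\<tau> \<omega> \<le> ennreal q" using elim(1) q r by auto
      then show False using x q r by simp
    qed
    then show ?case using x by simp
  qed
qed

text \<open>The weights \<open>h\<close> will be increments of the logarithm, for which no bound is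
  available; hence the conditional expectation of nonnegative functions.\<close>

lemma compensator_survival_nn_integral:
  assumes D: "regular_compensator \<tau> D" and \<tau>: "\<tau> \<in> borel_measurable M"
    and t: "0 \<le> t" and h: "h \<in> borel_measurable (F t)"
  shows "(\<integral>\<^sup>+\<omega>. h \<omega> * ennreal (1 - D t \<omega>) \<partial>M) = (\<integral>\<^sup>+\<omega>. h \<omega> * indicator {\<omega>. ennreal t < \<tau> \<omega>} \<omega> \<partial>M)"
proof -
  interpret S: sigma_finite_subalgebra M "F t" by (rule sigma_finite_subalgebra_F[OF t])
  let ?gt = "indicator {\<omega>. ennreal t < \<tau> \<omega>} :: 'a \<Rightarrow> ennreal"
  let ?ind = "indicator {\<omega>. \<tau> \<omega> \<le> ennreal t} :: 'a \<Rightarrow> real"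
  note gt_M = indicator_gt_time_measurable[OF \<tau>, of t]
  note [measurable] = indicator_le_time_measurable[OF \<tau>, of t] regular_compensatorD(2)[OF D t]
  have D_bd: "0 \<le> D t \<omega>" "D t \<omega> \<le> 1" for \<omega> using regular_compensatorD(6,7)[OF D, of t \<omega>] by auto
  have DF: "(\<lambda>\<omega>. ennreal (1 - D t \<omega>)) \<in> borel_measurable (F t)" using regular_compensatorD(1)[OF D t] by measurable
  have gt: "?gt \<omega> = ennreal (1 - ?ind \<omega>)" for \<omega> by (auto simp: indicator_def)
  have "AE \<omega> in M. ennreal (1 - D t \<omega>) = nn_cond_exp M (F t) ?gt \<omega>"
  proof (rule S.nn_cond_exp_charact[OF _ gt_M DF])
    fix A assume A: "A \<in> sets (F t)"
    note [measurable] = sets_F[OF t A]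
    have AF: "(indicator A :: 'a \<Rightarrow> real) \<in> borel_measurable (F t)" using A by measurable
    note int_A = integrable_indicator_bounded[OF sets_F[OF t A]]
    have int: "integrable M (\<lambda>\<omega>. indicator A \<omega> :: real)" "integrable M (\<lambda>\<omega>. indicator A \<omega> * ?ind \<omega>)"
      "integrable M (\<lambda>\<omega>. indicator A \<omega> * (1 - ?ind \<omega>))"
      using int_A[of "\<lambda>_. 1"] int_A[of ?ind] int_A[of "\<lambda>\<omega>. 1 - ?ind \<omega>"] by (simp_all add: indicator_le_time_measurable[OF \<tau>])
    have intD: "integrable M (\<lambda>\<omega>. indicator A \<omega> * D t \<omega>)" "integrable M (\<lambda>\<omega>. indicator A \<omega> * (1 - D t \<omega>))"
      using D_bd by (auto intro!: int_A)
    have eq: "(\<integral>\<omega>. indicator A \<omega> * (1 - D t \<omega>) \<partial>M) = (\<integral>\<omega>. indicator A \<omega> * (1 - ?ind \<omega>) \<partial>M)"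
    proof -
      have "(\<integral>\<omega>. indicator A \<omega> * (1 - D t \<omega>) \<partial>M) = (\<integral>\<omega>. indicator A \<omega> - indicator A \<omega> * D t \<omega> \<partial>M)"
        by (simp only: right_diff_distrib mult_1_right)
      also have "\<dots> = (\<integral>\<omega>. indicator A \<omega> \<partial>M) - (\<integral>\<omega>. indicator A \<omega> * D t \<omega> \<partial>M)"
        by (rule Bochner_Integration.integral_diff[OF int(1) intD(1)])
      also have "(\<integral>\<omega>. indicator A \<omega> * D t \<omega> \<partial>M) = (\<integral>\<omega>. indicator A \<omega> * ?ind \<omega> \<partial>M)"
        by (rule regular_compensator_integral[OF D \<tau> t AF, of 1]) (simp add: indicator_def)
      also have "(\<integral>\<omega>. indicator A \<omega> \<partial>M) - (\<integral>\<omega>. indicator A \<omega> * ?ind \<omega> \<partial>M) = (\<integral>\<omega>. indicator A \<omega> - indicator A \<omega> * ?ind \<omega> \<partial>M)"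
        by (rule Bochner_Integration.integral_diff[OF int(1,2), symmetric])
      finally show ?thesis by (simp only: right_diff_distrib mult_1_right)
    qed
    have "(\<integral>\<^sup>+\<omega>\<in>A. ?gt \<omega> \<partial>M) = (\<integral>\<^sup>+\<omega>. ennreal (indicator A \<omega> * (1 - ?ind \<omega>)) \<partial>M)"
      by (intro nn_integral_cong) (auto simp: indicator_def)
    also have "\<dots> = ennreal (\<integral>\<omega>. indicator A \<omega> * (1 - ?ind \<omega>) \<partial>M)"
      using int(3) by (intro nn_integral_eq_integral) (auto simp: indicator_def)
    also have "\<dots> = (\<integral>\<^sup>+\<omega>. ennreal (indicator A \<omega> * (1 - D t \<omega>)) \<partial>M)"
      unfolding eq[symmetric] using intD(2) D_bd
      by (intro nn_integral_eq_integral[symmetric]) (auto simp: indicator_def)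
    also have "\<dots> = (\<integral>\<^sup>+\<omega>\<in>A. ennreal (1 - D t \<omega>) \<partial>M)"
      by (intro nn_integral_cong) (auto simp: indicator_def)
    finally show "(\<integral>\<^sup>+\<omega>\<in>A. ?gt \<omega> \<partial>M) = (\<integral>\<^sup>+\<omega>\<in>A. ennreal (1 - D t \<omega>) \<partial>M)" .
  qed
  then have "(\<integral>\<^sup>+\<omega>. h \<omega> * ennreal (1 - D t \<omega>) \<partial>M) = (\<integral>\<^sup>+\<omega>. h \<omega> * nn_cond_exp M (F t) ?gt \<omega> \<partial>M)"
    by (intro nn_integral_cong_AE) (auto elim: eventually_mono)
  also have "\<dots> = (\<integral>\<^sup>+\<omega>. h \<omega> * ?gt \<omega> \<partial>M)" by (rule S.nn_cond_exp_intg[OF h gt_M])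
  finally show ?thesis .
qed

lemma compensator_rectangle:
  assumes D: "regular_compensator \<tau> D" and \<tau>[measurable]: "\<tau> \<in> borel_measurable M"
    and s: "0 \<le> s" "s \<le> t" and B: "B \<in> sets (F s)"
  shows "(\<integral>\<^sup>+\<omega>. indicator B \<omega> * ennreal (D t \<omega> - D s \<omega>) \<partial>M) =
    emeasure M {\<omega> \<in> space M. \<omega> \<in> B \<and> ennreal s < \<tau> \<omega> \<and> \<tau> \<omega> \<le> ennreal t}"
proof -
  have t: "0 \<le> t" using s by simp
  let ?ind = "\<lambda>d. indicator {\<omega>. \<tau> \<omega> \<le> ennreal d} :: 'a \<Rightarrow> real"
  let ?C = "{\<omega> \<in> space M. \<omega> \<in> B \<and> ennreal s < \<tau> \<omega> \<and> \<tau> \<omega> \<le> ennreal t}"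
  note [measurable] = indicator_le_time_measurable[OF \<tau>, of s] indicator_le_time_measurable[OF \<tau>, of t]
    regular_compensatorD(2)[OF D s(1)] regular_compensatorD(2)[OF D t] sets_F[OF s(1) B]
  have D_bd: "0 \<le> D u \<omega>" "D u \<omega> \<le> 1" for u \<omega> using regular_compensatorD(6,7)[OF D, of u \<omega>] by auto
  have D_mono: "D s \<omega> \<le> D t \<omega>" if "\<omega> \<in> space M" for \<omega>
    using mono_onD[OF regular_compensatorD(3)[OF D that], of s t] s by simp
  have BF: "(indicator B :: 'a \<Rightarrow> real) \<in> borel_measurable (F s)" "(indicator B :: 'a \<Rightarrow> real) \<in> borel_measurable (F t)"
    using B sets_F_mono[OF B s] by measurable
  have int: "integrable M (\<lambda>\<omega>. indicator B \<omega> * ?ind u \<omega>)" if "u \<in> {s, t}" for u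
    by (intro integrable_indicator_bounded sets_F[OF s(1) B] indicator_le_time_measurable[OF \<tau>]) (simp add: indicator_def)
  have intD: "integrable M (\<lambda>\<omega>. indicator B \<omega> * D u \<omega>)" if "u \<in> {s, t}" for u
    using that D_bd s t by (intro integrable_indicator_bounded sets_F[OF s(1) B] regular_compensatorD(2)[OF D]) auto
  have eq: "(\<integral>\<omega>. indicator B \<omega> * D u \<omega> \<partial>M) = (\<integral>\<omega>. indicator B \<omega> * ?ind u \<omega> \<partial>M)" if "u \<in> {s, t}" for u
    using that s t BF by (intro regular_compensator_integral[OF D \<tau>, of _ _ 1]) (auto simp: abs_le_iff)
  have "(\<integral>\<^sup>+\<omega>. indicator B \<omega> * ennreal (D t \<omega> - D s \<omega>) \<partial>M) =
      (\<integral>\<^sup>+\<omega>. ennreal (indicator B \<omega> * D t \<omega> - indicator B \<omega> * D s \<omega>) \<partial>M)"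
    by (intro nn_integral_cong) (auto simp: indicator_def)
  also have "\<dots> = ennreal (\<integral>\<omega>. indicator B \<omega> * D t \<omega> - indicator B \<omega> * D s \<omega> \<partial>M)"
    using intD D_mono by (intro nn_integral_eq_integral) (auto simp: indicator_def)
  also have "(\<integral>\<omega>. indicator B \<omega> * D t \<omega> - indicator B \<omega> * D s \<omega> \<partial>M) =
      (\<integral>\<omega>. indicator B \<omega> * ?ind t \<omega> - indicator B \<omega> * ?ind s \<omega> \<partial>M)"
    using int intD eq by (simp add: Bochner_Integration.integral_diff)
  also have "\<dots> = (\<integral>\<omega>. indicator ?C \<omega> \<partial>M)"
    using ennreal_leI[OF s(2)] by (intro Bochner_Integration.integral_cong) (auto simp: indicator_def)
  also have "\<dots> = measure M ?C" by simp
  finally show ?thesis by (simp add: emeasure_eq_measure)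
qed

text \<open>\<open>X n\<close> sums the increments of the logarithm over cells that end before
  \<tau>, and \<open>Y n\<close> is its projection. The means agree. Those of \<open>Y n\<close>
  tend to the mean of \<open>D t - D s\<close> on \<open>B\<close> by bounded convergence, while
  \<open>X n\<close> converges to the increment of \<open>V\<close> from below: Fatou's lemma bounds
  the mean of this increment from above, and domination of \<open>X n\<close> by it gives the
  converse.\<close>

lemma log_compensator_rectangle:
  assumes D: "regular_compensator \<tau> D" and \<tau>[measurable]: "\<tau> \<in> borel_measurable M"
    and cont: "AE \<omega> in M. continuous_on {0..} (\<lambda>t. D t \<omega>)"
    and finite: "AE \<omega> in M. \<tau> \<omega> < \<infinity>" and less: "AE \<omega> in M. D (enn2real (\<tau> \<omega>)) \<omega> < 1"
    and V: "AE \<omega> in M. \<forall>t\<ge>0. V t \<omega> = ln (1 / (1 - D (min t (enn2real (\<tau> \<omega>))) \<omega>))"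
    and s: "0 \<le> s" "s \<le> t" and B: "B \<in> sets (F s)"
  shows "(\<integral>\<^sup>+\<omega>. ennreal (V t \<omega> - V s \<omega>) * indicator B \<omega> \<partial>M) =
    emeasure M {\<omega> \<in> space M. \<omega> \<in> B \<and> ennreal s < \<tau> \<omega> \<and> \<tau> \<omega> \<le> ennreal t}"
proof -
  have t: "0 \<le> t" using s by simp
  let ?g = "grid s t"
  let ?\<phi> = "\<lambda>u \<omega>. ln (1 / (1 - D u \<omega>))"
  let ?gt = "\<lambda>u. indicator {\<omega>. ennreal u < \<tau> \<omega>} :: 'a \<Rightarrow> ennreal"
  note g_nonneg[simp] = grid_nonneg[OF s]
  have g_mono: "?g n i \<le> ?g n (Suc i)" for n i by (rule grid_mono[OF s]) simp
  have D_M[measurable]: "D u \<in> borel_measurable M" if "0 \<le> u" for u by (rule regular_compensatorD(2)[OF D that])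
  have D_bd: "0 \<le> D u \<omega>" "D u \<omega> \<le> 1" for u \<omega> using regular_compensatorD(6,7)[OF D, of u \<omega>] by auto
  have D_mono: "D u \<omega> \<le> D v \<omega>" if "\<omega> \<in> space M" "0 \<le> u" "u \<le> v" for u v \<omega>
    using mono_onD[OF regular_compensatorD(3)[OF D that(1)], of u v] that by simp
  note [measurable] = sets_F[OF s(1) B]
  define X where "X n \<omega> = indicator B \<omega> * (\<Sum>i<2 ^ n. ennreal (?\<phi> (?g n (Suc i)) \<omega> - ?\<phi> (?g n i) \<omega>) * ?gt (?g n (Suc i)) \<omega>)"
    for n \<omega>
  define Y where "Y n \<omega> = indicator B \<omega> * ennreal (log_sum s t (\<lambda>u. 1 - D u \<omega>) n)" for n \<omega>
  have \<phi>_M[measurable]: "(\<lambda>\<omega>. ?\<phi> (?g n i) \<omega>) \<in> borel_measurable M" for n i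
    using D_M[OF g_nonneg[of n i]] by measurable
  have \<phi>_F: "(\<lambda>\<omega>. ?\<phi> (?g n i) \<omega>) \<in> borel_measurable (F (?g n (Suc i)))"
    "(\<lambda>\<omega>. ?\<phi> (?g n (Suc i)) \<omega>) \<in> borel_measurable (F (?g n (Suc i)))" for n i
    using measurable_F_mono[OF regular_compensatorD(1)[OF D g_nonneg] g_nonneg g_mono, of n i]
      regular_compensatorD(1)[OF D g_nonneg, of n "Suc i"] by measurable
  have X_M: "X n \<in> borel_measurable M" for n
    unfolding X_def[abs_def] using indicator_gt_time_measurable[OF \<tau>]
    by (intro borel_measurable_times_ennreal borel_measurable_sum measurable_compose[OF _ measurable_ennreal]
        borel_measurable_diff \<phi>_M) auto
  have Y_M: "Y n \<in> borel_measurable M" for n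
    unfolding Y_def[abs_def] log_sum_def[OF s]
    by (intro borel_measurable_times_ennreal borel_measurable_sum measurable_compose[OF _ measurable_ennreal]
        borel_measurable_diff borel_measurable_times borel_measurable_max \<phi>_M D_M) auto
  \<comment> \<open>Each increment is known at the right end of its cell, where the indicator that
    \<tau> comes later projects to \<open>1 - D\<close>. This dictates that \<open>D\<close> be
    evaluated at the right end points.\<close>
  have X_Y: "(\<integral>\<^sup>+\<omega>. X n \<omega> \<partial>M) = (\<integral>\<^sup>+\<omega>. Y n \<omega> \<partial>M)" for n
  proof -
    let ?h = "\<lambda>i \<omega>. indicator B \<omega> * ennreal (?\<phi> (?g n (Suc i)) \<omega> - ?\<phi> (?g n i) \<omega>)"
    have h_F: "?h i \<in> borel_measurable (F (?g n (Suc i)))" for i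
      using \<phi>_F[of n i] sets_F_mono[OF B s(1) grid_ge[OF s, of n "Suc i"]] by measurable
    have h_M: "?h i \<in> borel_measurable M" for i by (rule measurable_F_M[OF h_F g_nonneg])
    have "(\<integral>\<^sup>+\<omega>. X n \<omega> \<partial>M) = (\<integral>\<^sup>+\<omega>. (\<Sum>i<2 ^ n. ?h i \<omega> * ?gt (?g n (Suc i)) \<omega>) \<partial>M)"
      unfolding X_def by (simp only: sum_distrib_left mult.assoc)
    also have "\<dots> = (\<Sum>i<2 ^ n. \<integral>\<^sup>+\<omega>. ?h i \<omega> * ?gt (?g n (Suc i)) \<omega> \<partial>M)"
      by (intro nn_integral_sum borel_measurable_times_ennreal h_M indicator_gt_time_measurable[OF \<tau>])
    also have "\<dots> = (\<Sum>i<2 ^ n. \<integral>\<^sup>+\<omega>. ?h i \<omega> * ennreal (1 - D (?g n (Suc i)) \<omega>) \<partial>M)"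
      by (intro sum.cong refl compensator_survival_nn_integral[OF D \<tau>, symmetric] g_nonneg h_F)
    also have "\<dots> = (\<integral>\<^sup>+\<omega>. (\<Sum>i<2 ^ n. ?h i \<omega> * ennreal (1 - D (?g n (Suc i)) \<omega>)) \<partial>M)"
      by (intro nn_integral_sum[symmetric] borel_measurable_times_ennreal h_M
          measurable_compose[OF _ measurable_ennreal] borel_measurable_diff D_M g_nonneg) auto
    also have "\<dots> = (\<integral>\<^sup>+\<omega>. Y n \<omega> \<partial>M)"
    proof (rule nn_integral_cong)
      fix \<omega>
      have "(\<Sum>i<2 ^ n. ?h i \<omega> * ennreal (1 - D (?g n (Suc i)) \<omega>)) =
          indicator B \<omega> * (\<Sum>i<2 ^ n. ennreal ((1 - D (?g n (Suc i)) \<omega>) * max 0 (?\<phi> (?g n (Suc i)) \<omega> - ?\<phi> (?g n i) \<omega>)))"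
        unfolding sum_distrib_left
      proof (rule sum.cong[OF refl])
        fix i
        \<comment> \<open>Conversion to \<open>ennreal\<close> already truncates negative increments
          at \<open>0\<close>, which is the effect of the maximum in \<open>log_sum\<close>.\<close>
        have pos: "ennreal (max 0 y) = ennreal y" for y by (auto simp: max_def ennreal_neg)
        show "?h i \<omega> * ennreal (1 - D (?g n (Suc i)) \<omega>) =
            indicator B \<omega> * ennreal ((1 - D (?g n (Suc i)) \<omega>) * max 0 (?\<phi> (?g n (Suc i)) \<omega> - ?\<phi> (?g n i) \<omega>))"
          using D_bd(2)[of "?g n (Suc i)" \<omega>] by (simp add: ennreal_mult pos mult_ac)
      qed
      also have "\<dots> = Y n \<omega>"
        unfolding Y_def log_sum_def[OF s] using D_bd(2) by (subst sum_ennreal) auto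
      finally show "(\<Sum>i<2 ^ n. ?h i \<omega> * ennreal (1 - D (?g n (Suc i)) \<omega>)) = Y n \<omega>" .
    qed
    finally show ?thesis .
  qed
  have Y_lim: "(\<lambda>n. \<integral>\<^sup>+\<omega>. Y n \<omega> \<partial>M) \<longlonglongrightarrow> (\<integral>\<^sup>+\<omega>. indicator B \<omega> * ennreal (D t \<omega> - D s \<omega>) \<partial>M)"
  proof (rule nn_integral_dominated_convergence[where w = "\<lambda>_. 1"])
    show "Y n \<in> borel_measurable M" for n by (rule Y_M)
    show "(\<lambda>\<omega>. indicator B \<omega> * ennreal (D t \<omega> - D s \<omega>)) \<in> borel_measurable M"
      using D_M[OF s(1)] D_M[OF t] by measurable
    show "(\<integral>\<^sup>+\<omega>. 1 \<partial>M) < \<infinity>" by (simp add: emeasure_space_1)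
    show "AE \<omega> in M. Y n \<omega> \<le> 1" for n
      using AE_space
    proof eventually_elim
      case (elim \<omega>)
      have "log_sum s t (\<lambda>u. 1 - D u \<omega>) n \<le> (1 - D s \<omega>) - (1 - D t \<omega>)"
        by (rule log_sum_le[OF s]) (use D_mono[OF elim] D_bd in auto)
      also have "\<dots> \<le> 1" using D_bd(1)[of s \<omega>] D_bd(2)[of t \<omega>] by simp
      finally show ?case by (simp add: Y_def indicator_def)
    qed
    show "AE \<omega> in M. (\<lambda>n. Y n \<omega>) \<longlonglongrightarrow> indicator B \<omega> * ennreal (D t \<omega> - D s \<omega>)"
      using AE_space cont
    proof eventually_elim
      case (elim \<omega>)
      have "log_sum s t (\<lambda>u. 1 - D u \<omega>) \<longlonglongrightarrow> (1 - D s \<omega>) - (1 - D t \<omega>)"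
        by (rule log_sum_tendsto[OF s]) (use D_mono[OF elim(1)] D_bd elim(2) in \<open>auto intro!: continuous_intros\<close>)
      then have "(\<lambda>n. ennreal (log_sum s t (\<lambda>u. 1 - D u \<omega>) n)) \<longlonglongrightarrow> ennreal (D t \<omega> - D s \<omega>)"
        by (intro tendsto_ennrealI) simp
      then show ?case by (cases "\<omega> \<in> B") (simp_all add: Y_def)
    qed
  qed simp
  have AE_X: "AE \<omega> in M. (\<forall>n. X n \<omega> \<le> ennreal (V t \<omega> - V s \<omega>) * indicator B \<omega>) \<and>
      (\<lambda>n. X n \<omega>) \<longlonglongrightarrow> ennreal (V t \<omega> - V s \<omega>) * indicator B \<omega>"
    using AE_space cont finite less V
  proof eventually_elim
    case (elim \<omega>)
    then obtain x where x: "\<tau> \<omega> = ennreal x" "0 \<le> x" by (cases "\<tau> \<omega>") auto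
    let ?v = "\<lambda>u. ?\<phi> u \<omega>"
    \<comment> \<open>On the time interval up to \<tau> the default value
      \<open>ln (1 / 0) = 0\<close> does not occur, so the logarithm is increasing and continuous
      there.\<close>
    have less1: "D u \<omega> < 1" if "0 \<le> u" "u \<le> x" for u
      using D_mono[OF elim(1) that] elim(4) x by simp
    have mono: "mono_on {0..x} ?v"
    proof (rule mono_onI)
      fix u v assume uv: "u \<in> {0..x}" "v \<in> {0..x}" "u \<le> v"
      then have "D u \<omega> \<le> D v \<omega>" "D u \<omega> < 1" "D v \<omega> < 1" using D_mono[OF elim(1)] less1 by auto
      then show "?v u \<le> ?v v" by (simp add: ln_div)
    qed
    have cont_x: "continuous_on {0..x} ?v"
    proof (intro continuous_intros)
      show "continuous_on {0..x} (\<lambda>u. D u \<omega>)" by (rule continuous_on_subset[OF elim(2)]) auto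
      show "\<forall>u\<in>{0..x}. 1 - D u \<omega> \<noteq> 0" using less1 by (auto simp: less_imp_neq[THEN not_sym])
      show "\<forall>u\<in>{0..x}. 1 / (1 - D u \<omega>) \<noteq> 0" using less1 by (auto simp: less_imp_neq[THEN not_sym])
    qed
    have V_eq: "V t \<omega> - V s \<omega> = ?v (min t x) - ?v (min s x)" using elim(5) s t x by simp
    have X_eq: "X n \<omega> = ennreal (before_sum s t ?v x n) * indicator B \<omega>" for n
    proof -
      have "(\<Sum>i<2 ^ n. ennreal (?v (?g n (Suc i)) - ?v (?g n i)) * ?gt (?g n (Suc i)) \<omega>) =
          (\<Sum>i<2 ^ n. ennreal (if ?g n (Suc i) < x then ?v (?g n (Suc i)) - ?v (?g n i) else 0))"
        using x by (intro sum.cong refl) (simp add: indicator_def ennreal_less_iff)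
      also have "\<dots> = ennreal (before_sum s t ?v x n)"
        unfolding before_sum_def[OF s]
      proof (rule sum_ennreal)
        fix i
        show "0 \<le> (if ?g n (Suc i) < x then ?v (?g n (Suc i)) - ?v (?g n i) else 0)"
          using mono_onD[OF mono, of "?g n i" "?g n (Suc i)"] g_mono[of n i] by auto
      qed
      finally show ?thesis by (simp only: X_def mult.commute)
    qed
    have "X n \<omega> \<le> ennreal (V t \<omega> - V s \<omega>) * indicator B \<omega>" for n
      unfolding X_eq V_eq by (intro mult_right_mono ennreal_leI before_sum_le[OF s x(2) mono]) simp
    moreover have "(\<lambda>n. X n \<omega>) \<longlonglongrightarrow> ennreal (V t \<omega> - V s \<omega>) * indicator B \<omega>"
    proof -
      have "(\<lambda>n. ennreal (before_sum s t ?v x n)) \<longlonglongrightarrow> ennreal (V t \<omega> - V s \<omega>)"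
        unfolding V_eq by (intro tendsto_ennrealI before_sum_tendsto[OF s x(2) mono cont_x])
      then show ?thesis unfolding X_eq by (cases "\<omega> \<in> B") simp_all
    qed
    ultimately show ?case by blast
  qed
  have "(\<integral>\<^sup>+\<omega>. ennreal (V t \<omega> - V s \<omega>) * indicator B \<omega> \<partial>M) = (\<integral>\<^sup>+\<omega>. indicator B \<omega> * ennreal (D t \<omega> - D s \<omega>) \<partial>M)"
  proof (rule antisym)
    have "(\<integral>\<^sup>+\<omega>. ennreal (V t \<omega> - V s \<omega>) * indicator B \<omega> \<partial>M) = (\<integral>\<^sup>+\<omega>. liminf (\<lambda>n. X n \<omega>) \<partial>M)"
    proof (rule nn_integral_cong_AE)
      show "AE \<omega> in M. ennreal (V t \<omega> - V s \<omega>) * indicator B \<omega> = liminf (\<lambda>n. X n \<omega>)"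
        using AE_X by eventually_elim (rule lim_imp_Liminf[OF _ conjunct2, symmetric], simp)
    qed
    also have "\<dots> \<le> liminf (\<lambda>n. \<integral>\<^sup>+\<omega>. X n \<omega> \<partial>M)" by (rule nn_integral_liminf[OF X_M])
    also have "\<dots> = (\<integral>\<^sup>+\<omega>. indicator B \<omega> * ennreal (D t \<omega> - D s \<omega>) \<partial>M)"
      unfolding X_Y by (rule lim_imp_Liminf[OF _ Y_lim]) simp
    finally show "(\<integral>\<^sup>+\<omega>. ennreal (V t \<omega> - V s \<omega>) * indicator B \<omega> \<partial>M) \<le> \<dots>" .
    show "(\<integral>\<^sup>+\<omega>. indicator B \<omega> * ennreal (D t \<omega> - D s \<omega>) \<partial>M) \<le> (\<integral>\<^sup>+\<omega>. ennreal (V t \<omega> - V s \<omega>) * indicator B \<omega> \<partial>M)"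
    proof (rule LIMSEQ_le_const2[OF Y_lim], intro exI allI impI)
      fix n
      show "(\<integral>\<^sup>+\<omega>. Y n \<omega> \<partial>M) \<le> (\<integral>\<^sup>+\<omega>. ennreal (V t \<omega> - V s \<omega>) * indicator B \<omega> \<partial>M)"
        unfolding X_Y[symmetric] using AE_X by (intro nn_integral_mono_AE) (auto elim: eventually_mono)
    qed
  qed
  also have "\<dots> = emeasure M {\<omega> \<in> space M. \<omega> \<in> B \<and> ennreal s < \<tau> \<omega> \<and> \<tau> \<omega> \<le> ennreal t}"
    by (rule compensator_rectangle[OF D \<tau> s B])
  finally show ?thesis .
qed

end

context usual_filtered_prob_space
begin

lemma stopped_process_eq:
  assumes "\<tau> \<omega> = ennreal x" "0 \<le> x"
  shows "stopped_process X \<tau> t \<omega> = X (min (max 0 t) x) \<omega>"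
proof (cases "0 \<le> t")
  case True
  then have "min (ennreal t) (ennreal x) = ennreal (min t x)" using assms(2) by (auto simp: min_def)
  then show ?thesis using True assms by (simp add: stopped_process_def max_def)
next
  case False
  then show ?thesis using assms by (simp add: stopped_process_def max_def ennreal_neg)
qed

text \<open>The stopped value is \<open>Z\<close> composed with the pair of
  \<open>min \<tau> t\<close> and the path, and this pair is measurable for the join. Progressive
  measurability of \<open>Z\<close> is at hand for times strictly before \<open>t\<close> only, so
  the event that the stopped time equals \<open>t\<close> is treated apart through
  \<open>Z t\<close>.\<close>

lemma stopped_process_measurable_enlargement:
  assumes Z: "adapted F Z" "cadlag M Z" and \<tau>: "\<tau> \<in> borel_measurable M" and t: "0 \<le> t"
  shows "stopped_process Z \<tau> t \<in> borel_measurable (progressive_enlargement M F \<tau> t)"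
proof (rule measurableI)
  let ?J = "filtration_join_time M F \<tau> t"
  let ?T = "\<lambda>\<omega>. enn2real (min (\<tau> \<omega>) (ennreal t))"
  fix B :: "real set" assume B: "B \<in> sets borel"
  let ?C = "{(s, \<omega>). 0 \<le> s \<and> \<omega> \<in> space M \<and> Z s \<omega> \<in> B}"
  have "?C \<in> sets (optional_sigma M F)"
    unfolding optional_sigma_def using Z B by (intro process_in_sigma) auto
  from optional_progressive[OF this t] have C: "?C \<inter> {..<t} \<times> UNIV \<in> sets (borel \<Otimes>\<^sub>M F t)" .
  note [measurable] = min_measurable_join[OF \<tau> t]
  have id: "(\<lambda>\<omega>. \<omega>) \<in> measurable ?J (F t)"
    by (rule measurableI) (use F_subset_join[OF \<tau> t] sets.sets_into_space[of _ "F t"] in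
        \<open>auto simp: space_join[OF \<tau> t] space_F[OF t] Int_absorb2\<close>)
  have "(\<lambda>\<omega>. (?T \<omega>, \<omega>)) \<in> measurable ?J (borel \<Otimes>\<^sub>M F t)"
    by (intro measurable_Pair id) measurable
  from measurable_sets[OF this C] have 1: "(\<lambda>\<omega>. (?T \<omega>, \<omega>)) -` (?C \<inter> {..<t} \<times> UNIV) \<inter> space M \<in> sets ?J"
    by (simp add: space_join[OF \<tau> t])
  have "{\<omega> \<in> space ?J. ?T \<omega> = t} \<in> sets ?J" by measurable
  then have 2: "{\<omega> \<in> space M. ?T \<omega> = t} \<in> sets ?J" by (simp add: space_join[OF \<tau> t])
  have "Z t \<in> borel_measurable (F t)" using Z(1) t by (simp add: adapted_def)
  from measurable_sets[OF this B] have 3: "Z t -` B \<inter> space M \<in> sets ?J"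
    using F_subset_join[OF \<tau> t] by (auto simp: space_F[OF t])
  have le: "?T \<omega> \<le> t" for \<omega>
    using enn2real_mono[of "min (\<tau> \<omega>) (ennreal t)" "ennreal t"] t by simp
  have "stopped_process Z \<tau> t -` B \<inter> space M =
      ((\<lambda>\<omega>. (?T \<omega>, \<omega>)) -` (?C \<inter> {..<t} \<times> UNIV) \<inter> space M) \<union> ({\<omega> \<in> space M. ?T \<omega> = t} \<inter> (Z t -` B \<inter> space M))"
    using le by (auto simp: stopped_process_def min.commute less_le)
  also have "\<dots> \<in> sets ?J" by (intro sets.Un sets.Int 1 2 3)
  finally show "stopped_process Z \<tau> t -` B \<inter> space (progressive_enlargement M F \<tau> t) \<in> sets (progressive_enlargement M F \<tau> t)"
    using join_subset_enlargement[OF \<tau> t] by (auto simp: space_enlargement[OF \<tau> t])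
qed simp

lemma stopped_process_joint_measurable:
  assumes Z: "adapted F Z" "cadlag M Z" and \<tau>[measurable]: "\<tau> \<in> borel_measurable M" and B: "B \<in> sets borel"
  shows "{(t, \<omega>). 0 \<le> t \<and> \<omega> \<in> space M \<and> stopped_process Z \<tau> t \<omega> \<in> B} \<in> sets (borel \<Otimes>\<^sub>M M)"
proof -
  let ?C = "{(s, \<omega>). 0 \<le> s \<and> \<omega> \<in> space M \<and> Z s \<omega> \<in> B}"
  let ?T = "\<lambda>z. (enn2real (min (ennreal (fst z)) (\<tau> (snd z))), snd z)"
  have "?C \<in> sets (optional_sigma M F)"
    unfolding optional_sigma_def using Z B by (intro process_in_sigma) auto
  then have C: "?C \<in> sets (borel \<Otimes>\<^sub>M M)" by (rule optional_pair)
  have "?T \<in> measurable (borel \<Otimes>\<^sub>M M) (borel \<Otimes>\<^sub>M M)" by measurable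
  from measurable_sets[OF this C] have "?T -` ?C \<inter> space (borel \<Otimes>\<^sub>M M) \<in> sets (borel \<Otimes>\<^sub>M M)" .
  moreover have "{0::real..} \<times> space M \<in> sets (borel \<Otimes>\<^sub>M M)" by (intro pair_measureI) auto
  ultimately have "(?T -` ?C \<inter> space (borel \<Otimes>\<^sub>M M)) \<inter> {0..} \<times> space M \<in> sets (borel \<Otimes>\<^sub>M M)" by (rule sets.Int)
  also have "(?T -` ?C \<inter> space (borel \<Otimes>\<^sub>M M)) \<inter> {0..} \<times> space M =
      {(t, \<omega>). 0 \<le> t \<and> \<omega> \<in> space M \<and> stopped_process Z \<tau> t \<omega> \<in> B}"
    by (auto simp: space_pair_measure stopped_process_def)
  finally show ?thesis .
qed

lemma pseudo_stopping_time_projection: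
  assumes \<tau>: "pseudo_stopping_time M F \<tau>" and avoids: "avoids_stopping_times M F \<tau>"
    and Z: "azema_supermartingale M F \<tau> Z"
  shows "dual_predictable_projection M (progressive_enlargement M F \<tau>) (jump_process \<tau>)
    (\<lambda>t \<omega>. ln (1 / stopped_process Z \<tau> t \<omega>))"
proof -
  have \<tau>_M: "\<tau> \<in> borel_measurable M" using \<tau> by (simp add: pseudo_stopping_time_def random_time_def)
  have Z_ad: "adapted F Z" "cadlag M Z" using Z by (simp_all add: azema_supermartingale_def)
  have nonzero: "AE \<omega> in M. \<tau> \<omega> \<noteq> 0" and "AE \<omega> in M. \<tau> \<omega> \<noteq> \<infinity>" by (rule avoids_const[OF avoids \<tau>_M])+
  then have fin: "AE \<omega> in M. \<tau> \<omega> < \<infinity>" by (simp add: less_top)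
  have pos: "AE \<omega> in M. 0 < \<tau> \<omega>" using nonzero by eventually_elim (simp add: zero_less_iff_neq_zero)
  obtain D where D: "regular_compensator \<tau> D" and DZ: "AE \<omega> in M. \<forall>t\<ge>0. D t \<omega> = 1 - Z t \<omega>"
    by (rule regular_compensator_ex[OF \<tau> pos fin Z])
  have cont: "AE \<omega> in M. continuous_on {0..} (\<lambda>t. D t \<omega>)"
    using AE_compensator_left_continuous[OF D avoids \<tau>_M] AE_space
    by eventually_elim (intro continuous_on_Ici_if_cadlag regular_compensatorD(4)[OF D]; blast)
  note less = AE_compensator_less_1[OF D avoids \<tau>_M]
  let ?V = "\<lambda>t \<omega>. ln (1 / stopped_process Z \<tau> t \<omega>)"
  \<comment> \<open>At negative times \<open>stopped_process\<close> takes the value at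
    \<open>0\<close>, since \<open>ennreal\<close> truncates; with the maximum the equation holds
    for all real \<open>t\<close>, as continuity on the whole line requires.\<close>
  have V: "AE \<omega> in M. \<forall>t. ?V t \<omega> = ln (1 / (1 - D (min (max 0 t) (enn2real (\<tau> \<omega>))) \<omega>))"
    using fin DZ
  proof eventually_elim
    case (elim \<omega>)
    then obtain x where x: "\<tau> \<omega> = ennreal x" "0 \<le> x" by (cases "\<tau> \<omega>") auto
    have "1 - D (min (max 0 t) x) \<omega> = Z (min (max 0 t) x) \<omega>" for t using elim(2) x(2) by simp
    then show ?case using x by (simp add: stopped_process_eq[of \<tau> \<omega> x])
  qed
  have path: "AE \<omega> in M. continuous_on UNIV (\<lambda>t. ?V t \<omega>) \<and> mono_on {0..} (\<lambda>t. ?V t \<omega>) \<and> ?V 0 \<omega> = 0"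
    using V cont less AE_space
  proof eventually_elim
    case (elim \<omega>)
    let ?x = "enn2real (\<tau> \<omega>)"
    have V_eq: "(\<lambda>t. ?V t \<omega>) = (\<lambda>t. ln (1 / (1 - D (min (max 0 t) ?x) \<omega>)))" using elim(1) by blast
    note p = stopped_log_path[OF regular_compensatorD(3)[OF D elim(4)] elim(2) enn2real_nonneg elim(3)]
    have "mono_on {0..} (\<lambda>t. ?V t \<omega>)" unfolding V_eq by (rule mono_onI) (rule p(2))
    moreover have "?V 0 \<omega> = ln (1 / (1 - D (min (max 0 0) ?x) \<omega>))" using elim(1) by blast
    then have "?V 0 \<omega> = 0" using regular_compensatorD(5)[OF D elim(4)] by simp
    moreover have "continuous_on UNIV (\<lambda>t. ?V t \<omega>)" unfolding V_eq by (rule p(1))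
    ultimately show ?case by blast
  qed
  interpret G: complete_filtration M "progressive_enlargement M F \<tau>"
    by (rule complete_filtration_enlargement[OF \<tau>_M])
  have log_M: "(\<lambda>z::real. ln (1 / z)) \<in> borel_measurable borel" by measurable
  show ?thesis
  proof (rule dual_predictable_projection_enlargementI[OF \<tau>_M nonzero fin])
    show "(\<lambda>(t, \<omega>). ?V t \<omega>) \<in> borel_measurable (predictable_sigma M (progressive_enlargement M F \<tau>))"
    proof (rule G.AE_caglad_predictable)
      show "adapted (progressive_enlargement M F \<tau>) ?V"
        unfolding adapted_def
        by (intro allI impI measurable_compose[OF _ log_M] stopped_process_measurable_enlargement[OF Z_ad \<tau>_M])
      show "AE \<omega> in M. caglad_path (\<lambda>t. ?V t \<omega>)"
        using path by eventually_elim (blast intro: continuous_paths(1))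
      fix B :: "real set" assume "B \<in> sets borel"
      from measurable_sets[OF log_M this] have "(\<lambda>z. ln (1 / z)) -` B \<in> sets borel" by simp
      from stopped_process_joint_measurable[OF Z_ad \<tau>_M this]
      show "{(t, \<omega>). 0 \<le> t \<and> \<omega> \<in> space M \<and> ?V t \<omega> \<in> B} \<in> sets (borel \<Otimes>\<^sub>M M)" by simp
    qed
    show "AE \<omega> in M. increasing_path (\<lambda>t. ?V t \<omega>)"
      using path
    proof eventually_elim
      case (elim \<omega>)
      then show ?case using continuous_paths(2)[of "\<lambda>t. ?V t \<omega>"] unfolding increasing_path_def by simp
    qed
    show "AE \<omega> in M. ?V 0 \<omega> = 0" using path by eventually_elim blast
    show "AE \<omega> in M. \<forall>t\<ge>enn2real (\<tau> \<omega>). ?V t \<omega> = ?V (enn2real (\<tau> \<omega>)) \<omega>"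
      using V
    proof eventually_elim
      case (elim \<omega>)
      have min_eq: "min (max 0 t) (enn2real (\<tau> \<omega>)) = enn2real (\<tau> \<omega>)" if "enn2real (\<tau> \<omega>) \<le> t" for t
        using that by (simp add: min_absorb2 le_max_iff_disj)
      show ?case
      proof (intro allI impI)
        fix t assume t: "enn2real (\<tau> \<omega>) \<le> t"
        show "?V t \<omega> = ?V (enn2real (\<tau> \<omega>)) \<omega>"
          unfolding spec[OF elim, of t] spec[OF elim, of "enn2real (\<tau> \<omega>)"] min_eq[OF t] min_eq[OF order_refl] by (rule refl)
      qed
    qed
    fix s t :: real and B assume st: "0 \<le> s" "s \<le> t" "B \<in> sets (F s)"
    have V': "AE \<omega> in M. \<forall>t\<ge>0. ?V t \<omega> = ln (1 / (1 - D (min t (enn2real (\<tau> \<omega>))) \<omega>))"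
      using V
    proof eventually_elim
      case (elim \<omega>)
      have "max 0 t = t" if "0 \<le> t" for t :: real using that by simp
      then show ?case using elim by metis
    qed
    show "(\<integral>\<^sup>+\<omega>. ennreal (?V t \<omega> - ?V s \<omega>) * indicator B \<omega> \<partial>M) =
        emeasure M {\<omega> \<in> space M. \<omega> \<in> B \<and> ennreal s < \<tau> \<omega> \<and> \<tau> \<omega> \<le> ennreal t}"
      by (rule log_compensator_rectangle[OF D \<tau>_M cont fin less V' st])
  qed
qed

end

theorem corollary3p6:
  fixes M :: "'a measure" and F :: "real \<Rightarrow> 'a measure"
  assumes "usual_filtered_prob_space M F"
  shows "(\<forall>(\<tau> :: 'a \<Rightarrow> ennreal) (Z :: real \<Rightarrow> 'a \<Rightarrow> real).
            pseudo_stopping_time M F \<tau> \<and> avoids_stopping_times M F \<tau> \<and>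
            azema_supermartingale M F \<tau> Z \<longrightarrow>
            dual_predictable_projection M (progressive_enlargement M F \<tau>)
              (jump_process \<tau>) (\<lambda>t \<omega>. ln (1 / stopped_process Z \<tau> t \<omega>)))
       \<and> (\<forall>(g :: 'a \<Rightarrow> ennreal) (A :: real \<Rightarrow> 'a \<Rightarrow> real).
            honest_time M F g \<and> avoids_stopping_times M F g \<and>
            dual_optional_projection M F (jump_process g) A \<longrightarrow>
            dual_predictable_projection M (progressive_enlargement M F g)
              (jump_process g) A)"
proof -
  interpret usual_filtered_prob_space M F by fact
  show ?thesis using pseudo_stopping_time_projection honest_time_projection by blast
qed

end
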